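(* Let $n$ be a positive integer and let $\alpha>0$ be fixed. The following relations hold between $C^*$-subalgebras of $B(\mathcal{A}_n^2(\Pi))$: $$\mathcal{C}^*(\mathcal{T}_n^{0,0})\subset \mathcal{C}^*(P,B_{\Pi,(1)},\dots,B_{\Pi,(n)})\subset \mathcal{C}^*(T_{n,a_0},B_{\Pi,(1)},\dots,B_{\Pi,(n)}),$$ $$\mathcal{C}^*(\mathcal{T}_n^{0,\infty})\subset \mathcal{C}^*(T_{n,a_0},B_{\Pi,(1)},\dots,B_{\Pi,(n)}).$$ Moreover, for $n=2$ one has $\mathcal{C}^*(P,B_{\Pi,(1)},B_{\Pi,(2)})=\mathcal{C}^*(T_{2,a_0},B_{\Pi,(1)},B_{\Pi,(2)})$; that is, $\mathcal{C}^*(\mathcal{T}_2^{0,\infty})$ is contained in the algebra generated by the orthogonal projections $P,B_{\Pi,(1)},B_{\Pi,(2)}$.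
   Context: $\mathbb{R}_+=(0,\infty)$, and $\Pi=\{z=x+iy\in\mathbb{C}: y>0\}$ with Lebesgue area measure $dx\,dy$. The poly-Bergman space $\mathcal{A}^2_n(\Pi)$ is the closed subspace of $L_2(\Pi)$ of all $n$-polyanalytic functions (functions in the kernel of $(\partial/\partial\overline z)^n$); $\mathcal{A}^2(\Pi)=\mathcal{A}_1^2(\Pi)$ and $\mathcal{A}^2_0(\Pi)=\{0\}$. The true-$k$-poly-Bergman space is $\mathcal{A}^2_{(k)}(\Pi)=\mathcal{A}^2_k(\Pi)\ominus\mathcal{A}^2_{k-1}(\Pi)$, and $B_{\Pi,(k)}$ is the orthogonal projection from $\mathcal{A}_n^2(\Pi)$ onto $\mathcal{A}^2_{(k)}(\Pi)$, $1\le k\le n$. For a bounded measurable $a$ on $\Pi$, $T_{n,a}$ is the Toeplitz operator on $\mathcal{A}^2_n(\Pi)$, $T_{n,a}f=B_{\Pi,n}(af)$, where $B_{\Pi,n}$ is the orthogonal projection of $L_2(\Pi)$ onto $\mathcal{A}_n^2(\Pi)$; $T_a=T_{1,a}$. $L_\infty^{\{0,\infty\}}(\mathbb{R}_+)$ is the set of $a\in L_\infty(\mathbb{R}_+)$ for which the limits $a^0=\lim_{y\to0^+}a(y)$ and $a^{+\infty}=\lim_{y\to+\infty}a(y)$ exist; such $a$ is regarded as a function on $\Pi$ by $a(z)=a(\operatorname{Im}z)$. $\mathcal{T}_n^{0,\infty}=\{T_{n,a}:a\in L_\infty^{\{0,\infty\}}(\mathbb{R}_+)\}$, and $\mathcal{T}_n^{0,0}$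 is the set of those $T_{n,b}$ with $b\in L_\infty^{\{0,\infty\}}(\mathbb{R}_+)$ and $b^0=b^{+\infty}$. $a_0(z)=\chi_{[0,\alpha/2]}(\operatorname{Im}z)$. $\mathcal{C}^*(\mathcal{F})$ is the $C^*$-algebra generated by the family $\mathcal{F}$. Definition of $P$. Let $\ell_k(y)=(-1)^k\chi_{\mathbb{R}_+}(y)e^{-y/2}\frac{e^y}{k!}\frac{d^k}{dy^k}(e^{-y}y^k)$ and $N_m(y)=(\ell_0(y),\dots,\ell_{m-1}(y))^t$. For $m\ge1$ the operator $R_m:L_2(\Pi)\to(L_2(\mathbb{R}_+))^m$, $$(R_m\varphi)(x)=\frac{1}{\sqrt{2\pi}}\int_{\mathbb{R}}e^{-ixt}\int_{\mathbb{R}_+}\varphi(t,r)\sqrt{2x}\,N_m(2xr)\,dr\,dt$$ (Fourier transform in the $L_2$ sense), satisfies $R_m^*R_m=B_{\Pi,m}$, $R_mR_m^*=I$, so it maps $\mathcal{A}_m^2(\Pi)$ unitarily onto $(L_2(\mathbb{R}_+))^m$. Put $\mathbf{R}=\bigoplus_{k=1}^nR_1:(L_2(\Pi))^n\to(L_2(\mathbb{R}_+))^n$. Let $a_k(z)=\chi_{[k-1,k)}(\operatorname{Im}z)$ for $1\le k\le n-1$ and $a_n(z)=\chi_{[n-1,\infty)}(\operatorname{Im}z)$; let $T_{a_k}$ be the corresponding (positive) Toeplitz operators on $\mathcal{A}^2(\Pi)$ and $P_T=(\sqrt{T_{a_j}}\sqrt{T_{a_k}})_{j,k=1}^n$ acting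 on $(\mathcal{A}^2(\Pi))^n$. Then $P=R_n^*\mathbf{R}P_T\mathbf{R}^*R_n:\mathcal{A}_n^2(\Pi)\to\mathcal{A}_n^2(\Pi)$.
   Formalization: The first inclusion, of C*(T_n^{0,0}) in C*(P, B_(1),…,B_(n)), is stated only for n ≥ 2: for n = 1 it is false, since then P = B_(1) = I and the right side is the scalars, while T_{1,b} with b = χ_[1,2] is not a scalar. *)

theory Defs
  imports "HOL-Analysis.Analysis"
begin

section \<open>The Hilbert space of square-integrable complex functions\<close>

text \<open>Using Borel instead of Lebesgue measurable functions gives the same space of classes, since
  every Lebesgue measurable function has a Borel representative.\<close>
definition square_integrable :: "('a::euclidean_space \<Rightarrow> complex) \<Rightarrow> bool" where
  "square_integrable f \<longleftrightarrow>
     f \<in> borel_measurable lborel \<and> integrable lborel (\<lambda>x. (cmod (f x))\<^sup>2)"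

lemma square_integrable_0: "square_integrable (\<lambda>_. 0)"
  by (simp add: square_integrable_def)

lemma square_integrable_add:
  assumes "square_integrable f" "square_integrable g"
  shows "square_integrable (\<lambda>x. f x + g x)"
proof -
  have [measurable]: "f \<in> borel_measurable lborel" "g \<in> borel_measurable lborel"
    using assms by (auto simp: square_integrable_def)
  have "integrable lborel (\<lambda>x. 2 * (cmod (f x))\<^sup>2 + 2 * (cmod (g x))\<^sup>2)"
    using assms by (auto simp: square_integrable_def)
  then have "integrable lborel (\<lambda>x. (cmod (f x + g x))\<^sup>2)"
  proof (rule Bochner_Integration.integrable_bound)
    show "AE x in lborel. norm ((cmod (f x + g x))\<^sup>2)
        \<le> norm (2 * (cmod (f x))\<^sup>2 + 2 * (cmod (g x))\<^sup>2)"
    proof (intro AE_I2)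
      fix x
      have "(cmod (f x + g x))\<^sup>2 \<le> (cmod (f x) + cmod (g x))\<^sup>2"
        by (intro power_mono norm_triangle_ineq) auto
      also have "\<dots> \<le> 2 * (cmod (f x))\<^sup>2 + 2 * (cmod (g x))\<^sup>2"
        using sum_squares_bound[of "cmod (f x)" "cmod (g x)"] by (simp add: power2_sum)
      finally show "norm ((cmod (f x + g x))\<^sup>2)
          \<le> norm (2 * (cmod (f x))\<^sup>2 + 2 * (cmod (g x))\<^sup>2)"
        by simp
    qed
  qed measurable
  then show ?thesis
    by (simp add: square_integrable_def)
qed

lemma square_integrable_scale:
  assumes "square_integrable f"
  shows "square_integrable (\<lambda>x. c * f x)"
  using assms by (auto simp: square_integrable_def norm_mult power_mult_distrib)

lemma square_integrable_prod:
  assumes "square_integrable f" "square_integrable g"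
  shows "integrable lborel (\<lambda>x. f x * cnj (g x))"
proof -
  have [measurable]: "f \<in> borel_measurable lborel" "g \<in> borel_measurable lborel"
    using assms by (auto simp: square_integrable_def)
  have "integrable lborel (\<lambda>x. (cmod (f x))\<^sup>2 + (cmod (g x))\<^sup>2)"
    using assms by (auto simp: square_integrable_def)
  then show ?thesis
  proof (rule Bochner_Integration.integrable_bound)
    show "(\<lambda>x. f x * cnj (g x)) \<in> borel_measurable lborel"
      by (intro borel_measurable_times borel_measurable_continuous_on[where f = cnj])
         (auto intro: continuous_intros)
    show "AE x in lborel. norm (f x * cnj (g x))
        \<le> norm ((cmod (f x))\<^sup>2 + (cmod (g x))\<^sup>2)"
    proof (intro AE_I2)
      fix x
      have "0 \<le> cmod (f x) * cmod (g x)" by simp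
      then have "cmod (f x) * cmod (g x) \<le> (cmod (f x))\<^sup>2 + (cmod (g x))\<^sup>2"
        using sum_squares_bound[of "cmod (f x)" "cmod (g x)"] by linarith
      then show "norm (f x * cnj (g x)) \<le> norm ((cmod (f x))\<^sup>2 + (cmod (g x))\<^sup>2)"
        by (simp add: norm_mult)
    qed
  qed
qed

quotient_type (overloaded) 'a L2 = "'a::euclidean_space \<Rightarrow> complex" / partial:
  "\<lambda>f g. square_integrable f \<and> square_integrable g \<and> (AE x in lborel. f x = g x)"
proof (rule part_equivpI)
  show "\<exists>f::'a \<Rightarrow> complex. square_integrable f \<and> square_integrable f \<and> (AE x in lborel. f x = f x)"
    using square_integrable_0 by blast
  show "symp (\<lambda>f g::'a \<Rightarrow> complex.
      square_integrable f \<and> square_integrable g \<and> (AE x in lborel. f x = g x))"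
    by (auto intro!: sympI elim: AE_mp)
  show "transp (\<lambda>f g::'a \<Rightarrow> complex.
      square_integrable f \<and> square_integrable g \<and> (AE x in lborel. f x = g x))"
    by (auto intro!: transpI elim: AE_mp)
qed

lift_definition scaleC :: "complex \<Rightarrow> 'a::euclidean_space L2 \<Rightarrow> 'a L2" is
  "\<lambda>c f x. c * f x"
  by (auto simp: square_integrable_scale elim: AE_mp)

text \<open>Linear in the first argument.\<close>
lift_definition cinner :: "'a::euclidean_space L2 \<Rightarrow> 'a L2 \<Rightarrow> complex" is
  "\<lambda>f g. \<integral>x. f x * cnj (g x) \<partial>lborel"
proof clarify
  fix f f' g g' :: "'a \<Rightarrow> complex"
  assume sq: "square_integrable f" "square_integrable f'"
    "square_integrable g" "square_integrable g'"
    and ae: "AE x in lborel. f x = f' x" "AE x in lborel. g x = g' x"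
  show "(\<integral>x. f x * cnj (g x) \<partial>lborel) = (\<integral>x. f' x * cnj (g' x) \<partial>lborel)"
    using square_integrable_prod[OF sq(1,3)] square_integrable_prod[OF sq(2,4)] ae
    by (intro integral_cong_AE borel_measurable_integrable) (auto elim: AE_mp)
qed

instantiation L2 :: (euclidean_space) real_inner
begin

lift_definition zero_L2 :: "'a L2" is "\<lambda>_. 0"
  by (simp add: square_integrable_0)

lift_definition plus_L2 :: "'a L2 \<Rightarrow> 'a L2 \<Rightarrow> 'a L2" is "\<lambda>f g x. f x + g x"
  by (auto simp: square_integrable_add elim: AE_mp)

lift_definition uminus_L2 :: "'a L2 \<Rightarrow> 'a L2" is "\<lambda>f x. - f x"
  using square_integrable_scale[of _ "-1"] by (auto elim: AE_mp)

definition minus_L2 :: "'a L2 \<Rightarrow> 'a L2 \<Rightarrow> 'a L2" where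
  "minus_L2 f g = f + (- g)"

definition scaleR_L2 :: "real \<Rightarrow> 'a L2 \<Rightarrow> 'a L2" where
  "scaleR_L2 r f = scaleC (complex_of_real r) f"

definition inner_L2 :: "'a L2 \<Rightarrow> 'a L2 \<Rightarrow> real" where
  "inner_L2 f g = Re (cinner f g)"

definition norm_L2 :: "'a L2 \<Rightarrow> real" where
  "norm_L2 f = sqrt (inner f f)"

definition sgn_L2 :: "'a L2 \<Rightarrow> 'a L2" where
  "sgn_L2 f = inverse (norm f) *\<^sub>R f"

definition dist_L2 :: "'a L2 \<Rightarrow> 'a L2 \<Rightarrow> real" where
  "dist_L2 f g = norm (f - g)"

definition uniformity_L2 :: "('a L2 \<times> 'a L2) filter" where
  "uniformity_L2 = (INF e\<in>{0<..}. principal {(f, g). dist f g < e})"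

definition open_L2 :: "'a L2 set \<Rightarrow> bool" where
  "open_L2 U \<longleftrightarrow> (\<forall>x\<in>U. \<forall>\<^sub>F (x', y) in uniformity. x' = x \<longrightarrow> y \<in> U)"

instance
proof
  fix f g h :: "'a L2" and r s :: real
  show "f + g + h = f + (g + h)"
    by transfer (simp add: square_integrable_add add.assoc)
  show "f + g = g + f"
    by transfer (simp add: square_integrable_add add.commute)
  show "0 + f = f"
    by transfer simp
  show "- f + f = 0"
    by transfer (simp add: square_integrable_0)
  show "f - g = f + - g"
    by (simp add: minus_L2_def)
  show "r *\<^sub>R (f + g) = r *\<^sub>R f + r *\<^sub>R g"
    unfolding scaleR_L2_def
    by transfer (simp add: square_integrable_add square_integrable_scale distrib_left)
  show "(r + s) *\<^sub>R f = r *\<^sub>R f + s *\<^sub>R f"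
    unfolding scaleR_L2_def
    by transfer (simp add: square_integrable_add square_integrable_scale distrib_right[symmetric]
        flip: of_real_add)
  show "r *\<^sub>R s *\<^sub>R f = (r * s) *\<^sub>R f"
    unfolding scaleR_L2_def
    by transfer (simp add: square_integrable_scale mult.assoc)
  show "1 *\<^sub>R f = f"
    unfolding scaleR_L2_def by transfer simp
  show "sgn f = inverse (norm f) *\<^sub>R f"
    by (simp add: sgn_L2_def)
  show "dist f g = norm (f - g)"
    by (simp add: dist_L2_def)
  show "uniformity = (INF e\<in>{0<..}. principal {(f, g::'a L2). dist f g < e})"
    by (simp add: uniformity_L2_def)
  show "open U \<longleftrightarrow> (\<forall>x\<in>U. \<forall>\<^sub>F (x', y) in uniformity. x' = x \<longrightarrow> y \<in> U)" for U :: "'a L2 set"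
    by (simp add: open_L2_def)
  show "inner f g = inner g f"
    unfolding inner_L2_def
  proof transfer
    fix f g :: "'a \<Rightarrow> complex"
    assume "square_integrable f \<and> square_integrable f \<and> (AE x in lborel. f x = f x)"
      "square_integrable g \<and> square_integrable g \<and> (AE x in lborel. g x = g x)"
    then have "integrable lborel (\<lambda>x. f x * cnj (g x))" "integrable lborel (\<lambda>x. g x * cnj (f x))"
      by (auto intro: square_integrable_prod)
    moreover have "(\<lambda>x. Re (f x * cnj (g x))) = (\<lambda>x. Re (g x * cnj (f x)))"
      by (simp add: fun_eq_iff algebra_simps)
    ultimately show "Re (\<integral>x. f x * cnj (g x) \<partial>lborel) = Re (\<integral>x. g x * cnj (f x) \<partial>lborel)"
      by (simp only: integral_Re[symmetric])
  qed
  show "inner (f + g) h = inner f h + inner g h"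
    unfolding inner_L2_def
    by transfer (simp add: distrib_right square_integrable_prod)
  show "inner (r *\<^sub>R f) g = r * inner f g"
    unfolding inner_L2_def scaleR_L2_def
    by transfer (simp add: mult.assoc)
  have nn: "inner f f \<ge> 0 \<and> (inner f f = 0 \<longleftrightarrow> f = 0)"
    unfolding inner_L2_def
  proof transfer
    fix f :: "'a \<Rightarrow> complex"
    assume "square_integrable f \<and> square_integrable f \<and> (AE x in lborel. f x = f x)"
    then have f: "square_integrable f" by simp
    then have int: "integrable lborel (\<lambda>x. (cmod (f x))\<^sup>2)"
      by (simp add: square_integrable_def)
    have "(\<integral>x. f x * cnj (f x) \<partial>lborel) = complex_of_real (\<integral>x. (cmod (f x))\<^sup>2 \<partial>lborel)"
      by (simp add: complex_norm_square[symmetric] flip: of_real_power)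
    then have eq: "Re (\<integral>x. f x * cnj (f x) \<partial>lborel) = (\<integral>x. (cmod (f x))\<^sup>2 \<partial>lborel)"
      by simp
    have "(\<integral>x. (cmod (f x))\<^sup>2 \<partial>lborel) = 0 \<longleftrightarrow> (AE x in lborel. f x = 0)"
      by (subst integral_nonneg_eq_0_iff_AE[OF int]) auto
    then show "0 \<le> Re (\<integral>x. f x * cnj (f x) \<partial>lborel) \<and>
        (Re (\<integral>x. f x * cnj (f x) \<partial>lborel) = 0) =
        (square_integrable f \<and> square_integrable (\<lambda>_::'a. 0) \<and> (AE x in lborel. f x = 0))"
      using f unfolding eq by (simp add: square_integrable_0)
  qed
  show "0 \<le> inner f f" using nn by simp
  show "inner f f = 0 \<longleftrightarrow> f = 0" using nn by simp
  show "norm f = sqrt (inner f f)"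
    by (simp add: norm_L2_def)
qed

end

text \<open>\<open>L\<^sub>2(\<Omega>)\<close>, identified with the classes that have a representative vanishing off \<open>\<Omega>\<close>.\<close>
definition L2_on :: "'a::euclidean_space set \<Rightarrow> 'a L2 set" where
  "L2_on \<Omega> = {abs_L2 f |f. square_integrable f \<and> (\<forall>x. x \<notin> \<Omega> \<longrightarrow> f x = 0)}"

definition proj_onto :: "'a::euclidean_space L2 set \<Rightarrow> 'a L2 \<Rightarrow> 'a L2" where
  "proj_onto S f = (THE g. g \<in> S \<and> (\<forall>h\<in>S. cinner (f - g) h = 0))"


section \<open>Operators and generated C*-algebras\<close>

text \<open>Operators are extensional functions on their domain, so that operators agreeing on the
  domain are equal. The inner products are explicit parameters because the adjoint is also needed
  for operators between direct sums.\<close>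

definition adjoint_op ::
  "'v set \<Rightarrow> ('v \<Rightarrow> 'v \<Rightarrow> complex) \<Rightarrow> 'w set \<Rightarrow> ('w \<Rightarrow> 'w \<Rightarrow> complex) \<Rightarrow> ('v \<Rightarrow> 'w) \<Rightarrow> 'w \<Rightarrow> 'v" where
  "adjoint_op V ipV W ipW T =
     (\<lambda>w\<in>W. THE v. v \<in> V \<and> (\<forall>u\<in>V. ipW (T u) w = ipV u v))"

definition bounded_ops :: "'a::euclidean_space L2 set \<Rightarrow> ('a L2 \<Rightarrow> 'a L2) set" where
  "bounded_ops H = {T \<in> H \<rightarrow>\<^sub>E H.
     (\<forall>f\<in>H. \<forall>g\<in>H. T (f + g) = T f + T g) \<and>
     (\<forall>c. \<forall>f\<in>H. T (scaleC c f) = scaleC c (T f)) \<and>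
     (\<exists>K. \<forall>f\<in>H. norm (T f) \<le> K * norm f)}"

definition op_norm :: "'a::euclidean_space L2 set \<Rightarrow> ('a L2 \<Rightarrow> 'a L2) \<Rightarrow> real" where
  "op_norm H T = (SUP f\<in>{f\<in>H. norm f \<le> 1}. norm (T f))"

definition cstar_subalgebra :: "'a::euclidean_space L2 set \<Rightarrow> ('a L2 \<Rightarrow> 'a L2) set \<Rightarrow> bool" where
  "cstar_subalgebra H \<A> \<longleftrightarrow>
     \<A> \<subseteq> bounded_ops H \<and>
     (\<lambda>f\<in>H. 0) \<in> \<A> \<and>
     (\<forall>S\<in>\<A>. \<forall>T\<in>\<A>. (\<lambda>f\<in>H. S f + T f) \<in> \<A>) \<and>
     (\<forall>c. \<forall>T\<in>\<A>. (\<lambda>f\<in>H. scaleC c (T f)) \<in> \<A>) \<and>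
     (\<forall>S\<in>\<A>. \<forall>T\<in>\<A>. compose H S T \<in> \<A>) \<and>
     (\<forall>T\<in>\<A>. adjoint_op H cinner H cinner T \<in> \<A>) \<and>
     (\<forall>S. \<forall>T\<in>bounded_ops H.
        (\<forall>i::nat. S i \<in> \<A>) \<and> (\<lambda>i. op_norm H (\<lambda>f\<in>H. S i f - T f)) \<longlonglongrightarrow> 0 \<longrightarrow> T \<in> \<A>)"

text \<open>If \<open>F\<close> is not contained in \<open>bounded_ops H\<close>, this is an empty intersection and hence not a
  C*-subalgebra.\<close>
definition cstar_generated ::
  "'a::euclidean_space L2 set \<Rightarrow> ('a L2 \<Rightarrow> 'a L2) set \<Rightarrow> ('a L2 \<Rightarrow> 'a L2) set" where
  "cstar_generated H F = \<Inter>{\<A>. cstar_subalgebra H \<A> \<and> F \<subseteq> \<A>}"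

definition orthogonal_projection_on :: "'a::euclidean_space L2 set \<Rightarrow> ('a L2 \<Rightarrow> 'a L2) \<Rightarrow> bool" where
  "orthogonal_projection_on H Q \<longleftrightarrow>
     Q \<in> bounded_ops H \<and> compose H Q Q = Q \<and> adjoint_op H cinner H cinner Q = Q"

definition positive_op :: "'a::euclidean_space L2 set \<Rightarrow> ('a L2 \<Rightarrow> 'a L2) \<Rightarrow> bool" where
  "positive_op H T \<longleftrightarrow> T \<in> bounded_ops H \<and> (\<forall>f\<in>H. cinner (T f) f \<in> \<real>\<^sub>\<ge>\<^sub>0)"

definition sqrt_op :: "'a::euclidean_space L2 set \<Rightarrow> ('a L2 \<Rightarrow> 'a L2) \<Rightarrow> 'a L2 \<Rightarrow> 'a L2" where
  "sqrt_op H T = (THE S. positive_op H S \<and> compose H S S = T)"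

text \<open>The direct sum of \<open>m\<close> copies of \<open>H\<close>, as families indexed by \<open>{1..m}\<close>.\<close>
definition dsum :: "nat \<Rightarrow> 'v set \<Rightarrow> (nat \<Rightarrow> 'v) set" where
  "dsum m H = {1..m} \<rightarrow>\<^sub>E H"

definition dsum_inner ::
  "nat \<Rightarrow> (nat \<Rightarrow> 'a::euclidean_space L2) \<Rightarrow> (nat \<Rightarrow> 'a L2) \<Rightarrow> complex" where
  "dsum_inner m F G = (\<Sum>k=1..m. cinner (F k) (G k))"


section \<open>Poly-Bergman spaces of the upper half-plane\<close>

definition upper_half_plane :: "complex set" where
  "upper_half_plane = {z. Im z > 0}"

definition dx :: "(complex \<Rightarrow> complex) \<Rightarrow> complex \<Rightarrow> complex" where
  "dx f z = frechet_derivative f (at z) 1"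

definition dy :: "(complex \<Rightarrow> complex) \<Rightarrow> complex \<Rightarrow> complex" where
  "dy f z = frechet_derivative f (at z) \<i>"

text \<open>The Wirtinger operator \<open>\<partial>/\<partial>z\<^sup>*\<close>, where \<open>z\<^sup>*\<close> is the conjugate of \<open>z\<close>.\<close>
definition dbar :: "(complex \<Rightarrow> complex) \<Rightarrow> complex \<Rightarrow> complex" where
  "dbar f z = (dx f z + \<i> * dy f z) / 2"

text \<open>\<open>k\<close> times continuously differentiable in the real sense, for an open set \<open>\<Omega>\<close>.\<close>
primrec Ck_on :: "nat \<Rightarrow> complex set \<Rightarrow> (complex \<Rightarrow> complex) \<Rightarrow> bool" where
  "Ck_on 0 \<Omega> f \<longleftrightarrow> continuous_on \<Omega> f"
| "Ck_on (Suc k) \<Omega> f \<longleftrightarrow>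
     (\<forall>z\<in>\<Omega>. f differentiable at z) \<and> Ck_on k \<Omega> (dx f) \<and> Ck_on k \<Omega> (dy f)"

definition polyanalytic_on :: "nat \<Rightarrow> complex set \<Rightarrow> (complex \<Rightarrow> complex) \<Rightarrow> bool" where
  "polyanalytic_on n \<Omega> f \<longleftrightarrow> Ck_on n \<Omega> f \<and> (\<forall>z\<in>\<Omega>. (dbar ^^ n) f z = 0)"

definition poly_bergman :: "nat \<Rightarrow> complex L2 set" where
  "poly_bergman n = {abs_L2 f |f. square_integrable f \<and>
     (\<forall>z. z \<notin> upper_half_plane \<longrightarrow> f z = 0) \<and> polyanalytic_on n upper_half_plane f}"

definition true_poly_bergman :: "nat \<Rightarrow> complex L2 set" where
  "true_poly_bergman k =
     {f \<in> poly_bergman k. \<forall>g\<in>poly_bergman (k - 1). cinner f g = 0}"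

definition true_bergman_proj :: "nat \<Rightarrow> nat \<Rightarrow> complex L2 \<Rightarrow> complex L2" where
  "true_bergman_proj n k = (\<lambda>f\<in>poly_bergman n. proj_onto (true_poly_bergman k) f)"


section \<open>Toeplitz operators\<close>

definition toeplitz :: "nat \<Rightarrow> (complex \<Rightarrow> complex) \<Rightarrow> complex L2 \<Rightarrow> complex L2" where
  "toeplitz n a = (\<lambda>f\<in>poly_bergman n. proj_onto (poly_bergman n)
     (abs_L2 (\<lambda>z. if z \<in> upper_half_plane then a z * rep_L2 f z else 0)))"

definition vtoeplitz :: "nat \<Rightarrow> (real \<Rightarrow> complex) \<Rightarrow> complex L2 \<Rightarrow> complex L2" where
  "vtoeplitz n a = toeplitz n (\<lambda>z. a (Im z))"

definition Linf_pos :: "(real \<Rightarrow> complex) set" where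
  "Linf_pos = {a. a \<in> borel_measurable (restrict_space lborel {0<..}) \<and>
     (\<exists>C. AE y in lborel. y > 0 \<longrightarrow> cmod (a y) \<le> C)}"

text \<open>The limits are those of a representative. As all representatives are admitted, this gives the
  same set of operators as limits of classes.\<close>
definition toeplitz_0_inf :: "nat \<Rightarrow> (complex L2 \<Rightarrow> complex L2) set" where
  "toeplitz_0_inf n = {vtoeplitz n a |a. a \<in> Linf_pos \<and>
     (\<exists>l. (a \<longlongrightarrow> l) (at_right 0)) \<and> (\<exists>l. (a \<longlongrightarrow> l) at_top)}"

definition toeplitz_0_0 :: "nat \<Rightarrow> (complex L2 \<Rightarrow> complex L2) set" where
  "toeplitz_0_0 n = {vtoeplitz n b |b. b \<in> Linf_pos \<and>
     (\<exists>l. (b \<longlongrightarrow> l) (at_right 0) \<and> (b \<longlongrightarrow> l) at_top)}"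

definition a0_symbol :: "real \<Rightarrow> real \<Rightarrow> complex" where
  "a0_symbol \<alpha> = indicator {0..\<alpha> / 2}"


section \<open>The operator P\<close>

definition ell :: "nat \<Rightarrow> real \<Rightarrow> real" where
  "ell k y = (-1) ^ k * indicator {0<..} y * exp (- y / 2) *
     (exp y / fact k) * (deriv ^^ k) (\<lambda>u. exp (- u) * u ^ k) y"

text \<open>Component \<open>k\<close> (counted from 1) of the formula for \<open>R\<^sub>m \<phi>\<close>, with the integral over \<open>t\<close>
  cut off to \<open>[-N, N]\<close>. The Fourier transform in the \<open>L\<^sub>2\<close> sense is the \<open>L\<^sub>2\<close> limit
  for \<open>N \<rightarrow> \<infinity>\<close>.\<close>
definition R_trunc :: "nat \<Rightarrow> nat \<Rightarrow> complex L2 \<Rightarrow> real \<Rightarrow> complex" where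
  "R_trunc k N \<phi> x = (if x > 0 then
     of_real (1 / sqrt (2 * pi)) *
       (LINT t:{- real N..real N}|lborel. exp (- (\<i> * of_real (x * t))) *
          (LINT r:{0<..}|lborel.
             rep_L2 \<phi> (Complex t r) * of_real (sqrt (2 * x) * ell (k - 1) (2 * x * r))))
     else 0)"

definition R_op :: "nat \<Rightarrow> complex L2 \<Rightarrow> nat \<Rightarrow> real L2" where
  "R_op m = (\<lambda>\<phi>\<in>L2_on upper_half_plane. \<lambda>k\<in>{1..m}. lim (\<lambda>N. abs_L2 (R_trunc k N \<phi>)))"

definition R_adj :: "nat \<Rightarrow> (nat \<Rightarrow> real L2) \<Rightarrow> complex L2" where
  "R_adj m = adjoint_op (L2_on upper_half_plane) cinner (dsum m (L2_on {0<..})) (dsum_inner m) (R_op m)"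

text \<open>\<open>(L\<^sub>2(\<real>\<^sub>+))\<^sup>1\<close> is identified with \<open>L\<^sub>2(\<real>\<^sub>+)\<close> in each summand \<open>R\<^sub>1\<close>.\<close>
definition bold_R :: "nat \<Rightarrow> (nat \<Rightarrow> complex L2) \<Rightarrow> nat \<Rightarrow> real L2" where
  "bold_R n = (\<lambda>\<Phi>\<in>dsum n (L2_on upper_half_plane). \<lambda>k\<in>{1..n}. R_op 1 (\<Phi> k) 1)"

definition bold_R_adj :: "nat \<Rightarrow> (nat \<Rightarrow> real L2) \<Rightarrow> nat \<Rightarrow> complex L2" where
  "bold_R_adj n = adjoint_op (dsum n (L2_on upper_half_plane)) (dsum_inner n)
     (dsum n (L2_on {0<..})) (dsum_inner n) (bold_R n)"

definition strip_symbol :: "nat \<Rightarrow> nat \<Rightarrow> real \<Rightarrow> complex" where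
  "strip_symbol n k =
     indicator (if k < n then {real k - 1..<real k} else {real k - 1..})"

definition P_T :: "nat \<Rightarrow> (nat \<Rightarrow> complex L2) \<Rightarrow> nat \<Rightarrow> complex L2" where
  "P_T n = (\<lambda>F\<in>dsum n (poly_bergman 1). \<lambda>j\<in>{1..n}. \<Sum>k=1..n.
     sqrt_op (poly_bergman 1) (vtoeplitz 1 (strip_symbol n j))
       (sqrt_op (poly_bergman 1) (vtoeplitz 1 (strip_symbol n k)) (F k)))"

definition P_op :: "nat \<Rightarrow> complex L2 \<Rightarrow> complex L2" where
  "P_op n = (\<lambda>f\<in>poly_bergman n. R_adj n (bold_R n (P_T n (bold_R_adj n (R_op n f)))))"


section \<open>The algebras\<close>

abbreviation alg_00 :: "nat \<Rightarrow> (complex L2 \<Rightarrow> complex L2) set" where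
  "alg_00 n \<equiv> cstar_generated (poly_bergman n) (toeplitz_0_0 n)"

abbreviation alg_0_inf :: "nat \<Rightarrow> (complex L2 \<Rightarrow> complex L2) set" where
  "alg_0_inf n \<equiv> cstar_generated (poly_bergman n) (toeplitz_0_inf n)"

abbreviation alg_P :: "nat \<Rightarrow> (complex L2 \<Rightarrow> complex L2) set" where
  "alg_P n \<equiv> cstar_generated (poly_bergman n) (insert (P_op n) (true_bergman_proj n ` {1..n}))"

abbreviation alg_a0 :: "nat \<Rightarrow> real \<Rightarrow> (complex L2 \<Rightarrow> complex L2) set" where
  "alg_a0 n \<alpha> \<equiv> cstar_generated (poly_bergman n)
     (insert (vtoeplitz n (a0_symbol \<alpha>)) (true_bergman_proj n ` {1..n}))"

end

theory Submission
  imports Defs "HOL-Complex_Analysis.Complex_Analysis" "HOL-Probability.Probability"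
begin

text \<open>
  Take the Fourier transform along the real axis. With \<open>\<lambda>\<^sub>k\<close> the \<open>k\<close>-th Laguerre polynomial up to sign,
  every function in the \<open>n\<close>-th poly-Bergman space is a sum over \<open>k < n\<close> of functions
  \<open>t + i r \<mapsto> (2\<pi>)\<^sup>-\<^sup>1\<^sup>/\<^sup>2 \<integral> exp (i t x) \<surd>(2x) \<lambda>\<^sub>k(2xr) exp (- x r) g\<^sub>k(x) dx\<close>
  with profiles \<open>g\<^sub>k\<close> in \<open>L\<^sub>2(0, \<infinity>)\<close>, and this is an orthogonal decomposition into the true poly-Bergman
  spaces (\<open>poly_bergman_decomposition\<close>). Operators on the space thus become \<open>n \<times> n\<close> matrices.

  That the synthesis is isometric on each summand and that the summands are orthogonal follows from
  Plancherel's identity and the orthogonality of the Laguerre functions. That nothing is missing is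
  \<open>orthogonal_complement_trivial\<close>: the holomorphic components of a polyanalytic square-integrable
  function decay like powers of the height, so its inner products with explicit rational functions of
  the space can be evaluated by residues. They yield linear equations with the invertible Hankel
  matrix of the factorials for derivatives of the components.

  In this picture a Toeplitz operator whose symbol \<open>a\<close> depends on the height only is a matrix of
  multiplications by \<open>\<integral> a(s/2x) \<lambda>\<^sub>j(s) \<lambda>\<^sub>k(s) exp (- s) ds\<close> (\<open>vtoeplitz_matrix\<close>). These multipliers are
  continuous on \<open>(0, \<infinity>)\<close>; if \<open>a\<close> has limits at \<open>0\<close> and \<open>\<infinity>\<close>, they tend to multiples of the identity
  matrix at both ends (\<open>gam_cont_sym\<close>). The true projections are the matrix units on the diagonal
  (\<open>entry_one\<close>), and \<open>P\<close> is multiplication by the projection onto the unit vector of square roots of the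
  symbols \<open>exp (- 2(j-1)x) - exp (- 2jx)\<close>, the last one being \<open>exp (- 2(n-1)x)\<close> (\<open>P_op_matrix\<close>); that
  the abstract square roots of Toeplitz operators are these multiplications is \<open>sqrt_op_entry\<close>.

  All inclusions then rest on one Stone--Weierstrass argument (locale \<open>generating_entries\<close>): an algebra
  that contains the diagonal units, the entry \<open>exp (- c x)\<close> in the upper left corner, and for every \<open>j\<close>
  an entry without zeros joining the first summand to the \<open>j\<close>-th one and vanishing at both ends,
  contains every matrix of continuous symbols vanishing at \<open>0\<close> and \<open>\<infinity>\<close> off the diagonal and having
  equal limits on it. If each diagonal position also carries some symbol with distinct limits, the
  limits on the diagonal become arbitrary. For \<open>a\<^sub>0\<close> the joining entries are products of superdiagonal
  ones, which have no zeros by the positivity of the confluent Christoffel--Darboux kernel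
  (\<open>generating_entries_a0\<close>), and its diagonal symbols have the limits \<open>0\<close> and \<open>1\<close>. For \<open>P\<close> and \<open>n \<ge> 2\<close> the
  entries of the first row serve (\<open>generating_entries_P\<close>), but only the first and the last diagonal
  symbols have distinct limits. For \<open>n = 2\<close> these are all, and the two algebras coincide.
\<close>

abbreviation UHP :: "complex set" where "UHP \<equiv> upper_half_plane"

text \<open>The counterpart of \<open>LBINT\<close> for nonnegative functions.\<close>
abbreviation (input) nn_lborel :: "('a::euclidean_space \<Rightarrow> ennreal) \<Rightarrow> ennreal" (binder "NBINT " 10)
  where "nn_lborel f \<equiv> integral\<^sup>N lborel f"

section \<open>Laguerre polynomials\<close>

text \<open>Conjugated by the weight: \<open>(exp (- s) p(s))' = exp (- s) (tw p)(s)\<close>. Rodrigues' formula then defines the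
  Laguerre polynomials without leaving the ring of polynomials.\<close>
definition tw :: "real poly \<Rightarrow> real poly" where "tw p = pderiv p - p"

definition lag :: "nat \<Rightarrow> real poly" where
  "lag k = smult (1 / fact k) ((tw ^^ k) (monom 1 k))"

lemma tw_smult: "tw (smult c p) = smult c (tw p)"
  by (simp add: tw_def pderiv_smult smult_diff_right)

lemma tw_pow_smult: "(tw ^^ k) (smult c p) = smult c ((tw ^^ k) p)"
  by (induction k) (auto simp: tw_smult)

lemma tw_X: "tw ([:0,1:] * p) = [:0,1:] * tw p + p"
  by (simp add: tw_def pderiv_mult pderiv_pCons algebra_simps)

lemma tw_add: "tw (p + q) = tw p + tw q"
  by (simp add: tw_def pderiv_add)

lemma tw_pow_X: "(tw ^^ k) ([:0,1:] * p) = [:0,1:] * (tw ^^ k) p + smult (of_nat k) ((tw ^^ (k - 1)) p)"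
proof (induction k)
  case 0
  show ?case by simp
next
  case (Suc k)
  have "(tw ^^ Suc k) ([:0,1:] * p) = tw ([:0,1:] * (tw ^^ k) p) + smult (of_nat k) (tw ((tw ^^ (k - 1)) p))"
    by (simp only: funpow.simps o_apply Suc tw_add tw_smult)
  also have "smult (of_nat k) (tw ((tw ^^ (k - 1)) p)) = smult (of_nat k) ((tw ^^ k) p)"
    by (cases k) auto
  also have "tw ([:0,1:] * (tw ^^ k) p) = [:0,1:] * (tw ^^ Suc k) p + (tw ^^ k) p"
    by (simp only: tw_X funpow.simps o_apply)
  finally show ?case
    by (simp add: smult_add_left)
qed

lemma pderiv_tw_pow: "pderiv ((tw ^^ k) p) = (tw ^^ k) (pderiv p)"
  by (induction k) (auto simp: tw_def pderiv_diff)

lemma lag_0: "lag 0 = 1"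
  by (simp add: lag_def)

lemma fact_lag: "(tw ^^ k) (monom 1 k) = smult (fact k) (lag k)"
  by (simp add: lag_def)

lemma fact_smult_cancel:
  fixes p q :: "real poly"
  shows "smult (fact k) p = smult (fact k) q \<Longrightarrow> p = q"
  by (rule poly_eqI) (metis coeff_smult fact_nonzero mult_cancel_left)

lemma lag_Suc: "smult (of_nat (Suc k)) (lag (Suc k)) = [:0,1:] * (pderiv (lag k) - lag k) + smult (of_nat (Suc k)) (lag k)"
proof -
  have "monom (1::real) (Suc k) = [:0,1:] * monom 1 k"
    by (simp add: monom_Suc)
  then have "(tw ^^ Suc k) (monom 1 (Suc k)) = [:0,1:] * tw (smult (fact k) (lag k)) + smult (of_nat (Suc k)) (smult (fact k) (lag k))"
    using tw_pow_X[of "Suc k" "monom 1 k"] fact_lag[of k] by simp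
  then have "smult (fact k) (smult (of_nat (Suc k)) (lag (Suc k)))
      = smult (fact k) ([:0,1:] * (pderiv (lag k) - lag k) + smult (of_nat (Suc k)) (lag k))"
    unfolding fact_lag
    by (simp add: tw_smult smult_add_right mult.commute) (simp add: tw_def)
  then show ?thesis by (rule fact_smult_cancel)
qed

lemma pderiv_lag_Suc: "pderiv (lag (Suc k)) = pderiv (lag k) - lag k"
proof -
  have "smult (fact (Suc k)) (pderiv (lag (Suc k))) = pderiv ((tw ^^ Suc k) (monom 1 (Suc k)))"
    by (simp add: fact_lag pderiv_smult del: funpow.simps)
  also have "\<dots> = (tw ^^ Suc k) (smult (of_nat (Suc k)) (monom 1 k))"
    by (simp only: pderiv_tw_pow pderiv_monom smult_monom) simp
  also have "\<dots> = smult (of_nat (Suc k)) (tw (smult (fact k) (lag k)))"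
    by (simp only: tw_pow_smult funpow.simps o_apply fact_lag tw_smult)
  also have "\<dots> = smult (fact (Suc k)) (pderiv (lag k) - lag k)"
    by (simp add: tw_smult mult.commute) (simp add: tw_def)
  finally show ?thesis
    by (rule fact_smult_cancel)
qed

lemma lag_step: "real (Suc k) * poly (lag (Suc k)) s = s * (poly (pderiv (lag k)) s - poly (lag k) s) + real (Suc k) * poly (lag k) s"
  using arg_cong[OF lag_Suc[of k], of "\<lambda>p. poly p s"] by simp

lemma lag_ode: "s * poly (pderiv (pderiv (lag k))) s = (s - 1) * poly (pderiv (lag k)) s - real k * poly (lag k) s"
proof -
  have "pderiv (smult (of_nat (Suc k)) (lag (Suc k))) = pderiv ([:0,1:] * (pderiv (lag k) - lag k) + smult (of_nat (Suc k)) (lag k))"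
    by (simp only: lag_Suc)
  then have "poly (pderiv (smult (of_nat (Suc k)) (lag (Suc k)))) s = poly (pderiv ([:0,1:] * (pderiv (lag k) - lag k) + smult (of_nat (Suc k)) (lag k))) s"
    by simp
  then show ?thesis
    by (simp add: pderiv_smult pderiv_mult pderiv_add pderiv_diff pderiv_pCons pderiv_lag_Suc algebra_simps)
qed

lemma lag_deriv: "s * poly (pderiv (lag k)) s = real k * (poly (lag k) s - poly (lag (k - 1)) s)"
proof (cases k)
  case 0
  then show ?thesis by (simp add: lag_0)
next
  case (Suc m)
  have "s * poly (pderiv (lag (Suc m))) s = s * (poly (pderiv (lag m)) s - poly (lag m) s)"
    by (simp add: pderiv_lag_Suc)
  with Suc show ?thesis using lag_step[of m s] by (simp add: right_diff_distrib)
qed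

lemma lag_three_term:
  "real (Suc k) * poly (lag (Suc k)) s = (2 * real k + 1 - s) * poly (lag k) s - real k * poly (lag (k - 1)) s"
  using lag_step[of k s] lag_deriv[of s k] by (simp add: algebra_simps)

lemma lag_three_term_poly:
  "smult (real (Suc k)) (lag (Suc k)) = [:2 * real k + 1, -1:] * lag k - smult (real k) (lag (k - 1))"
  unfolding poly_eq_poly_eq_iff[symmetric] using lag_three_term by (auto simp: fun_eq_iff algebra_simps)

text \<open>The confluent Christoffel--Darboux kernel: its positivity is what makes the incomplete
  inner products of neighbouring Laguerre functions nonzero.\<close>
definition wronskian :: "nat \<Rightarrow> nat \<Rightarrow> real poly" where
  "wronskian j k = lag k * pderiv (lag j) - pderiv (lag k) * lag j"

lemma wronskian_step:
  "real (Suc (Suc k)) * poly (wronskian (Suc k) (Suc (Suc k))) s = real (Suc k) * poly (wronskian k (Suc k)) s + (poly (lag (Suc k)) s)\<^sup>2"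
proof -
  let ?a = "poly (lag k) s" and ?b = "poly (lag (Suc k)) s" and ?c = "poly (lag (Suc (Suc k))) s"
  let ?a' = "poly (pderiv (lag k)) s" and ?b' = "poly (pderiv (lag (Suc k))) s" and ?c' = "poly (pderiv (lag (Suc (Suc k)))) s"
  let ?u = "real (Suc k)" and ?v = "real (Suc (Suc k))"
  have 1: "?v * ?c = (2 * ?u + 1 - s) * ?b - ?u * ?a"
    using lag_three_term[of "Suc k" s] by simp
  have 2: "?v * ?c' = (2 * ?u + 1 - s) * ?b' - ?b - ?u * ?a'"
    using arg_cong[OF lag_three_term_poly[of "Suc k"], of "\<lambda>p. poly (pderiv p) s"]
    by (simp only: pderiv_smult pderiv_mult pderiv_diff poly_smult poly_mult poly_diff poly_add)
      (simp add: pderiv_pCons algebra_simps)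
  have "?v * (?c * ?b' - ?c' * ?b) = (?v * ?c) * ?b' - (?v * ?c') * ?b"
    by (simp only: algebra_simps)
  also have "\<dots> = ?u * (?b * ?a' - ?b' * ?a) + ?b\<^sup>2"
    unfolding 1 2 by (simp only: algebra_simps power2_eq_square)
  finally show ?thesis by (simp add: wronskian_def)
qed

lemma wronskian_pos: "poly (wronskian k (Suc k)) s > 0"
proof -
  have "real (Suc k) * poly (wronskian k (Suc k)) s > 0"
  proof (induction k)
    case 0
    have "poly (wronskian 0 (Suc 0)) s = 1"
      using lag_Suc[of 0] by (simp add: wronskian_def pderiv_pCons lag_0)
    then show ?case by simp
  next
    case (Suc k)
    then show ?case unfolding wronskian_step by (simp add: add_pos_nonneg)
  qed
  then show ?thesis by (simp add: zero_less_mult_iff)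
qed

text \<open>The Sturm--Liouville form of the Laguerre equation: a product of two different Laguerre polynomials
  times the weight has an explicit primitive, which gives orthogonality over \<open>(0, \<infinity>)\<close> and the value
  of incomplete inner products.\<close>
lemma wronskian_tw: "tw ([:0,1:] * wronskian j k) = smult (real k - real j) (lag j * lag k)"
proof -
  have "poly (tw ([:0,1:] * wronskian j k)) s = (real k - real j) * (poly (lag j) s * poly (lag k) s)" for s
  proof -
    have "poly (tw ([:0,1:] * wronskian j k)) s
      = poly (lag k) s * (s * poly (pderiv (pderiv (lag j))) s) - (s * poly (pderiv (pderiv (lag k))) s) * poly (lag j) s
        + (1 - s) * (poly (lag k) s * poly (pderiv (lag j)) s - poly (pderiv (lag k)) s * poly (lag j) s)"
      by (simp add: tw_def wronskian_def pderiv_mult pderiv_diff pderiv_pCons algebra_simps)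
    also have "\<dots> = (real k - real j) * (poly (lag j) s * poly (lag k) s)"
      unfolding lag_ode by (simp add: algebra_simps)
    finally show ?thesis .
  qed
  then show ?thesis
    unfolding poly_eq_poly_eq_iff[symmetric] by (auto simp: fun_eq_iff)
qed

lemma deriv_exp_poly: "((\<lambda>u. exp (- u) * poly p u) has_real_derivative exp (- x) * poly (tw p) x) (at x)"
  by (auto intro!: derivative_eq_intros poly_DERIV simp: tw_def algebra_simps)

lemma deriv_pow_exp_poly: "(deriv ^^ k) (\<lambda>u. exp (- u) * poly p u) = (\<lambda>u. exp (- u) * poly ((tw ^^ k) p) u)"
proof (induction k)
  case (Suc k)
  show ?case
    unfolding funpow.simps o_apply Suc
    by (intro ext DERIV_imp_deriv deriv_exp_poly)
qed simp

text \<open>The sign \<open>(-1)\<^sup>k\<close> is that of the functions \<open>ell\<close>.\<close>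
definition lagp :: "nat \<Rightarrow> real poly" where "lagp k = smult ((-1) ^ k) (lag k)"

lemma ell_eq: "ell k y = indicator {0<..} y * (poly (lagp k) y * exp (- y / 2))"
proof -
  have "(deriv ^^ k) (\<lambda>u. exp (- u) * u ^ k) y = exp (- y) * (fact k * poly (lag k) y)"
    using fun_cong[OF deriv_pow_exp_poly[of k "monom 1 k"], of y] by (simp add: poly_monom fact_lag)
  moreover have "exp y * exp (-y) = 1" by (simp flip: exp_add)
  ultimately show ?thesis
    by (simp add: ell_def lagp_def field_simps)
qed

subsection \<open>Integrals against the exponential weight\<close>

lemma integrable_monom_exp: "set_integrable lborel {0<..} (\<lambda>s. s ^ n * exp (- s :: real))"
  and integral_monom_exp: "(LINT s:{0<..}|lborel. s ^ n * exp (- s :: real)) = fact n"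
proof -
  have "(NBINT s. ennreal (indicator {0<..} s * (s ^ n * exp (- s))))
      = (NBINT s. ennreal (s ^ n * exp (- s)) * indicator {0..} s)"
    using AE_lborel_singleton[of "0::real"]
    by (intro nn_integral_cong_AE) (auto elim!: eventually_mono split: split_indicator)
  also have "\<dots> = ennreal (fact n)"
    using nn_intergal_power_times_exp_Ici[of n] by simp
  finally have eq: "(NBINT s. ennreal (indicator {0<..} s * (s ^ n * exp (- s)))) = ennreal (fact n)" .
  have hb: "has_bochner_integral lborel (\<lambda>s. indicator {0<..} s * (s ^ n * exp (- s))) (fact n :: real)"
    by (rule has_bochner_integral_nn_integral[OF _ _ _ eq]) (auto split: split_indicator)
  show "set_integrable lborel {0<..} (\<lambda>s. s ^ n * exp (- s :: real))"
    using hb by (simp add: set_integrable_def has_bochner_integral_iff)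
  show "(LINT s:{0<..}|lborel. s ^ n * exp (- s :: real)) = fact n"
    using hb by (simp add: set_lebesgue_integral_def has_bochner_integral_iff)
qed

definition pint :: "real poly \<Rightarrow> real" where
  "pint P = (LINT s:{0<..}|lborel. poly P s * exp (- s))"

lemma integrable_poly_exp: "set_integrable lborel {0<..} (\<lambda>s. poly P s * exp (- s :: real))"
  and pint_eq: "pint P = (\<Sum>i\<le>degree P. coeff P i * fact i)"
proof -
  have eq: "poly P s * exp (- s) = (\<Sum>i\<le>degree P. coeff P i * (s ^ i * exp (- s)))" for s
    by (simp add: poly_altdef sum_distrib_right mult.assoc)
  show "set_integrable lborel {0<..} (\<lambda>s. poly P s * exp (- s :: real))"
    using integrable_monom_exp unfolding eq set_integrable_def scaleR_sum_right
    by (intro Bochner_Integration.integrable_sum) (simp add: mult.left_commute)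
  show "pint P = (\<Sum>i\<le>degree P. coeff P i * fact i)"
    using integrable_monom_exp unfolding pint_def eq set_lebesgue_integral_def set_integrable_def scaleR_sum_right
    by (subst Bochner_Integration.integral_sum)
      (simp_all only: integral_monom_exp[unfolded set_lebesgue_integral_def, symmetric], simp_all add: mult.left_commute)
qed

lemma pint_add: "pint (p + q) = pint p + pint q"
  unfolding pint_def
  by (subst set_integral_add(2)[symmetric]) (auto intro!: integrable_poly_exp simp: algebra_simps)

lemma pint_smult: "pint (smult c p) = c * pint p"
  unfolding pint_def by (simp add: mult.assoc)

lemma pint_diff: "pint (p - q) = pint p - pint q"
  using pint_add[of p "smult (-1) q"] pint_smult[of "-1" q] by simp

lemma pint_tw: "pint (tw p) = - poly p 0"
proof -
  have *: "pint (tw (monom c n)) = - poly (monom c n) 0" for c n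
  proof -
    have m: "pint (monom b k) = b * fact k" for b k
      unfolding pint_def poly_monom using integral_monom_exp[of k] by (simp add: mult.assoc)
    show ?thesis
    proof (cases n)
      case 0
      have "tw (monom c 0) = smult (-1) (monom c 0)" by (simp add: tw_def monom_0 pderiv_pCons)
      then show ?thesis unfolding 0 by (simp only: pint_smult m poly_monom) simp
    next
      case (Suc k)
      then show ?thesis by (simp add: tw_def pint_diff pderiv_monom poly_monom m)
    qed
  qed
  have "pint (tw (\<Sum>i\<in>A. monom (coeff p i) i)) = - poly (\<Sum>i\<in>A. monom (coeff p i) i) 0" if "finite A" for A
    using that
  proof induction
    case empty
    show ?case by (simp add: tw_def pint_def)
  next
    case (insert x F)
    then show ?case by (simp add: tw_add pint_add *)
  qed
  from this[of "{..degree p}"] show ?thesis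
    by (simp add: poly_as_sum_of_monoms)
qed

lemma pint_lag_neq: "j \<noteq> k \<Longrightarrow> pint (lag j * lag k) = 0"
  using pint_tw[of "[:0,1:] * wronskian j k"] unfolding wronskian_tw pint_smult by simp

lemma pint_lag_sq: "pint (lag k * lag k) = 1"
proof (induction k)
  case 0
  show ?case using integral_monom_exp[of 0] by (simp add: lag_0 pint_def)
next
  case (Suc k)
  have 1: "real (Suc k) * pint (lag (Suc k) * lag (Suc k)) = - pint ([:0,1:] * lag k * lag (Suc k))"
  proof -
    have "smult (real (Suc k)) (lag (Suc k) * lag (Suc k))
       = smult (2 * real k + 1) (lag k * lag (Suc k)) - [:0,1:] * lag k * lag (Suc k) - smult (real k) (lag (k - 1) * lag (Suc k))"
      using arg_cong[OF lag_three_term_poly[of k], of "\<lambda>p. p * lag (Suc k)"] by (simp add: algebra_simps)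
    from arg_cong[OF this, of pint] show ?thesis
      by (simp add: pint_smult pint_diff pint_lag_neq)
  qed
  have 2: "0 = - pint ([:0,1:] * lag k * lag (Suc k)) - real (Suc k) * pint (lag k * lag k)"
  proof -
    have "smult (real (Suc (Suc k))) (lag (Suc (Suc k)) * lag k)
       = smult (2 * real (Suc k) + 1) (lag (Suc k) * lag k) - [:0,1:] * lag k * lag (Suc k) - smult (real (Suc k)) (lag k * lag k)"
      using arg_cong[OF lag_three_term_poly[of "Suc k"], of "\<lambda>p. p * lag k"] by (simp add: algebra_simps)
    from arg_cong[OF this, of pint] show ?thesis
      by (simp add: pint_smult pint_diff pint_lag_neq)
  qed
  have "real (Suc k) * pint (lag (Suc k) * lag (Suc k)) = real (Suc k) * 1"
    using 1 2 Suc by simp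
  then show ?case by simp
qed

lemma pint_lagp: "pint (lagp j * lagp k) = (if j = k then 1 else 0)"
  by (auto simp: lagp_def pint_smult pint_lag_sq pint_lag_neq)

subsection \<open>Representatives\<close>

section \<open>The Hilbert space structure\<close>

lemma sq_rep: "square_integrable (rep_L2 f)"
  using Quotient_rep_reflp[OF Quotient_L2, of f] by simp

lemma abs_rep [simp]: "abs_L2 (rep_L2 f) = f"
  by (rule Quotient_abs_rep[OF Quotient_L2])

lemma rep_abs: "square_integrable f \<Longrightarrow> AE x in lborel. rep_L2 (abs_L2 f) x = f x"
  using Quotient_rep_abs[OF Quotient_L2, of f] by simp

lemma abs_eqI: "square_integrable f \<Longrightarrow> square_integrable g \<Longrightarrow> (AE x in lborel. f x = g x) \<Longrightarrow> abs_L2 f = abs_L2 g"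
  using Quotient_rel_abs[OF Quotient_L2, of f g] by simp

lemma square_integrable_cong_AE:
  assumes "square_integrable f" "g \<in> borel_measurable lborel" "AE x in lborel. f x = g x"
  shows "square_integrable g"
proof -
  have [measurable]: "f \<in> borel_measurable lborel" "g \<in> borel_measurable lborel"
    using assms by (auto simp: square_integrable_def)
  have "integrable lborel (\<lambda>x. (cmod (g x))\<^sup>2)"
    using assms(1) unfolding square_integrable_def
    by (subst integrable_cong_AE[where g = "\<lambda>x. (cmod (f x))\<^sup>2"]) (use assms(3) in \<open>auto elim: eventually_mono\<close>)
  with assms show ?thesis by (simp add: square_integrable_def)
qed

lemma square_integrable_bound:
  assumes "square_integrable g" "f \<in> borel_measurable lborel" "AE x in lborel. cmod (f x) \<le> c * cmod (g x)"
  shows "square_integrable f"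
proof -
  have [measurable]: "f \<in> borel_measurable lborel" "g \<in> borel_measurable lborel"
    using assms by (auto simp: square_integrable_def)
  have "integrable lborel (\<lambda>x. c\<^sup>2 * (cmod (g x))\<^sup>2)"
    using assms(1) by (auto simp: square_integrable_def)
  then have "integrable lborel (\<lambda>x. (cmod (f x))\<^sup>2)"
  proof (rule Bochner_Integration.integrable_bound)
    show "AE x in lborel. norm ((cmod (f x))\<^sup>2) \<le> norm (c\<^sup>2 * (cmod (g x))\<^sup>2)"
      using assms(3)
    proof eventually_elim
      case (elim x)
      then have "(cmod (f x))\<^sup>2 \<le> (c * cmod (g x))\<^sup>2" by (intro power_mono) auto
      then show ?case by (simp add: power_mult_distrib)
    qed
  qed measurable
  with assms show ?thesis by (simp add: square_integrable_def)
qed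

lemma sq_measurable: "square_integrable f \<Longrightarrow> f \<in> borel_measurable borel"
  by (simp add: square_integrable_def)

lemma rep_measurable [measurable]: "rep_L2 f \<in> borel_measurable borel"
  using sq_rep sq_measurable by blast

lemma abs_add: "square_integrable f \<Longrightarrow> square_integrable g \<Longrightarrow> abs_L2 f + abs_L2 g = abs_L2 (\<lambda>x. f x + g x)"
  by (rule plus_L2.abs_eq) auto

lemma abs_scale: "square_integrable f \<Longrightarrow> scaleC c (abs_L2 f) = abs_L2 (\<lambda>x. c * f x)"
  by (rule scaleC.abs_eq) auto

lemma abs_minus: "square_integrable f \<Longrightarrow> - abs_L2 f = abs_L2 (\<lambda>x. - f x)"
  by (rule uminus_L2.abs_eq) auto

lemma abs_zero: "abs_L2 (\<lambda>_. 0) = 0"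
  by (simp add: zero_L2_def)

lemma square_integrable_minus: "square_integrable f \<Longrightarrow> square_integrable (\<lambda>x. - f x)"
  using square_integrable_scale[of f "-1"] by simp

lemma square_integrable_diff: "square_integrable f \<Longrightarrow> square_integrable g \<Longrightarrow> square_integrable (\<lambda>x. f x - g x)"
  using square_integrable_add[of f "\<lambda>x. - g x"] square_integrable_minus[of g] by simp

lemma abs_diff: "square_integrable f \<Longrightarrow> square_integrable g \<Longrightarrow> abs_L2 f - abs_L2 g = abs_L2 (\<lambda>x. f x - g x)"
  by (simp add: minus_L2_def abs_minus abs_add square_integrable_minus)

lemma cinner_abs: "square_integrable f \<Longrightarrow> square_integrable g \<Longrightarrow> cinner (abs_L2 f) (abs_L2 g) = (LBINT x. f x * cnj (g x))"
  by (rule cinner.abs_eq) auto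

subsection \<open>The complex inner product\<close>

lemma cinner_add_left: "cinner (f + g) h = cinner f h + cinner g h"
  by transfer (simp add: distrib_right square_integrable_prod)

lemma cinner_scale_left: "cinner (scaleC c f) h = c * cinner f h"
  by transfer (simp add: mult.assoc)

lemma cinner_commute: "cinner g f = cnj (cinner f g)"
proof transfer
  fix g f :: "'a \<Rightarrow> complex"
  show "(LBINT x. g x * cnj (f x)) = cnj (LBINT x. f x * cnj (g x))"
    by (simp add: mult.commute flip: Bochner_Integration.integral_cnj)
qed

lemma cinner_add_right: "cinner h (f + g) = cinner h f + cinner h g"
  by (metis cinner_commute cinner_add_left complex_cnj_add)

lemma cinner_scale_right: "cinner h (scaleC c f) = cnj c * cinner h f"
  by (metis cinner_commute cinner_scale_left complex_cnj_mult)

lemma cinner_zero [simp]: "cinner 0 f = 0" "cinner f 0 = 0"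
  using cinner_add_left[of 0 0 f] cinner_add_right[of f 0 0] by auto

lemma cinner_minus_left: "cinner (- f) h = - cinner f h"
  using cinner_add_left[of f "-f" h] by (simp add: eq_neg_iff_add_eq_0 add.commute)

lemma cinner_diff_left: "cinner (f - g) h = cinner f h - cinner g h"
  using cinner_add_left[of f "-g" h] by (simp add: cinner_minus_left)

lemma cinner_diff_right: "cinner h (f - g) = cinner h f - cinner h g"
  by (metis cinner_commute cinner_diff_left complex_cnj_diff)

lemma cinner_sum_left: "cinner (\<Sum>i\<in>A. f i) h = (\<Sum>i\<in>A. cinner (f i) h)"
  by (induction A rule: infinite_finite_induct) (auto simp: cinner_add_left)

lemma cinner_sum_right: "cinner h (\<Sum>i\<in>A. f i) = (\<Sum>i\<in>A. cinner h (f i))"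
  by (induction A rule: infinite_finite_induct) (auto simp: cinner_add_right)

lemma cinner_self: "cinner f f = complex_of_real ((norm f)\<^sup>2)"
proof -
  have "Im (cinner f f) = 0" using arg_cong[OF cinner_commute[of f f], of Im] by simp
  moreover have "Re (cinner f f) = (norm f)\<^sup>2"
    by (simp add: power2_norm_eq_inner inner_L2_def)
  ultimately show ?thesis by (simp add: complex_eq_iff)
qed

lemma scaleC_of_real: "scaleC (complex_of_real r) f = r *\<^sub>R f"
  by (simp add: scaleR_L2_def)

lemma norm_scaleC: "norm (scaleC c f) = cmod c * norm f"
proof -
  have "cinner (scaleC c f) (scaleC c f) = complex_of_real ((cmod c * norm f)\<^sup>2)"
  proof -
    have "cinner (scaleC c f) (scaleC c f) = (c * cnj c) * cinner f f"
      by (simp add: cinner_scale_left cinner_scale_right)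
    then show ?thesis
      by (simp only: cinner_self power_mult_distrib of_real_mult complex_norm_square[of c])
  qed
  then have "(norm (scaleC c f))\<^sup>2 = (cmod c * norm f)\<^sup>2"
    unfolding cinner_self by (metis of_real_eq_iff)
  then show ?thesis by (simp add: power2_eq_iff_nonneg)
qed

lemma cinner_Cauchy_Schwarz: "cmod (cinner f g) \<le> norm f * norm g"
proof (cases "cinner f g = 0")
  case False
  define c where "c = cnj (cinner f g) / cmod (cinner f g)"
  have "cmod c = 1" using False by (simp add: c_def norm_divide)
  have "cinner (scaleC c f) g = (cinner f g * cnj (cinner f g)) / complex_of_real (cmod (cinner f g))"
    by (simp add: c_def cinner_scale_left mult.commute)
  also have "\<dots> = complex_of_real (cmod (cinner f g))"
    unfolding complex_norm_square[symmetric] power2_eq_square of_real_mult using False by simp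
  finally have "cinner (scaleC c f) g = complex_of_real (cmod (cinner f g))" .
  then have "cmod (cinner f g) = inner (scaleC c f) g" by (simp add: inner_L2_def)
  also have "\<dots> \<le> norm (scaleC c f) * norm g" by (rule norm_cauchy_schwarz)
  also have "\<dots> = norm f * norm g" by (simp add: norm_scaleC \<open>cmod c = 1\<close>)
  finally show ?thesis .
qed simp

lemma scaleC_add_right: "scaleC c (f + g) = scaleC c f + scaleC c g"
  by transfer (simp add: square_integrable_add square_integrable_scale distrib_left)

lemma scaleC_scaleC: "scaleC c (scaleC d f) = scaleC (c * d) f"
  by transfer (simp add: square_integrable_scale mult.assoc)

lemma scaleC_one: "scaleC 1 f = f" by transfer simp

lemma scaleC_minus1: "scaleC (-1) f = - f"
  by transfer (simp add: square_integrable_minus)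

lemma scaleC_zero [simp]: "scaleC c 0 = 0"
  by transfer (simp add: square_integrable_0)

lemma norm_abs_sq: "square_integrable f \<Longrightarrow> (norm (abs_L2 f))\<^sup>2 = (LBINT x. (cmod (f x))\<^sup>2)"
proof -
  assume f: "square_integrable f"
  have "complex_of_real ((norm (abs_L2 f))\<^sup>2) = (LBINT x. f x * cnj (f x))"
    using cinner_abs[OF f f] by (simp add: cinner_self)
  also have "\<dots> = complex_of_real (LBINT x. (cmod (f x))\<^sup>2)"
    by (simp add: complex_norm_square[symmetric] flip: of_real_power)
  finally show ?thesis by (metis of_real_eq_iff)
qed

subsection \<open>Completeness and the representation of functionals\<close>

lemma nn_norm_abs_sq: "square_integrable f \<Longrightarrow> (NBINT x. ennreal ((cmod (f x))\<^sup>2)) = ennreal ((norm (abs_L2 f))\<^sup>2)"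
  by (subst nn_integral_eq_integral) (auto simp: norm_abs_sq square_integrable_def)

lemma square_integrableI_nn:
  assumes "f \<in> borel_measurable borel" "(NBINT x. ennreal ((cmod (f x))\<^sup>2)) < \<infinity>"
  shows "square_integrable f"
  using assms by (auto simp: square_integrable_def integrable_iff_bounded)

text \<open>Riesz--Fischer: the weights \<open>4\<^sup>k\<close> keep the sum of the squared differences integrable and turn its
  pointwise finiteness into geometric decay of the differences.\<close>
lemma L2_Cauchy_fast:
  fixes f :: "nat \<Rightarrow> 'a::euclidean_space \<Rightarrow> complex"
  assumes f: "\<And>k. square_integrable (f k)"
    and d: "\<And>k. norm (abs_L2 (f (Suc k)) - abs_L2 (f k)) \<le> (1/4) ^ k"
  shows "AE x in lborel. convergent (\<lambda>k. f k x)"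
proof -
  let ?A = "\<lambda>f k x. 4 ^ k * (cmod (f (Suc k) x - f k x))\<^sup>2"
  have [measurable]: "f k \<in> borel_measurable borel" for k using f by (rule sq_measurable)
  have "(NBINT x. (\<Sum>k. ennreal (?A f k x)))
     = (\<Sum>k. NBINT x. ennreal (?A f k x))"
    by (rule nn_integral_suminf) measurable
  also have "\<dots> \<le> (\<Sum>k. ennreal ((1/4) ^ k))"
  proof (intro suminf_le allI)
    fix k
    have "(NBINT x. ennreal (?A f k x))
        = ennreal (4 ^ k) * (NBINT x. ennreal ((cmod (f (Suc k) x - f k x))\<^sup>2))"
      by (subst nn_integral_cmult[symmetric]) (auto simp: ennreal_mult)
    also have "\<dots> = ennreal (4 ^ k * (norm (abs_L2 (f (Suc k)) - abs_L2 (f k)))\<^sup>2)"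
      by (subst nn_norm_abs_sq) (auto simp: square_integrable_diff f abs_diff ennreal_mult)
    also have "\<dots> \<le> ennreal (4 ^ k * ((1/4) ^ k)\<^sup>2)"
      by (intro ennreal_leI mult_left_mono power_mono d) auto
    also have "4 ^ k * ((1/4) ^ k)\<^sup>2 = (1/4 :: real) ^ k"
      by (simp add: power2_eq_square power_divide)
    finally show "(NBINT x. ennreal (?A f k x)) \<le> ennreal ((1/4) ^ k)" .
  qed auto
  also have "\<dots> < \<infinity>"
    by (subst suminf_ennreal2) (simp_all only: summable_geometric_iff zero_le_power, simp_all)
  finally have "AE x in lborel. (\<Sum>k. ennreal (?A f k x)) \<noteq> \<infinity>"
    by (intro nn_integral_noteq_infinite) (auto simp: less_top)
  then show ?thesis
  proof eventually_elim
    case (elim x)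
    let ?a = "\<lambda>k. 4 ^ k * (cmod (f (Suc k) x - f k x))\<^sup>2"
    have "summable ?a" using elim by (intro summable_suminf_not_top) auto
    then have "?a \<longlonglongrightarrow> 0" by (rule summable_LIMSEQ_zero)
    then have "Bseq ?a" by (simp add: convergentI convergent_imp_Bseq)
    then obtain B where B: "B > 0" "\<And>k. \<bar>?a k\<bar> \<le> B" unfolding Bseq_def by auto
    have "cmod (f (Suc k) x - f k x) \<le> sqrt B * (1/2) ^ k" for k
    proof (rule power2_le_imp_le)
      have "(4::real) ^ k = (2 ^ k)\<^sup>2" by (simp add: power2_eq_square flip: power_mult_distrib)
      then show "(cmod (f (Suc k) x - f k x))\<^sup>2 \<le> (sqrt B * (1/2) ^ k)\<^sup>2"
        using B(2)[of k] B(1) by (simp add: power_mult_distrib power_divide field_simps)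
    qed (use B in auto)
    then have le: "norm (f (Suc k) x - f k x) \<le> sqrt B * (1/2) ^ k" for k by simp
    have "summable (\<lambda>k. sqrt B * (1/2::real) ^ k)" by (intro summable_mult summable_geometric) simp
    then have "summable (\<lambda>k. f (Suc k) x - f k x)"
      by (rule summable_comparison_test'[where N = 0]) (rule le)
    then have "convergent (\<lambda>n. \<Sum>k<n. f (Suc k) x - f k x)"
      by (simp add: summable_iff_convergent)
    then have "convergent (\<lambda>n. f n x - f 0 x)"
      using sum_lessThan_telescope[of "\<lambda>k. f k x"] by simp
    then obtain l where "(\<lambda>n. f n x - f 0 x) \<longlonglongrightarrow> l" unfolding convergent_def by blast
    from tendsto_add[OF this tendsto_const[of "f 0 x"]] show ?case
      by (auto simp: convergent_def)
  qed
qed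

instance L2 :: (euclidean_space) complete_space
proof
  fix X :: "nat \<Rightarrow> 'a L2" assume X: "Cauchy X"
  have "\<exists>N. \<forall>m\<ge>N. \<forall>n\<ge>N. dist (X m) (X n) < (1/4) ^ k" for k
    using X unfolding Cauchy_def by (metis zero_less_power zero_less_divide_1_iff zero_less_numeral)
  then obtain N where N: "\<And>k m n. m \<ge> N k \<Longrightarrow> n \<ge> N k \<Longrightarrow> dist (X m) (X n) < (1/4) ^ k" by metis
  define r where "r = (\<lambda>k. \<Sum>i\<le>k. N i)"
  have r1: "r k \<ge> N k" for k by (simp add: r_def member_le_sum)
  have r2: "r (Suc k) \<ge> r k" for k by (simp add: r_def)
  define f where "f = (\<lambda>k. rep_L2 (X (r k)))"
  have f: "square_integrable (f k)" and absf: "abs_L2 (f k) = X (r k)" for k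
    by (auto simp: f_def sq_rep)
  have [measurable]: "f k \<in> borel_measurable borel" for k using f by (rule sq_measurable)
  have "norm (abs_L2 (f (Suc k)) - abs_L2 (f k)) \<le> (1/4) ^ k" for k
    using N[of k "r (Suc k)" "r k"] r1[of k] r2[of k] by (simp add: absf dist_norm)
  then have "AE x in lborel. convergent (\<lambda>k. f k x)" by (intro L2_Cauchy_fast f)
  then have lim: "AE x in lborel. (\<lambda>k. f k x) \<longlonglongrightarrow> lim (\<lambda>k. f k x)"
    by (auto simp: convergent_LIMSEQ_iff)
  define g where "g = (\<lambda>x. lim (\<lambda>k. f k x))"
  have [measurable]: "g \<in> borel_measurable borel" unfolding g_def by measurable
  have bound: "(NBINT x. ennreal ((cmod (g x - rep_L2 (X m) x))\<^sup>2)) \<le> ennreal (((1/4) ^ i)\<^sup>2)" if m: "m \<ge> N i" for m i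
  proof -
    have "(NBINT x. ennreal ((cmod (g x - rep_L2 (X m) x))\<^sup>2))
       = (NBINT x. liminf (\<lambda>k. ennreal ((cmod (f k x - rep_L2 (X m) x))\<^sup>2)))"
    proof (intro nn_integral_cong_AE)
      show "AE x in lborel. ennreal ((cmod (g x - rep_L2 (X m) x))\<^sup>2) = liminf (\<lambda>k. ennreal ((cmod (f k x - rep_L2 (X m) x))\<^sup>2))"
        using lim
      proof eventually_elim
        case (elim x)
        have "(\<lambda>k. ennreal ((cmod (f k x - rep_L2 (X m) x))\<^sup>2)) \<longlonglongrightarrow> ennreal ((cmod (g x - rep_L2 (X m) x))\<^sup>2)"
          unfolding g_def by (intro tendsto_intros elim tendsto_ennrealI)
        from lim_imp_Liminf[OF _ this] show ?case by simp
      qed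
    qed
    also have "\<dots> \<le> liminf (\<lambda>k. NBINT x. ennreal ((cmod (f k x - rep_L2 (X m) x))\<^sup>2))"
      by (rule nn_integral_liminf) measurable
    also have "\<dots> \<le> ennreal (((1/4) ^ i)\<^sup>2)"
    proof -
      have "(NBINT x. ennreal ((cmod (f k x - rep_L2 (X m) x))\<^sup>2)) \<le> ennreal (((1/4) ^ i)\<^sup>2)" if "k \<ge> i" for k
      proof -
        have "r k \<ge> N i" using that unfolding r_def by (intro member_le_sum) auto
        then have "norm (X (r k) - X m) \<le> (1/4) ^ i" using N[of i "r k" m] m by (simp add: dist_norm)
        then have "ennreal ((norm (X (r k) - X m))\<^sup>2) \<le> ennreal (((1/4) ^ i)\<^sup>2)"
          by (intro ennreal_leI power_mono) auto
        then show ?thesis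
          using abs_diff[OF f sq_rep, of k "X m"] nn_norm_abs_sq[OF square_integrable_diff[OF f sq_rep], of k "X m"]
          by (simp add: absf)
      qed
      then have "eventually (\<lambda>k. (NBINT x. ennreal ((cmod (f k x - rep_L2 (X m) x))\<^sup>2)) \<le> ennreal (((1/4) ^ i)\<^sup>2)) sequentially"
        by (auto simp: eventually_sequentially)
      from Limsup_bounded[OF this] show ?thesis
        using Liminf_le_Limsup[OF sequentially_bot] order_trans by blast
    qed
    finally show ?thesis .
  qed
  have sqd: "square_integrable (\<lambda>x. g x - rep_L2 (X m) x)" if "m \<ge> N i" for m i
    using bound[OF that] by (intro square_integrableI_nn) (auto intro: order_le_less_trans)
  have sqg: "square_integrable g"
    using square_integrable_add[OF sqd[of 0 "N 0"] sq_rep, of "X (N 0)"] by simp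
  have "norm (abs_L2 g - X m) \<le> (1/4) ^ i" if "m \<ge> N i" for m i
  proof -
    have "abs_L2 g - X m = abs_L2 (\<lambda>x. g x - rep_L2 (X m) x)"
      using abs_diff[OF sqg sq_rep, of "X m"] by simp
    then have "ennreal ((norm (abs_L2 g - X m))\<^sup>2) \<le> ennreal (((1/4) ^ i)\<^sup>2)"
      using bound[OF that] nn_norm_abs_sq[OF sqd[OF that]] by simp
    then have "(norm (abs_L2 g - X m))\<^sup>2 \<le> ((1/4) ^ i)\<^sup>2" by (simp add: ennreal_le_iff)
    then show ?thesis by (rule power2_le_imp_le) simp
  qed
  then have c: "dist (X m) (abs_L2 g) \<le> (1/4) ^ i" if "m \<ge> N i" for m i
    using that by (simp add: dist_norm norm_minus_commute)
  have "X \<longlonglongrightarrow> abs_L2 g"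
  proof (rule metric_LIMSEQ_I)
    fix e :: real assume "e > 0"
    then obtain i where "(1/4::real) ^ i < e" using real_arch_pow_inv[of e "1/4"] by auto
    then show "\<exists>no. \<forall>n\<ge>no. dist (X n) (abs_L2 g) < e"
      using c by (meson order_le_less_trans)
  qed
  then show "convergent X" by (auto simp: convergent_def)
qed

definition csubspace :: "'a::euclidean_space L2 set \<Rightarrow> bool" where
  "csubspace S \<longleftrightarrow> 0 \<in> S \<and> (\<forall>u\<in>S. \<forall>v\<in>S. u + v \<in> S) \<and> (\<forall>c. \<forall>u\<in>S. scaleC c u \<in> S)"

lemma csubspace_diff: "csubspace S \<Longrightarrow> u \<in> S \<Longrightarrow> v \<in> S \<Longrightarrow> u - v \<in> S"
  unfolding csubspace_def by (metis diff_conv_add_uminus scaleC_minus1)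

lemma csubspace_sum: "csubspace S \<Longrightarrow> (\<And>i. i \<in> A \<Longrightarrow> f i \<in> S) \<Longrightarrow> (\<Sum>i\<in>A. f i) \<in> S"
  by (induction A rule: infinite_finite_induct) (auto simp: csubspace_def)

text \<open>The representing vector minimizes \<open>\<parallel>u\<parallel>\<^sup>2 - 2 Re (\<phi> u)\<close>.\<close>
theorem riesz_representation:
  assumes S: "csubspace S" "closed S"
    and add: "\<And>u v. u \<in> S \<Longrightarrow> v \<in> S \<Longrightarrow> \<phi> (u + v) = \<phi> u + \<phi> v"
    and scale: "\<And>c u. u \<in> S \<Longrightarrow> \<phi> (scaleC c u) = c * \<phi> u"
    and bound: "\<And>u. u \<in> S \<Longrightarrow> cmod (\<phi> u) \<le> K * norm u"
  shows "\<exists>v\<in>S. \<forall>u\<in>S. \<phi> u = cinner u v"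
proof -
  define J where "J = (\<lambda>u. (norm u)\<^sup>2 - 2 * Re (\<phi> u))"
  define m where "m = Inf (J ` S)"
  have S0: "0 \<in> S" and Sadd: "\<And>u v. u \<in> S \<Longrightarrow> v \<in> S \<Longrightarrow> u + v \<in> S" and Sscale: "\<And>c u. u \<in> S \<Longrightarrow> scaleC c u \<in> S"
    using S by (auto simp: csubspace_def)
  have SR: "r *\<^sub>R u \<in> S" if "u \<in> S" for r u using Sscale[OF that, of "of_real r"] by (simp add: scaleC_of_real)
  have \<phi>R: "\<phi> (r *\<^sub>R u) = of_real r * \<phi> u" if "u \<in> S" for r u using scale[OF that, of "of_real r"] by (simp add: scaleC_of_real)
  have lb: "J u \<ge> - K\<^sup>2" if "u \<in> S" for u
  proof -
    have "Re (\<phi> u) \<le> K * norm u" using bound[OF that] complex_Re_le_cmod order_trans by blast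
    moreover have "2 * (K * norm u) \<le> K\<^sup>2 + (norm u)\<^sup>2" using sum_squares_bound[of K "norm u"] by simp
    ultimately show ?thesis unfolding J_def by linarith
  qed
  have bdd: "bdd_below (J ` S)" using lb by (auto intro!: bdd_belowI)
  have mle: "m \<le> J u" if "u \<in> S" for u unfolding m_def using bdd that by (auto intro: cInf_lower)
  have "\<exists>u\<in>S. J u < m + 1 / Suc n" for n :: nat
  proof -
    have "Inf (J ` S) < m + 1 / Suc n" by (simp add: m_def)
    then show ?thesis using cInf_lessD[of "J ` S" "m + 1 / Suc n"] S0 by auto
  qed
  then obtain X where XS: "\<And>n. X n \<in> S" and XJ: "\<And>n. J (X n) < m + 1 / Suc n" by metis
  have par: "(norm (u - w))\<^sup>2 = 2 * J u + 2 * J w - 4 * J ((1/2) *\<^sub>R (u + w))" if "u \<in> S" "w \<in> S" for u w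
    using that unfolding J_def \<phi>R[OF Sadd[OF that]] add[OF that]
    by (simp add: power2_norm_eq_inner inner_simps inner_commute power_mult_distrib algebra_simps)
  have XC: "(norm (X i - X j))\<^sup>2 \<le> 2 / Suc i + 2 / Suc j" for i j
    using par[OF XS XS, of i j] XJ[of i] XJ[of j] mle[OF SR[OF Sadd[OF XS XS]], of "1/2" i j]
    by linarith
  have "Cauchy X"
  proof (rule metric_CauchyI)
    fix e :: real assume "e > 0"
    then obtain N where N: "4 / e\<^sup>2 < real N" using reals_Archimedean2 by blast
    have "dist (X i) (X j) < e" if "i \<ge> N" "j \<ge> N" for i j
    proof -
      have "4 / e\<^sup>2 < real (Suc i)" "4 / e\<^sup>2 < real (Suc j)" using N that by auto
      then have "2 / Suc i < e\<^sup>2 / 2" "2 / Suc j < e\<^sup>2 / 2" using \<open>e > 0\<close> by (auto simp: field_simps)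
      then have "(norm (X i - X j))\<^sup>2 < e\<^sup>2" using XC[of i j] by linarith
      then show ?thesis using \<open>e > 0\<close> power2_less_imp_less[of "norm (X i - X j)" e] by (simp add: dist_norm)
    qed
    then show "\<exists>M. \<forall>m\<ge>M. \<forall>n\<ge>M. dist (X m) (X n) < e" by blast
  qed
  then obtain v where v: "X \<longlonglongrightarrow> v" using Cauchy_convergent convergent_def by blast
  have vS: "v \<in> S" using S(2) XS v closed_sequentially by blast
  have "J v \<le> m"
  proof (rule field_le_epsilon)
    fix e :: real assume e: "e > 0"
    have "(\<lambda>n. \<phi> (X n)) \<longlonglongrightarrow> \<phi> v"
    proof (rule LIM_zero_cancel, rule Lim_null_comparison)
      show "(\<lambda>n. K * norm (X n - v)) \<longlonglongrightarrow> 0"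
        using v tendsto_mult_right_zero[OF tendsto_norm_zero[OF LIM_zero[OF v]]] by simp
      have "\<phi> (X n) - \<phi> v = \<phi> (X n - v)" for n
        using add[OF XS[of n] Sscale[OF vS, of "-1"]] scale[OF vS, of "-1"] by (simp add: scaleC_minus1)
      then show "\<forall>\<^sub>F n in sequentially. norm (\<phi> (X n) - \<phi> v) \<le> K * norm (X n - v)"
        using bound csubspace_diff[OF S(1) XS vS] by simp
    qed
    then have "(\<lambda>n. J (X n)) \<longlonglongrightarrow> J v" unfolding J_def by (intro tendsto_intros v)
    moreover have "(\<lambda>n. m + 1 / Suc n) \<longlonglongrightarrow> m + 0" by (intro tendsto_intros LIMSEQ_Suc lim_1_over_n)
    ultimately have "J v \<le> m + 0" using XJ by (intro LIMSEQ_le[of "\<lambda>n. J (X n)"]) (auto intro: less_imp_le)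
    then show "J v \<le> m + e" using e by simp
  qed
  then have min: "J v \<le> J u" if "u \<in> S" for u using mle[OF that] by simp
  have re: "Re (\<phi> u) = inner u v" if u: "u \<in> S" for u
  proof -
    define d where "d = inner u v - Re (\<phi> u)"
    have pos: "0 \<le> 2 * t * d + t\<^sup>2 * (norm u)\<^sup>2" for t
    proof -
      have "J (v + t *\<^sub>R u) = J v + 2 * t * d + t\<^sup>2 * (norm u)\<^sup>2"
        unfolding J_def d_def
        by (simp add: add[OF vS SR[OF u]] \<phi>R u power2_norm_eq_inner inner_simps)
          (simp add: inner_commute power2_eq_square algebra_simps)
      then show ?thesis using min[OF Sadd[OF vS SR[OF u]], of t] by simp
    qed
    have "d = 0"
    proof (rule ccontr)
      assume "d \<noteq> 0"
      define t where "t = - d / (1 + (norm u)\<^sup>2)"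
      have pp: "1 + (norm u)\<^sup>2 > 0" by (simp add: add_pos_nonneg)
      have "2 * t * d + t\<^sup>2 * (norm u)\<^sup>2 \<le> 2 * t * d + t\<^sup>2 * (1 + (norm u)\<^sup>2)"
        by (simp add: mult_left_mono)
      also have "t\<^sup>2 * (1 + (norm u)\<^sup>2) = - t * d" using pp by (simp add: t_def power2_eq_square)
      also have "2 * t * d + - t * d = - (d\<^sup>2 / (1 + (norm u)\<^sup>2))" by (simp add: t_def power2_eq_square)
      also have "\<dots> < 0" using pp \<open>d \<noteq> 0\<close> by simp
      finally show False using pos[of t] by simp
    qed
    then show ?thesis by (simp add: d_def)
  qed
  have "\<phi> u = cinner u v" if u: "u \<in> S" for u
  proof -
    have 1: "Re (\<phi> u) = Re (cinner u v)" using re[OF u] by (simp add: inner_L2_def)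
    have "Re (\<phi> (scaleC \<i> u)) = Re (cinner (scaleC \<i> u) v)" using re[OF Sscale[OF u]] by (simp add: inner_L2_def)
    then have "Im (\<phi> u) = Im (cinner u v)" by (simp add: scale[OF u] cinner_scale_left)
    with 1 show ?thesis by (simp add: complex_eq_iff)
  qed
  with vS show ?thesis by blast
qed

lemma csubspace_UNIV: "csubspace UNIV" by (simp add: csubspace_def)

section \<open>Plancherel's identity for integrable square-integrable functions\<close>

lemma cnj_measurable [measurable (raw)]:
  "f \<in> borel_measurable M \<Longrightarrow> (\<lambda>x. cnj (f x)) \<in> borel_measurable M"
  by (rule borel_measurable_continuous_on[where f = cnj]) (auto intro: continuous_intros)

lemma integrable_translate:
  fixes u :: "real \<Rightarrow> 'b::{banach, second_countable_topology}"
  shows "integrable lborel u \<Longrightarrow> integrable lborel (\<lambda>x. u (x + h))"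
  using lborel_integrable_real_affine[of u 1 h] by (simp add: add.commute)

lemma integral_translate:
  fixes u :: "real \<Rightarrow> 'b::{banach, second_countable_topology}"
  shows "(LBINT x. u (x + h)) = (LBINT x. u x)"
  using lborel_integral_real_affine[of 1 u h] by (simp add: add.commute)

lemma translation_triangle:
  fixes u v :: "real \<Rightarrow> complex"
  assumes u: "integrable lborel u" and v: "integrable lborel v"
  shows "(LBINT x. cmod (u (x + h) - u x))
    \<le> 2 * (LBINT x. cmod (v x - u x)) + (LBINT x. cmod (v (x + h) - v x))"
proof -
  let ?d = "\<lambda>x. cmod (v x - u x)"
  have d: "integrable lborel ?d" using u v by auto
  note it = integrable_translate
  have "(LBINT x. cmod (u (x + h) - u x)) \<le> (LBINT x. ?d (x + h) + ?d x + cmod (v (x + h) - v x))"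
  proof (intro integral_mono Bochner_Integration.integrable_add it[OF d] d)
    show "integrable lborel (\<lambda>x. cmod (u (x + h) - u x))" using it[OF u] u by auto
    show "integrable lborel (\<lambda>x. cmod (v (x + h) - v x))" using it[OF v] v by auto
    fix x
    have "u (x + h) - u x = - (v (x + h) - u (x + h)) + (v x - u x) + (v (x + h) - v x)" by simp
    then show "cmod (u (x + h) - u x) \<le> ?d (x + h) + ?d x + cmod (v (x + h) - v x)"
      by (metis (no_types, opaque_lifting) add_mono_thms_linordered_semiring(3) norm_minus_cancel norm_triangle_ineq order_trans)
  qed
  also have "\<dots> = 2 * (LBINT x. ?d x) + (LBINT x. cmod (v (x + h) - v x))"
  proof -
    have "integrable lborel (\<lambda>x. cmod (v (x + h) - v x))" using it[OF v] v by auto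
    then show ?thesis using d it[OF d, of h] integral_translate[of ?d h] by simp
  qed
  finally show ?thesis .
qed

text \<open>Continuity of translation in \<open>L\<^sub>1\<close> is stable under \<open>L\<^sub>1\<close> limits, because translations are isometric.\<close>
lemma translation_approx:
  fixes u :: "real \<Rightarrow> complex"
  assumes u: "integrable lborel u"
    and v: "\<And>e. e > 0 \<Longrightarrow> \<exists>v. integrable lborel v \<and> (LBINT x. cmod (v x - u x)) < e \<and>
      (\<lambda>i. LBINT x. cmod (v (x + X i) - v x)) \<longlonglongrightarrow> 0"
  shows "(\<lambda>i. LBINT x. cmod (u (x + X i) - u x)) \<longlonglongrightarrow> 0"
proof (rule LIMSEQ_I)
  fix e :: real assume e: "e > 0"
  obtain v where v: "integrable lborel v" "(LBINT x. cmod (v x - u x)) < e / 4"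
      "(\<lambda>i. LBINT x. cmod (v (x + X i) - v x)) \<longlonglongrightarrow> 0"
    using assms(2)[of "e / 4"] e by auto
  obtain N where N: "\<And>i. i \<ge> N \<Longrightarrow> (LBINT x. cmod (v (x + X i) - v x)) < e / 2"
    using LIMSEQ_D[OF v(3), of "e / 2"] e by fastforce
  have "norm ((LBINT x. cmod (u (x + X i) - u x)) - 0) < e" if "i \<ge> N" for i
    using translation_triangle[OF u v(1), of "X i"] v(2) N[OF that] by simp
  then show "\<exists>no. \<forall>i\<ge>no. norm ((LBINT x. cmod (u (x + X i) - u x)) - 0) < e" by blast
qed

text \<open>For an open set \<open>U\<close> of finite measure, \<open>indicator U (x + X\<^sub>i)\<close> is eventually \<open>1\<close> at each \<open>x \<in> U\<close>; the measure of
  the symmetric difference is then controlled by that of the intersection.\<close>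
lemma translation_open:
  fixes U :: "real set"
  assumes U: "open U" "emeasure lborel U < \<infinity>" and X: "X \<longlonglongrightarrow> 0"
  shows "(\<lambda>i. LBINT x. cmod (indicator U (x + X i) *\<^sub>R c - indicator U x *\<^sub>R (c::complex))) \<longlonglongrightarrow> 0"
proof -
  have Us [measurable]: "U \<in> sets borel" using U by auto
  have iU: "integrable lborel (indicator U :: real \<Rightarrow> real)" using U by auto
  have iUx: "integrable lborel (\<lambda>x. indicator U (x + h) :: real)" for h using integrable_translate[OF iU] .
  have iP: "integrable lborel (\<lambda>x. indicator U x * indicator U (x + h) :: real)" for h
    by (rule Bochner_Integration.integrable_bound[OF iU]) (auto split: split_indicator)
  have "(\<lambda>i. LBINT x. indicator U x * indicator U (x + X i)) \<longlonglongrightarrow> (\<integral>x. indicator U x \<partial>lborel :: real)"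
  proof (rule integral_dominated_convergence[where w = "indicator U"])
    show "AE x in lborel. (\<lambda>i. indicator U x * indicator U (x + X i)) \<longlonglongrightarrow> (indicator U x :: real)"
    proof (intro AE_I2)
      fix x
      show "(\<lambda>i. indicator U x * indicator U (x + X i)) \<longlonglongrightarrow> (indicator U x :: real)"
      proof (cases "x \<in> U")
        case True
        have "(\<lambda>i. x + X i) \<longlonglongrightarrow> x + 0" by (intro tendsto_intros X)
        then have "eventually (\<lambda>i. x + X i \<in> U) sequentially"
          using topological_tendstoD[of _ "x + 0" sequentially U] U True by simp
        then have "eventually (\<lambda>i. indicator U x * indicator U (x + X i) = (1::real)) sequentially"
          by eventually_elim (use True in simp)
        then show ?thesis using True by (simp add: tendsto_eventually)
      qed simp
    qed
  qed (use iU in \<open>auto split: split_indicator\<close>)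
  then have "(\<lambda>i. 2 * cmod c * ((LBINT x. indicator U x) - (LBINT x. indicator U x * indicator U (x + X i)))) \<longlonglongrightarrow> 2 * cmod c * ((LBINT x. indicator U x) - (LBINT x. indicator U x))"
    by (intro tendsto_intros)
  moreover have "(LBINT x. cmod (indicator U (x + h) *\<^sub>R c - indicator U x *\<^sub>R c))
     = 2 * cmod c * ((LBINT x. indicator U x) - (LBINT x. indicator U x * indicator U (x + h)))" for h
  proof -
    have "(LBINT x. cmod (indicator U (x + h) *\<^sub>R c - indicator U x *\<^sub>R c))
       = (LBINT x. cmod c * (indicator U (x + h) + indicator U x - 2 * (indicator U x * indicator U (x + h))))"
      by (intro Bochner_Integration.integral_cong) (auto split: split_indicator)
    also have "\<dots> = cmod c * ((LBINT x. indicator U (x + h)) + (LBINT x. indicator U x) - 2 * (LBINT x. indicator U x * indicator U (x + h)))"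
      using iU iUx iP by simp
    also have "(\<integral>x. indicator U (x + h) \<partial>lborel :: real) = (LBINT x. indicator U x)"
      by (rule integral_translate)
    finally show ?thesis by (simp add: algebra_simps)
  qed
  ultimately show ?thesis by simp
qed

lemma translation_continuous:
  fixes u :: "real \<Rightarrow> complex"
  assumes "integrable lborel u" and X: "X \<longlonglongrightarrow> 0"
  shows "(\<lambda>i. LBINT x. cmod (u (x + X i) - u x)) \<longlonglongrightarrow> 0"
  using assms(1)
proof (induction rule: integrable_induct)
  case (base A c)
  have As [measurable]: "A \<in> sets borel" using base by simp
  have fin: "emeasure lborel A < \<infinity>" using base by simp
  have iA: "integrable lborel (\<lambda>x. indicator A x *\<^sub>R c)" using base by simp
  show ?case
  proof (rule translation_approx[OF iA])
    fix e :: real assume e: "e > 0"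
    define d where "d = e / (cmod c + 1)"
    have d: "d > 0" using e by (simp add: d_def add_nonneg_pos)
    obtain U where U: "open U" "A \<subseteq> U" "emeasure lborel (U - A) < ennreal d"
    proof -
      have "A \<in> sets lebesgue" by (simp add: sets_completionI_sets)
      from sets_lebesgue_outer_open[OF this d] obtain U
        where U: "open U" "A \<subseteq> U" "emeasure lebesgue (U - A) < ennreal d" by metis
      have "U - A \<in> sets lborel" using U(1) by auto
      then have "emeasure lebesgue (U - A) = emeasure lborel (U - A)" by (simp add: sets_completionI_sets)
      with U that show ?thesis by metis
    qed
    have [measurable]: "U \<in> sets borel" using U by auto
    have Ufin: "emeasure lborel U < \<infinity>"
    proof -
      have "emeasure lborel U \<le> emeasure lborel A + emeasure lborel (U - A)"
        using emeasure_subadditive[of A lborel "U - A"] U(2) by (simp add: Un_absorb1)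
      also have "\<dots> < \<infinity>" using fin order_less_trans[OF U(3) ennreal_less_top] by (simp add: ennreal_add_less_top)
      finally show ?thesis .
    qed
    have "(LBINT x. cmod (indicator U x *\<^sub>R c - indicator A x *\<^sub>R c)) = (LBINT x. cmod c * indicator (U - A) x)"
      using U(2) by (intro Bochner_Integration.integral_cong) (auto split: split_indicator)
    also have "\<dots> = cmod c * measure lborel (U - A)"
      by simp
    also have "\<dots> \<le> cmod c * d"
      using U(3) d by (intro mult_left_mono) (auto simp: measure_def enn2real_leI)
    also have "\<dots> < e"
    proof -
      have "cmod c * d = e - d" using add_nonneg_pos[of "cmod c" 1] by (simp add: d_def field_simps)
      then show ?thesis using d by simp
    qed
    finally have "(LBINT x. cmod (indicator U x *\<^sub>R c - indicator A x *\<^sub>R c)) < e" .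
    moreover have "integrable lborel (\<lambda>x. indicator U x *\<^sub>R c)" using Ufin by simp
    ultimately show "\<exists>v. integrable lborel v \<and> (LBINT x. cmod (v x - indicator A x *\<^sub>R c)) < e \<and>
      (\<lambda>i. LBINT x. cmod (v (x + X i) - v x)) \<longlonglongrightarrow> 0"
      using translation_open[OF U(1) Ufin X, of c] by blast
  qed
next
  case (add f g)
  have "(\<lambda>i. (LBINT x. cmod (f (x + X i) - f x)) + (LBINT x. cmod (g (x + X i) - g x))) \<longlonglongrightarrow> 0 + 0"
    by (intro tendsto_add add)
  then have lim: "(\<lambda>i. (LBINT x. cmod (f (x + X i) - f x)) + (LBINT x. cmod (g (x + X i) - g x))) \<longlonglongrightarrow> 0" by simp
  show ?case
  proof (rule Lim_null_comparison[OF _ lim], intro always_eventually allI)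
    fix i
    note it = integrable_translate
    have "(LBINT x. cmod (f (x + X i) + g (x + X i) - (f x + g x)))
      \<le> (LBINT x. cmod (f (x + X i) - f x) + cmod (g (x + X i) - g x))"
      by (intro integral_mono Bochner_Integration.integrable_add integrable_norm Bochner_Integration.integrable_diff it add norm_diff_triangle_ineq)
    also have "\<dots> = (LBINT x. cmod (f (x + X i) - f x)) + (LBINT x. cmod (g (x + X i) - g x))"
      using add it[OF add(1)] it[OF add(2)] by (intro Bochner_Integration.integral_add) auto
    finally show "norm (LBINT x. cmod (f (x + X i) + g (x + X i) - (f x + g x))) \<le> 
      (LBINT x. cmod (f (x + X i) - f x)) + (LBINT x. cmod (g (x + X i) - g x))"
      by simp
  qed
next
  case (lim f s)
  show ?case
  proof (rule translation_approx[OF lim(4)])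
    fix e :: real assume e: "e > 0"
    have [measurable]: "f \<in> borel_measurable borel" "s i \<in> borel_measurable borel" for i
      using lim(4) lim(1)[of i] by (auto dest: borel_measurable_integrable)
    have "(\<lambda>i. LBINT x. cmod (s i x - f x)) \<longlonglongrightarrow> integral\<^sup>L (lborel :: real measure) (\<lambda>_. 0)"
    proof (rule integral_dominated_convergence[where w = "\<lambda>x. 3 * cmod (f x)"])
      show "AE x in lborel. (\<lambda>i. cmod (s i x - f x)) \<longlonglongrightarrow> 0"
        using lim(2) by (auto intro!: tendsto_norm_zero LIM_zero)
      show "AE x in lborel. norm (cmod (s i x - f x)) \<le> 3 * cmod (f x)" for i
      proof (intro AE_I2)
        fix x
        have "cmod (s i x - f x) \<le> cmod (s i x) + cmod (f x)" by (rule norm_triangle_ineq4)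
        then show "norm (cmod (s i x - f x)) \<le> 3 * cmod (f x)" using lim(3)[of x i] by simp
      qed
    qed (use lim(4) in auto)
    then have "(\<lambda>i. LBINT x. cmod (s i x - f x)) \<longlonglongrightarrow> 0" by simp
    from LIMSEQ_D[OF this e] obtain i where "(LBINT x. cmod (s i x - f x)) < e" by force
    then show "\<exists>v. integrable lborel v \<and> (LBINT x. cmod (v x - f x)) < e \<and>
      (\<lambda>i. LBINT x. cmod (v (x + X i) - v x)) \<longlonglongrightarrow> 0"
      using lim(1) lim(5) by blast
  qed
qed

subsection \<open>Gaussian regularization\<close>

lemma lebesgue_norm_bound:
  fixes f :: "'a \<Rightarrow> 'b::{banach, second_countable_topology}" and g :: "'a \<Rightarrow> real"
  assumes "integrable M f" "integrable M g" "\<And>x. norm (f x) \<le> g x"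
  shows "norm (integral\<^sup>L M f) \<le> integral\<^sup>L M g"
  by (rule order_trans[OF integral_norm_bound Bochner_Integration.integral_mono]) (use assms in auto)

lemma norm_integral_le_nn:
  fixes f :: "'a \<Rightarrow> 'b::{banach, second_countable_topology}"
  shows "ennreal (norm (integral\<^sup>L M f)) \<le> (\<integral>\<^sup>+x. ennreal (norm (f x)) \<partial>M)"
  by (cases "integrable M f") (auto simp: integral_norm_bound_ennreal not_integrable_integral_eq)

lemma gaussian_integral:
  shows "integrable lborel (\<lambda>s. exp (- s\<^sup>2 / 2) :: real)" "(LBINT s. exp (- s\<^sup>2 / 2)) = sqrt (2 * pi)"
proof -
  have "has_bochner_integral lborel (\<lambda>x. std_normal_density x * x ^ (2 * 0)) (fact (2 * 0) / (2 ^ 0 * fact 0))"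
    by (rule std_normal_moment_even)
  then have h: "has_bochner_integral lborel (\<lambda>x. sqrt (2 * pi) * std_normal_density x) (sqrt (2 * pi) * 1)"
    by (intro has_bochner_integral_mult_right) simp
  have e: "(\<lambda>x. sqrt (2 * pi) * std_normal_density x) = (\<lambda>s. exp (- s\<^sup>2 / 2))"
    by (simp add: std_normal_density_def fun_eq_iff)
  show "integrable lborel (\<lambda>s. exp (- s\<^sup>2 / 2) :: real)" "(LBINT s. exp (- s\<^sup>2 / 2)) = sqrt (2 * pi)"
    using h unfolding e by (auto simp: has_bochner_integral_iff)
qed

lemma gaussian_fourier1: "(LBINT x. iexp (t * x) * of_real (exp (- x\<^sup>2 / 2))) = of_real (sqrt (2 * pi) * exp (- t\<^sup>2 / 2))"
proof -
  have "complex_of_real (exp (- t\<^sup>2 / 2)) = char std_normal_distribution t"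
    by (simp add: char_std_normal_distribution)
  also have "\<dots> = (LBINT x. std_normal_density x *\<^sub>R iexp (t * x))"
    unfolding char_def by (subst integral_density) (auto intro!: normal_density_nonneg)
  also have "\<dots> = (LBINT x. of_real (1 / sqrt (2 * pi)) * (iexp (t * x) * of_real (exp (- x\<^sup>2 / 2))))"
    by (intro Bochner_Integration.integral_cong) (auto simp: std_normal_density_def scaleR_conv_of_real)
  also have "\<dots> = of_real (1 / sqrt (2 * pi)) * (LBINT x. (iexp (t * x) * of_real (exp (- x\<^sup>2 / 2))))"
    by (rule integral_mult_right_zero)
  finally show ?thesis by (simp add: field_simps)
qed

lemma gaussian_fourier:
  assumes a: "a > 0"
  shows "(LBINT t. iexp (t * s) * of_real (exp (- (a * t)\<^sup>2 / 2))) = of_real (sqrt (2 * pi) / a * exp (- (s / a)\<^sup>2 / 2))"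
proof -
  have "(LBINT x. iexp ((s / a) * x) * of_real (exp (- x\<^sup>2 / 2)))
    = \<bar>a\<bar> *\<^sub>R (LBINT t. iexp ((s / a) * (0 + a * t)) * of_real (exp (- (0 + a * t)\<^sup>2 / 2)))"
    using a by (intro lborel_integral_real_affine) simp
  also have "(\<lambda>t. iexp ((s / a) * (0 + a * t)) * of_real (exp (- (0 + a * t)\<^sup>2 / 2))) = (\<lambda>t. iexp (t * s) * of_real (exp (- (a * t)\<^sup>2 / 2)))"
    using a by (auto simp: fun_eq_iff mult.commute)
  finally show ?thesis unfolding gaussian_fourier1
    using a by (simp add: scaleR_conv_of_real field_simps)
qed

definition fint :: "(real \<Rightarrow> complex) \<Rightarrow> real \<Rightarrow> complex" where
  "fint u t = (LBINT x. iexp (t * x) * u x)"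

lemma integrable_iexp_mult [intro]: "integrable lborel u \<Longrightarrow> integrable lborel (\<lambda>x. iexp (t * x) * u x)"
  by (rule Bochner_Integration.integrable_bound[of _ u]) (auto simp: norm_mult dest: borel_measurable_integrable)

lemma fint_measurable [measurable]:
  assumes [measurable]: "u \<in> borel_measurable borel" shows "fint u \<in> borel_measurable borel"
  unfolding fint_def[abs_def] by measurable

lemma fint_add:
  assumes "integrable lborel u" "integrable lborel v"
  shows "fint (\<lambda>x. u x + v x) = (\<lambda>t. fint u t + fint v t)"
  unfolding fint_def distrib_left
  by (intro ext Bochner_Integration.integral_add integrable_iexp_mult assms)

lemma fint_diff:
  assumes "integrable lborel u" "integrable lborel v"
  shows "fint (\<lambda>x. u x - v x) = (\<lambda>t. fint u t - fint v t)"
  unfolding fint_def right_diff_distrib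
  by (intro ext Bochner_Integration.integral_diff integrable_iexp_mult assms)

lemma fint_scale: "fint (\<lambda>x. c * u x) = (\<lambda>t. c * fint u t)"
  by (simp add: fint_def mult.left_commute fun_eq_iff)

lemma integrable_gauss_weight: "a > 0 \<Longrightarrow> integrable lborel (\<lambda>t. exp (- (a * t)\<^sup>2 / 2) :: real)"
  using lborel_integrable_real_affine[OF gaussian_integral(1), of a 0] by simp

lemma integrable_outer_prod:
  fixes u v :: "real \<Rightarrow> complex"
  assumes u: "integrable lborel u" and v: "integrable lborel v"
  shows "integrable (lborel \<Otimes>\<^sub>M lborel) (\<lambda>(x, y). u x * v y)"
proof -
  have [measurable]: "u \<in> borel_measurable borel" "v \<in> borel_measurable borel"
    using u v by (auto dest: borel_measurable_integrable)
  show ?thesis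
  proof (rule lborel_pair.Fubini_integrable)
    have "integrable lborel (\<lambda>x. cmod (u x) * (LBINT y. cmod (v y)))" using u by simp
    then show "integrable lborel (\<lambda>x. LBINT y. norm (case (x, y) of (x, y) \<Rightarrow> u x * v y))"
      by (simp add: norm_mult)
    show "AE x in lborel. integrable lborel (\<lambda>y. case (x, y) of (x, y) \<Rightarrow> u x * v y)"
      using v by simp
  qed measurable
qed

text \<open>The squared modulus of a Fourier transform is the Fourier transform of the autocorrelation, so
  that Plancherel's identity is Fourier inversion for the autocorrelation at the single point \<open>0\<close>.\<close>
lemma autocorrelation:
  assumes u: "integrable lborel u"
  defines "h \<equiv> \<lambda>r. LBINT y. u (y + r) * cnj (u y)"
  shows "integrable lborel h" "fint h t = of_real ((cmod (fint u t))\<^sup>2)"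
proof -
  have [measurable]: "u \<in> borel_measurable borel" using u by (auto dest: borel_measurable_integrable)
  let ?k = "\<lambda>t y r. iexp (t * r) * (u (y + r) * cnj (u y))"
  have int: "integrable (lborel \<Otimes>\<^sub>M lborel) (case_prod (?k t))" for t
  proof (rule lborel_pair.Fubini_integrable)
    have "(LBINT r. norm (?k t y r)) = cmod (u y) * (LBINT x. cmod (u x))" for y
      using integral_translate[of "\<lambda>x. cmod (u x)" y] by (simp add: norm_mult add.commute mult.commute)
    then show "integrable lborel (\<lambda>y. LBINT r. norm (case (y, r) of (y, r) \<Rightarrow> ?k t y r))" using u by simp
    have "integrable lborel (\<lambda>r. u (y + r))" for y using integrable_translate[OF u, of y] by (simp add: add.commute)
    then show "AE y in lborel. integrable lborel (\<lambda>r. case (y, r) of (y, r) \<Rightarrow> ?k t y r)"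
      unfolding prod.case by (intro AE_I2 integrable_iexp_mult integrable_mult_left)
  qed measurable
  show "integrable lborel h" using lborel_pair.integrable_snd[OF int[of 0]] by (simp add: h_def)
  have "fint h t = (LBINT r. LBINT y. ?k t y r)" by (simp add: fint_def h_def)
  also have "\<dots> = (LBINT y. LBINT r. ?k t y r)" by (rule lborel_pair.Fubini_integral[OF int])
  also have "\<dots> = (LBINT y. fint u t * (iexp (- (t * y)) * cnj (u y)))"
  proof (rule Bochner_Integration.integral_cong[OF refl])
    fix y
    have "?k t y r = iexp (t * (r + y)) * u (r + y) * (iexp (- (t * y)) * cnj (u y))" for r
    proof -
      have "iexp (t * r) = iexp (t * (r + y)) * iexp (- (t * y))" by (simp add: algebra_simps flip: exp_add)
      then show ?thesis by (simp add: add.commute mult_ac)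
    qed
    then have "(LBINT r. ?k t y r) = (LBINT r. iexp (t * (r + y)) * u (r + y)) * (iexp (- (t * y)) * cnj (u y))"
      by (simp only: integral_mult_left_zero)
    then show "(LBINT r. ?k t y r) = fint u t * (iexp (- (t * y)) * cnj (u y))"
      using integral_translate[of "\<lambda>x. iexp (t * x) * u x" y] by (simp only: fint_def)
  qed
  also have "\<dots> = fint u t * cnj (fint u t)"
    by (simp add: fint_def exp_cnj flip: Bochner_Integration.integral_cnj)
  finally show "fint h t = of_real ((cmod (fint u t))\<^sup>2)" unfolding complex_norm_square .
qed

text \<open>Multiplication formula for a Fourier transform and a Gaussian. As \<open>a\<close> tends to \<open>0\<close> the right-hand side
  concentrates at \<open>h 0\<close>.\<close>
lemma gaussian_mean:
  assumes h: "integrable lborel h" and a: "a > 0"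
  shows "(LBINT t. fint h t * of_real (exp (- (a * t)\<^sup>2 / 2))) = (LBINT s. of_real (sqrt (2 * pi) * exp (- s\<^sup>2 / 2)) * h (a * s))"
proof -
  have [measurable]: "h \<in> borel_measurable borel" using h by (auto dest: borel_measurable_integrable)
  let ?w = "\<lambda>t. complex_of_real (exp (- (a * t)\<^sup>2 / 2))"
  have w: "integrable lborel ?w" using integrable_gauss_weight[OF a] by (intro integrable_of_real) auto
  have int: "integrable (lborel \<Otimes>\<^sub>M lborel) (\<lambda>(t, x). iexp (t * x) * (?w t * h x))"
    by (rule Bochner_Integration.integrable_bound[OF integrable_outer_prod[OF w h]]) (auto simp: norm_mult)
  have "(LBINT t. fint h t * ?w t) = (LBINT t. LBINT x. iexp (t * x) * (?w t * h x))"
    unfolding fint_def integral_mult_left_zero[symmetric] by (simp only: mult.assoc mult.commute[of "h _"])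
  also have "\<dots> = (LBINT x. LBINT t. iexp (t * x) * (?w t * h x))"
    by (rule lborel_pair.Fubini_integral[OF int, symmetric])
  also have "\<dots> = (LBINT x. of_real (sqrt (2 * pi) / a * exp (- (x / a)\<^sup>2 / 2)) * h x)"
    unfolding mult.assoc[symmetric] integral_mult_left_zero gaussian_fourier[OF a] ..
  also have "\<dots> = \<bar>a\<bar> *\<^sub>R (LBINT s. of_real (sqrt (2 * pi) / a * exp (- ((0 + a * s) / a)\<^sup>2 / 2)) * h (0 + a * s))"
    using a by (intro lborel_integral_real_affine) simp
  also have "\<dots> = (LBINT s. of_real (sqrt (2 * pi) * exp (- s\<^sup>2 / 2)) * h (a * s))"
    unfolding integral_scaleR_right[symmetric] using a by (simp add: scaleR_conv_of_real)
  finally show ?thesis .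
qed

lemma integrable_bounded_square:
  assumes "integrable lborel u" "\<And>x. cmod (u x) \<le> M"
  shows "square_integrable u"
proof -
  have [measurable]: "u \<in> borel_measurable borel" using assms by (auto dest: borel_measurable_integrable)
  have "integrable lborel (\<lambda>x. (cmod (u x))\<^sup>2)"
  proof (rule Bochner_Integration.integrable_bound[where f = "\<lambda>x. M * cmod (u x)"])
    show "AE x in lborel. norm ((cmod (u x))\<^sup>2) \<le> norm (M * cmod (u x))"
    proof (intro AE_I2)
      fix x
      have "(cmod (u x))\<^sup>2 \<le> M * cmod (u x)"
        unfolding power2_eq_square by (intro mult_right_mono assms) simp
      then show "norm ((cmod (u x))\<^sup>2) \<le> norm (M * cmod (u x))" by simp
    qed
  qed (use assms in auto)
  then show ?thesis by (simp add: square_integrable_def)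
qed

text \<open>Boundedness of \<open>u\<close> makes the autocorrelation continuous at \<open>0\<close> by continuity of translation in \<open>L\<^sub>1\<close>;
  the Gaussian means increase to the square integral of the transform.\<close>
lemma plancherel_bounded:
  assumes u: "integrable lborel u" and M: "\<And>x. cmod (u x) \<le> M"
  shows "square_integrable (fint u)" "(norm (abs_L2 (fint u)))\<^sup>2 = 2 * pi * (norm (abs_L2 u))\<^sup>2"
proof -
  let ?A = "\<lambda>s. sqrt (2 * pi) * exp (- s\<^sup>2 / 2)"
  have [measurable]: "u \<in> borel_measurable borel" using u by (auto dest: borel_measurable_integrable)
  have u2: "square_integrable u" by (rule integrable_bounded_square[OF u M])
  define h where "h = (\<lambda>r. LBINT y. u (y + r) * cnj (u y))"
  note auto_h = autocorrelation[OF u, folded h_def]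
  have [measurable]: "h \<in> borel_measurable borel" using auto_h(1) by (auto dest: borel_measurable_integrable)
  have ir: "integrable lborel (\<lambda>y. u (y + r))" for r by (rule integrable_translate[OF u])
  have prod: "integrable lborel (\<lambda>y. v y * cnj (u y))" "cmod (LBINT y. v y * cnj (u y)) \<le> (LBINT y. cmod (v y)) * M"
    if v: "integrable lborel v" for v
  proof -
    have [measurable]: "v \<in> borel_measurable borel" using v by (auto dest: borel_measurable_integrable)
    have b: "cmod (v y * cnj (u y)) \<le> cmod (v y) * M" for y unfolding norm_mult complex_mod_cnj by (intro mult_left_mono M) simp
    have i: "integrable lborel (\<lambda>y. cmod (v y) * M)" using v by simp
    show p: "integrable lborel (\<lambda>y. v y * cnj (u y))"
    proof (rule Bochner_Integration.integrable_bound[OF i])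
      show "AE y in lborel. norm (v y * cnj (u y)) \<le> norm (cmod (v y) * M)"
        unfolding real_norm_def using b by (intro AE_I2 order_trans[OF _ abs_ge_self])
    qed measurable
    show "cmod (LBINT y. v y * cnj (u y)) \<le> (LBINT y. cmod (v y)) * M"
      using lebesgue_norm_bound[OF p i b] by simp
  qed
  define B where "B = (LBINT y. cmod (u y)) * M"
  have hB: "cmod (h r) \<le> B" for r
    unfolding h_def B_def using prod(2)[OF ir[of r]] integral_translate[of "\<lambda>y. cmod (u y)" r] by simp
  have h0: "h 0 = of_real ((norm (abs_L2 u))\<^sup>2)"
    using cinner_abs[OF u2 u2] by (simp add: h_def cinner_self)
  have hc: "(\<lambda>i. h (X i)) \<longlonglongrightarrow> h 0" if X: "X \<longlonglongrightarrow> 0" for X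
  proof (rule LIM_zero_cancel, rule Lim_null_comparison)
    have "h r - h 0 = (LBINT y. (u (y + r) - u y) * cnj (u y))" for r
      unfolding h_def left_diff_distrib using prod(1)[OF ir[of r]] prod(1)[OF u] by simp
    then show "\<forall>\<^sub>F i in sequentially. norm (h (X i) - h 0) \<le> (LBINT y. cmod (u (y + X i) - u y)) * M"
      using prod(2)[of "\<lambda>y. u (y + r) - u y" for r] ir u by simp
    show "(\<lambda>i. (LBINT y. cmod (u (y + X i) - u y)) * M) \<longlonglongrightarrow> 0"
      by (rule tendsto_mult_left_zero[OF translation_continuous[OF u X]])
  qed
  define a where "a = (\<lambda>i. 1 / real (Suc i))"
  have a: "a i > 0" for i by (simp add: a_def)
  have a0: "a \<longlonglongrightarrow> 0" unfolding a_def by (rule LIMSEQ_Suc[OF lim_1_over_n])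
  let ?f = "\<lambda>i t. (cmod (fint u t))\<^sup>2 * exp (- (a i * t)\<^sup>2 / 2)"
  let ?g = "\<lambda>s. complex_of_real (?A s)"
  have ig: "integrable lborel (\<lambda>s. B * (?A s))"
    using gaussian_integral(1) by (intro integrable_mult_right)
  have "(\<lambda>i. LBINT s. ?g s * h (a i * s)) \<longlonglongrightarrow> (LBINT s. ?g s * h 0)"
  proof (rule integral_dominated_convergence[OF _ _ ig])
    show "AE s in lborel. (\<lambda>i. ?g s * h (a i * s)) \<longlonglongrightarrow> ?g s * h 0"
      by (intro AE_I2 tendsto_mult tendsto_const hc tendsto_mult_left_zero[OF a0])
    show "AE s in lborel. norm (?g s * h (a i * s)) \<le> B * (?A s)" for i
    proof (intro AE_I2)
      fix s
      show "norm (?g s * h (a i * s)) \<le> B * (?A s)"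
        unfolding norm_mult[of "?g s"] norm_of_real by (subst mult.commute) (simp add: mult_right_mono[OF hB])
    qed
  qed measurable
  moreover have "(LBINT s. ?g s * h (a i * s)) = of_real (LBINT t. ?f i t)" for i
    unfolding gaussian_mean[OF auto_h(1) a, symmetric] auto_h(2) of_real_mult[symmetric] by (rule integral_complex_of_real)
  moreover have "(LBINT s. ?g s * h 0) = of_real (2 * pi * (norm (abs_L2 u))\<^sup>2)"
  proof -
    have "(LBINT s. ?g s * h 0) = of_real (sqrt (2 * pi) * sqrt (2 * pi)) * h 0"
      unfolding integral_mult_left_zero integral_complex_of_real integral_mult_right_zero gaussian_integral(2) ..
    then show ?thesis unfolding h0 by simp
  qed
  ultimately have "(\<lambda>i. complex_of_real (LBINT t. ?f i t)) \<longlonglongrightarrow> of_real (2 * pi * (norm (abs_L2 u))\<^sup>2)" by simp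
  then have lim: "(\<lambda>i. LBINT t. ?f i t) \<longlonglongrightarrow> 2 * pi * (norm (abs_L2 u))\<^sup>2" by (simp only: tendsto_of_real_iff)
  have fb: "cmod (fint u t) \<le> (LBINT x. cmod (u x))" for t
    unfolding fint_def by (rule order_trans[OF integral_norm_bound]) (simp add: norm_mult)
  have i: "integrable lborel (?f i)" for i
  proof (rule Bochner_Integration.integrable_bound[where f = "\<lambda>t. (LBINT x. cmod (u x))\<^sup>2 * exp (- (a i * t)\<^sup>2 / 2)"])
    show "AE t in lborel. norm (?f i t) \<le> norm ((LBINT x. cmod (u x))\<^sup>2 * exp (- (a i * t)\<^sup>2 / 2))"
      by (intro AE_I2) (auto intro!: mult_right_mono power_mono fb)
  qed (use integrable_gauss_weight[OF a] in auto)
  have mono: "AE t in lborel. mono (\<lambda>i. ?f i t)"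
  proof (intro AE_I2 monoI mult_left_mono)
    fix t and i j :: nat assume "i \<le> j"
    then have "a j \<le> a i" by (simp add: a_def frac_le)
    then have "(a j)\<^sup>2 * t\<^sup>2 \<le> (a i)\<^sup>2 * t\<^sup>2" using a[of j] by (intro mult_right_mono power_mono) auto
    then show "exp (- (a i * t)\<^sup>2 / 2) \<le> exp (- (a j * t)\<^sup>2 / 2)" by (simp add: power_mult_distrib)
  qed simp
  have ptw: "AE t in lborel. (\<lambda>i. ?f i t) \<longlonglongrightarrow> (cmod (fint u t))\<^sup>2"
  proof (intro AE_I2)
    fix t
    have "(\<lambda>i. ?f i t) \<longlonglongrightarrow> (cmod (fint u t))\<^sup>2 * exp (- (0 * t)\<^sup>2 / 2)" by (intro tendsto_intros a0) auto
    then show "(\<lambda>i. ?f i t) \<longlonglongrightarrow> (cmod (fint u t))\<^sup>2" by simp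
  qed
  have m: "(\<lambda>t. (cmod (fint u t))\<^sup>2) \<in> borel_measurable lborel" by measurable
  show sq: "square_integrable (fint u)"
    using integrable_monotone_convergence[OF i mono ptw lim m] by (simp add: square_integrable_def)
  show "(norm (abs_L2 (fint u)))\<^sup>2 = 2 * pi * (norm (abs_L2 u))\<^sup>2"
    unfolding norm_abs_sq[OF sq] by (rule integral_monotone_convergence[OF i mono ptw lim m])
qed

lemma truncations:
  assumes u: "integrable lborel u" and u2: "square_integrable u"
  obtains v :: "nat \<Rightarrow> real \<Rightarrow> complex"
    where "\<And>i. integrable lborel (v i)" "\<And>i. square_integrable (v i)" "\<And>i. square_integrable (fint (v i))"
    "\<And>i. (norm (abs_L2 (fint (v i))))\<^sup>2 = 2 * pi * (norm (abs_L2 (v i)))\<^sup>2" "\<And>i. norm (abs_L2 (v i)) \<le> norm (abs_L2 u)"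
    "\<And>x. eventually (\<lambda>i. v i x = u x) sequentially" "\<And>i x. v i x = u x \<or> v i x = 0"
proof -
  define v where "v = (\<lambda>(i::nat) x. if cmod (u x) \<le> real i then u x else 0)"
  have [measurable]: "u \<in> borel_measurable borel" using u by (auto dest: borel_measurable_integrable)
  have [measurable]: "v i \<in> borel_measurable borel" for i unfolding v_def by measurable
  have iv: "integrable lborel (v i)" for i
    by (rule Bochner_Integration.integrable_bound[OF u]) (auto simp: v_def)
  have sv: "square_integrable (v i)" for i
    by (rule square_integrable_bound[OF u2, where c = 1]) (auto simp: v_def)
  have b: "cmod (v i x) \<le> real i" for i x by (simp add: v_def)
  show thesis
  proof (rule that[OF iv sv plancherel_bounded[OF iv b]])
    fix i x
    have "(norm (abs_L2 (v i)))\<^sup>2 \<le> (norm (abs_L2 u))\<^sup>2"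
      unfolding norm_abs_sq[OF sv] norm_abs_sq[OF u2]
      using sv u2 by (intro integral_mono) (auto simp: v_def square_integrable_def)
    then show "norm (abs_L2 (v i)) \<le> norm (abs_L2 u)" by (rule power2_le_imp_le) simp
    obtain N :: nat where "cmod (u x) \<le> real N" using real_arch_simple by blast
    then show "eventually (\<lambda>i. v i x = u x) sequentially"
      unfolding eventually_sequentially v_def by (intro exI[of _ N]) auto
    show "v i x = u x \<or> v i x = 0" by (simp add: v_def)
  qed
qed

lemma fint_square_bound:
  assumes u: "integrable lborel u" and u2: "square_integrable u"
  shows "square_integrable (fint u)" "(norm (abs_L2 (fint u)))\<^sup>2 \<le> 2 * pi * (norm (abs_L2 u))\<^sup>2"
proof -
  have [measurable]: "u \<in> borel_measurable borel" using u by (auto dest: borel_measurable_integrable)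
  obtain v where v: "\<And>i. integrable lborel (v i)" "\<And>i. square_integrable (v i)" "\<And>i. square_integrable (fint (v i))"
    "\<And>i. (norm (abs_L2 (fint (v i))))\<^sup>2 = 2 * pi * (norm (abs_L2 (v i)))\<^sup>2" "\<And>i. norm (abs_L2 (v i)) \<le> norm (abs_L2 u)"
    "\<And>x. eventually (\<lambda>i. v i x = u x) sequentially" "\<And>i x. v i x = u x \<or> v i x = 0"
    by (rule truncations[OF u u2]) blast
  have [measurable]: "v i \<in> borel_measurable borel" for i using v(1) by (auto dest: borel_measurable_integrable)
  have lim: "(\<lambda>i. fint (v i) t) \<longlonglongrightarrow> fint u t" for t
    unfolding fint_def
  proof (rule integral_dominated_convergence[where w = "\<lambda>x. cmod (u x)"])
    show "AE x in lborel. (\<lambda>i. iexp (t * x) * v i x) \<longlonglongrightarrow> iexp (t * x) * u x"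
      by (intro AE_I2 tendsto_mult tendsto_const tendsto_eventually v)
    show "AE x in lborel. norm (iexp (t * x) * v i x) \<le> cmod (u x)" for i
    proof (intro AE_I2)
      show "norm (iexp (t * x) * v i x) \<le> cmod (u x)" for x using v(7)[of i x] by (auto simp: norm_mult)
    qed
  qed (use u in auto)
  have "(NBINT t. ennreal ((cmod (fint u t))\<^sup>2)) = (NBINT t. liminf (\<lambda>i. ennreal ((cmod (fint (v i) t))\<^sup>2)))"
    by (intro nn_integral_cong lim_imp_Liminf[symmetric] tendsto_ennrealI tendsto_power tendsto_norm lim) simp
  also have "\<dots> \<le> liminf (\<lambda>i. NBINT t. ennreal ((cmod (fint (v i) t))\<^sup>2))"
    by (rule nn_integral_liminf) measurable
  also have "\<dots> \<le> limsup (\<lambda>i. NBINT t. ennreal ((cmod (fint (v i) t))\<^sup>2))"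
    by (rule Liminf_le_Limsup) simp
  also have "\<dots> \<le> ennreal (2 * pi * (norm (abs_L2 u))\<^sup>2)"
    unfolding nn_norm_abs_sq[OF v(3)] v(4)
    by (intro Limsup_bounded always_eventually allI ennreal_leI mult_left_mono power_mono v) auto
  finally have le: "(NBINT t. ennreal ((cmod (fint u t))\<^sup>2)) \<le> ennreal (2 * pi * (norm (abs_L2 u))\<^sup>2)" .
  show sq: "square_integrable (fint u)"
    using le by (intro square_integrableI_nn) (auto intro: order_le_less_trans)
  show "(norm (abs_L2 (fint u)))\<^sup>2 \<le> 2 * pi * (norm (abs_L2 u))\<^sup>2"
    using le unfolding nn_norm_abs_sq[OF sq] by simp
qed

theorem plancherel_norm:
  assumes u: "integrable lborel u" and u2: "square_integrable u"
  shows "(norm (abs_L2 (fint u)))\<^sup>2 = 2 * pi * (norm (abs_L2 u))\<^sup>2"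
proof -
  have [measurable]: "u \<in> borel_measurable borel" using u by (auto dest: borel_measurable_integrable)
  obtain v where v: "\<And>i. integrable lborel (v i)" "\<And>i. square_integrable (v i)" "\<And>i. square_integrable (fint (v i))"
    "\<And>i. (norm (abs_L2 (fint (v i))))\<^sup>2 = 2 * pi * (norm (abs_L2 (v i)))\<^sup>2" "\<And>i. norm (abs_L2 (v i)) \<le> norm (abs_L2 u)"
    "\<And>x. eventually (\<lambda>i. v i x = u x) sequentially" "\<And>i x. v i x = u x \<or> v i x = 0"
    by (rule truncations[OF u u2]) blast
  have [measurable]: "v i \<in> borel_measurable borel" for i using v(1) by (auto dest: borel_measurable_integrable)
  have id: "integrable lborel (\<lambda>x. v i x - u x)" and sd: "square_integrable (\<lambda>x. v i x - u x)" for i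
    using v(1,2) u u2 by (auto intro: square_integrable_diff)
  have "(\<lambda>i. LBINT x. (cmod (v i x - u x))\<^sup>2) \<longlonglongrightarrow> integral\<^sup>L (lborel :: real measure) (\<lambda>_. 0)"
  proof (rule integral_dominated_convergence[where w = "\<lambda>x. (cmod (u x))\<^sup>2"])
    show "integrable lborel (\<lambda>x. (cmod (u x))\<^sup>2)" using u2 by (simp add: square_integrable_def)
    show "AE x in lborel. (\<lambda>i. (cmod (v i x - u x))\<^sup>2) \<longlonglongrightarrow> 0"
      by (intro AE_I2 tendsto_eventually eventually_mono[OF v(6)]) simp
    show "AE x in lborel. norm ((cmod (v i x - u x))\<^sup>2) \<le> (cmod (u x))\<^sup>2" for i
    proof (intro AE_I2)
      show "norm ((cmod (v i x - u x))\<^sup>2) \<le> (cmod (u x))\<^sup>2" for x using v(7)[of i x] by auto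
    qed
  qed auto
  then have "(\<lambda>i. (norm (abs_L2 (v i) - abs_L2 u))\<^sup>2) \<longlonglongrightarrow> 0"
    by (simp add: abs_diff[OF v(2) u2] norm_abs_sq[OF sd])
  then have d0: "(\<lambda>i. norm (abs_L2 (v i) - abs_L2 u)) \<longlonglongrightarrow> 0"
    using tendsto_real_sqrt[of "\<lambda>i. (norm (abs_L2 (v i) - abs_L2 u))\<^sup>2" 0] by simp
  have l1: "(\<lambda>i. abs_L2 (v i)) \<longlonglongrightarrow> abs_L2 u" by (rule LIM_zero_cancel[OF tendsto_norm_zero_cancel[OF d0]])
  have "norm (abs_L2 (fint (v i)) - abs_L2 (fint u)) \<le> sqrt (2 * pi) * norm (abs_L2 (v i) - abs_L2 u)" for i
  proof (rule power2_le_imp_le)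
    have "abs_L2 (fint (v i)) - abs_L2 (fint u) = abs_L2 (fint (\<lambda>x. v i x - u x))"
      using fint_square_bound(1)[OF v(1,2)] fint_square_bound(1)[OF u u2]
      by (simp add: abs_diff fint_diff[OF v(1) u])
    then show "(norm (abs_L2 (fint (v i)) - abs_L2 (fint u)))\<^sup>2 \<le> (sqrt (2 * pi) * norm (abs_L2 (v i) - abs_L2 u))\<^sup>2"
      using fint_square_bound(2)[OF id sd, of i] by (simp add: power_mult_distrib abs_diff[OF v(2) u2])
  qed simp
  then have "(\<lambda>i. abs_L2 (fint (v i)) - abs_L2 (fint u)) \<longlonglongrightarrow> 0"
    by (intro Lim_null_comparison[OF _ tendsto_mult_right_zero[OF d0, of "sqrt (2 * pi)"]]) auto
  then have l2: "(\<lambda>i. abs_L2 (fint (v i))) \<longlonglongrightarrow> abs_L2 (fint u)" by (rule LIM_zero_cancel)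
  have "(\<lambda>i. (norm (abs_L2 (fint (v i))))\<^sup>2) \<longlonglongrightarrow> (norm (abs_L2 (fint u)))\<^sup>2" by (intro tendsto_intros l2)
  moreover have "(\<lambda>i. 2 * pi * (norm (abs_L2 (v i)))\<^sup>2) \<longlonglongrightarrow> 2 * pi * (norm (abs_L2 u))\<^sup>2" by (intro tendsto_intros l1)
  ultimately show ?thesis unfolding v(4) by (rule LIMSEQ_unique)
qed

lemma cinner_polarization:
  "4 * cinner f g = of_real ((norm (f + g))\<^sup>2) - of_real ((norm (f - g))\<^sup>2)
     + \<i> * (of_real ((norm (f + scaleC \<i> g))\<^sup>2) - of_real ((norm (f - scaleC \<i> g))\<^sup>2))"
  unfolding cinner_self[symmetric] cinner_add_left cinner_add_right cinner_diff_left cinner_diff_right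
    cinner_scale_left cinner_scale_right
  by (simp add: algebra_simps)

theorem plancherel:
  assumes u: "integrable lborel u" and u2: "square_integrable u"
    and v: "integrable lborel v" and v2: "square_integrable v"
  shows "(LBINT t. fint u t * cnj (fint v t)) = 2 * pi * (LBINT x. u x * cnj (v x))"
proof -
  define F where "F = (\<lambda>w. abs_L2 (fint w))"
  have P: "complex_of_real ((norm (F w))\<^sup>2) = 2 * pi * of_real ((norm (abs_L2 w))\<^sup>2)" if "integrable lborel w" "square_integrable w" for w
    using plancherel_norm[OF that] by (simp add: F_def flip: of_real_power)
  have sF: "square_integrable (fint w)" if "integrable lborel w" "square_integrable w" for w
    using fint_square_bound(1)[OF that] .
  let ?iv = "\<lambda>x. \<i> * v x"
  have iv: "integrable lborel ?iv" "square_integrable ?iv" using v v2 by (auto intro: square_integrable_scale)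
  have Fiv: "F ?iv = scaleC \<i> (F v)" unfolding F_def by (simp add: fint_scale abs_scale sF v v2)
  have a: "F (\<lambda>x. u x + w x) = F u + F w" "F (\<lambda>x. u x - w x) = F u - F w" if "integrable lborel w" "square_integrable w" for w
    using that u u2 unfolding F_def by (simp_all add: fint_add fint_diff abs_add abs_diff sF)
  have b: "abs_L2 (\<lambda>x. u x + w x) = abs_L2 u + abs_L2 w" "abs_L2 (\<lambda>x. u x - w x) = abs_L2 u - abs_L2 w" if "square_integrable w" for w
    using that u2 by (simp_all add: abs_add abs_diff)
  have c: "integrable lborel (\<lambda>x. u x + w x)" "integrable lborel (\<lambda>x. u x - w x)" "square_integrable (\<lambda>x. u x + w x)" "square_integrable (\<lambda>x. u x - w x)"
    if "integrable lborel w" "square_integrable w" for w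
    using that u u2 by (auto intro: square_integrable_add square_integrable_diff)
  have "4 * cinner (F u) (F v) = 2 * pi * (4 * cinner (abs_L2 u) (abs_L2 v))"
    unfolding cinner_polarization Fiv[symmetric] abs_scale[OF v2]
      a[OF v v2, symmetric] a[OF iv, symmetric] b[OF v2, symmetric] b[OF iv(2), symmetric]
    by (simp only: P c v v2 iv) (simp add: algebra_simps)
  then have "cinner (F u) (F v) = 2 * pi * cinner (abs_L2 u) (abs_L2 v)" by simp
  then show ?thesis unfolding F_def by (simp add: cinner_abs sF u u2 v v2)
qed

section \<open>Multiplication operators\<close>

definition bdd_meas :: "('a::euclidean_space \<Rightarrow> complex) \<Rightarrow> bool" where
  "bdd_meas m \<longleftrightarrow> m \<in> borel_measurable borel \<and> (\<exists>C. \<forall>x. cmod (m x) \<le> C)"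

definition mulop :: "('a::euclidean_space \<Rightarrow> complex) \<Rightarrow> 'a L2 \<Rightarrow> 'a L2" where
  "mulop m f = abs_L2 (\<lambda>x. m x * rep_L2 f x)"

lemma sq_mul_bound:
  assumes "m \<in> borel_measurable borel" "\<And>x. cmod (m x) \<le> C" "square_integrable f"
  shows "square_integrable (\<lambda>x. m x * f x)"
  using assms sq_measurable[OF assms(3)]
  by (intro square_integrable_bound[OF assms(3), where c = C]) (auto simp: norm_mult intro!: mult_right_mono)

lemma sq_mul: "bdd_meas m \<Longrightarrow> square_integrable f \<Longrightarrow> square_integrable (\<lambda>x. m x * f x)"
  unfolding bdd_meas_def using sq_mul_bound by blast

lemma mulop_abs:
  assumes "bdd_meas m" "square_integrable f"
  shows "mulop m (abs_L2 f) = abs_L2 (\<lambda>x. m x * f x)"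
  unfolding mulop_def
  by (rule abs_eqI[OF sq_mul[OF assms(1) sq_rep] sq_mul[OF assms]])
    (use rep_abs[OF assms(2)] in \<open>auto elim: eventually_mono\<close>)

lemma mulop_norm_le:
  assumes "m \<in> borel_measurable borel" "\<And>x. cmod (m x) \<le> C"
  shows "norm (mulop m f) \<le> C * norm f"
proof (rule power2_le_imp_le)
  have C: "C \<ge> 0" using assms(2) norm_ge_zero order_trans by blast
  then show "0 \<le> C * norm f" by simp
  have sq: "square_integrable (\<lambda>x. m x * rep_L2 f x)" by (rule sq_mul_bound[OF assms sq_rep])
  have "(norm (mulop m f))\<^sup>2 = (LBINT x. (cmod (m x * rep_L2 f x))\<^sup>2)"
    unfolding mulop_def by (rule norm_abs_sq[OF sq])
  also have "\<dots> \<le> (LBINT x. C\<^sup>2 * (cmod (rep_L2 f x))\<^sup>2)"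
  proof (rule integral_mono)
    show "integrable lborel (\<lambda>x. (cmod (m x * rep_L2 f x))\<^sup>2)" using sq by (simp add: square_integrable_def)
    show "integrable lborel (\<lambda>x. C\<^sup>2 * (cmod (rep_L2 f x))\<^sup>2)" using sq_rep[of f] by (simp add: square_integrable_def)
    fix x
    show "(cmod (m x * rep_L2 f x))\<^sup>2 \<le> C\<^sup>2 * (cmod (rep_L2 f x))\<^sup>2"
      unfolding norm_mult power_mult_distrib using assms(2)[of x] by (intro mult_right_mono power_mono) auto
  qed
  also have "\<dots> = (C * norm f)\<^sup>2"
    using norm_abs_sq[OF sq_rep, of f] by (simp add: power_mult_distrib)
  finally show "(norm (mulop m f))\<^sup>2 \<le> (C * norm f)\<^sup>2" .
qed

lemma mulop_add: "bdd_meas m \<Longrightarrow> mulop m (f + g) = mulop m f + mulop m g"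
  using abs_add[OF sq_rep sq_rep, of f g] mulop_abs[of m "\<lambda>x. rep_L2 f x + rep_L2 g x"]
  by (simp add: mulop_def square_integrable_add sq_rep abs_add sq_mul distrib_left)

lemma mulop_scaleC: "bdd_meas m \<Longrightarrow> mulop m (scaleC c f) = scaleC c (mulop m f)"
  using abs_scale[OF sq_rep, of c f] mulop_abs[of m "\<lambda>x. c * rep_L2 f x"]
  by (simp add: mulop_def square_integrable_scale sq_rep abs_scale sq_mul mult_ac)

lemma bdd_meas_mult: 
  assumes "bdd_meas m" "bdd_meas k" shows "bdd_meas (\<lambda>x. m x * k x)"
proof -
  obtain C D where C: "\<And>x. cmod (m x) \<le> C" and D: "\<And>x. cmod (k x) \<le> D" using assms unfolding bdd_meas_def by blast
  have "C \<ge> 0" using C norm_ge_zero order_trans by blast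
  then have "cmod (m x * k x) \<le> C * D" for x unfolding norm_mult by (intro mult_mono C D) auto
  then show ?thesis using assms unfolding bdd_meas_def by auto
qed

lemma bdd_meas_cnj: "bdd_meas m \<Longrightarrow> bdd_meas (\<lambda>x. cnj (m x))"
  unfolding bdd_meas_def by auto

lemma bdd_meas_add: 
  assumes "bdd_meas m" "bdd_meas k" shows "bdd_meas (\<lambda>x. m x + k x)"
proof -
  obtain C D where C: "\<And>x. cmod (m x) \<le> C" and D: "\<And>x. cmod (k x) \<le> D" using assms unfolding bdd_meas_def by blast
  have "cmod (m x + k x) \<le> C + D" for x by (rule norm_triangle_mono[OF C D])
  then show ?thesis using assms unfolding bdd_meas_def by auto
qed

lemma bdd_meas_const [simp]: "bdd_meas (\<lambda>x. c)"
  unfolding bdd_meas_def by auto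

lemma mulop_mulop: "bdd_meas m \<Longrightarrow> bdd_meas k \<Longrightarrow> mulop m (mulop k f) = mulop (\<lambda>x. m x * k x) f"
  unfolding mulop_def[of k] by (subst mulop_abs) (auto simp: sq_mul sq_rep mulop_def mult.assoc)

lemma mulop_plus: "bdd_meas m \<Longrightarrow> bdd_meas k \<Longrightarrow> mulop (\<lambda>x. m x + k x) f = mulop m f + mulop k f"
  unfolding mulop_def by (subst abs_add) (auto simp: sq_mul sq_rep distrib_right)

lemma mulop_cmult: "bdd_meas m \<Longrightarrow> mulop (\<lambda>x. c * m x) f = scaleC c (mulop m f)"
  unfolding mulop_def by (subst abs_scale) (auto simp: sq_mul sq_rep mult.assoc)

lemma mulop_const: "mulop (\<lambda>x. c) f = scaleC c f"
  using abs_scale[OF sq_rep, of c f] by (simp add: mulop_def)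

lemma cinner_mulop:
  assumes "bdd_meas m" shows "cinner (mulop m f) g = (LBINT x. m x * (rep_L2 f x * cnj (rep_L2 g x)))"
  using cinner_abs[OF sq_mul[OF assms sq_rep] sq_rep, of f g] by (simp add: mulop_def mult.assoc)

lemma mulop_adjoint:
  assumes "bdd_meas m" shows "cinner (mulop m f) g = cinner f (mulop (\<lambda>x. cnj (m x)) g)"
  using cinner_abs[OF sq_rep sq_mul[OF bdd_meas_cnj[OF assms] sq_rep], of f g]
  unfolding cinner_mulop[OF assms] by (simp add: mulop_def mult_ac)

lemma L2_on_iff:
  assumes [measurable]: "A \<in> sets borel"
  shows "f \<in> L2_on A \<longleftrightarrow> mulop (\<lambda>x. indicator A x) f = f"
proof
  have b: "bdd_meas (\<lambda>x. indicator A x :: complex)"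
    unfolding bdd_meas_def by (auto intro!: exI[of _ 1] split: split_indicator)
  {
    assume "f \<in> L2_on A"
    then obtain g where g: "f = abs_L2 g" "square_integrable g" "\<And>x. x \<notin> A \<Longrightarrow> g x = 0" unfolding L2_on_def by auto
    have "(\<lambda>x. indicator A x * g x) = g" using g(3) by (auto simp: fun_eq_iff split: split_indicator)
    then show "mulop (\<lambda>x. indicator A x) f = f" using mulop_abs[OF b g(2)] g(1) by simp
  next
    assume "mulop (\<lambda>x. indicator A x) f = f"
    then show "f \<in> L2_on A" unfolding L2_on_def mulop_def
      by (intro CollectI exI[of _ "\<lambda>x. indicator A x * rep_L2 f x"]) (auto simp: sq_mul[OF b sq_rep])
  }
qed

section \<open>Integration over the plane in cartesian coordinates\<close>

lemma Complex_measurable [measurable]: "(\<lambda>(t, r). Complex t r) \<in> borel_measurable (borel \<Otimes>\<^sub>M borel)"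
proof -
  have "(\<lambda>p::real \<times> real. Complex (fst p) (snd p)) \<in> borel_measurable borel"
    by (intro borel_measurable_continuous_onI continuous_intros)
  then show ?thesis by (simp add: borel_prod split_beta')
qed

lemma Complex_measurable' [measurable (raw)]:
  assumes "f \<in> borel_measurable M" "g \<in> borel_measurable M" 
  shows "(\<lambda>x. Complex (f x) (g x)) \<in> borel_measurable M"
  using measurable_compose[OF measurable_Pair[OF assms] Complex_measurable] by simp

lemma lborel_complex: "(lborel :: complex measure) = distr (lborel \<Otimes>\<^sub>M lborel) borel (\<lambda>(t, r). Complex t r)"
proof (rule lborel_eqI)
  let ?A = "lborel \<Otimes>\<^sub>M lborel"
  fix l u :: complex
  assume le: "\<And>b. b \<in> Basis \<Longrightarrow> l \<bullet> b \<le> u \<bullet> b"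
  have lu: "Re l \<le> Re u" "Im l \<le> Im u" using le[of 1] le[of \<i>] by (auto simp: Basis_complex_def)
  have "(\<lambda>(t, r). Complex t r) -` box l u \<inter> space ?A = {Re l<..<Re u} \<times> {Im l<..<Im u}"
    by (auto simp: box_def Basis_complex_def space_pair_measure)
  then have "emeasure (distr ?A borel (\<lambda>(t, r). Complex t r)) (box l u)
     = emeasure ?A ({Re l<..<Re u} \<times> {Im l<..<Im u})"
    by (subst emeasure_distr) auto
  also have "\<dots> = emeasure lborel {Re l<..<Re u} * emeasure lborel {Im l<..<Im u}"
    by (rule lborel.emeasure_pair_measure_Times) auto
  also have "\<dots> = (\<Prod>b\<in>Basis. (u - l) \<bullet> b)"
    using lu by (simp add: Basis_complex_def ennreal_mult)
  finally show "emeasure (distr ?A borel (\<lambda>(t, r). Complex t r)) (box l u) = (\<Prod>b\<in>Basis. (u - l) \<bullet> b)" .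
qed simp

lemma nn_integral_complex:
  assumes [measurable]: "f \<in> borel_measurable borel"
  shows "(NBINT z. f z) = (NBINT r. NBINT t. f (Complex t r))"
proof -
  have "(NBINT z. f z) = (\<integral>\<^sup>+p. f (Complex (fst p) (snd p)) \<partial>(lborel \<Otimes>\<^sub>M lborel))"
    by (subst lborel_complex, subst nn_integral_distr) (auto simp: split_beta')
  also have "\<dots> = (NBINT r. NBINT t. f (Complex t r))"
    by (subst lborel_pair.nn_integral_snd[symmetric]) auto
  finally show ?thesis .
qed

lemma integrable_complex_iff:
  fixes f :: "complex \<Rightarrow> 'b::{banach, second_countable_topology}"
  assumes [measurable]: "f \<in> borel_measurable borel"
  shows "integrable lborel f \<longleftrightarrow> integrable (lborel \<Otimes>\<^sub>M lborel) (\<lambda>(t, r). f (Complex t r))"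
  by (subst lborel_complex, subst integrable_distr_eq) (auto simp: split_beta')

lemma integral_complex:
  fixes f :: "complex \<Rightarrow> 'b::{banach, second_countable_topology}"
  assumes i: "integrable lborel f"
  shows "(LBINT z. f z) = (LBINT r. LBINT t. f (Complex t r))"
    "integrable lborel (\<lambda>r. LBINT t. f (Complex t r))"
proof -
  have [measurable]: "f \<in> borel_measurable borel" using i by (auto dest: borel_measurable_integrable)
  have int: "integrable (lborel \<Otimes>\<^sub>M lborel) (\<lambda>(t, r). f (Complex t r))" using i integrable_complex_iff[of f] by simp
  have "(LBINT z. f z) = (\<integral>p. f (Complex (fst p) (snd p)) \<partial>(lborel \<Otimes>\<^sub>M lborel))"
    by (subst lborel_complex, subst integral_distr) (auto simp: split_beta')
  with lborel_pair.integral_snd[OF int] show "(LBINT z. f z) = (LBINT r. LBINT t. f (Complex t r))"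
    by (simp add: split_beta')
  show "integrable lborel (\<lambda>r. LBINT t. f (Complex t r))"
    using lborel_pair.integrable_snd[OF int] by simp
qed

lemma AE_complex_Im:
  assumes "AE y in lborel. Q y"
  shows "AE z in (lborel :: complex measure). Q (Im z)"
proof -
  obtain N where N: "{y. \<not> Q y} \<subseteq> N" "N \<in> null_sets lborel" using assms by (auto elim!: AE_E simp: null_sets_def)
  then have [measurable]: "N \<in> sets borel" by (auto simp: null_sets_def)
  have "Im -` N \<in> sets borel"
    using measurable_sets[of Im borel borel N] by simp
  moreover have "(\<lambda>z. indicator N (Im z) :: ennreal) = indicator (Im -` N)" by (auto simp: fun_eq_iff indicator_def)
  ultimately have "emeasure lborel (Im -` N) = (NBINT z. indicator N (Im z))"
    by simp
  also have "\<dots> = (NBINT r. NBINT t. indicator N r + 0 * ennreal t)"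
    by (subst nn_integral_complex) auto
  also have "\<dots> = (NBINT r. \<infinity> * indicator N r)"
    by (intro nn_integral_cong) (simp add: mult.commute)
  also have "\<dots> = 0" using N(2) by (auto simp: nn_integral_cmult)
  moreover have "Im -` N \<in> sets borel"
    using measurable_sets[of Im borel borel N] by simp
  ultimately have "Im -` N \<in> null_sets lborel" by (auto simp: null_sets_def)
  then show ?thesis by (rule AE_I') (use N(1) in auto)
qed

lemma poly_measurable [measurable (raw)]:
  fixes p :: "real poly"
  shows "f \<in> borel_measurable M \<Longrightarrow> (\<lambda>x. poly p (f x)) \<in> borel_measurable M"
  by (rule borel_measurable_continuous_on[where f = "poly p"]) (auto intro: continuous_intros)

section \<open>Fourier--Laguerre synthesis on the half-plane\<close>

lemma poly_exp_bound:
  fixes p :: "real poly"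
  assumes "\<delta> > 0" shows "\<exists>C\<ge>0. \<forall>s\<ge>0. \<bar>poly p s\<bar> \<le> C * exp (\<delta> * s)"
  using assms
proof (induction p arbitrary: \<delta>)
  case 0
  then show ?case by (intro exI[of _ 0]) auto
next
  case (pCons a p)
  from pCons.IH[of "\<delta> / 2"] pCons.prems obtain C where C: "C \<ge> 0" "\<And>s. s \<ge> 0 \<Longrightarrow> \<bar>poly p s\<bar> \<le> C * exp (\<delta> / 2 * s)" by auto
  show ?case
  proof (intro exI[of _ "\<bar>a\<bar> + 2 / \<delta> * C"] conjI allI impI)
    show "\<bar>a\<bar> + 2 / \<delta> * C \<ge> 0" using C pCons.prems by (intro add_nonneg_nonneg mult_nonneg_nonneg) auto
    fix s :: real assume s: "s \<ge> 0"
    have e1: "1 \<le> exp (\<delta> * s)" using s pCons.prems by simp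
    have e2: "s \<le> 2 / \<delta> * exp (\<delta> / 2 * s)"
    proof -
      have "\<delta> / 2 * s \<le> exp (\<delta> / 2 * s)" using exp_ge_add_one_self[of "\<delta> / 2 * s"] by linarith
      then show ?thesis using pCons.prems by (simp add: field_simps)
    qed
    have "\<bar>s * poly p s\<bar> \<le> (2 / \<delta> * exp (\<delta> / 2 * s)) * (C * exp (\<delta> / 2 * s))"
      unfolding abs_mult using s e2 C pCons.prems by (intro mult_mono) auto
    also have "\<dots> = 2 / \<delta> * C * exp (\<delta> * s)" by (simp flip: exp_add)
    finally have "\<bar>a + s * poly p s\<bar> \<le> \<bar>a\<bar> * exp (\<delta> * s) + 2 / \<delta> * C * exp (\<delta> * s)"
      using mult_left_mono[OF e1, of "\<bar>a\<bar>"] by linarith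
    then show "\<bar>poly (pCons a p) s\<bar> \<le> (\<bar>a\<bar> + 2 / \<delta> * C) * exp (\<delta> * s)"
      by (simp add: algebra_simps)
  qed
qed

text \<open>The function \<open>\<surd>(2x) \<ell>(2xr)\<close> of the transform \<open>R\<close>, with \<open>\<ell>(s) = p(s) exp (- s / 2)\<close> for an arbitrary
  polynomial \<open>p\<close> in place of the Laguerre polynomials.\<close>
definition weight :: "real poly \<Rightarrow> real \<Rightarrow> real \<Rightarrow> real" where
  "weight p r x = indicator {0<..} x * (sqrt (2 * x) * poly p (2 * x * r) * exp (- (x * r)))"

lemma weight_measurable [measurable (raw)]:
  assumes [measurable]: "f \<in> borel_measurable M" "g \<in> borel_measurable M"
  shows "(\<lambda>x. weight p (f x) (g x)) \<in> borel_measurable M"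
  unfolding weight_def by measurable

lemma weight_bound:
  assumes "r > 0" shows "\<exists>C\<ge>0. \<forall>x. \<bar>weight p r x\<bar> \<le> C * exp (- (r / 2 * \<bar>x\<bar>))"
proof -
  define q where "q = [:1, 2:] * pcompose p [:0, 2 * r:]"
  obtain C where C: "C \<ge> 0" "\<And>s. s \<ge> 0 \<Longrightarrow> \<bar>poly q s\<bar> \<le> C * exp (r / 2 * s)"
    using poly_exp_bound[of "r / 2" q] assms by auto
  have "\<bar>weight p r x\<bar> \<le> C * exp (- (r / 2 * \<bar>x\<bar>))" for x
  proof (cases "x > 0")
    case True
    have "sqrt (2 * x) \<le> 1 + 2 * x"
      by (rule real_le_lsqrt[THEN order_trans[rotated]]) (use True in \<open>auto simp: power2_eq_square algebra_simps intro: real_le_lsqrt\<close>)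
    then have "\<bar>sqrt (2 * x) * poly p (2 * x * r)\<bar> \<le> \<bar>poly q x\<bar>"
    proof -
      have "poly q x = (1 + 2 * x) * poly p (2 * x * r)"
        by (simp add: q_def poly_pcompose algebra_simps)
      then show ?thesis using True \<open>sqrt (2 * x) \<le> 1 + 2 * x\<close> by (simp add: abs_mult mult_right_mono del: real_sqrt_mult)
    qed
    also have "\<dots> \<le> C * exp (r / 2 * x)" using C(2) True by simp
    finally have "\<bar>sqrt (2 * x) * poly p (2 * x * r)\<bar> * exp (- (x * r)) \<le> C * exp (r / 2 * x) * exp (- (x * r))"
      by (intro mult_right_mono) auto
    also have "\<dots> = C * exp (- (r / 2 * x))" by (simp add: mult.assoc mult.commute flip: exp_add)
    finally show ?thesis using True by (simp add: weight_def abs_mult)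
  qed (use C in \<open>auto simp: weight_def\<close>)
  with C(1) show ?thesis by blast
qed

definition slice :: "real poly \<Rightarrow> (real \<Rightarrow> complex) \<Rightarrow> real \<Rightarrow> real \<Rightarrow> complex" where
  "slice p g r x = of_real (weight p r x) * g x"

text \<open>Synthesis of a function on the half-plane from its Fourier profile \<open>g\<close>.\<close>
definition Vfun :: "real poly \<Rightarrow> (real \<Rightarrow> complex) \<Rightarrow> complex \<Rightarrow> complex" where
  "Vfun p g z = (if Im z > 0 then of_real (1 / sqrt (2 * pi)) * fint (slice p g (Im z)) (Re z) else 0)"

lemma integrable_exp_abs: "c > 0 \<Longrightarrow> integrable lborel (\<lambda>x::real. exp (- (c * \<bar>x\<bar>)))"
proof -
  assume c: "c > 0"
  have "set_integrable lborel {0<..} (\<lambda>x::real. exp (- x))" using integrable_monom_exp[of 0] by simp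
  then have i0: "integrable lborel (\<lambda>x::real. indicator {0<..} x * exp (- x))" by (simp add: set_integrable_def)
  from lborel_integrable_real_affine[OF i0, of c 0] lborel_integrable_real_affine[OF i0, of "-c" 0]
  have "integrable lborel (\<lambda>x::real. indicator {0<..} (c * x) * exp (- (c * x)) + indicator {0<..} (- (c * x)) * exp (c * x))"
    using c by (intro Bochner_Integration.integrable_add) simp_all
  moreover have "AE x in lborel. exp (- (c * \<bar>x\<bar>)) = indicator {0<..} (c * x) * exp (- (c * x)) + indicator {0<..} (- (c * x)) * exp (c * x)"
    using AE_lborel_singleton[of "0::real"]
    by eventually_elim (use c in \<open>auto simp: indicator_def zero_less_mult_iff mult_less_0_iff abs_if\<close>)
  ultimately show ?thesis
    by (subst integrable_cong_AE) auto
qed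

lemma weight_square_integrable: "r > 0 \<Longrightarrow> square_integrable (\<lambda>x. complex_of_real (weight p r x))"
proof -
  assume r: "r > 0"
  obtain C where C: "C \<ge> 0" "\<And>x. \<bar>weight p r x\<bar> \<le> C * exp (- (r / 2 * \<bar>x\<bar>))" using weight_bound[OF r] by metis
  have "integrable lborel (\<lambda>x. (cmod (complex_of_real (weight p r x)))\<^sup>2)"
  proof (rule Bochner_Integration.integrable_bound[where f = "\<lambda>x. C\<^sup>2 * exp (- (r * \<bar>x\<bar>))"])
    show "integrable lborel (\<lambda>x. C\<^sup>2 * exp (- (r * \<bar>x\<bar>)))" using integrable_exp_abs[OF r] by simp
    show "AE x in lborel. norm ((cmod (complex_of_real (weight p r x)))\<^sup>2) \<le> norm (C\<^sup>2 * exp (- (r * \<bar>x\<bar>)))"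
    proof (intro AE_I2)
      fix x
      have "\<bar>weight p r x\<bar>\<^sup>2 \<le> (C * exp (- (r / 2 * \<bar>x\<bar>)))\<^sup>2" by (intro power_mono C) auto
      also have "\<dots> = C\<^sup>2 * exp (- (r * \<bar>x\<bar>))" by (simp add: power_mult_distrib flip: exp_double)
      finally show "norm ((cmod (complex_of_real (weight p r x)))\<^sup>2) \<le> norm (C\<^sup>2 * exp (- (r * \<bar>x\<bar>)))" by simp
    qed
  qed measurable
  then show ?thesis by (simp add: square_integrable_def)
qed

lemma slice_integrable:
  assumes "r > 0" "square_integrable g" shows "integrable lborel (slice p g r)" "square_integrable (slice p g r)"
proof -
  have "square_integrable (\<lambda>x. cnj (g x))" using assms(2) sq_measurable[OF assms(2)] by (auto simp: square_integrable_def)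
  from square_integrable_prod[OF weight_square_integrable[OF assms(1)] this] show "integrable lborel (slice p g r)"
    by (simp add: slice_def[abs_def])
  obtain C where C: "C \<ge> 0" "\<And>x. \<bar>weight p r x\<bar> \<le> C * exp (- (r / 2 * \<bar>x\<bar>))" using weight_bound[OF assms(1)] by metis
  have "C * exp (- (r / 2 * \<bar>x\<bar>)) \<le> C * 1" for x using C(1) assms(1) by (intro mult_left_mono) auto
  then have "\<bar>weight p r x\<bar> \<le> C" for x using C(2)[of x] order_trans by fastforce
  then show "square_integrable (slice p g r)"
    unfolding slice_def[abs_def] by (intro sq_mul_bound[OF _ _ assms(2), where C = C]) auto
qed

lemma slice_measurable [measurable (raw)]:
  assumes [measurable]: "g \<in> borel_measurable borel" "f \<in> borel_measurable M" "h \<in> borel_measurable M"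
  shows "(\<lambda>x. slice p g (f x) (h x)) \<in> borel_measurable M"
  unfolding slice_def by measurable

lemma Vfun_measurable [measurable]:
  assumes [measurable]: "g \<in> borel_measurable borel"
  shows "Vfun p g \<in> borel_measurable borel"
  unfolding Vfun_def[abs_def] fint_def by measurable

lemma scaled_poly_exp:
  assumes x: "x > 0"
  shows "integrable lborel (\<lambda>r. indicator {0<..} r * (2 * x * (poly P (2 * x * r) * exp (- (2 * x * r)))))"
    "(LBINT r. indicator {0<..} r * (2 * x * (poly P (2 * x * r) * exp (- (2 * x * r))))) = pint P"
proof -
  let ?A = "\<lambda>r. indicator {0<..} r * (2 * x * (poly P (2 * x * r) * exp (- (2 * x * r))))"
  let ?f = "\<lambda>s. indicator {0<..} s * (poly P s * exp (- s))"
  have i: "integrable lborel ?f" using integrable_poly_exp[of P] by (simp add: set_integrable_def)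
  have e: "(\<lambda>r. 2 * x * ?f (0 + 2 * x * r)) = ?A"
    using x by (auto simp: fun_eq_iff indicator_def zero_less_mult_iff)
  show "integrable lborel ?A"
    unfolding e[symmetric] using lborel_integrable_real_affine[OF i, of "2 * x" 0] x by (intro integrable_mult_right) auto
  have "pint P = (LBINT s. ?f s)" by (simp add: pint_def set_lebesgue_integral_def)
  also have "\<dots> = \<bar>2 * x\<bar> *\<^sub>R (LBINT r. ?f (0 + 2 * x * r))" using x by (intro lborel_integral_real_affine) simp
  also have "\<dots> = (LBINT r. 2 * x * ?f (0 + 2 * x * r))" using x by simp
  finally show "(LBINT r. indicator {0<..} r * (2 * x * (poly P (2 * x * r) * exp (- (2 * x * r))))) = pint P"
    unfolding e by simp
qed

lemma weight_mult:
  "x > 0 \<Longrightarrow> weight p r x * weight q r x = 2 * x * (poly (p * q) (2 * x * r) * exp (- (2 * x * r)))"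
proof -
  assume "x > 0"
  then have "weight p r x * weight q r x = (sqrt (2 * x) * sqrt (2 * x)) * (poly p (2 * x * r) * poly q (2 * x * r)) * (exp (- (x * r)) * exp (- (x * r)))"
    by (simp add: weight_def mult_ac)
  also have "\<dots> = 2 * x * (poly p (2 * x * r) * poly q (2 * x * r)) * exp (- (2 * x * r))"
    using \<open>x > 0\<close> by (simp flip: exp_add)
  finally show ?thesis by (simp add: mult.assoc)
qed

definition plane_slice :: "real poly \<Rightarrow> (real \<Rightarrow> complex) \<Rightarrow> real \<times> real \<Rightarrow> complex" where
  "plane_slice p g = (\<lambda>(r, x). indicator {0<..} r * slice p g r x)"

lemma plane_slice_measurable [measurable]:
  assumes [measurable]: "g \<in> borel_measurable borel"
  shows "plane_slice p g \<in> borel_measurable borel"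
  unfolding plane_slice_def slice_def borel_prod[symmetric] by measurable

lemma plane_slice_square:
  assumes g: "square_integrable g"
  shows "(NBINT r. NBINT x. ennreal ((cmod (plane_slice p g (r, x)))\<^sup>2)) < \<infinity>"
    and "square_integrable (plane_slice p g)"
proof -
  let ?B = "\<lambda>r x. (cmod (plane_slice p g (r, x)))\<^sup>2"
  let ?A = "\<lambda>r x. indicator {0<..} r * (2 * x * (poly (p * p) (2 * x * r) * exp (- (2 * x * r))))"
  have [measurable]: "g \<in> borel_measurable borel" using g by (rule sq_measurable)
  have "(NBINT r. NBINT x. ennreal (?B r x))
     = (NBINT x. NBINT r. ennreal (?B r x))"
    by (rule lborel_pair.Fubini'[symmetric]) (simp add: lborel_prod split_beta')
  also have "\<dots> \<le> (NBINT x. ennreal (pint (p * p)) * ennreal ((cmod (g x))\<^sup>2))"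
  proof (intro nn_integral_mono)
    fix x
    show "(NBINT r. ennreal (?B r x)) \<le> ennreal (pint (p * p)) * ennreal ((cmod (g x))\<^sup>2)"
    proof (cases "x > 0")
      case True
      have "(NBINT r. ennreal (?B r x))
        = (NBINT r. ennreal (?A r x) * ennreal ((cmod (g x))\<^sup>2))"
        using True weight_mult[OF True, of p _ p]
        by (intro nn_integral_cong) (auto simp: plane_slice_def slice_def norm_mult power_mult_distrib power2_eq_square abs_mult ennreal_mult split: split_indicator simp flip: ennreal_mult)
      also have "\<dots> = (NBINT r. ennreal (?A r x)) * ennreal ((cmod (g x))\<^sup>2)"
        by (rule nn_integral_multc) measurable
      also have "(NBINT r. ennreal (?A r x)) = ennreal (pint (p * p))"
        using scaled_poly_exp[OF True, of "p * p"] True by (subst nn_integral_eq_integral) (auto split: split_indicator)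
      finally show ?thesis by simp
    qed (simp add: plane_slice_def slice_def weight_def)
  qed
  also have "\<dots> = ennreal (pint (p * p)) * ennreal ((norm (abs_L2 g))\<^sup>2)"
    by (simp add: nn_integral_cmult nn_norm_abs_sq[OF g])
  also have "\<dots> < \<infinity>" by (simp add: ennreal_mult_less_top)
  finally show fin: "(NBINT r. NBINT x. ennreal (?B r x)) < \<infinity>" .
  have "(\<integral>\<^sup>+q. ennreal ((cmod (plane_slice p g q))\<^sup>2) \<partial>(lborel \<Otimes>\<^sub>M lborel)) < \<infinity>"
    using fin by (subst lborel.nn_integral_fst[symmetric]) (auto simp: lborel_prod)
  then show "square_integrable (plane_slice p g)"
    by (intro square_integrableI_nn) (auto simp: lborel_prod)
qed

lemma Vfun_square_integrable:
  assumes g: "square_integrable g" shows "square_integrable (Vfun p g)"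
proof (rule square_integrableI_nn)
  have [measurable]: "g \<in> borel_measurable borel" using g by (rule sq_measurable)
  show "Vfun p g \<in> borel_measurable borel" by measurable
  have "(NBINT z. ennreal ((cmod (Vfun p g z))\<^sup>2)) = (NBINT r. NBINT t. ennreal ((cmod (Vfun p g (Complex t r)))\<^sup>2))"
    by (rule nn_integral_complex) measurable
  also have "\<dots> = (NBINT r. NBINT x. ennreal ((cmod (plane_slice p g (r, x)))\<^sup>2))"
  proof (rule nn_integral_cong)
    fix r :: real
    show "(NBINT t. ennreal ((cmod (Vfun p g (Complex t r)))\<^sup>2)) = (NBINT x. ennreal ((cmod (plane_slice p g (r, x)))\<^sup>2))"
    proof (cases "r > 0")
      case True
      note s = slice_integrable[OF True g, of p]
      have "(NBINT t. ennreal ((cmod (Vfun p g (Complex t r)))\<^sup>2))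
         = (NBINT t. ennreal (1 / (2 * pi)) * ennreal ((cmod (fint (slice p g r) t))\<^sup>2))"
        using True by (intro nn_integral_cong) (simp add: Vfun_def norm_mult norm_divide power_mult_distrib power_divide ennreal_mult[symmetric])
      also have "\<dots> = ennreal (1 / (2 * pi)) * ennreal ((norm (abs_L2 (fint (slice p g r))))\<^sup>2)"
        using fint_square_bound(1)[OF s] sq_measurable[OF fint_square_bound(1)[OF s]] by (simp add: nn_integral_cmult nn_norm_abs_sq)
      also have "\<dots> = ennreal ((norm (abs_L2 (slice p g r)))\<^sup>2)"
        unfolding plancherel_norm[OF s] by (simp flip: ennreal_mult)
      also have "\<dots> = (NBINT x. ennreal ((cmod (plane_slice p g (r, x)))\<^sup>2))"
        using True by (simp add: nn_norm_abs_sq[OF s(2), symmetric] plane_slice_def)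
      finally show ?thesis .
    qed (simp add: Vfun_def plane_slice_def)
  qed
  also have "\<dots> < \<infinity>" by (rule plane_slice_square(1)[OF g])
  finally show "(NBINT z. ennreal ((cmod (Vfun p g z))\<^sup>2)) < \<infinity>" .
qed

text \<open>The multiplier by which a symbol of the vertical variable acts on the Fourier side.\<close>
definition gam :: "(real \<Rightarrow> complex) \<Rightarrow> real poly \<Rightarrow> real \<Rightarrow> complex" where
  "gam a P x = (if x > 0 then \<integral>r. indicator {0<..} r * (a r * of_real (2 * x * (poly P (2 * x * r) * exp (- (2 * x * r))))) \<partial>lborel else 0)"

lemma gam_bdd_meas:
  assumes "bdd_meas a" shows "bdd_meas (gam a P)"
proof -
  have [measurable]: "a \<in> borel_measurable borel" using assms by (simp add: bdd_meas_def)
  obtain C where C: "\<And>x. cmod (a x) \<le> C" using assms by (auto simp: bdd_meas_def)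
  have C0: "C \<ge> 0" using C norm_ge_zero order_trans by blast
  obtain B where B: "B \<ge> 0" "\<And>s. s \<ge> 0 \<Longrightarrow> \<bar>poly P s\<bar> \<le> B * exp (1/2 * s)" using poly_exp_bound[of "1/2" P] by auto
  have "cmod (gam a P x) \<le> 2 * (C * B)" for x
  proof (cases "x > 0")
    case True
    have "(LBINT r. indicator {0<..} r * (2 * (C * B) * (x * exp (- (x * r))))) = 2 * (C * B)"
      "integrable lborel (\<lambda>r. indicator {0<..} r * (2 * (C * B) * (x * exp (- (x * r)))))"
      using scaled_poly_exp[of "x / 2" "[:2 * (C * B):]"] True integral_monom_exp[of 0]
      by (simp_all add: pint_eq mult_ac)
    note I = this
    have "cmod (gam a P x) \<le> (LBINT r. indicator {0<..} r * (2 * (C * B) * (x * exp (- (x * r)))))"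
      unfolding gam_def if_P[OF True]
    proof (rule order_trans[OF integral_norm_bound Bochner_Integration.integral_mono'])
      show "integrable lborel (\<lambda>r. indicator {0<..} r * (2 * (C * B) * (x * exp (- (x * r)))))" by (rule I)
      fix r
      show "cmod (indicator {0<..} r * (a r * of_real (2 * x * (poly P (2 * x * r) * exp (- (2 * x * r)))))) \<le> indicator {0<..} r * (2 * (C * B) * (x * exp (- (x * r))))"
      proof (cases "r > 0")
        case r: True
        have "\<bar>poly P (2 * x * r)\<bar> * exp (- (2 * x * r)) \<le> B * exp (1/2 * (2 * x * r)) * exp (- (2 * x * r))"
          using B(2)[of "2 * x * r"] r True by (intro mult_right_mono) auto
        also have "\<dots> = B * exp (- (x * r))" by (simp add: mult.assoc flip: exp_add)
        finally have "2 * x * (\<bar>poly P (2 * x * r)\<bar> * exp (- (2 * x * r))) \<le> 2 * x * (B * exp (- (x * r)))"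
          using True by (intro mult_left_mono) auto
        then have "cmod (a r) * (2 * x * (\<bar>poly P (2 * x * r)\<bar> * exp (- (2 * x * r)))) \<le> C * (2 * x * (B * exp (- (x * r))))"
          using True C0 by (intro mult_mono[OF C]) (assumption | simp)+
        then show ?thesis using r True by (simp add: norm_mult abs_mult mult_ac)
      qed simp
      show "indicator {0<..} r * (2 * (C * B) * (x * exp (- (x * r)))) \<ge> 0"
        using C0 B(1) True by auto
    qed
    then show ?thesis using I by simp
  qed (use C0 B in \<open>simp add: gam_def\<close>)
  moreover have "gam a P \<in> borel_measurable borel" unfolding gam_def[abs_def] by measurable
  ultimately show ?thesis by (auto simp: bdd_meas_def)
qed

text \<open>Plancherel on each horizontal line, and then integration over the height: the profile \<open>x\<close> is fixed
  throughout, so a multiplier of the height only averages against the two weights.\<close>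
lemma Vfun_pairing:
  assumes g: "square_integrable g" and h: "square_integrable h" and a: "bdd_meas a"
  shows "(LBINT z. a (Im z) * Vfun p g z * cnj (Vfun q h z)) = (LBINT x. gam a (p * q) x * g x * cnj (h x))"
proof -
  have [measurable]: "a \<in> borel_measurable borel" "g \<in> borel_measurable borel" "h \<in> borel_measurable borel"
    using a g h sq_measurable by (auto simp: bdd_meas_def)
  obtain C where C: "\<And>x. cmod (a x) \<le> C" using a by (auto simp: bdd_meas_def)
  have "square_integrable (\<lambda>z. a (Im z) * Vfun p g z)"
    by (rule sq_mul_bound[OF _ _ Vfun_square_integrable[OF g], where C = C]) (auto simp: C)
  from square_integrable_prod[OF this Vfun_square_integrable[OF h]]
  have i: "integrable lborel (\<lambda>z. a (Im z) * Vfun p g z * cnj (Vfun q h z))" .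
  have "square_integrable (\<lambda>s. a (fst s) * plane_slice p g s)"
    by (rule sq_mul_bound[OF _ _ plane_slice_square(2)[OF g], where C = C]) (auto simp: C borel_prod[symmetric])
  from square_integrable_prod[OF this plane_slice_square(2)[OF h]]
  have "integrable lborel (\<lambda>s. a (fst s) * plane_slice p g s * cnj (plane_slice q h s))" .
  then have i2: "integrable (lborel \<Otimes>\<^sub>M lborel) (\<lambda>(r, x). a r * plane_slice p g (r, x) * cnj (plane_slice q h (r, x)))"
    by (simp add: lborel_prod split_beta')
  have "(LBINT z. a (Im z) * Vfun p g z * cnj (Vfun q h z))
     = (LBINT r. LBINT t. a r * Vfun p g (Complex t r) * cnj (Vfun q h (Complex t r)))"
    using integral_complex(1)[OF i] by simp
  also have "\<dots> = (LBINT r. LBINT x. a r * plane_slice p g (r, x) * cnj (plane_slice q h (r, x)))"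
  proof (rule Bochner_Integration.integral_cong[OF refl])
    fix r :: real
    show "(LBINT t. a r * Vfun p g (Complex t r) * cnj (Vfun q h (Complex t r))) = (LBINT x. a r * plane_slice p g (r, x) * cnj (plane_slice q h (r, x)))"
    proof (cases "r > 0")
      case True
      have s: "complex_of_real (sqrt (2 * pi)) * complex_of_real (sqrt (2 * pi)) = 2 * pi" by (simp flip: of_real_mult)
      have "(LBINT t. a r * Vfun p g (Complex t r) * cnj (Vfun q h (Complex t r)))
         = (LBINT t. a r / (2 * pi) * (fint (slice p g r) t * cnj (fint (slice q h r) t)))"
        using True s by (intro Bochner_Integration.integral_cong) (auto simp: Vfun_def field_simps)
      also have "\<dots> = a r / (2 * pi) * (LBINT t. fint (slice p g r) t * cnj (fint (slice q h r) t))"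
        by (rule integral_mult_right_zero)
      also have "\<dots> = a r * (LBINT x. slice p g r x * cnj (slice q h r x))"
        by (subst plancherel) (auto simp: slice_integrable True g h)
      also have "\<dots> = (LBINT x. a r * (slice p g r x * cnj (slice q h r x)))"
        by (rule integral_mult_right_zero[symmetric])
      finally show ?thesis using True by (simp add: plane_slice_def mult.assoc)
    qed (simp add: Vfun_def plane_slice_def)
  qed
  also have "\<dots> = (LBINT x. LBINT r. a r * plane_slice p g (r, x) * cnj (plane_slice q h (r, x)))"
    using lborel_pair.Fubini_integral[OF i2] by simp
  also have "\<dots> = (LBINT x. gam a (p * q) x * g x * cnj (h x))"
  proof (rule Bochner_Integration.integral_cong[OF refl])
    fix x :: real
    show "(LBINT r. a r * plane_slice p g (r, x) * cnj (plane_slice q h (r, x))) = gam a (p * q) x * g x * cnj (h x)"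
    proof (cases "x > 0")
      case True
      have "(LBINT r. a r * plane_slice p g (r, x) * cnj (plane_slice q h (r, x)))
        = (LBINT r. indicator {0<..} r * (a r * of_real (2 * x * (poly (p * q) (2 * x * r) * exp (- (2 * x * r))))) * (g x * cnj (h x)))"
        unfolding weight_mult[OF True, symmetric]
        by (intro Bochner_Integration.integral_cong) (auto simp: plane_slice_def slice_def split: split_indicator)
      also have "\<dots> = gam a (p * q) x * (g x * cnj (h x))"
        unfolding gam_def if_P[OF True] by (rule integral_mult_left_zero)
      finally show ?thesis by (simp add: mult.assoc)
    qed (simp add: plane_slice_def slice_def weight_def gam_def)
  qed
  finally show ?thesis .
qed

subsection \<open>The synthesis operators and their adjoints\<close>

lemma Vfun_cong:
  assumes "g \<in> borel_measurable borel" "h \<in> borel_measurable borel" "AE x in lborel. g x = h x"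
  shows "Vfun p g = Vfun p h"
proof -
  have [measurable]: "g \<in> borel_measurable borel" "h \<in> borel_measurable borel" using assms by auto
  have "fint (slice p g r) t = fint (slice p h r) t" for r t
    unfolding fint_def
  proof (rule integral_cong_AE)
    show "AE x in lborel. iexp (t * x) * slice p g r x = iexp (t * x) * slice p h r x"
      using assms(3) by eventually_elim (simp add: slice_def)
  qed measurable
  then show ?thesis by (auto simp: Vfun_def fun_eq_iff)
qed

definition Vop :: "real poly \<Rightarrow> real L2 \<Rightarrow> complex L2" where
  "Vop p g = abs_L2 (Vfun p (rep_L2 g))"

lemma Vop_abs: "square_integrable g \<Longrightarrow> Vop p (abs_L2 g) = abs_L2 (Vfun p g)"
  unfolding Vop_def using Vfun_cong[OF rep_measurable sq_measurable rep_abs] by metis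

lemma Vfun_add:
  assumes "square_integrable g" "square_integrable h"
  shows "Vfun p (\<lambda>x. g x + h x) = (\<lambda>z. Vfun p g z + Vfun p h z)"
proof
  fix z
  have "fint (slice p (\<lambda>x. g x + h x) r) t = fint (slice p g r) t + fint (slice p h r) t" if "r > 0" for r t
    using fint_add[OF slice_integrable(1)[OF that assms(1)] slice_integrable(1)[OF that assms(2)], of p p]
    by (simp add: slice_def[abs_def] distrib_left)
  then show "Vfun p (\<lambda>x. g x + h x) z = Vfun p g z + Vfun p h z"
    by (simp add: Vfun_def distrib_left add_divide_distrib)
qed

lemma Vfun_scale: "Vfun p (\<lambda>x. c * g x) = (\<lambda>z. c * Vfun p g z)"
proof
  fix z
  have "fint (slice p (\<lambda>x. c * g x) r) t = c * fint (slice p g r) t" for r t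
    using fun_cong[OF fint_scale[of c "slice p g r"], of t] by (simp add: slice_def[abs_def] mult_ac)
  then show "Vfun p (\<lambda>x. c * g x) z = c * Vfun p g z" by (simp add: Vfun_def)
qed

lemma Vfun_poly_add:
  assumes "square_integrable g"
  shows "Vfun (p + q) g = (\<lambda>z. Vfun p g z + Vfun q g z)"
proof
  fix z
  have "fint (slice (p + q) g r) t = fint (slice p g r) t + fint (slice q g r) t" if "r > 0" for r t
  proof -
    have "slice (p + q) g r = (\<lambda>x. slice p g r x + slice q g r x)"
      by (auto simp: slice_def weight_def algebra_simps split: split_indicator)
    then show ?thesis using fint_add[OF slice_integrable(1)[OF that assms] slice_integrable(1)[OF that assms], of p q] by simp
  qed
  then show "Vfun (p + q) g z = Vfun p g z + Vfun q g z"
    by (simp add: Vfun_def distrib_left add_divide_distrib)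
qed

lemma Vfun_poly_smult: "Vfun (smult c p) g = (\<lambda>z. of_real c * Vfun p g z)"
proof
  fix z
  have "slice (smult c p) g r = (\<lambda>x. of_real c * slice p g r x)" for r
    by (auto simp: slice_def weight_def algebra_simps split: split_indicator)
  then show "Vfun (smult c p) g z = of_real c * Vfun p g z"
    by (simp add: Vfun_def fint_scale)
qed

lemma Vop_add: "Vop p (g + h) = Vop p g + Vop p h"
proof -
  have "g + h = abs_L2 (\<lambda>x. rep_L2 g x + rep_L2 h x)" using abs_add[OF sq_rep sq_rep, of g h] by simp
  then have "Vop p (g + h) = abs_L2 (\<lambda>z. Vfun p (rep_L2 g) z + Vfun p (rep_L2 h) z)"
    by (simp add: Vop_abs square_integrable_add sq_rep Vfun_add)
  then show ?thesis by (simp add: Vop_def abs_add Vfun_square_integrable sq_rep)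
qed

lemma Vop_scaleC: "Vop p (scaleC c g) = scaleC c (Vop p g)"
proof -
  have "scaleC c g = abs_L2 (\<lambda>x. c * rep_L2 g x)" using abs_scale[OF sq_rep, of c g] by simp
  then have "Vop p (scaleC c g) = abs_L2 (\<lambda>z. c * Vfun p (rep_L2 g) z)"
    by (simp add: Vop_abs square_integrable_scale sq_rep Vfun_scale)
  then show ?thesis by (simp add: Vop_def abs_scale Vfun_square_integrable sq_rep)
qed

lemma Vop_poly_add: "Vop (p + q) g = Vop p g + Vop q g"
  by (simp add: Vop_def abs_add Vfun_square_integrable sq_rep Vfun_poly_add)

lemma Vop_poly_smult: "Vop (smult c p) g = scaleC (of_real c) (Vop p g)"
  by (simp add: Vop_def abs_scale Vfun_square_integrable sq_rep Vfun_poly_smult)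

lemma bdd_meas_Im: "bdd_meas a \<Longrightarrow> bdd_meas (\<lambda>z. a (Im z))"
  unfolding bdd_meas_def by auto

lemma cinner_mulop_Vop:
  assumes a: "bdd_meas a"
  shows "cinner (mulop (\<lambda>z. a (Im z)) (Vop p g)) (Vop q h) = cinner (mulop (gam a (p * q)) g) h"
proof -
  have "cinner (mulop (\<lambda>z. a (Im z)) (Vop p g)) (Vop q h)
     = (LBINT z. a (Im z) * Vfun p (rep_L2 g) z * cnj (Vfun q (rep_L2 h) z))"
    unfolding Vop_def
    by (simp add: mulop_abs bdd_meas_Im a Vfun_square_integrable sq_rep cinner_abs sq_mul)
  also have "\<dots> = (LBINT x. gam a (p * q) x * rep_L2 g x * cnj (rep_L2 h x))"
    by (rule Vfun_pairing[OF sq_rep sq_rep a])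
  also have "\<dots> = cinner (mulop (gam a (p * q)) g) h"
    by (simp add: cinner_mulop gam_bdd_meas a mult.assoc)
  finally show ?thesis .
qed

definition posfun :: "real \<Rightarrow> complex" where "posfun x = indicator {0<..} x"

lemma posfun_bdd [simp]: "bdd_meas posfun"
  unfolding bdd_meas_def posfun_def[abs_def] by (auto intro!: exI[of _ 1] split: split_indicator)

abbreviation restr :: "real L2 \<Rightarrow> real L2" where "restr \<equiv> mulop posfun"

lemma L2_on_pos: "g \<in> L2_on {0<..} \<longleftrightarrow> restr g = g"
  using L2_on_iff[of "{0<..}" g] by (simp add: posfun_def[abs_def])

lemma restr_restr [simp]: "restr (restr g) = restr g"
  by (subst mulop_mulop) (auto simp: posfun_def mulop_def split: split_indicator intro!: arg_cong[of _ _ abs_L2])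

lemma gam_one: "gam (\<lambda>_. 1) P x = of_real (pint P) * posfun x"
proof (cases "x > 0")
  case True
  have "gam (\<lambda>_. 1) P x = (LBINT r. complex_of_real (indicator {0<..} r * (2 * x * (poly P (2 * x * r) * exp (- (2 * x * r))))))"
    using True unfolding gam_def by (auto intro!: Bochner_Integration.integral_cong split: split_indicator)
  also have "\<dots> = of_real (pint P)"
    unfolding integral_complex_of_real scaled_poly_exp(2)[OF True] ..
  finally show ?thesis using True by (simp add: posfun_def)
qed (simp add: gam_def posfun_def)

lemma mulop_one: "mulop (\<lambda>_. 1) f = f"
  by (simp add: mulop_def)

lemma cinner_Vop: "cinner (Vop p g) (Vop q h) = of_real (pint (p * q)) * cinner (restr g) h"
  using cinner_mulop_Vop[of "\<lambda>_. 1" p g q h]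
  by (simp add: mulop_one gam_one[abs_def] mulop_cmult cinner_scale_left)

lemma restr_norm: "norm (restr g) \<le> norm g"
  using mulop_norm_le[of posfun 1 g] by (auto simp: posfun_def[abs_def] split: split_indicator)

lemma Vop_norm: "norm (Vop p g) \<le> sqrt \<bar>pint (p * p)\<bar> * norm g"
proof (rule power2_le_imp_le)
  have "(norm (Vop p g))\<^sup>2 = cmod (cinner (Vop p g) (Vop p g))" by (simp add: cinner_self norm_power)
  also have "\<dots> = \<bar>pint (p * p)\<bar> * cmod (cinner (restr g) g)" by (simp add: cinner_Vop norm_mult)
  also have "\<dots> \<le> \<bar>pint (p * p)\<bar> * (norm g * norm g)"
    by (intro mult_left_mono order_trans[OF cinner_Cauchy_Schwarz] mult_right_mono restr_norm) auto
  finally show "(norm (Vop p g))\<^sup>2 \<le> (sqrt \<bar>pint (p * p)\<bar> * norm g)\<^sup>2"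
    by (simp add: power_mult_distrib power2_eq_square[of "norm g"])
qed simp

text \<open>The adjoint of \<open>Vop p\<close>, the orthogonal analysis operator; it exists by the Riesz representation.\<close>
definition Wop :: "real poly \<Rightarrow> complex L2 \<Rightarrow> real L2" where
  "Wop p f = (SOME w. \<forall>u. cinner (Vop p u) f = cinner u w)"

lemma Wop_adj: "cinner (Vop p u) f = cinner u (Wop p f)"
proof -
  have "\<exists>w\<in>UNIV. \<forall>u\<in>UNIV. cinner (Vop p u) f = cinner u w"
  proof (rule riesz_representation[OF csubspace_UNIV closed_UNIV, where K = "sqrt \<bar>pint (p * p)\<bar> * norm f"])
    fix u
    show "cmod (cinner (Vop p u) f) \<le> sqrt \<bar>pint (p * p)\<bar> * norm f * norm u"
      using order_trans[OF cinner_Cauchy_Schwarz[of "Vop p u" f] mult_right_mono[OF Vop_norm norm_ge_zero]] by (simp add: mult_ac)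
  qed (auto simp: Vop_add Vop_scaleC cinner_add_left cinner_scale_left)
  then have "\<exists>w. \<forall>u. cinner (Vop p u) f = cinner u w" by auto
  from someI_ex[OF this] show ?thesis unfolding Wop_def by blast
qed

lemma Wop_adj': "cinner (Wop p f) u = cinner f (Vop p u)"
  using Wop_adj[of p u f] by (metis cinner_commute)

lemma cinner_eqI: 
  assumes "\<And>u. cinner u v = cinner u w" shows "v = w"
proof -
  have "cinner (v - w) (v - w) = 0" using assms[of "v - w"] by (simp add: cinner_diff_right)
  then show ?thesis by (simp add: cinner_self)
qed

lemma cinner_eqI': 
  assumes "\<And>u. cinner v u = cinner w u" shows "v = w"
  using assms by (intro cinner_eqI) (metis cinner_commute)

lemma Wop_add: "Wop p (f + g) = Wop p f + Wop p g"
  by (rule cinner_eqI) (simp add: Wop_adj[symmetric] cinner_add_right)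

lemma Wop_scaleC: "Wop p (scaleC c f) = scaleC c (Wop p f)"
  by (rule cinner_eqI) (simp add: Wop_adj[symmetric] cinner_scale_right)

lemma Wop_mulop_Vop: "bdd_meas a \<Longrightarrow> Wop q (mulop (\<lambda>z. a (Im z)) (Vop p g)) = mulop (gam a (p * q)) g"
  by (rule cinner_eqI') (simp add: Wop_adj' cinner_mulop_Vop)

lemma Wop_Vop: "Wop q (Vop p g) = scaleC (of_real (pint (p * q))) (restr g)"
  by (rule cinner_eqI') (simp add: Wop_adj' cinner_Vop cinner_scale_left)

lemma Wop_norm: "norm (Wop p f) \<le> sqrt \<bar>pint (p * p)\<bar> * norm f"
proof (cases "norm (Wop p f) = 0")
  case False
  have "(norm (Wop p f))\<^sup>2 = cmod (cinner (Vop p (Wop p f)) f)"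
    by (simp add: Wop_adj cinner_self norm_power)
  also have "\<dots> \<le> sqrt \<bar>pint (p * p)\<bar> * norm (Wop p f) * norm f"
    by (rule order_trans[OF cinner_Cauchy_Schwarz mult_right_mono[OF Vop_norm norm_ge_zero]])
  finally show ?thesis using False by (simp add: power2_eq_square mult_ac)
qed simp

lemma Vop_restr: "Vop p (restr g) = Vop p g"
proof -
  have "slice p (\<lambda>x. posfun x * rep_L2 g x) r = slice p (rep_L2 g) r" for r
    by (rule ext) (auto simp: slice_def weight_def posfun_def split: split_indicator)
  then have "Vfun p (\<lambda>x. posfun x * rep_L2 g x) = Vfun p (rep_L2 g)"
    by (intro ext) (auto simp: Vfun_def)
  moreover have "Vop p (restr g) = abs_L2 (Vfun p (\<lambda>x. posfun x * rep_L2 g x))"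
    unfolding mulop_def by (rule Vop_abs) (simp add: sq_mul sq_rep)
  ultimately show ?thesis by (simp add: Vop_def)
qed

lemma restr_Wop: "restr (Wop p f) = Wop p f"
proof (rule cinner_eqI')
  fix u
  have "(\<lambda>x. cnj (posfun x)) = posfun" by (auto simp: posfun_def fun_eq_iff split: split_indicator)
  then have "cinner (restr (Wop p f)) u = cinner (Wop p f) (restr u)"
    using mulop_adjoint[OF posfun_bdd, of "Wop p f" u] by simp
  then show "cinner (restr (Wop p f)) u = cinner (Wop p f) u" by (simp add: Wop_adj' Vop_restr)
qed

lemma Wop_in: "Wop p f \<in> L2_on {0<..}"
  by (simp add: L2_on_pos restr_Wop)

lemma Vop_in: "Vop p g \<in> L2_on UHP"
  unfolding Vop_def L2_on_def
  by (intro CollectI exI[of _ "Vfun p (rep_L2 g)"]) (auto simp: Vfun_square_integrable sq_rep Vfun_def upper_half_plane_def)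

subsection \<open>The truncated Fourier transform\<close>

definition cutoff :: "nat \<Rightarrow> complex \<Rightarrow> complex" where "cutoff N z = indicator {- real N..real N} (Re z)"

lemma cutoff_bdd: "bdd_meas (cutoff N)"
  unfolding bdd_meas_def cutoff_def[abs_def] by (auto intro!: exI[of _ 1] split: split_indicator)

lemma cutoff_tendsto: "(\<lambda>N. mulop (cutoff N) \<phi>) \<longlonglongrightarrow> \<phi>"
proof -
  let ?f = "rep_L2 \<phi>"
  have i: "integrable lborel (\<lambda>x. (cmod (?f x))\<^sup>2)" using sq_rep[of \<phi>] by (simp add: square_integrable_def)
  have sq: "square_integrable (\<lambda>z. cutoff N z * ?f z)" for N by (rule sq_mul[OF cutoff_bdd sq_rep])
  have "(\<lambda>N. LBINT z. (cmod (cutoff N z * ?f z - ?f z))\<^sup>2) \<longlonglongrightarrow> integral\<^sup>L (lborel :: complex measure) (\<lambda>_. 0)"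
  proof (rule integral_dominated_convergence[OF _ _ i])
    show "AE z in lborel. (\<lambda>N. (cmod (cutoff N z * ?f z - ?f z))\<^sup>2) \<longlonglongrightarrow> 0"
    proof (intro AE_I2)
      fix z
      obtain M :: nat where "\<bar>Re z\<bar> \<le> real M" using real_arch_simple by blast
      then have "eventually (\<lambda>N. (cmod (cutoff N z * ?f z - ?f z))\<^sup>2 = 0) sequentially"
        unfolding eventually_sequentially cutoff_def by (intro exI[of _ M]) (auto split: split_indicator)
      then show "(\<lambda>N. (cmod (cutoff N z * ?f z - ?f z))\<^sup>2) \<longlonglongrightarrow> 0" by (rule tendsto_eventually)
    qed
    show "AE z in lborel. norm ((cmod (cutoff N z * ?f z - ?f z))\<^sup>2) \<le> (cmod (?f z))\<^sup>2" for N
      by (intro AE_I2) (auto simp: cutoff_def split: split_indicator)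
    show "(\<lambda>z. (cmod (cutoff N z * ?f z - ?f z))\<^sup>2) \<in> borel_measurable lborel" for N
      using sq_measurable[OF sq] by auto
  qed auto
  moreover have "mulop (cutoff N) \<phi> - \<phi> = abs_L2 (\<lambda>z. cutoff N z * ?f z - ?f z)" for N
    using abs_diff[OF sq sq_rep, of N \<phi>] by (simp add: mulop_def)
  ultimately have "(\<lambda>N. (norm (mulop (cutoff N) \<phi> - \<phi>))\<^sup>2) \<longlonglongrightarrow> 0"
    by (simp add: norm_abs_sq square_integrable_diff sq sq_rep)
  then have "(\<lambda>N. norm (mulop (cutoff N) \<phi> - \<phi>)) \<longlonglongrightarrow> 0"
    using tendsto_real_sqrt[of "\<lambda>i. (norm (mulop (cutoff i) \<phi> - \<phi>))\<^sup>2" 0] by simp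
  then show ?thesis by (rule LIM_zero_cancel[OF tendsto_norm_zero_cancel])
qed

text \<open>Conjugated, the kernel by which the truncated transform \<open>R_trunc\<close> integrates over the half-plane.\<close>
definition trunc_kernel :: "real poly \<Rightarrow> nat \<Rightarrow> real \<Rightarrow> complex \<Rightarrow> complex" where
  "trunc_kernel p N x z = cutoff N z * (indicator {0<..} (Im z) * (iexp (Re z * x) * of_real (weight p (Im z) x)))"

lemma trunc_kernel_measurable [measurable (raw)]:
  assumes [measurable]: "f \<in> borel_measurable M" "g \<in> borel_measurable M"
  shows "(\<lambda>x. trunc_kernel p N (f x) (g x)) \<in> borel_measurable M"
  unfolding trunc_kernel_def cutoff_def by measurable

lemma trunc_kernel_L2:
  shows "square_integrable (trunc_kernel p N x)" "norm (abs_L2 (trunc_kernel p N x)) \<le> sqrt (2 * real N * pint (p * p))"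
proof -
  let ?A = "\<lambda>r. indicator {0<..} r * (2 * x * (poly (p * p) (2 * x * r) * exp (- (2 * x * r))))"
  have "(NBINT z. ennreal ((cmod (trunc_kernel p N x z))\<^sup>2)) \<le> ennreal (2 * real N * pint (p * p))"
  proof (cases "x > 0")
    case True
    have "(NBINT z. ennreal ((cmod (trunc_kernel p N x z))\<^sup>2))
       = (NBINT r. NBINT t. ennreal ((cmod (trunc_kernel p N x (Complex t r)))\<^sup>2))"
      by (rule nn_integral_complex) measurable
    also have "\<dots> = (NBINT r. NBINT t. indicator {- real N..real N} t * ennreal (?A r))"
      unfolding weight_mult[OF True, symmetric]
      by (intro nn_integral_cong) (auto simp: trunc_kernel_def cutoff_def norm_mult power_mult_distrib power2_eq_square split: split_indicator)
    also have "\<dots> = (NBINT r. ennreal (2 * real N) * ennreal (?A r))"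
      by (subst nn_integral_multc) auto
    also have "\<dots> = ennreal (2 * real N) * (NBINT r. ennreal (?A r))"
      by (rule nn_integral_cmult) measurable
    also have "(NBINT r. ennreal (?A r)) = ennreal (pint (p * p))"
      using scaled_poly_exp[OF True, of "p * p"] True by (subst nn_integral_eq_integral) (auto split: split_indicator)
    also have "ennreal (2 * real N) * ennreal (pint (p * p)) = ennreal (2 * real N * pint (p * p))"
      by (rule ennreal_mult'[symmetric]) simp
    finally show ?thesis by simp
  qed (simp add: trunc_kernel_def weight_def)
  note le = this
  show sq: "square_integrable (trunc_kernel p N x)"
    using le by (intro square_integrableI_nn) (auto intro: order_le_less_trans)
  have nn: "pint (p * p) \<ge> 0" unfolding pint_def set_lebesgue_integral_def by (intro Bochner_Integration.integral_nonneg) (auto split: split_indicator)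
  have "(norm (abs_L2 (trunc_kernel p N x)))\<^sup>2 \<le> 2 * real N * pint (p * p)"
    using le nn unfolding nn_norm_abs_sq[OF sq] by (subst (asm) ennreal_le_iff) auto
  then show "norm (abs_L2 (trunc_kernel p N x)) \<le> sqrt (2 * real N * pint (p * p))"
    by (rule real_le_rsqrt)
qed

lemma R_trunc_eq:
  "R_trunc k N \<phi> x = of_real (1 / sqrt (2 * pi)) * (LBINT z. rep_L2 \<phi> z * cnj (trunc_kernel (lagp (k - 1)) N x z))"
proof (cases "x > 0")
  let ?A = "\<lambda>r t x. rep_L2 \<phi> (Complex t r) * of_real (sqrt (2 * x) * ell (k - 1) (2 * x * r))"
  case True
  let ?p = "lagp (k - 1)"
  have i: "integrable lborel (\<lambda>z. rep_L2 \<phi> z * cnj (trunc_kernel ?p N x z))"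
    by (rule square_integrable_prod[OF sq_rep trunc_kernel_L2(1)])
  have [measurable]: "(\<lambda>z. rep_L2 \<phi> z * cnj (trunc_kernel ?p N x z)) \<in> borel_measurable borel" by measurable
  have i2: "integrable (lborel \<Otimes>\<^sub>M lborel) (\<lambda>(t, r). rep_L2 \<phi> (Complex t r) * cnj (trunc_kernel ?p N x (Complex t r)))"
    using i by (subst (asm) integrable_complex_iff) auto
  have "(LBINT z. rep_L2 \<phi> z * cnj (trunc_kernel ?p N x z))
     = (LBINT t. LBINT r. rep_L2 \<phi> (Complex t r) * cnj (trunc_kernel ?p N x (Complex t r)))"
    using integral_complex(1)[OF i] lborel_pair.Fubini_integral[OF i2] by simp
  also have "\<dots> = (LINT t:{- real N..real N}|lborel. exp (- (\<i> * of_real (x * t))) *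
          (LINT r:{0<..}|lborel. rep_L2 \<phi> (Complex t r) * of_real (sqrt (2 * x) * ell (k - 1) (2 * x * r))))"
    unfolding set_lebesgue_integral_def
  proof (rule Bochner_Integration.integral_cong[OF refl])
    fix t :: real
    let ?e = "indicator {- real N..real N} t *\<^sub>R exp (- (\<i> * of_real (x * t)))"
    have "(LBINT r. rep_L2 \<phi> (Complex t r) * cnj (trunc_kernel ?p N x (Complex t r)))
       = (LBINT r. ?e * (indicator {0<..} r *\<^sub>R (?A r t x)))"
    proof (rule Bochner_Integration.integral_cong[OF refl])
      fix r :: real
      have "cnj (iexp (t * x)) = exp (- (\<i> * of_real (x * t)))"
        by (simp add: exp_cnj mult_ac)
      then show "rep_L2 \<phi> (Complex t r) * cnj (trunc_kernel ?p N x (Complex t r))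
         = ?e * (indicator {0<..} r *\<^sub>R (?A r t x))"
        using True by (auto simp: trunc_kernel_def cutoff_def weight_def ell_eq zero_less_mult_iff mult_ac split: split_indicator)
    qed
    also have "\<dots> = ?e * (LBINT r. indicator {0<..} r *\<^sub>R (?A r t x))"
      by (rule integral_mult_right_zero)
    finally show "(LBINT r. rep_L2 \<phi> (Complex t r) * cnj (trunc_kernel ?p N x (Complex t r)))
      = indicator {- real N..real N} t *\<^sub>R (exp (- (\<i> * of_real (x * t))) *
        (LBINT r. indicator {0<..} r *\<^sub>R (?A r t x)))"
      by simp
  qed
  finally show ?thesis using True by (simp add: R_trunc_def)
qed (simp add: R_trunc_def trunc_kernel_def weight_def)

text \<open>The truncated transform is an absolutely convergent integral for almost every \<open>x\<close>. Interchanging it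
  with the pairing against \<open>g\<close> exhibits it as the adjoint of the synthesis.\<close>
lemma trunc_pairing:
  assumes g: "square_integrable g" "integrable lborel g"
  shows "(LBINT x. (of_real (1 / sqrt (2 * pi)) * (LBINT z. rep_L2 \<phi> z * cnj (trunc_kernel p N x z))) * cnj (g x))
     = cinner (Wop p (mulop (cutoff N) \<phi>)) (abs_L2 g)"
proof -
  let ?D = "\<lambda>x. LBINT z. cmod (rep_L2 \<phi> z) * cmod (trunc_kernel p N x z)"
  let ?C = "\<lambda>x. \<lambda>z. complex_of_real (cmod (trunc_kernel p N x z))"
  let ?B = "\<lambda>z. complex_of_real (cmod (rep_L2 \<phi> z))"
  let ?A = "norm \<phi> * sqrt (2 * real N * pint (p * p))"
  have [measurable]: "g \<in> borel_measurable borel" using g(1) by (rule sq_measurable)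
  let ?c = "complex_of_real (1 / sqrt (2 * pi))"
  let ?H = "\<lambda>x z. ?c * rep_L2 \<phi> z * cnj (trunc_kernel p N x z) * cnj (g x)"
  have b: "(LBINT z. cmod (?H x z)) \<le> cmod ?c * ?A * cmod (g x)" for x
  proof -
    have sqa: "square_integrable (\<lambda>z. of_real (cmod (rep_L2 \<phi> z)))" "square_integrable (\<lambda>z. of_real (cmod (trunc_kernel p N x z)))"
      using sq_rep[of \<phi>] trunc_kernel_L2(1)[of p N x] by (auto simp: square_integrable_def)
    have "complex_of_real (?D x)
       = cinner (abs_L2 (\<lambda>z. of_real (cmod (rep_L2 \<phi> z)))) (abs_L2 (\<lambda>z. of_real (cmod (trunc_kernel p N x z))))"
      by (simp add: cinner_abs sqa flip: of_real_mult)
    then have "(?D x) \<le>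
       norm (abs_L2 ?B) * norm (abs_L2 (?C x))"
      using cinner_Cauchy_Schwarz[of "abs_L2 ?B" "abs_L2 (?C x)"]
      by (metis abs_le_D1 norm_of_real)
    also have "norm (abs_L2 ?B) = norm \<phi>"
    proof (rule power2_eq_imp_eq)
      show "(norm (abs_L2 ?B))\<^sup>2 = (norm \<phi>)\<^sup>2"
        using norm_abs_sq[OF sqa(1)] norm_abs_sq[OF sq_rep, of \<phi>] by simp
    qed auto
    also have "norm (abs_L2 (?C x)) = norm (abs_L2 (trunc_kernel p N x))"
    proof (rule power2_eq_imp_eq)
      show "(norm (abs_L2 (?C x)))\<^sup>2 = (norm (abs_L2 (trunc_kernel p N x)))\<^sup>2"
        using norm_abs_sq[OF sqa(2)] norm_abs_sq[OF trunc_kernel_L2(1), of p N x] by simp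
    qed auto
    also have "norm \<phi> * norm (abs_L2 (trunc_kernel p N x)) \<le> norm \<phi> * sqrt (2 * real N * pint (p * p))"
      by (intro mult_left_mono trunc_kernel_L2) auto
    finally have "cmod ?c * (?D x) * cmod (g x)
      \<le> cmod ?c * ?A * cmod (g x)"
      by (intro mult_right_mono mult_left_mono) auto
    moreover have "(LBINT z. cmod (?H x z)) = (LBINT z. cmod ?c * (cmod (rep_L2 \<phi> z) * cmod (trunc_kernel p N x z)) * cmod (g x))"
      by (simp only: norm_mult complex_mod_cnj mult.assoc)
    ultimately show ?thesis by (simp only: integral_mult_left_zero integral_mult_right_zero)
  qed
  have iz: "integrable lborel (?H x)" for x
    using square_integrable_prod[OF sq_rep trunc_kernel_L2(1), of \<phi> p N x] by (simp only: mult.assoc[of ?c]) auto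
  have mH: "(\<lambda>(x, z). ?H x z) \<in> borel_measurable (lborel \<Otimes>\<^sub>M lborel)" by measurable
  have int: "integrable (lborel \<Otimes>\<^sub>M lborel) (\<lambda>(x, z). ?H x z)"
  proof (rule lborel_pair.Fubini_integrable[OF mH])
    show "integrable lborel (\<lambda>x. LBINT z. norm (case (x, z) of (x, z) \<Rightarrow> ?H x z))"
    proof (rule Bochner_Integration.integrable_bound[where f = "\<lambda>x. cmod ?c * ?A * cmod (g x)"])
      show "integrable lborel (\<lambda>x. cmod ?c * ?A * cmod (g x))" using g by auto
      show "AE x in lborel. norm (LBINT z. norm (case (x, z) of (x, z) \<Rightarrow> ?H x z)) \<le> norm (cmod ?c * ?A * cmod (g x))"
        unfolding prod.case by (intro AE_I2) (use b in \<open>auto intro!: order_trans[OF _ abs_ge_self] simp: abs_of_nonneg\<close>)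
      show "(\<lambda>x. LBINT z. norm (case (x, z) of (x, z) \<Rightarrow> ?H x z)) \<in> borel_measurable lborel"
        unfolding prod.case by measurable
    qed
    show "AE x in lborel. integrable lborel (\<lambda>z. case (x, z) of (x, z) \<Rightarrow> ?H x z)"
      unfolding prod.case by (intro AE_I2 iz)
  qed
  have "(LBINT x. (?c * (LBINT z. rep_L2 \<phi> z * cnj (trunc_kernel p N x z))) * cnj (g x))
     = (LBINT x. LBINT z. ?H x z)"
  proof (rule Bochner_Integration.integral_cong[OF refl])
    fix x
    have "(LBINT z. ?H x z) = (LBINT z. ?c * (rep_L2 \<phi> z * cnj (trunc_kernel p N x z)) * cnj (g x))"
      by (simp only: mult.assoc)
    then show "(?c * (LBINT z. rep_L2 \<phi> z * cnj (trunc_kernel p N x z))) * cnj (g x) = (LBINT z. ?H x z)"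
      by (simp only: integral_mult_left_zero integral_mult_right_zero)
  qed
  also have "\<dots> = (LBINT z. LBINT x. ?H x z)"
    by (rule lborel_pair.Fubini_integral[OF int, symmetric])
  also have "\<dots> = (LBINT z. cutoff N z * rep_L2 \<phi> z * cnj (Vfun p g z))"
  proof (rule Bochner_Integration.integral_cong[OF refl])
    fix z :: complex
    have "(LBINT x. ?H x z) = (LBINT x. (?c * rep_L2 \<phi> z * (cutoff N z * indicator {0<..} (Im z))) * cnj (iexp (Re z * x) * slice p g (Im z) x))"
      by (rule Bochner_Integration.integral_cong) (auto simp: trunc_kernel_def slice_def cutoff_def split: split_indicator)
    also have "\<dots> = (?c * rep_L2 \<phi> z * (cutoff N z * indicator {0<..} (Im z))) * cnj (fint (slice p g (Im z)) (Re z))"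
      unfolding fint_def Bochner_Integration.integral_cnj[symmetric] by (rule integral_mult_right_zero)
    also have "\<dots> = cutoff N z * rep_L2 \<phi> z * cnj (Vfun p g z)"
      by (auto simp: Vfun_def split: split_indicator)
    finally show "(LBINT x. ?H x z) = cutoff N z * rep_L2 \<phi> z * cnj (Vfun p g z)" .
  qed
  also have "\<dots> = cinner (mulop (cutoff N) \<phi>) (Vop p (abs_L2 g))"
    using cinner_abs[OF sq_mul[OF cutoff_bdd sq_rep] Vfun_square_integrable[OF g(1)], of N \<phi> p]
    by (simp add: mulop_def Vop_abs g)
  finally show ?thesis by (simp add: Wop_adj')
qed

lemma trunc_bounded:
  "cmod (LBINT z. rep_L2 \<phi> z * cnj (trunc_kernel p N x z)) \<le> norm \<phi> * sqrt (2 * real N * pint (p * p))"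
proof -
  have "(LBINT z. rep_L2 \<phi> z * cnj (trunc_kernel p N x z)) = cinner \<phi> (abs_L2 (trunc_kernel p N x))"
    using cinner_abs[OF sq_rep trunc_kernel_L2(1), of \<phi> p N x] by simp
  then show ?thesis
    using order_trans[OF cinner_Cauchy_Schwarz mult_left_mono[OF trunc_kernel_L2(2) norm_ge_zero], of \<phi> p N x] by simp
qed

text \<open>Two functions with the same pairings against bounded functions of bounded support agree:
  test with \<open>d / (1 + cmod d)\<close> for their difference \<open>d\<close>.\<close>
lemma AE_eq_by_testing:
  fixes Q G :: "real \<Rightarrow> complex"
  assumes Q: "Q \<in> borel_measurable borel" "\<And>x. cmod (Q x) \<le> C" and G: "square_integrable G"
    and eq: "\<And>g. square_integrable g \<Longrightarrow> integrable lborel g \<Longrightarrow> (LBINT x. Q x * cnj (g x)) = (LBINT x. G x * cnj (g x))"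
  shows "AE x in lborel. Q x = G x"
proof -
  have [measurable]: "Q \<in> borel_measurable borel" "G \<in> borel_measurable borel" using Q G sq_measurable by auto
  define d where "d = (\<lambda>x. Q x - G x)"
  have [measurable]: "d \<in> borel_measurable borel" unfolding d_def by measurable
  have "AE x in lborel. x \<in> {- real M..real M} \<longrightarrow> d x = 0" for M :: nat
  proof -
    define g where "g = (\<lambda>x. indicator {- real M..real M} x * (d x / of_real (1 + cmod (d x))))"
    have [measurable]: "g \<in> borel_measurable borel" unfolding g_def by measurable
    have gb: "cmod (g x) \<le> indicator {- real M..real M} x" for x
    proof -
      have "1 + cmod (d x) > 0" by (simp add: add_pos_nonneg)
      then show ?thesis
        by (auto simp: g_def norm_divide divide_le_eq_1 simp del: of_real_add split: split_indicator)
    qed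
    have ind: "integrable lborel (indicator {- real M..real M} :: real \<Rightarrow> real)" by simp
    have ig: "integrable lborel g" by (rule Bochner_Integration.integrable_bound[OF ind]) (use gb in \<open>auto intro: order_trans[OF _ abs_ge_self]\<close>)
    have "cmod (g x) \<le> 1" for x using gb[of x] by (auto split: split_indicator_asm)
    then have sg: "square_integrable g" by (rule integrable_bounded_square[OF ig])
    have iQ: "integrable lborel (\<lambda>x. Q x * cnj (g x))"
      by (rule Bochner_Integration.integrable_bound[where f = "\<lambda>x. of_real C * g x"])
        (use ig in \<open>auto simp: norm_mult intro!: mult_right_mono order_trans[OF Q(2) abs_ge_self]\<close>)
    have iG: "integrable lborel (\<lambda>x. G x * cnj (g x))" by (rule square_integrable_prod[OF G sg])
    have e: "d x * cnj (g x) = of_real (indicator {- real M..real M} x * ((cmod (d x))\<^sup>2 / (1 + cmod (d x))))" for x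
      using complex_norm_square[of "d x"] by (simp add: g_def split: split_indicator)
    have "(LBINT x. d x * cnj (g x)) = 0"
      using eq[OF sg ig] iQ iG by (simp add: d_def left_diff_distrib)
    then have z: "(LBINT x. indicator {- real M..real M} x * ((cmod (d x))\<^sup>2 / (1 + cmod (d x)))) = 0"
      unfolding e integral_complex_of_real by simp
    have i: "integrable lborel (\<lambda>x. indicator {- real M..real M} x * ((cmod (d x))\<^sup>2 / (1 + cmod (d x))))"
    proof -
      have "integrable lborel (\<lambda>x. d x * cnj (g x))" using iQ iG by (simp add: d_def left_diff_distrib)
      from integrable_Re[OF this] show ?thesis unfolding e by (simp only: Re_complex_of_real)
    qed
    have "AE x in lborel. indicator {- real M..real M} x * ((cmod (d x))\<^sup>2 / (1 + cmod (d x))) = 0"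
      using z by (subst (asm) integral_nonneg_eq_0_iff_AE[OF i]) (auto split: split_indicator)
    then show ?thesis
    proof eventually_elim
      case (elim x)
      have "1 + cmod (d x) \<noteq> 0" using norm_ge_zero[of "d x"] by linarith
      then show ?case using elim by (auto split: split_indicator_asm)
    qed
  qed
  then have "AE x in lborel. \<forall>M::nat. x \<in> {- real M..real M} \<longrightarrow> d x = 0"
    unfolding AE_all_countable by blast
  then show ?thesis
  proof eventually_elim
    case (elim x)
    obtain M :: nat where "\<bar>x\<bar> \<le> real M" using real_arch_simple by blast
    then have "x \<in> {- real M..real M}" by auto
    then show ?case using elim by (auto simp: d_def)
  qed
qed

lemma abs_R_trunc: "abs_L2 (R_trunc k N \<phi>) = Wop (lagp (k - 1)) (mulop (cutoff N) \<phi>)"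
proof -
  let ?p = "lagp (k - 1)"
  let ?G = "Wop ?p (mulop (cutoff N) \<phi>)"
  have [measurable]: "R_trunc k N \<phi> \<in> borel_measurable borel"
    unfolding R_trunc_eq[abs_def] by measurable
  have ae: "AE x in lborel. R_trunc k N \<phi> x = rep_L2 ?G x"
  proof (rule AE_eq_by_testing[OF _ _ sq_rep])
    show "cmod (R_trunc k N \<phi> x) \<le> 1 / sqrt (2 * pi) * (norm \<phi> * sqrt (2 * real N * pint (?p * ?p)))" for x
      unfolding R_trunc_eq norm_mult norm_of_real by (intro mult_mono trunc_bounded) auto
    fix g :: "real \<Rightarrow> complex" assume g: "square_integrable g" "integrable lborel g"
    show "(LBINT x. R_trunc k N \<phi> x * cnj (g x)) = (LBINT x. rep_L2 ?G x * cnj (g x))"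
      unfolding R_trunc_eq trunc_pairing[OF g] using cinner_abs[OF sq_rep g(1), of ?G] by simp
  qed measurable
  then have "AE x in lborel. rep_L2 ?G x = R_trunc k N \<phi> x" by (auto elim: eventually_mono)
  then have sq: "square_integrable (R_trunc k N \<phi>)" by (intro square_integrable_cong_AE[OF sq_rep]) auto
  have "abs_L2 (R_trunc k N \<phi>) = abs_L2 (rep_L2 ?G)" by (rule abs_eqI[OF sq sq_rep ae])
  then show ?thesis by simp
qed

lemma Wop_tendsto:
  assumes "X \<longlonglongrightarrow> f" shows "(\<lambda>i. Wop p (X i)) \<longlonglongrightarrow> Wop p f"
proof (rule LIM_zero_cancel, rule Lim_null_comparison)
  have "Wop p u - Wop p v = Wop p (u - v)" for u v
    using Wop_add[of p "u - v" v] by simp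
  then show "\<forall>\<^sub>F i in sequentially. norm (Wop p (X i) - Wop p f) \<le> sqrt \<bar>pint (p * p)\<bar> * norm (X i - f)"
    using Wop_norm by simp
  show "(\<lambda>i. sqrt \<bar>pint (p * p)\<bar> * norm (X i - f)) \<longlonglongrightarrow> 0"
    by (intro tendsto_mult_right_zero tendsto_norm_zero LIM_zero assms)
qed

text \<open>Cutting off the horizontal variable converges strongly to the identity and \<open>Wop\<close> is bounded, so the
  limit in the definition of the transform exists.\<close>
theorem R_op_eq: "\<phi> \<in> L2_on UHP \<Longrightarrow> R_op m \<phi> = (\<lambda>k\<in>{1..m}. Wop (lagp (k - 1)) \<phi>)"
  unfolding R_op_def by (auto simp: abs_R_trunc intro!: restrict_ext limI Wop_tendsto cutoff_tendsto)

section \<open>Polyanalytic functions on the half-plane\<close>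

lemma UHP_iff: "z \<in> UHP \<longleftrightarrow> Im z > 0"
  by (simp add: upper_half_plane_def)

lemma open_UHP: "open UHP"
  unfolding upper_half_plane_def by (rule open_halfspace_Im_gt)

lemma convex_UHP: "convex UHP"
  unfolding upper_half_plane_def by (rule convex_halfspace_Im_gt)

text \<open>The components of a polyanalytic function with respect to powers of the height.\<close>
definition polyform :: "nat \<Rightarrow> (nat \<Rightarrow> complex \<Rightarrow> complex) \<Rightarrow> (complex \<Rightarrow> complex) \<Rightarrow> bool" where
  "polyform n \<phi> f \<longleftrightarrow> (\<forall>i<n. \<phi> i holomorphic_on UHP) \<and>
     (\<forall>z\<in>UHP. f z = (\<Sum>i<n. of_real (Im z) ^ i * \<phi> i z))"

lemma dx_cong:
  assumes "z \<in> UHP" "\<And>w. w \<in> UHP \<Longrightarrow> f w = g w" "f differentiable at z"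
  shows "dx f z = dx g z" "dy f z = dy g z" "g differentiable at z"
proof -
  have "(f has_derivative frechet_derivative f (at z)) (at z)"
    using assms(3) by (simp add: frechet_derivative_works)
  then have d: "(g has_derivative frechet_derivative f (at z)) (at z)"
    by (rule has_derivative_transform_within_open[OF _ open_UHP assms(1)]) (use assms(2) in auto)
  then have "frechet_derivative g (at z) = frechet_derivative f (at z)"
    by (rule frechet_derivative_at[symmetric])
  then show "dx f z = dx g z" "dy f z = dy g z" by (auto simp: dx_def dy_def)
  show "g differentiable at z" using d by (auto simp: differentiable_def)
qed

lemma has_derivative_dxdy:
  assumes "(f has_derivative D) (at z)" shows "dx f z = D 1" "dy f z = D \<i>"
  using frechet_derivative_at[OF assms] by (auto simp: dx_def dy_def)

lemma polyform_has_derivative: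
  assumes p: "polyform n \<phi> f" and z: "z \<in> UHP"
  shows "(f has_derivative (\<lambda>h. \<Sum>i<n. of_nat i * of_real (Im z) ^ (i - 1) * of_real (Im h) * \<phi> i z
      + of_real (Im z) ^ i * (deriv (\<phi> i) z * h))) (at z)"
proof -
  let ?g = "\<lambda>z. \<Sum>i<n. of_real (Im z) ^ i * \<phi> i z"
  have "(?g has_derivative (\<lambda>h. \<Sum>i<n. of_nat i * of_real (Im z) ^ (i - 1) * of_real (Im h) * \<phi> i z
      + of_real (Im z) ^ i * (deriv (\<phi> i) z * h))) (at z)"
  proof (rule has_derivative_sum)
    fix i assume i: "i \<in> {..<n}"
    have "(\<phi> i has_field_derivative deriv (\<phi> i) z) (at z)"
      using p i z open_UHP holomorphic_derivI unfolding polyform_def by blast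
    then have 1: "(\<phi> i has_derivative (\<lambda>h. deriv (\<phi> i) z * h)) (at z)"
      by (simp add: has_field_derivative_def mult_commute_abs)
    have "((\<lambda>w. complex_of_real (Im w)) has_derivative (\<lambda>h. of_real (Im h))) (at z)"
      by (intro derivative_eq_intros bounded_linear_imp_has_derivative bounded_linear_compose[OF bounded_linear_of_real bounded_linear_Im]) auto
    then have 2: "((\<lambda>w. complex_of_real (Im w) ^ i) has_derivative (\<lambda>h. of_nat i * of_real (Im h) * of_real (Im z) ^ (i - 1))) (at z)"
      by (rule has_derivative_power)
    show "((\<lambda>w. of_real (Im w) ^ i * \<phi> i w) has_derivative (\<lambda>h. of_nat i * of_real (Im z) ^ (i - 1) * of_real (Im h) * \<phi> i z
      + of_real (Im z) ^ i * (deriv (\<phi> i) z * h))) (at z)"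
      by (rule has_derivative_eq_rhs[OF has_derivative_mult[OF 2 1]]) (auto simp: fun_eq_iff mult_ac add.commute)
  qed
  then show ?thesis
    by (rule has_derivative_transform_within_open[OF _ open_UHP z]) (use p in \<open>auto simp: polyform_def\<close>)
qed

lemma polyform_differentiable: "polyform n \<phi> f \<Longrightarrow> z \<in> UHP \<Longrightarrow> f differentiable at z"
  unfolding differentiable_def using polyform_has_derivative by blast

lemma polyform_dx_eq:
  assumes "polyform n \<phi> f" "z \<in> UHP"
  shows "dx f z = (\<Sum>i<n. of_real (Im z) ^ i * deriv (\<phi> i) z)"
    "dy f z = (\<Sum>i<n. of_nat i * of_real (Im z) ^ (i - 1) * \<phi> i z) + (\<Sum>i<n. of_real (Im z) ^ i * (\<i> * deriv (\<phi> i) z))"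
  unfolding has_derivative_dxdy[OF polyform_has_derivative[OF assms]]
  by (simp_all add: sum.distrib mult_ac)

lemma sum_shift_down: 
  fixes a :: "nat \<Rightarrow> complex"
  shows "(\<Sum>i<n. of_nat i * y ^ (i - 1) * a i) = (\<Sum>i<n - 1. y ^ i * (of_nat (Suc i) * a (Suc i)))"
proof (cases n)
  case (Suc m)
  then show ?thesis by (simp only: sum.lessThan_Suc_shift) (simp add: mult_ac)
qed simp

lemma polyform_dx: "polyform n \<phi> f \<Longrightarrow> polyform n (\<lambda>i. deriv (\<phi> i)) (dx f)"
  unfolding polyform_def using polyform_dx_eq(1)[of n \<phi> f] open_UHP
  by (auto simp: polyform_def intro: holomorphic_deriv)

lemma polyform_dbar:
  assumes "polyform n \<phi> f"
  shows "polyform (n - 1) (\<lambda>i z. \<i> / 2 * (of_nat (Suc i) * \<phi> (Suc i) z)) (dbar f)"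
  unfolding polyform_def
proof (intro conjI allI impI ballI)
  fix i assume "i < n - 1"
  then have "\<phi> (Suc i) holomorphic_on UHP" using assms by (auto simp: polyform_def)
  then show "(\<lambda>z. \<i> / 2 * (of_nat (Suc i) * \<phi> (Suc i) z)) holomorphic_on UHP"
    by (intro holomorphic_intros)
next
  fix z assume z: "z \<in> UHP"
  have c: "(\<Sum>i<n. of_real (Im z) ^ i * (\<i> * deriv (\<phi> i) z)) = \<i> * (\<Sum>i<n. of_real (Im z) ^ i * deriv (\<phi> i) z)"
    by (simp add: sum_distrib_left mult_ac)
  have "dbar f z = \<i> / 2 * (\<Sum>i<n. of_nat i * of_real (Im z) ^ (i - 1) * \<phi> i z)"
    unfolding dbar_def polyform_dx_eq[OF assms z] c by (simp add: algebra_simps add_divide_distrib)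
  then show "dbar f z = (\<Sum>i<n - 1. of_real (Im z) ^ i * (\<i> / 2 * (of_nat (Suc i) * \<phi> (Suc i) z)))"
    unfolding sum_shift_down by (simp add: sum_distrib_left mult_ac)
qed

lemma polyform_dy: "polyform n \<phi> f \<Longrightarrow> \<exists>\<psi>. polyform n \<psi> (dy f)"
proof (intro exI[of _ "\<lambda>i z. \<i> * deriv (\<phi> i) z + (if Suc i < n then of_nat (Suc i) * \<phi> (Suc i) z else 0)"])
  let ?A = "\<lambda>i z. if Suc i < n then of_nat (Suc i) * \<phi> (Suc i) z else 0"
  assume p: "polyform n \<phi> f"
  show "polyform n (\<lambda>i z. \<i> * deriv (\<phi> i) z + (?A i z)) (dy f)"
    unfolding polyform_def
  proof (intro conjI allI impI ballI)
    fix i assume "i < n"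
    then have "\<phi> i holomorphic_on UHP" "Suc i < n \<Longrightarrow> \<phi> (Suc i) holomorphic_on UHP"
      using p by (auto simp: polyform_def)
    then show "(\<lambda>z. \<i> * deriv (\<phi> i) z + (?A i z)) holomorphic_on UHP"
      using open_UHP by (cases "Suc i < n") (auto intro!: holomorphic_intros)
  next
    fix z assume z: "z \<in> UHP"
    have "(\<Sum>i<n. of_real (Im z) ^ i * (?A i z)) = (\<Sum>i<n - 1. of_real (Im z) ^ i * (of_nat (Suc i) * \<phi> (Suc i) z))"
      by (rule sum.mono_neutral_cong_right) auto
    then show "dy f z = (\<Sum>i<n. of_real (Im z) ^ i * (\<i> * deriv (\<phi> i) z + (?A i z)))"
      unfolding polyform_dx_eq(2)[OF p z] sum_shift_down distrib_left sum.distrib by simp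
  qed
qed

lemma polyform_continuous: "polyform n \<phi> f \<Longrightarrow> continuous_on UHP f"
  using polyform_differentiable differentiable_imp_continuous_within
  by (intro continuous_at_imp_continuous_on) blast

lemma polyform_Ck: "polyform n \<phi> f \<Longrightarrow> Ck_on k UHP f"
proof (induction k arbitrary: \<phi> f)
  case 0
  then show ?case by (simp add: polyform_continuous)
next
  case (Suc k)
  then show ?case using polyform_differentiable polyform_dx polyform_dy by (metis Ck_on.simps(2))
qed

lemma polyform_dbar_pow: "polyform n \<phi> f \<Longrightarrow> \<exists>\<psi>. polyform (n - k) \<psi> ((dbar ^^ k) f)"
proof (induction k)
  case (Suc k)
  then obtain \<psi> where "polyform (n - k) \<psi> ((dbar ^^ k) f)" by blast
  from polyform_dbar[OF this] show ?case by auto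
qed auto

lemma polyform_imp_polyanalytic: "polyform n \<phi> f \<Longrightarrow> polyanalytic_on n UHP f"
  unfolding polyanalytic_on_def using polyform_Ck polyform_dbar_pow[of n \<phi> f n]
  by (auto simp: polyform_def)

lemma Ck_cong:
  "Ck_on k UHP f \<Longrightarrow> (\<And>z. z \<in> UHP \<Longrightarrow> f z = g z) \<Longrightarrow> Ck_on k UHP g"
proof (induction k arbitrary: f g)
  case 0
  then show ?case by (simp cong: continuous_on_cong)
next
  case (Suc k)
  note d = dx_cong[where f = f and g = g]
  have "\<And>z. z \<in> UHP \<Longrightarrow> dx f z = dx g z \<and> dy f z = dy g z \<and> g differentiable at z"
    using d Suc.prems by simp
  then show ?case using Suc.IH[of "dx f" "dx g"] Suc.IH[of "dy f" "dy g"] Suc.prems by simp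
qed

lemma Ck_add_scale:
  "Ck_on k UHP f \<Longrightarrow> Ck_on k UHP g \<Longrightarrow> Ck_on k UHP (\<lambda>z. f z + c * g z)"
proof (induction k arbitrary: f g)
  case 0
  then show ?case by (auto intro!: continuous_intros)
next
  case (Suc k)
  have d: "dx (\<lambda>z. f z + c * g z) z = dx f z + c * dx g z \<and> dy (\<lambda>z. f z + c * g z) z = dy f z + c * dy g z \<and>
     (\<lambda>z. f z + c * g z) differentiable at z" if z: "z \<in> UHP" for z
  proof -
    have "(f has_derivative frechet_derivative f (at z)) (at z)" "(g has_derivative frechet_derivative g (at z)) (at z)"
      using Suc.prems z by (auto simp: frechet_derivative_works[symmetric])
    then have h: "((\<lambda>z. f z + c * g z) has_derivative (\<lambda>h. frechet_derivative f (at z) h + c * frechet_derivative g (at z) h)) (at z)"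
      by (intro has_derivative_add has_derivative_mult_right)
    show ?thesis using has_derivative_dxdy[OF h] h by (auto simp: dx_def dy_def differentiable_def)
  qed
  have "Ck_on k UHP (\<lambda>z. dx f z + c * dx g z)" "Ck_on k UHP (\<lambda>z. dy f z + c * dy g z)"
    using Suc by auto
  then have "Ck_on k UHP (dx (\<lambda>z. f z + c * g z)) \<and> Ck_on k UHP (dy (\<lambda>z. f z + c * g z))"
    using d by (intro conjI; elim Ck_cong; simp)
  then show ?case using d by simp
qed

lemma dbar_zero_holomorphic:
  assumes "\<And>z. z \<in> UHP \<Longrightarrow> f differentiable at z" "\<And>z. z \<in> UHP \<Longrightarrow> dbar f z = 0"
  shows "f holomorphic_on UHP"
proof (rule holomorphic_onI)
  fix z assume z: "z \<in> UHP"
  define D where "D = frechet_derivative f (at z)"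
  have hD: "(f has_derivative D) (at z)" using assms(1)[OF z] by (simp add: D_def frechet_derivative_works)
  then have lin: "linear D" using has_derivative_linear by blast
  have "D 1 + \<i> * D \<i> = 0" using assms(2)[OF z] by (simp add: dbar_def dx_def dy_def D_def)
  then have "\<i> * (D 1 + \<i> * D \<i>) = 0" by simp
  then have Di: "D \<i> = \<i> * D 1" by (simp add: distrib_left mult.assoc[symmetric])
  have "D h = D 1 * h" for h
  proof -
    have "h = Re h *\<^sub>R 1 + Im h *\<^sub>R \<i>" by (simp add: complex_eq_iff)
    then have "D h = Re h *\<^sub>R D 1 + Im h *\<^sub>R D \<i>" using lin by (metis linear_add linear_scale)
    also have "\<dots> = D 1 * (Re h + \<i> * Im h)" unfolding Di by (simp add: scaleR_conv_of_real algebra_simps)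
    also have "Re h + \<i> * Im h = h" by (simp add: complex_eq_iff)
    finally show ?thesis .
  qed
  then have "D = (*) (D 1)" by (rule ext)
  then have "(f has_field_derivative D 1) (at z)" using hD by (simp add: has_field_derivative_def)
  then show "f field_differentiable at z within UHP"
    using field_differentiable_at_within field_differentiable_def by blast
qed

text \<open>By induction \<open>\<partial>f/\<partial>z\<^sup>*\<close> has components; integrating their powers of the height produces a
  function with the same derivative, and the difference is holomorphic.\<close>
theorem polyanalytic_imp_polyform:
  "polyanalytic_on n UHP f \<Longrightarrow> \<exists>\<phi>. polyform n \<phi> f"
proof (induction n arbitrary: f)
  case 0
  then show ?case by (auto simp: polyanalytic_on_def polyform_def)
next
  case (Suc n)
  have C: "Ck_on (Suc n) UHP f" and z0: "\<And>z. z \<in> UHP \<Longrightarrow> (dbar ^^ Suc n) f z = 0"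
    using Suc.prems by (auto simp: polyanalytic_on_def)
  have df: "f differentiable at z" if "z \<in> UHP" for z using C that by simp
  have zero: "Ck_on n UHP (\<lambda>_. 0)"
    using polyform_Ck[of 0 "\<lambda>_ _. 0" "\<lambda>_. 0"] by (simp add: polyform_def)
  have "Ck_on n UHP (\<lambda>z. dx f z + \<i> * dy f z)" using C by (intro Ck_add_scale) auto
  from Ck_add_scale[OF zero this, of "1/2"] have "Ck_on n UHP (dbar f)"
    by (rule Ck_cong) (simp add: dbar_def)
  then have "polyanalytic_on n UHP (dbar f)"
    using z0 unfolding polyanalytic_on_def by (auto simp: funpow_swap1)
  then obtain \<phi> where p: "polyform n \<phi> (dbar f)" using Suc.IH by blast
  define \<psi> where "\<psi> = (\<lambda>i z. case i of 0 \<Rightarrow> 0 | Suc j \<Rightarrow> (2 / (\<i> * of_nat (Suc j))) * \<phi> j z)"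
  define g where "g = (\<lambda>z. \<Sum>i<Suc n. of_real (Im z) ^ i * \<psi> i z)"
  have "\<psi> i holomorphic_on UHP" if "i < Suc n" for i
    using p that unfolding polyform_def \<psi>_def by (cases i) (auto intro!: holomorphic_intros)
  then have pg: "polyform (Suc n) \<psi> g" unfolding polyform_def g_def by blast
  have dg: "g differentiable at z" if "z \<in> UHP" for z using polyform_differentiable[OF pg that] .
  have dbg: "dbar g z = dbar f z" if "z \<in> UHP" for z
    using polyform_dbar[OF pg] p that unfolding polyform_def \<psi>_def by (simp add: field_simps del: of_nat_Suc)
  define h where "h = (\<lambda>z. f z - g z)"
  have "h holomorphic_on UHP"
  proof (rule dbar_zero_holomorphic)
    fix z assume z: "z \<in> UHP"
    have hd: "(h has_derivative (\<lambda>u. frechet_derivative f (at z) u - frechet_derivative g (at z) u)) (at z)"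
      unfolding h_def using df[OF z] dg[OF z] by (intro has_derivative_diff) (auto simp: frechet_derivative_works[symmetric])
    then show "h differentiable at z" by (auto simp: differentiable_def)
    have e: "dx h z = dx f z - dx g z" "dy h z = dy f z - dy g z"
      using has_derivative_dxdy[OF hd] by (simp_all only: dx_def dy_def)
    have "dbar h z = dbar f z - dbar g z"
      unfolding dbar_def e by (simp add: algebra_simps add_divide_distrib diff_divide_distrib)
    then show "dbar h z = 0" using dbg[OF z] by simp
  qed
  then have "polyform (Suc n) (\<psi>(0 := h)) f"
    using pg unfolding polyform_def
    by (auto simp: sum.lessThan_Suc_shift h_def g_def \<psi>_def simp del: sum.lessThan_Suc)
  then show ?case by blast
qed

lemma poly_bergman_iff: "f \<in> poly_bergman n \<longleftrightarrow> (\<exists>g \<phi>. f = abs_L2 g \<and> square_integrable g \<and>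
    (\<forall>z. z \<notin> UHP \<longrightarrow> g z = 0) \<and> polyform n \<phi> g)"
  unfolding poly_bergman_def using polyanalytic_imp_polyform polyform_imp_polyanalytic by blast

lemma polyform_add_scale:
  assumes "polyform n \<phi> f" "polyform n \<psi> g"
  shows "polyform n (\<lambda>i z. \<phi> i z + c * \<psi> i z) (\<lambda>z. f z + c * g z)"
  using assms unfolding polyform_def
  by (auto intro!: holomorphic_intros simp: sum.distrib sum_distrib_left algebra_simps)

lemma poly_bergman_csubspace: "csubspace (poly_bergman n)"
proof -
  have z: "0 \<in> poly_bergman n"
    unfolding poly_bergman_iff by (intro exI[of _ "\<lambda>_. 0"] exI[of _ "\<lambda>_ _. 0"]) (auto simp: abs_zero square_integrable_0 polyform_def)
  have s: "u + scaleC c v \<in> poly_bergman n" if uv: "u \<in> poly_bergman n" "v \<in> poly_bergman n" for u v c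
  proof -
    obtain f g \<phi> \<psi> where f: "u = abs_L2 f" "square_integrable f" "\<forall>z. z \<notin> UHP \<longrightarrow> f z = 0" "polyform n \<phi> f"
      and g: "v = abs_L2 g" "square_integrable g" "\<forall>z. z \<notin> UHP \<longrightarrow> g z = 0" "polyform n \<psi> g"
      using uv unfolding poly_bergman_iff by blast
    have "u + scaleC c v = abs_L2 (\<lambda>z. f z + c * g z)"
      by (simp add: f g abs_scale abs_add square_integrable_scale)
    then show ?thesis unfolding poly_bergman_iff
      using polyform_add_scale[OF f(4) g(4)] f g square_integrable_add[OF f(2) square_integrable_scale[OF g(2), of c]] by force
  qed
  have "u + v \<in> poly_bergman n" if "u \<in> poly_bergman n" "v \<in> poly_bergman n" for u v
    using s[OF that, of 1] by (simp add: scaleC_one)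
  moreover have "scaleC c v \<in> poly_bergman n" if "v \<in> poly_bergman n" for v c
    using s[OF z that, of c] by simp
  ultimately show ?thesis using z by (simp add: csubspace_def)
qed

lemma poly_bergman_mono:
  assumes "m \<le> n" shows "poly_bergman m \<subseteq> poly_bergman n"
proof
  fix f assume "f \<in> poly_bergman m"
  then obtain g \<phi> where g: "f = abs_L2 g" "square_integrable g" "\<forall>z. z \<notin> UHP \<longrightarrow> g z = 0" "polyform m \<phi> g"
    unfolding poly_bergman_iff by blast
  have "polyform n (\<lambda>i. if i < m then \<phi> i else (\<lambda>_. 0)) g"
    unfolding polyform_def
  proof (intro conjI allI impI ballI)
    fix z assume z: "z \<in> UHP"
    have "(\<Sum>i<m. of_real (Im z) ^ i * \<phi> i z) = (\<Sum>i<n. of_real (Im z) ^ i * (if i < m then \<phi> i else (\<lambda>_. 0)) z)"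
      using assms by (intro sum.mono_neutral_cong_left) auto
    then show "g z = (\<Sum>i<n. of_real (Im z) ^ i * (if i < m then \<phi> i else (\<lambda>_. 0)) z)"
      using g(4) z by (simp add: polyform_def)
  qed (use g(4) in \<open>auto simp: polyform_def\<close>)
  then show "f \<in> poly_bergman n" unfolding poly_bergman_iff using g by blast
qed

lemma poly_bergman_0: "poly_bergman 0 = {0}"
proof -
  have "f = 0" if "f \<in> poly_bergman 0" for f
  proof -
    obtain g \<phi> where g: "f = abs_L2 g" "\<forall>z. z \<notin> UHP \<longrightarrow> g z = 0" "polyform 0 \<phi> g"
      using \<open>f \<in> poly_bergman 0\<close> unfolding poly_bergman_iff by blast
    then have "g = (\<lambda>_. 0)" by (auto simp: polyform_def fun_eq_iff)
    then show ?thesis using g by (simp add: abs_zero)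
  qed
  then show ?thesis using poly_bergman_csubspace[of 0] by (auto simp: csubspace_def)
qed

lemma poly_bergman_in_L2: "poly_bergman n \<subseteq> L2_on UHP"
  unfolding poly_bergman_def L2_on_def by blast

subsection \<open>The range of the synthesis operators\<close>

definition laplace :: "nat \<Rightarrow> (real \<Rightarrow> complex) \<Rightarrow> complex \<Rightarrow> complex" where
  "laplace k g z = (LBINT x. of_real (indicator {0<..} x * (sqrt (2 * x) * (2 * x) ^ k)) * exp (\<i> * z * of_real x) * g x)"

lemma laplace_dominant:
  assumes g: "square_integrable g" and \<eta>: "\<eta> > 0"
  shows "integrable lborel (\<lambda>x. indicator {0<..} x * (sqrt (2 * x) * (2 * x) ^ k * exp (- (x * \<eta>))) * cmod (g x))"
proof -
  have "integrable lborel (\<lambda>x. cmod (of_real (1 / \<eta> ^ k) * slice (monom 1 k) g \<eta> x))"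
    using slice_integrable(1)[OF \<eta> g, of "monom 1 k"] by (intro integrable_norm integrable_mult_right) auto
  moreover have "cmod (of_real (1 / \<eta> ^ k) * slice (monom 1 k) g \<eta> x) = indicator {0<..} x * (sqrt (2 * x) * (2 * x) ^ k * exp (- (x * \<eta>))) * cmod (g x)" for x
    using \<eta> by (auto simp: slice_def weight_def poly_monom norm_mult norm_divide norm_power power_mult_distrib abs_mult split: split_indicator)
  ultimately show ?thesis by simp
qed

lemma laplace_integrable:
  assumes g: "square_integrable g" and z: "z \<in> UHP"
  shows "integrable lborel (\<lambda>x. of_real (indicator {0<..} x * (sqrt (2 * x) * (2 * x) ^ k)) * exp (\<i> * z * of_real x) * g x)"
proof (rule Bochner_Integration.integrable_bound[OF laplace_dominant[OF g, where k = k and \<eta> = "Im z"]])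
  have [measurable]: "g \<in> borel_measurable borel" using g by (rule sq_measurable)
  show "(\<lambda>x. of_real (indicator {0<..} x * (sqrt (2 * x) * (2 * x) ^ k)) * exp (\<i> * z * of_real x) * g x) \<in> borel_measurable lborel"
    by measurable
  show "AE x in lborel. norm (of_real (indicator {0<..} x * (sqrt (2 * x) * (2 * x) ^ k)) * exp (\<i> * z * of_real x) * g x)
      \<le> norm (indicator {0<..} x * (sqrt (2 * x) * (2 * x) ^ k * exp (- (x * Im z))) * cmod (g x))"
    by (intro AE_I2) (auto simp: norm_mult norm_power abs_mult mult_ac split: split_indicator)
qed (use z in \<open>simp add: UHP_iff\<close>)

lemma exp_difference_bound:
  assumes "Im w > \<eta>" "Im z > \<eta>" "x > 0"
  shows "cmod (exp (\<i> * w * of_real x) - exp (\<i> * z * of_real x)) \<le> x * exp (- (x * \<eta>)) * cmod (w - z)"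
proof (rule field_differentiable_bound[where S = "{w. Im w > \<eta>}" and f' = "\<lambda>w. \<i> * of_real x * exp (\<i> * w * of_real x)"])
  show "convex {w. \<eta> < Im w}" by (rule convex_halfspace_Im_gt)
  show "((\<lambda>w. exp (\<i> * w * of_real x)) has_field_derivative \<i> * of_real x * exp (\<i> * u * of_real x)) (at u within {w. \<eta> < Im w})" for u
    by (auto intro!: derivative_eq_intros simp: mult_ac)
  show "cmod (\<i> * of_real x * exp (\<i> * u * of_real x)) \<le> x * exp (- (x * \<eta>))" if "u \<in> {w. \<eta> < Im w}" for u
    using that assms(3) by (auto simp: norm_mult mult.commute intro!: mult_left_mono)
qed (use assms in auto)

text \<open>Differentiation under the integral by sequences: the difference quotients are dominated by
  \<open>x exp (- x \<eta>)\<close> on the half-plane above \<open>\<eta>\<close>.\<close>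
lemma laplace_holomorphic:
  assumes g: "square_integrable g"
  shows "laplace k g holomorphic_on UHP"
proof (rule holomorphic_onI)
  let ?A = "\<lambda>\<eta> x. indicator {0<..} x * (sqrt (2 * x) * (2 * x) ^ Suc k * exp (- (x * \<eta>))) * cmod (g x)"
  fix z assume z: "z \<in> UHP"
  have [measurable]: "g \<in> borel_measurable borel" using g by (rule sq_measurable)
  define \<eta> where "\<eta> = Im z / 2"
  have \<eta>: "\<eta> > 0" "Im z > \<eta>" using z by (auto simp: \<eta>_def UHP_iff)
  let ?w = "\<lambda>x. of_real (indicator {0<..} x * (sqrt (2 * x) * (2 * x) ^ k)) :: complex"
  let ?D = "LBINT x. ?w x * (\<i> * of_real x * exp (\<i> * z * of_real x)) * g x"
  have "((\<lambda>w. (laplace k g w - laplace k g z) / (w - z)) \<longlongrightarrow> ?D) (at z)"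
    unfolding tendsto_at_iff_sequentially
  proof (intro allI impI)
    fix X :: "nat \<Rightarrow> complex" assume X: "\<forall>i. X i \<in> UNIV - {z}" "X \<longlonglongrightarrow> z"
    have ev: "eventually (\<lambda>i. Im (X i) > \<eta>) sequentially"
      using order_tendstoD(1)[OF tendsto_Im[OF X(2)] \<eta>(2)] .
    then obtain N where N: "\<And>i. i \<ge> N \<Longrightarrow> Im (X i) > \<eta>" by (auto simp: eventually_sequentially)
    define Y where "Y = (\<lambda>i. X (i + N))"
    have Y: "Y i \<noteq> z" "Im (Y i) > \<eta>" for i using X(1) N by (auto simp: Y_def)
    have Yz: "Y \<longlonglongrightarrow> z" unfolding Y_def by (rule LIMSEQ_ignore_initial_segment[OF X(2)])
    let ?Q = "\<lambda>i x. ?w x * ((exp (\<i> * Y i * of_real x) - exp (\<i> * z * of_real x)) / (Y i - z)) * g x"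
    have "(\<lambda>i. LBINT x. ?Q i x) \<longlonglongrightarrow> ?D"
    proof (rule integral_dominated_convergence)
      show "integrable lborel (\<lambda>x. 1 / 2 * (?A \<eta> x))"
        by (intro integrable_mult_right laplace_dominant g \<eta>)
      show "AE x in lborel. (\<lambda>i. ?Q i x) \<longlonglongrightarrow> ?w x * (\<i> * of_real x * exp (\<i> * z * of_real x)) * g x"
      proof (intro AE_I2 tendsto_mult tendsto_const)
        fix x :: real
        have "((\<lambda>w. exp (\<i> * w * of_real x)) has_field_derivative \<i> * of_real x * exp (\<i> * z * of_real x)) (at z)"
          by (auto intro!: derivative_eq_intros simp: mult_ac)
        then have "((\<lambda>w. (exp (\<i> * w * of_real x) - exp (\<i> * z * of_real x)) / (w - z)) \<longlongrightarrow> \<i> * of_real x * exp (\<i> * z * of_real x)) (at z)"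
          by (simp add: has_field_derivative_iff)
        from this[unfolded tendsto_at_iff_sequentially, rule_format, of Y] Y Yz
        show "(\<lambda>i. (exp (\<i> * Y i * of_real x) - exp (\<i> * z * of_real x)) / (Y i - z)) \<longlonglongrightarrow> \<i> * of_real x * exp (\<i> * z * of_real x)"
          by (simp add: o_def)
      qed
      show "AE x in lborel. norm (?Q i x) \<le> 1 / 2 * (?A \<eta> x)" for i
      proof (intro AE_I2)
        fix x :: real
        show "norm (?Q i x) \<le> 1 / 2 * (?A \<eta> x)"
        proof (cases "x > 0")
          case True
          have "cmod ((exp (\<i> * Y i * of_real x) - exp (\<i> * z * of_real x)) / (Y i - z)) \<le> x * exp (- (x * \<eta>))"
            using exp_difference_bound[OF Y(2)[of i] \<eta>(2) True] Y(1)[of i] by (simp add: norm_divide divide_le_eq)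
          then have "cmod (?w x) * cmod ((exp (\<i> * Y i * of_real x) - exp (\<i> * z * of_real x)) / (Y i - z)) * cmod (g x)
             \<le> cmod (?w x) * (x * exp (- (x * \<eta>))) * cmod (g x)"
            by (intro mult_right_mono mult_left_mono) auto
          also have "\<dots> = 1 / 2 * (?A \<eta> x)"
            using True by (simp add: norm_mult norm_power abs_mult)
          finally show ?thesis by (simp only: norm_mult)
        qed simp
      qed
    qed measurable
    moreover have "(LBINT x. ?Q i x) = (laplace k g (Y i) - laplace k g z) / (Y i - z)" for i
    proof -
      have yi: "Y i \<in> UHP" using Y(2)[of i] \<eta>(1) by (simp add: UHP_iff)
      have "(laplace k g (Y i) - laplace k g z) / (Y i - z)
        = (LBINT x. (?w x * exp (\<i> * Y i * of_real x) * g x - ?w x * exp (\<i> * z * of_real x) * g x) / (Y i - z))"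
        unfolding laplace_def
        by (simp only: Bochner_Integration.integral_diff[OF laplace_integrable[OF g yi] laplace_integrable[OF g z]] integral_divide_zero)
      then show ?thesis by (simp add: diff_divide_distrib right_diff_distrib left_diff_distrib)
    qed
    ultimately have "(\<lambda>i. (laplace k g (Y i) - laplace k g z) / (Y i - z)) \<longlonglongrightarrow> ?D" by (simp only:)
    then have "(\<lambda>i. (\<lambda>i. (laplace k g (X i) - laplace k g z) / (X i - z)) (i + N)) \<longlonglongrightarrow> ?D" by (simp add: Y_def)
    then show "((\<lambda>w. (laplace k g w - laplace k g z) / (w - z)) \<circ> X) \<longlonglongrightarrow> ?D"
      unfolding o_def by (rule LIMSEQ_offset)
  qed
  then have "(laplace k g has_field_derivative ?D) (at z)" by (simp add: has_field_derivative_iff)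
  then show "laplace k g field_differentiable at z within UHP"
    using field_differentiable_at_within field_differentiable_def by blast
qed

lemma Vfun_laplace:
  assumes g: "square_integrable g" and z: "z \<in> UHP"
  shows "Vfun p g z = (\<Sum>i\<le>degree p. of_real (Im z) ^ i * (of_real (coeff p i / sqrt (2 * pi)) * laplace i g z))"
proof -
  let ?I = "\<lambda>i x. of_real (indicator {0<..} x * (sqrt (2 * x) * (2 * x) ^ i)) * exp (\<i> * z * of_real x) * g x"
  have e: "iexp (Re z * x) * slice p g (Im z) x = (\<Sum>i\<le>degree p. of_real (coeff p i * Im z ^ i) * ?I i x)" for x
  proof (cases "x > 0")
    case True
    have "exp (\<i> * z * of_real x) = iexp (Re z * x) * of_real (exp (- (x * Im z)))"
    proof -
      have "\<i> * z * of_real x = \<i> * of_real (Re z * x) + of_real (- (x * Im z))"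
        by (simp add: complex_eq_iff)
      then show ?thesis by (simp only: exp_add exp_of_real)
    qed
    moreover have "poly p (2 * x * Im z) = (\<Sum>i\<le>degree p. coeff p i * ((2 * x) ^ i * Im z ^ i))"
      by (simp add: poly_altdef power_mult_distrib)
    ultimately show ?thesis using True
      by (simp add: slice_def weight_def sum_distrib_left sum_distrib_right mult_ac)
  qed (simp add: slice_def weight_def)
  have "fint (slice p g (Im z)) (Re z) = (\<Sum>i\<le>degree p. of_real (coeff p i * Im z ^ i) * laplace i g z)"
    unfolding fint_def e laplace_def
    by (subst Bochner_Integration.integral_sum, rule integrable_mult_right, rule laplace_integrable[OF g z])
      (simp only: integral_mult_right_zero)
  then show ?thesis using z by (simp add: Vfun_def UHP_iff sum_divide_distrib mult_ac)
qed

lemma Vop_poly_bergman: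
  assumes "degree p < n" shows "Vop p g \<in> poly_bergman n"
proof -
  have "polyform (Suc (degree p)) (\<lambda>i z. of_real (coeff p i / sqrt (2 * pi)) * laplace i (rep_L2 g) z) (Vfun p (rep_L2 g))"
    unfolding polyform_def using Vfun_laplace[OF sq_rep] laplace_holomorphic[OF sq_rep]
    by (auto simp: lessThan_Suc_atMost intro!: holomorphic_intros)
  then have "Vop p g \<in> poly_bergman (Suc (degree p))"
    unfolding poly_bergman_iff Vop_def using Vfun_square_integrable[OF sq_rep, of p g]
    by (intro exI conjI) (auto simp: Vfun_def UHP_iff)
  then show ?thesis using poly_bergman_mono[of "Suc (degree p)" n] assms by auto
qed

lemma degree_lag: "degree (lag k) \<le> k"
proof (induction k)
  case (Suc k)
  have "degree (pderiv (lag k) - lag k) \<le> k"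
    using Suc by (intro degree_diff_le) (auto simp: degree_pderiv)
  then have "degree ([:0,1:] * (pderiv (lag k) - lag k)) \<le> Suc k"
    by (intro order_trans[OF degree_mult_le]) auto
  then have "degree (smult (of_nat (Suc k)) (lag (Suc k))) \<le> Suc k"
    unfolding lag_Suc using Suc by (intro degree_add_le) (auto intro: order_trans[OF degree_smult_le])
  then show ?case by simp
qed (simp add: lag_0)

lemma degree_lagp: "degree (lagp k) \<le> k"
  unfolding lagp_def using degree_lag order_trans[OF degree_smult_le] by blast

section \<open>Decay of the holomorphic components\<close>

lemma nn_integral_translate_real:
  fixes f :: "real \<Rightarrow> ennreal"
  assumes [measurable]: "f \<in> borel_measurable borel"
  shows "(NBINT x. f (x + h)) = (NBINT x. f x)"
  using nn_integral_real_affine[of f 1 h] by (simp add: add.commute)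

lemma nn_integral_complex':
  assumes [measurable]: "f \<in> borel_measurable borel"
  shows "(NBINT z. f z) = (NBINT t. NBINT r. f (Complex t r))"
  unfolding nn_integral_complex[OF assms] by (rule lborel_pair.Fubini'[symmetric]) measurable

lemma nn_integral_shear_x:
  assumes [measurable]: "f \<in> borel_measurable borel"
  shows "(NBINT z. f (Complex (Re z + a * Im z) (Im z))) = (NBINT z. f z)"
  by (subst (1 2) nn_integral_complex) (auto intro!: nn_integral_cong nn_integral_translate_real)

lemma nn_integral_shear_y:
  assumes [measurable]: "f \<in> borel_measurable borel"
  shows "(NBINT z. f (Complex (Re z) (Im z + a * Re z))) = (NBINT z. f z)"
  by (subst (1 2) nn_integral_complex') (auto intro!: nn_integral_cong nn_integral_translate_real)

text \<open>A rotation by less than a half turn is a product of three shears.\<close>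
lemma nn_integral_rotate_aux:
  assumes [measurable]: "f \<in> borel_measurable borel" and u: "cmod u = 1" "Re u \<noteq> -1"
  shows "(NBINT z. f (u * z)) = (NBINT z. f z)"
proof -
  define c s where "c = Re u" and "s = Im u"
  define \<tau> where "\<tau> = s / (1 + c)"
  have cs: "c\<^sup>2 + s\<^sup>2 = 1" using u(1) by (simp add: c_def s_def cmod_def)
  have c1: "1 + c \<noteq> 0" using u(2) by (simp add: c_def add_eq_0_iff)
  have e1: "1 - s * \<tau> = c"
  proof -
    have "s * s = (1 - c) * (1 + c)" using cs by (simp add: power2_eq_square algebra_simps)
    then show ?thesis using c1 by (simp add: \<tau>_def)
  qed
  have e2: "\<tau> * (1 + c) = s" using c1 by (simp add: \<tau>_def)
  define X where "X = (\<lambda>z. Complex (Re z + (- \<tau>) * Im z) (Im z))"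
  define Y where "Y = (\<lambda>z. Complex (Re z) (Im z + s * Re z))"
  have [measurable]: "X \<in> borel_measurable borel" "Y \<in> borel_measurable borel" unfolding X_def Y_def by measurable
  have nX: "(NBINT z. h (X z)) = (NBINT z. h z)" if "h \<in> borel_measurable borel" for h :: "complex \<Rightarrow> ennreal"
    unfolding X_def by (rule nn_integral_shear_x[OF that])
  have nY: "(NBINT z. h (Y z)) = (NBINT z. h z)" if "h \<in> borel_measurable borel" for h :: "complex \<Rightarrow> ennreal"
    unfolding Y_def by (rule nn_integral_shear_y[OF that])
  have "u * z = X (Y (X z))" for z
  proof (rule complex_eqI)
    have "Re (X (Y (X z))) = (1 - s * \<tau>) * Re z - \<tau> * (1 + (1 - s * \<tau>)) * Im z"
      by (simp add: X_def Y_def algebra_simps)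
    also have "\<dots> = Re (u * z)" unfolding e1 e2 by (simp add: c_def s_def)
    finally show "Re (u * z) = Re (X (Y (X z)))" by simp
    have "Im (X (Y (X z))) = s * Re z + (1 - s * \<tau>) * Im z"
      by (simp add: X_def Y_def algebra_simps)
    also have "\<dots> = Im (u * z)" unfolding e1 by (simp add: c_def s_def)
    finally show "Im (u * z) = Im (X (Y (X z)))" by simp
  qed
  then have "(NBINT z. f (u * z)) = (NBINT z. (\<lambda>z. f (X (Y z))) (X z))" by simp
  also have "\<dots> = (NBINT z. f (X (Y z)))" by (rule nX) measurable
  also have "\<dots> = (NBINT z. f (X z))" by (rule nY[of "\<lambda>z. f (X z)"]) measurable
  also have "\<dots> = (NBINT z. f z)" by (rule nX) measurable
  finally show ?thesis .
qed

lemma nn_integral_rotate: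
  assumes [measurable]: "f \<in> borel_measurable borel" and u: "cmod u = 1"
  shows "(NBINT z. f (u * z)) = (NBINT z. f z)"
proof (cases "Re u = -1")
  case True
  have "(Im u)\<^sup>2 = 0" using u True by (simp add: cmod_def)
  then have "u = \<i> * \<i>" using True by (simp add: complex_eq_iff)
  then have "(NBINT z. f (u * z)) = (NBINT z. (\<lambda>z. f (\<i> * z)) (\<i> * z))" by (simp add: mult.assoc)
  also have "\<dots> = (NBINT z. f z)"
    using nn_integral_rotate_aux[of "\<lambda>z. f (\<i> * z)" \<i>] nn_integral_rotate_aux[of f \<i>] by simp
  finally show ?thesis .
qed (use nn_integral_rotate_aux[OF assms] in simp)

lemma circle_mean_bound:
  assumes G: "G holomorphic_on cball 0 1"
  shows "ennreal (cmod (G 0)) \<le> (NBINT s. indicator {0..1} s * ennreal (cmod (G (exp (2 * of_real pi * \<i> * of_real s)))))"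
proof -
  let ?e = "\<lambda>s::real. exp (2 * of_real pi * \<i> * of_real s)"
  have ne: "norm (?e s) = 1" for s by (simp add: norm_exp_eq_Re)
  have "((\<lambda>u. G u / (u - 0)) has_contour_integral (2 * of_real pi * \<i> * G 0)) (circlepath 0 1)"
    by (rule Cauchy_integral_circlepath_simple[OF G]) simp
  then have "((\<lambda>s. (G (circlepath 0 1 s) / circlepath 0 1 s) * vector_derivative (circlepath 0 1) (at s within {0..1})) has_integral 2 * of_real pi * \<i> * G 0) {0..1}"
    by (simp add: has_contour_integral_def)
  then have "((\<lambda>s. (2 * of_real pi * \<i>) * G (?e s)) has_integral (2 * of_real pi * \<i>) * G 0) {0..1}"
    by (rule has_integral_eq[rotated]) (simp add: vector_derivative_circlepath01, simp add: circlepath)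
  then have hi: "((\<lambda>s. G (?e s)) has_integral G 0) {0..1}"
    using has_integral_mult_right[of "\<lambda>s. (2 * of_real pi * \<i>) * G (?e s)" "(2 * of_real pi * \<i>) * G 0" "{0..1}" "1 / (2 * of_real pi * \<i>)"] by simp
  have cont: "continuous_on {0..1} (\<lambda>s. G (?e s))"
    by (rule continuous_on_compose2[OF holomorphic_on_imp_continuous_on[OF G]]) (auto intro!: continuous_intros simp: norm_exp_eq_Re)
  have si: "set_integrable lborel {0..1} (\<lambda>s. G (?e s))" by (rule borel_integrable_atLeastAtMost'[OF cont])
  have "G 0 = (LINT s:{0..1}|lborel. G (?e s))"
    using set_borel_integral_eq_integral(2)[OF si] hi by (simp add: integral_unique)
  then have "ennreal (cmod (G 0)) \<le> (NBINT s. ennreal (cmod (indicator {0..1} s *\<^sub>R G (?e s))))"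
    unfolding set_lebesgue_integral_def by (simp only: norm_integral_le_nn)
  also have "\<dots> = (NBINT s. indicator {0..1} s * ennreal (cmod (G (?e s))))"
    by (intro nn_integral_cong) (auto split: split_indicator)
  finally show ?thesis .
qed

text \<open>On the circle of radius \<open>R = cmod u\<close> about \<open>z\<^sub>0\<close> conjugation is \<open>v \<mapsto> R\<^sup>2 / v\<close>, so the height is a rational function of
  \<open>v\<close>. Multiplied by \<open>v\<^sup>m\<close> the polyanalytic function becomes a holomorphic function \<open>H\<close> of \<open>v\<close>, in which
  only the top component contributes at the centre, and the mean value property applies.\<close>
lemma top_component_circle:
  assumes p: "polyform (Suc m) \<phi> F" and z0: "z0 \<in> UHP" and u: "cmod u < Im z0"
  shows "ennreal ((cmod u)\<^sup>2 ^ m / 2 ^ m * cmod (\<phi> m z0)) \<le>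
     (NBINT s. indicator {0..1} s * ennreal (cmod u ^ m * cmod (F (z0 + exp (2 * of_real pi * \<i> * of_real s) * u))))"
proof -
  let ?e = "\<lambda>s::real. exp (2 * of_real pi * \<i> * of_real s)"
  let ?\<rho> = "of_real (cmod u) :: complex"
  define Q where "Q = (\<lambda>v. (v\<^sup>2 + 2 * \<i> * of_real (Im z0) * v - ?\<rho>\<^sup>2) / (2 * \<i>))"
  define H where "H = (\<lambda>v. \<Sum>i\<le>m. v ^ (m - i) * Q v ^ i * \<phi> i (z0 + v))"
  have inU: "z0 + v \<in> UHP" if "cmod v \<le> cmod u" for v
    using abs_Im_le_cmod[of v] that u by (auto simp: UHP_iff)
  have "(\<lambda>\<zeta>. H (\<zeta> * u)) holomorphic_on cball 0 1"
  proof -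
    have "(\<lambda>\<zeta>. \<phi> i (z0 + \<zeta> * u)) holomorphic_on cball 0 1" if "i \<le> m" for i
    proof -
      have 1: "\<phi> i holomorphic_on UHP" using p that by (auto simp: polyform_def)
      have 2: "(\<lambda>\<zeta>. z0 + \<zeta> * u) holomorphic_on cball 0 1" by (intro holomorphic_intros)
      have 3: "(\<lambda>\<zeta>. z0 + \<zeta> * u) ` cball 0 1 \<subseteq> UHP"
        by (auto intro!: inU simp: norm_mult mult_left_le_one_le)
      from holomorphic_on_compose_gen[OF 2 1 3] show ?thesis by (simp add: o_def)
    qed
    then show ?thesis unfolding H_def Q_def by (intro holomorphic_intros) auto
  qed
  note circle_mean_bound[OF this]
  also have "(NBINT s. indicator {0..1} s * ennreal (cmod (H (?e s * u))))
    = (NBINT s. indicator {0..1} s * ennreal (cmod u ^ m * cmod (F (z0 + ?e s * u))))"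
  proof (rule nn_integral_cong)
    fix s :: real
    define v where "v = ?e s * u"
    have nv: "cmod v = cmod u" by (simp add: v_def norm_mult norm_exp_eq_Re)
    have vv: "v * cnj v = ?\<rho>\<^sup>2" using complex_norm_square[of v] nv by simp
    have Qv: "Q v = v * of_real (Im (z0 + v))"
    proof -
      define c where "c = cnj v"
      have "of_real (Im (z0 + v)) = of_real (Im z0) + (v - c) / (2 * \<i>)" unfolding c_def by (simp add: complex_eq_iff)
      then have "v * of_real (Im (z0 + v)) = v * (of_real (Im z0) + (v - c) / (2 * \<i>))" by (rule arg_cong)
      also have "\<dots> = (v * v + 2 * \<i> * of_real (Im z0) * v - v * c) / (2 * \<i>)"
        by (simp add: field_simps)
      finally have "v * of_real (Im (z0 + v)) = (v * v + 2 * \<i> * of_real (Im z0) * v - v * cnj v) / (2 * \<i>)"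
        unfolding c_def .
      then show ?thesis unfolding vv by (simp add: Q_def power2_eq_square)
    qed
    have "H v = (\<Sum>i\<le>m. v ^ m * (of_real (Im (z0 + v)) ^ i * \<phi> i (z0 + v)))"
      unfolding H_def Qv by (intro sum.cong refl) (simp add: power_mult_distrib mult_ac flip: power_add)
    also have "\<dots> = v ^ m * F (z0 + v)"
      using p inU[of v] nv by (simp add: polyform_def sum_distrib_left lessThan_Suc_atMost)
    finally show "indicator {0..1} s * ennreal (cmod (H (?e s * u))) = indicator {0..1} s * ennreal (cmod u ^ m * cmod (F (z0 + ?e s * u)))"
      using nv by (simp add: v_def[symmetric] norm_mult norm_power)
  qed
  also have "cmod (H (0 * u)) = (cmod u)\<^sup>2 ^ m / 2 ^ m * cmod (\<phi> m z0)"
  proof -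
    have "H 0 = (\<Sum>i\<le>m. if i = m then Q 0 ^ m * \<phi> m z0 else 0)"
      unfolding H_def by (intro sum.cong refl) auto
    then show ?thesis by (simp add: Q_def norm_mult norm_power norm_divide power_divide)
  qed
  finally show ?thesis .
qed

lemma emeasure_box_complex: "a \<le> b \<Longrightarrow> c \<le> d \<Longrightarrow> emeasure lborel {z::complex. a \<le> Re z \<and> Re z \<le> b \<and> c \<le> Im z \<and> Im z \<le> d} = ennreal ((b - a) * (d - c))"
proof -
  assume "a \<le> b" "c \<le> d"
  moreover have "{z::complex. a \<le> Re z \<and> Re z \<le> b \<and> c \<le> Im z \<and> Im z \<le> d} = cbox (Complex a c) (Complex b d)"
    by (auto simp: in_cbox_complex_iff)
  ultimately show ?thesis by (subst (2) emeasure_lborel_cbox | subst emeasure_lborel_cbox | auto simp: Basis_complex_def)+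
qed

definition disc_half :: "complex \<Rightarrow> complex set" where "disc_half z = ball 0 (Im z / 2)"

lemma disc_half_measurable [measurable]: "disc_half z \<in> sets borel"
  by (simp add: disc_half_def)

lemma disc_half_area: "z \<in> UHP \<Longrightarrow> emeasure lborel (disc_half z) \<le> ennreal ((Im z)\<^sup>2)"
proof -
  assume z: "z \<in> UHP"
  let ?y = "Im z / 2"
  have "disc_half z \<subseteq> {w. - ?y \<le> Re w \<and> Re w \<le> ?y \<and> - ?y \<le> Im w \<and> Im w \<le> ?y}"
  proof
    fix w assume "w \<in> disc_half z"
    then have "cmod w < ?y" by (simp add: disc_half_def)
    then show "w \<in> {w. - ?y \<le> Re w \<and> Re w \<le> ?y \<and> - ?y \<le> Im w \<and> Im w \<le> ?y}"
      using abs_Re_le_cmod[of w] abs_Im_le_cmod[of w] by auto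
  qed
  then have "emeasure lborel (disc_half z) \<le> emeasure lborel {w::complex. - ?y \<le> Re w \<and> Re w \<le> ?y \<and> - ?y \<le> Im w \<and> Im w \<le> ?y}"
    by (intro emeasure_mono) auto
  also have "\<dots> = ennreal ((?y - (- ?y)) * (?y - (- ?y)))"
    using z by (intro emeasure_box_complex) (auto simp: UHP_iff)
  finally show ?thesis by (simp add: power2_eq_square)
qed

text \<open>The circle bounds are integrated over the disc of radius half the height; rotation invariance of the
  plane measure removes the angle.\<close>
lemma top_component_decay:
  assumes p: "polyform (Suc m) \<phi> F" and [measurable]: "F \<in> borel_measurable borel"
    and z0: "z0 \<in> UHP" and K0: "K \<ge> 0"
    and K: "(NBINT u. indicator (disc_half z0) u * ennreal ((cmod (F (z0 + u)))\<^sup>2)) \<le> ennreal K"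
  shows "cmod (\<phi> m z0) \<le> 32 ^ Suc m * (K + 1) / Im z0 ^ Suc m"
proof -
  define y where "y = Im z0"
  have y: "y > 0" using z0 by (simp add: y_def UHP_iff)
  let ?D = "disc_half z0"
  let ?e = "\<lambda>s::real. exp (2 * of_real pi * \<i> * of_real s)"
  have D: "cmod u < y / 2" if "u \<in> ?D" for u using that by (simp add: disc_half_def y_def)
  let ?c = "cmod (\<phi> m z0)"
  define B where "B = {u::complex. y / 4 \<le> Re u \<and> Re u \<le> 3 * y / 8 \<and> 0 \<le> Im u \<and> Im u \<le> y / 4}"
  have BD: "B \<subseteq> ?D"
  proof
    fix u assume u: "u \<in> B"
    have "(cmod u)\<^sup>2 = (Re u)\<^sup>2 + (Im u)\<^sup>2" by (rule cmod_power2)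
    also have "\<dots> \<le> (3 * y / 8)\<^sup>2 + (y / 4)\<^sup>2" using u y by (intro add_mono power_mono) (auto simp: B_def)
    also have "\<dots> < (y / 2)\<^sup>2" using y by (simp add: power2_eq_square)
    finally have "(cmod u)\<^sup>2 < (y / 2)\<^sup>2" .
    then have "cmod u < y / 2" by (rule power2_less_imp_less) (use y in simp)
    then show "u \<in> ?D" by (simp add: disc_half_def y_def)
  qed
  have [measurable]: "B \<in> sets borel" unfolding B_def by measurable
  define G where "G = (\<lambda>u. indicator ?D u * ennreal (cmod u ^ m * cmod (F (z0 + u))))"
  have [measurable]: "G \<in> borel_measurable borel" unfolding G_def by measurable
  have "ennreal ((y\<^sup>2 / 32) ^ m * ?c) * ennreal (y\<^sup>2 / 32) = (NBINT u. ennreal ((y\<^sup>2 / 32) ^ m * ?c) * indicator B u)"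
  proof -
    have "emeasure lborel B = ennreal ((3 * y / 8 - y / 4) * (y / 4 - 0))"
      unfolding B_def using y by (intro emeasure_box_complex) auto
    also have "(3 * y / 8 - y / 4) * (y / 4 - 0) = y\<^sup>2 / 32" by (simp add: power2_eq_square)
    finally show ?thesis by (simp add: nn_integral_cmult_indicator)
  qed
  also have "\<dots> \<le> (NBINT u. (NBINT s. indicator {0..1} s * (indicator ?D u * ennreal (cmod u ^ m * cmod (F (z0 + ?e s * u))))))"
  proof (rule nn_integral_mono)
    fix u :: complex
    show "ennreal ((y\<^sup>2 / 32) ^ m * ?c) * indicator B u \<le> (NBINT s. indicator {0..1} s * (indicator ?D u * ennreal (cmod u ^ m * cmod (F (z0 + ?e s * u)))))"
    proof (cases "u \<in> B")
      case True
      then have uD: "u \<in> ?D" using BD by auto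
      have "y / 4 \<le> cmod u" using True complex_Re_le_cmod[of u] by (auto simp: B_def)
      then have "(y / 4)\<^sup>2 \<le> (cmod u)\<^sup>2" using y by (intro power_mono) auto
      then have "y\<^sup>2 / 32 \<le> (cmod u)\<^sup>2 / 2" by (simp add: power_divide)
      then have "(y\<^sup>2 / 32) ^ m \<le> ((cmod u)\<^sup>2 / 2) ^ m" by (intro power_mono) auto
      then have "ennreal ((y\<^sup>2 / 32) ^ m * ?c) \<le> ennreal ((cmod u)\<^sup>2 ^ m / 2 ^ m * ?c)"
        by (intro ennreal_leI mult_right_mono) (auto simp: power_divide)
      also have "\<dots> \<le> (NBINT s. indicator {0..1} s * ennreal (cmod u ^ m * cmod (F (z0 + ?e s * u))))"
        using D[OF uD] y by (intro top_component_circle[OF p z0]) (simp add: y_def)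
      finally show ?thesis using True uD by simp
    qed simp
  qed
  also have "\<dots> = (NBINT s. (NBINT u. indicator {0..1} s * (indicator ?D u * ennreal (cmod u ^ m * cmod (F (z0 + ?e s * u))))))"
    by (rule lborel_pair.Fubini') measurable
  also have "\<dots> = (\<integral>\<^sup>+s. indicator {0..1} s * (NBINT u. G u) \<partial>(lborel :: real measure))"
  proof (rule nn_integral_cong)
    fix s :: real
    have ne: "cmod (?e s) = 1" by (simp add: norm_exp_eq_Re)
    have "(NBINT u. indicator {0..1} s * (indicator ?D u * ennreal (cmod u ^ m * cmod (F (z0 + ?e s * u)))))
       = (NBINT u. indicator {0..1} s * G (?e s * u))"
      by (intro nn_integral_cong) (auto simp: G_def disc_half_def norm_mult ne split: split_indicator)
    also have "\<dots> = indicator {0..1} s * (NBINT u. G (?e s * u))" by (rule nn_integral_cmult) measurable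
    also have "(NBINT u. G (?e s * u)) = (NBINT u. G u)" by (rule nn_integral_rotate[OF _ ne]) measurable
    finally show "(NBINT u. indicator {0..1} s * (indicator ?D u * ennreal (cmod u ^ m * cmod (F (z0 + ?e s * u)))))
      = indicator {0..1} s * (NBINT u. G u)" .
  qed
  also have "\<dots> = (NBINT u. G u)"
    by (subst nn_integral_multc) auto
  also have "\<dots> \<le> (NBINT u. ennreal (y ^ Suc m / 2) * (indicator ?D u * ennreal ((cmod (F (z0 + u)))\<^sup>2)) + ennreal (y ^ m / (2 * y)) * indicator ?D u)"
  proof (rule nn_integral_mono)
    fix u :: complex
    show "G u \<le> ennreal (y ^ Suc m / 2) * (indicator ?D u * ennreal ((cmod (F (z0 + u)))\<^sup>2)) + ennreal (y ^ m / (2 * y)) * indicator ?D u"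
    proof (cases "u \<in> ?D")
      case True
      let ?f = "cmod (F (z0 + u))"
      have "2 * y * ?f \<le> y\<^sup>2 * ?f\<^sup>2 + 1" using sum_squares_bound[of "y * ?f" 1] by (simp add: power_mult_distrib)
      then have f: "?f \<le> y * ?f\<^sup>2 / 2 + 1 / (2 * y)" using y by (simp add: field_simps power2_eq_square)
      have "cmod u ^ m \<le> y ^ m" using D[OF True] y by (intro power_mono) auto
      then have "cmod u ^ m * ?f \<le> y ^ m * (y * ?f\<^sup>2 / 2 + 1 / (2 * y))"
        using f y by (intro mult_mono) auto
      also have "\<dots> = y ^ Suc m / 2 * ?f\<^sup>2 + y ^ m / (2 * y)" by (simp add: algebra_simps)
      finally have "ennreal (cmod u ^ m * ?f) \<le> ennreal (y ^ Suc m / 2 * ?f\<^sup>2 + y ^ m / (2 * y))" by (rule ennreal_leI)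
      also have "\<dots> = ennreal (y ^ Suc m / 2) * ennreal (?f\<^sup>2) + ennreal (y ^ m / (2 * y))"
        by (subst ennreal_plus, use y in simp, use y in simp, subst ennreal_mult) (use y in auto)
      finally show ?thesis using True by (simp only: G_def indicator_simps mult_1 mult_1_right)
    qed (simp add: G_def)
  qed
  also have "\<dots> = ennreal (y ^ Suc m / 2) * (NBINT u. indicator ?D u * ennreal ((cmod (F (z0 + u)))\<^sup>2)) + ennreal (y ^ m / (2 * y)) * emeasure lborel ?D"
    by (subst nn_integral_add) (auto simp: nn_integral_cmult nn_integral_cmult_indicator)
  also have "\<dots> \<le> ennreal (y ^ Suc m / 2) * ennreal K + ennreal (y ^ m / (2 * y)) * ennreal (y\<^sup>2)"
    using K disc_half_area[OF z0] by (intro add_mono mult_left_mono) (auto simp: y_def)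
  also have "\<dots> = ennreal (y ^ Suc m / 2 * (K + 1))"
  proof -
    have "y ^ m / (2 * y) * y\<^sup>2 = y ^ Suc m / 2" using y by (simp add: power2_eq_square)
    then show ?thesis using y K0 by (simp add: ennreal_mult[symmetric] ennreal_plus[symmetric] distrib_left del: ennreal_plus)
  qed
  finally have "ennreal ((y\<^sup>2 / 32) ^ m * ?c) * ennreal (y\<^sup>2 / 32) \<le> ennreal (y ^ Suc m / 2 * (K + 1))" .
  then have "ennreal ((y\<^sup>2 / 32) ^ m * ?c * (y\<^sup>2 / 32)) \<le> ennreal (y ^ Suc m / 2 * (K + 1))"
    by (subst ennreal_mult) auto
  then have "(y\<^sup>2 / 32) ^ m * ?c * (y\<^sup>2 / 32) \<le> y ^ Suc m / 2 * (K + 1)"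
    using y K0 by (subst (asm) ennreal_le_iff) auto
  also have "\<dots> \<le> y ^ Suc m * (K + 1)" using y K0 by simp
  finally have "?c * (y ^ Suc m * y ^ Suc m / 32 ^ Suc m) \<le> y ^ Suc m * (K + 1)"
    by (simp add: power_divide power2_eq_square power_mult_distrib mult_ac)
  then have "(?c * y ^ Suc m) * y ^ Suc m \<le> (32 ^ Suc m * (K + 1)) * y ^ Suc m"
    by (simp add: field_simps)
  then have "?c * y ^ Suc m \<le> 32 ^ Suc m * (K + 1)"
    by (rule mult_right_le_imp_le) (use y in simp)
  then show ?thesis using y by (simp add: y_def[symmetric] pos_le_divide_eq)
qed

text \<open>Once the top component is bounded, its term can be subtracted without spoiling the local square
  integrals, which reduces the order.\<close>
lemma component_decay:
  assumes "polyform n \<phi> F" "F \<in> borel_measurable borel" "K \<ge> 0"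
    and "\<And>z0. z0 \<in> UHP \<Longrightarrow> (NBINT u. indicator (disc_half z0) u * ennreal ((cmod (F (z0 + u)))\<^sup>2)) \<le> ennreal K"
  shows "\<exists>C\<ge>0. \<forall>i<n. \<forall>z\<in>UHP. cmod (\<phi> i z) \<le> C / Im z ^ Suc i"
  using assms
proof (induction n arbitrary: F K)
  case 0
  then show ?case by auto
next
  case (Suc m)
  note p = Suc.prems(1)
  have [measurable]: "F \<in> borel_measurable borel" by (rule Suc.prems(2))
  define C1 where "C1 = 32 ^ Suc m * (K + 1)"
  have C10: "C1 \<ge> 0" using Suc.prems(3) by (simp add: C1_def)
  have top: "cmod (\<phi> m z) \<le> C1 / Im z ^ Suc m" if "z \<in> UHP" for z
    unfolding C1_def by (rule top_component_decay[OF p Suc.prems(2) that Suc.prems(3) Suc.prems(4)[OF that]])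
  define T where "T = (\<lambda>z. indicator UHP z *\<^sub>R (of_real (Im z) ^ m * \<phi> m z))"
  have "continuous_on UHP (\<phi> m)"
    using p by (intro holomorphic_on_imp_continuous_on) (auto simp: polyform_def)
  then have "continuous_on UHP (\<lambda>z. of_real (Im z) ^ m * \<phi> m z)" by (intro continuous_intros)
  then have [measurable]: "T \<in> borel_measurable borel"
    unfolding T_def using open_UHP by (intro borel_measurable_continuous_on_indicator) auto
  define F' where "F' = (\<lambda>z. F z - T z)"
  have [measurable]: "F' \<in> borel_measurable borel" unfolding F'_def by measurable
  have p': "polyform m \<phi> F'" using p by (auto simp: polyform_def F'_def T_def)
  have T: "cmod (T z) \<le> C1 / Im z" if "z \<in> UHP" for z
  proof -
    have "cmod (T z) = Im z ^ m * cmod (\<phi> m z)" using that by (simp add: T_def norm_mult norm_power UHP_iff)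
    also have "\<dots> \<le> Im z ^ m * (C1 / Im z ^ Suc m)" using top[OF that] that by (intro mult_left_mono) (auto simp: UHP_iff)
    also have "\<dots> = C1 / Im z" using that by (simp add: UHP_iff)
    finally show ?thesis .
  qed
  have "\<exists>C\<ge>0. \<forall>i<m. \<forall>z\<in>UHP. cmod (\<phi> i z) \<le> C / Im z ^ Suc i"
  proof (rule Suc.IH[OF p'])
    show "0 \<le> 2 * K + 8 * C1\<^sup>2" using Suc.prems(3) by simp
    fix z0 assume z0: "z0 \<in> UHP"
    define y where "y = Im z0"
    have y: "y > 0" using z0 by (simp add: y_def UHP_iff)
    have "(NBINT u. indicator (disc_half z0) u * ennreal ((cmod (F' (z0 + u)))\<^sup>2))
       \<le> (NBINT u. 2 * (indicator (disc_half z0) u * ennreal ((cmod (F (z0 + u)))\<^sup>2)) + ennreal (8 * C1\<^sup>2 / y\<^sup>2) * indicator (disc_half z0) u)"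
    proof (rule nn_integral_mono)
      fix u
      show "indicator (disc_half z0) u * ennreal ((cmod (F' (z0 + u)))\<^sup>2) \<le> 2 * (indicator (disc_half z0) u * ennreal ((cmod (F (z0 + u)))\<^sup>2)) + ennreal (8 * C1\<^sup>2 / y\<^sup>2) * indicator (disc_half z0) u"
      proof (cases "u \<in> disc_half z0")
        case True
        then have "cmod u < y / 2" by (simp add: disc_half_def y_def)
        then have im: "Im (z0 + u) \<ge> y / 2" using abs_Im_le_cmod[of u] by (simp add: y_def)
        then have zu: "z0 + u \<in> UHP" using y by (simp add: UHP_iff)
        have "cmod (T (z0 + u)) \<le> C1 / Im (z0 + u)" by (rule T[OF zu])
        also have "\<dots> \<le> C1 / (y / 2)" using im y C10 by (intro divide_left_mono mult_pos_pos) auto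
        finally have "(cmod (T (z0 + u)))\<^sup>2 \<le> (2 * C1 / y)\<^sup>2" by (intro power_mono) (auto simp: mult.commute)
        moreover have "(cmod (F' (z0 + u)))\<^sup>2 \<le> 2 * (cmod (F (z0 + u)))\<^sup>2 + 2 * (cmod (T (z0 + u)))\<^sup>2"
        proof -
          have "(cmod (F' (z0 + u)))\<^sup>2 \<le> (cmod (F (z0 + u)) + cmod (T (z0 + u)))\<^sup>2"
            unfolding F'_def by (intro power_mono norm_triangle_ineq4) auto
          then show ?thesis using sum_squares_bound[of "cmod (F (z0 + u))" "cmod (T (z0 + u))"] by (simp add: power2_sum)
        qed
        ultimately have "(cmod (F' (z0 + u)))\<^sup>2 \<le> 2 * (cmod (F (z0 + u)))\<^sup>2 + 8 * C1\<^sup>2 / y\<^sup>2"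
          by (simp add: power_mult_distrib power_divide)
        then have "ennreal ((cmod (F' (z0 + u)))\<^sup>2) \<le> ennreal (2 * (cmod (F (z0 + u)))\<^sup>2 + 8 * C1\<^sup>2 / y\<^sup>2)" by (rule ennreal_leI)
        also have "\<dots> = 2 * ennreal ((cmod (F (z0 + u)))\<^sup>2) + ennreal (8 * C1\<^sup>2 / y\<^sup>2)"
          by (simp add: ennreal_plus ennreal_mult)
        finally show ?thesis using True by simp
      qed simp
    qed
    also have "\<dots> = 2 * (NBINT u. indicator (disc_half z0) u * ennreal ((cmod (F (z0 + u)))\<^sup>2)) + ennreal (8 * C1\<^sup>2 / y\<^sup>2) * emeasure lborel (disc_half z0)"
      by (subst nn_integral_add) (auto simp: nn_integral_cmult nn_integral_cmult_indicator)
    also have "\<dots> \<le> 2 * ennreal K + ennreal (8 * C1\<^sup>2 / y\<^sup>2) * ennreal (y\<^sup>2)"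
      using Suc.prems(4)[OF z0] disc_half_area[OF z0] by (intro add_mono mult_left_mono) (auto simp: y_def)
    also have "\<dots> = ennreal (2 * K + 8 * C1\<^sup>2)"
      using y Suc.prems(3) by (simp add: ennreal_plus ennreal_mult ennreal_mult[symmetric])
    finally show "(NBINT u. indicator (disc_half z0) u * ennreal ((cmod (F' (z0 + u)))\<^sup>2)) \<le> ennreal (2 * K + 8 * C1\<^sup>2)" .
  qed measurable
  then obtain C where C: "C \<ge> 0" "\<And>i z. i < m \<Longrightarrow> z \<in> UHP \<Longrightarrow> cmod (\<phi> i z) \<le> C / Im z ^ Suc i" by blast
  show ?case
  proof (intro exI[of _ "C + C1"] conjI allI impI ballI)
    show "C + C1 \<ge> 0" using C C10 by simp
    fix i z assume i: "i < Suc m" and z: "z \<in> UHP"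
    have "cmod (\<phi> i z) \<le> C / Im z ^ Suc i \<or> cmod (\<phi> i z) \<le> C1 / Im z ^ Suc i"
      using C(2)[of i z] top[of z] i z less_Suc_eq by metis
    moreover have "C / Im z ^ Suc i \<le> (C + C1) / Im z ^ Suc i" "C1 / Im z ^ Suc i \<le> (C + C1) / Im z ^ Suc i"
      using z C C10 by (auto intro!: divide_right_mono simp: UHP_iff)
    ultimately show "cmod (\<phi> i z) \<le> (C + C1) / Im z ^ Suc i" by linarith
  qed
qed

lemma bergman_component_decay:
  assumes "polyform n \<phi> F" "square_integrable F"
  shows "\<exists>C\<ge>0. \<forall>i<n. \<forall>z\<in>UHP. cmod (\<phi> i z) \<le> C / Im z ^ Suc i"
proof (rule component_decay[OF assms(1)])
  show [measurable]: "F \<in> borel_measurable borel" using assms(2) by (rule sq_measurable)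
  fix z0
  have "(NBINT u. indicator (disc_half z0) u * ennreal ((cmod (F (z0 + u)))\<^sup>2)) \<le> (NBINT u. ennreal ((cmod (F (z0 + u)))\<^sup>2))"
    by (intro nn_integral_mono) (auto split: split_indicator)
  also have "\<dots> = (\<integral>\<^sup>+u. ennreal ((cmod (F u))\<^sup>2) \<partial>distr lborel borel ((+) z0))"
    by (subst nn_integral_distr) auto
  also have "\<dots> = ennreal ((norm (abs_L2 F))\<^sup>2)"
    unfolding lborel_distr_plus by (rule nn_norm_abs_sq[OF assms(2)])
  finally show "(NBINT u. indicator (disc_half z0) u * ennreal ((cmod (F (z0 + u)))\<^sup>2)) \<le> ennreal ((norm (abs_L2 F))\<^sup>2)" .
qed simp

lemma derivative_decay:
  assumes h: "\<phi> holomorphic_on UHP" and C: "C \<ge> 0" "\<And>z. z \<in> UHP \<Longrightarrow> cmod (\<phi> z) \<le> C / Im z ^ j"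
  shows "\<exists>C'\<ge>0. \<forall>z\<in>UHP. cmod ((deriv ^^ q) \<phi> z) \<le> C' / Im z ^ (j + q)"
proof (intro exI[of _ "fact q * (C * 2 ^ (j + q))"] conjI ballI)
  show "0 \<le> fact q * (C * 2 ^ (j + q))" using C by simp
  fix z assume z: "z \<in> UHP"
  define r where "r = Im z / 2"
  have r: "r > 0" using z by (simp add: r_def UHP_iff)
  have sub: "cball z r \<subseteq> {w. Im w \<ge> r}"
  proof
    fix w assume "w \<in> cball z r"
    then have "cmod (w - z) \<le> r" by (simp add: dist_norm norm_minus_commute)
    then have "\<bar>Im w - Im z\<bar> \<le> r" using abs_Im_le_cmod[of "w - z"] by simp
    then have "Im w \<ge> Im z - r" by linarith
    then show "w \<in> {w. Im w \<ge> r}" by (simp add: r_def)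
  qed
  then have subU: "cball z r \<subseteq> UHP" using r by (auto simp: UHP_iff)
  have "cmod ((deriv ^^ q) \<phi> z) \<le> fact q * (C / r ^ j) / r ^ q"
  proof (rule Cauchy_inequality[OF _ _ r])
    show "\<phi> holomorphic_on ball z r" using h subU ball_subset_cball by (meson holomorphic_on_subset order_trans)
    show "continuous_on (cball z r) \<phi>" using h subU holomorphic_on_imp_continuous_on holomorphic_on_subset by blast
    fix x assume "cmod (z - x) = r"
    then have x: "x \<in> cball z r" by (simp add: dist_norm)
    then have "cmod (\<phi> x) \<le> C / Im x ^ j" using C(2) subU by auto
    also have "\<dots> \<le> C / r ^ j" using x sub r C(1) by (intro divide_left_mono power_mono mult_pos_pos zero_less_power) auto
    finally show "cmod (\<phi> x) \<le> C / r ^ j" .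
  qed
  also have "\<dots> = fact q * (C * 2 ^ (j + q)) / Im z ^ (j + q)"
    by (simp add: r_def power_divide power_add)
  finally show "cmod ((deriv ^^ q) \<phi> z) \<le> fact q * (C * 2 ^ (j + q)) / Im z ^ (j + q)" .
qed

section \<open>Completeness of the synthesis operators\<close>

lemma FTC_half_line:
  fixes F f :: "real \<Rightarrow> complex"
  assumes F: "\<And>x. x > 0 \<Longrightarrow> (F has_vector_derivative f x) (at x)"
    and f: "\<And>x. x > 0 \<Longrightarrow> isCont f x"
    and int: "set_integrable lborel {0<..} f"
    and A: "(F \<longlongrightarrow> A) (at_right 0)" and B: "(F \<longlongrightarrow> B) at_top"
  shows "(LINT x:{0<..}|lborel. f x) = B - A"
proof -
  have e: "einterval 0 \<infinity> = {0<..}" by (auto simp: einterval_def zero_ereal_def)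
  have "(LBINT x=0..\<infinity>. f x) = B - A"
  proof (rule interval_integral_FTC_integrable)
    show "((F \<circ> real_of_ereal) \<longlongrightarrow> A) (at_right 0)"
      using A unfolding zero_ereal_def by (simp add: ereal_tendsto_simps)
    show "((F \<circ> real_of_ereal) \<longlongrightarrow> B) (at_left \<infinity>)"
      using B by (simp add: ereal_tendsto_simps)
  qed (use F f int in \<open>auto simp: e zero_ereal_def\<close>)
  then show ?thesis by (simp add: interval_lebesgue_integral_def e)
qed

lemma set_integral_cmult:
  fixes f :: "real \<Rightarrow> complex"
  shows "(LINT x:A|lborel. c * f x) = c * (LINT x:A|lborel. f x)"
  unfolding set_lebesgue_integral_def mult_scaleR_right[symmetric] by (rule integral_mult_right_zero)

lemma gamma_integral_scaled:
  assumes c: "Re c > 0"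
  shows "set_integrable lborel {0<..} (\<lambda>x. of_real (x ^ N) * exp (- (c * of_real x)))"
    "(LINT x:{0<..}|lborel. of_real (x ^ N) * exp (- (c * of_real x))) = fact N / c ^ Suc N"
proof -
  let ?B = "\<lambda>N. \<lambda>x. of_real (x ^ N) * exp (- (c * of_real x))"
  let ?A = "\<lambda>x. - exp (- (c * of_real x)) / c"
  have c0: "c \<noteq> 0" using c by auto
  have int: "set_integrable lborel {0<..} (?B N)" for N
  proof -
    have "integrable lborel (\<lambda>x. indicator {0<..} x * (x ^ N * exp (- (Re c * x))))"
    proof -
      have "integrable lborel (\<lambda>r. indicator {0<..} r * (Re c * (poly (monom 1 N) (Re c * r) * exp (- (Re c * r)))))"
        using scaled_poly_exp(1)[of "Re c / 2" "monom 1 N"] c by simp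
      then have "integrable lborel (\<lambda>r. 1 / Re c ^ Suc N * (indicator {0<..} r * (Re c * (poly (monom 1 N) (Re c * r) * exp (- (Re c * r))))))"
        by (rule integrable_mult_right)
      then show ?thesis using c by (simp add: poly_monom power_mult_distrib field_simps)
    qed
    then show ?thesis unfolding set_integrable_def
      by (rule Bochner_Integration.integrable_bound) (auto simp: norm_mult norm_power split: split_indicator)
  qed
  show "set_integrable lborel {0<..} (?B N)" by (rule int)
  have lim: "((?B N) \<longlongrightarrow> 0) at_top" for N
  proof (rule tendsto_norm_zero_cancel)
    have "((\<lambda>x. 1 / Re c ^ N * ((Re c * x) ^ N / exp (Re c * x))) \<longlongrightarrow> 1 / Re c ^ N * 0) at_top"
      by (intro tendsto_mult tendsto_const filterlim_compose[OF tendsto_power_div_exp_0]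
        filterlim_tendsto_pos_mult_at_top[OF tendsto_const c filterlim_ident])
    then have l: "((\<lambda>x. 1 / Re c ^ N * ((Re c * x) ^ N / exp (Re c * x))) \<longlongrightarrow> 0) at_top" by simp
    show "((\<lambda>x. cmod (of_real (x ^ N) * exp (- (c * of_real x)))) \<longlongrightarrow> 0) at_top"
    proof (rule Lim_transform_eventually[OF l])
      show "\<forall>\<^sub>F x in at_top. 1 / Re c ^ N * ((Re c * x) ^ N / exp (Re c * x)) = cmod (of_real (x ^ N) * exp (- (c * of_real x)))"
        using eventually_gt_at_top[of 0]
      proof eventually_elim
        case (elim x)
        have "cmod (of_real (x ^ N) * exp (- (c * of_real x))) = x ^ N * exp (- (Re c * x))"
          using elim by (simp add: norm_mult norm_power)
        moreover have "1 / Re c ^ N * ((Re c * x) ^ N / exp (Re c * x)) = x ^ N * exp (- (Re c * x))"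
          using c by (simp add: power_mult_distrib exp_minus field_simps)
        ultimately show ?case by simp
      qed
    qed
  qed
  have cont: "isCont (\<lambda>x::real. of_real (x ^ N) * exp (- (c * of_real x))) x" for N x
    by (intro continuous_intros)
  show "(LINT x:{0<..}|lborel. of_real (x ^ N) * exp (- (c * of_real x))) = fact N / c ^ Suc N"
  proof (induction N)
    case 0
    have "(LINT x:{0<..}|lborel. of_real (x ^ 0) * exp (- (c * of_real x))) = 0 - (- 1 / c)"
    proof (rule FTC_half_line[where F = "\<lambda>x. - exp (- (c * of_real x)) / c"])
      show "(?A has_vector_derivative of_real (x ^ 0) * exp (- (c * of_real x))) (at x)" for x
      proof -
        have "((\<lambda>z. - exp (- (c * z)) / c) has_field_derivative exp (- (c * of_real x))) (at (of_real x))"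
          using c0 by (auto intro!: derivative_eq_intros)
        from has_vector_derivative_real_field[OF this] show ?thesis by simp
      qed
      have "(?A \<longlongrightarrow> - exp (- (c * of_real 0)) / c) (at_right 0)"
        using c0 by (intro tendsto_intros) auto
      then show "(?A \<longlongrightarrow> - 1 / c) (at_right 0)" by simp
      show "(?A \<longlongrightarrow> 0) at_top"
        using tendsto_divide[OF tendsto_minus[OF lim[of 0]] tendsto_const c0] by simp
    qed (use int[of 0] cont[of 0] in auto)
    then show ?case by simp
  next
    case (Suc N)
    let ?g = "\<lambda>N x. of_real (x ^ N) * exp (- (c * of_real x))"
    have "(LINT x:{0<..}|lborel. of_nat (Suc N) * ?g N x - c * ?g (Suc N) x) = 0 - 0"
    proof (rule FTC_half_line[where F = "?g (Suc N)"])
      fix x :: real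
      have 1: "((\<lambda>x. complex_of_real (x ^ Suc N)) has_vector_derivative of_real (of_nat (Suc N) * x ^ N)) (at x)"
        using DERIV_pow[of "Suc N" x] by (intro has_vector_derivative_of_real) (simp add: has_real_derivative_iff_has_vector_derivative)
      have 2: "((\<lambda>x. exp (- (c * of_real x))) has_vector_derivative (- c * exp (- (c * of_real x)))) (at x)"
      proof -
        have "((\<lambda>z. exp (- (c * z))) has_field_derivative - c * exp (- (c * of_real x))) (at (of_real x))"
          by (auto intro!: derivative_eq_intros)
        from has_vector_derivative_real_field[OF this] show ?thesis by simp
      qed
      show "(?g (Suc N) has_vector_derivative of_nat (Suc N) * ?g N x - c * ?g (Suc N) x) (at x)"
        using has_vector_derivative_mult[OF 1 2] by (simp add: algebra_simps)
      show "isCont (\<lambda>x. of_nat (Suc N) * ?g N x - c * ?g (Suc N) x) x" by (intro continuous_intros)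
    next
      show "set_integrable lborel {0<..} (\<lambda>x. of_nat (Suc N) * ?g N x - c * ?g (Suc N) x)"
        by (intro set_integral_diff set_integrable_mult_right int)
      have "(?g (Suc N) \<longlongrightarrow> ?g (Suc N) 0) (at_right 0)" by (intro tendsto_intros)
      then show "(?g (Suc N) \<longlongrightarrow> 0) (at_right 0)" by simp
      show "(?g (Suc N) \<longlongrightarrow> 0) at_top" by (rule lim)
    qed
    moreover have "(LINT x:{0<..}|lborel. of_nat (Suc N) * ?g N x - c * ?g (Suc N) x)
      = of_nat (Suc N) * (LINT x:{0<..}|lborel. ?g N x) - c * (LINT x:{0<..}|lborel. ?g (Suc N) x)"
      using set_integral_diff(2)[OF set_integrable_mult_right[OF int[of N], of "of_nat (Suc N)"] set_integrable_mult_right[OF int[of "Suc N"], of c]]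
      by (simp only: set_integral_cmult)
    ultimately have "c * (LINT x:{0<..}|lborel. ?g (Suc N) x) = of_nat (Suc N) * (fact N / c ^ Suc N)"
      unfolding Suc.IH by simp
    then have "(LINT x:{0<..}|lborel. ?g (Suc N) x) = of_nat (Suc N) * (fact N / c ^ Suc N) / c"
      using c0 by (simp add: field_simps)
    then show ?case by (simp add: field_simps)
  qed
qed

subsection \<open>Horizontal lines: the residue theorem\<close>

lemma contour_integral_horizontal:
  assumes c: "continuous_on (closed_segment (Complex a y) (Complex b y)) h" and ab: "a < b"
  shows "contour_integral (linepath (Complex a y) (Complex b y)) h = (LINT t:{a..b}|lborel. h (Complex t y))"
proof -
  have ci: "(h has_contour_integral contour_integral (linepath (Complex a y) (Complex b y)) h) (linepath (Complex a y) (Complex b y))"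
    using contour_integrable_continuous_linepath[OF c] by (rule has_contour_integral_integral)
  let ?I = "contour_integral (linepath (Complex a y) (Complex b y)) h"
  have lin: "linepath (Complex a y) (Complex b y) x = linepath (of_real a) (of_real b) x + \<i> * of_real y" for x
    by (simp add: linepath_def complex_eq_iff algebra_simps)
  have d: "Complex b y - Complex a y = of_real b - of_real a" by (simp add: complex_eq_iff)
  have "((\<lambda>z. h (z + \<i> * of_real y)) has_contour_integral ?I) (linepath (of_real a) (of_real b))"
    using ci unfolding has_contour_integral_linepath lin d .
  then have "((\<lambda>t. h (of_real t + \<i> * of_real y)) has_integral ?I) {a..b}"
    using ab has_contour_integral_linepath_Reals_iff[of "of_real a" "of_real b" "\<lambda>z. h (z + \<i> * of_real y)" ?I] by auto
  moreover have "of_real t + \<i> * of_real y = Complex t y" for t by (simp add: complex_eq_iff)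
  ultimately have hi: "((\<lambda>t. h (Complex t y)) has_integral ?I) {a..b}" by simp
  have seg: "closed_segment (Complex a y) (Complex b y) = {z. Im z = y \<and> Re z \<in> {a..b}}"
    using ab by (subst closed_segment_same_Im) (auto simp: closed_segment_eq_real_ivl)
  have im: "(\<lambda>t. Complex t y) ` {a..b} \<subseteq> closed_segment (Complex a y) (Complex b y)"
    unfolding seg by (rule image_subsetI) simp
  have ctc: "continuous_on {a..b} (\<lambda>t. Complex t y)"
    unfolding complex_eq by (intro continuous_intros)
  have "continuous_on {a..b} (\<lambda>t. h (Complex t y))"
    by (rule continuous_on_compose2[OF c ctc im])
  from set_borel_integral_eq_integral(2)[OF borel_integrable_atLeastAtMost'[OF this]]
  have "(LINT t:{a..b}|lborel. h (Complex t y)) = integral {a..b} (\<lambda>t. h (Complex t y))" .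
  then show ?thesis using hi by (simp add: integral_unique)
qed

lemma integrable_inverse_square:
  assumes "d > 0" shows "integrable lborel (\<lambda>t::real. 1 / ((t - a)\<^sup>2 + d\<^sup>2))"
proof -
  have i: "integrable lborel (\<lambda>x::real. inverse (1 + x\<^sup>2))"
    using integrable_inverse_1_plus_square by (simp add: set_integrable_def einterval_def)
  have "integrable lborel (\<lambda>t. inverse (d\<^sup>2) * inverse (1 + (- a / d + 1 / d * t)\<^sup>2))"
    using lborel_integrable_real_affine[OF i, of "1 / d" "- a / d"] assms by (intro integrable_mult_right) simp
  moreover have "inverse (d\<^sup>2) * inverse (1 + (- a / d + 1 / d * t)\<^sup>2) = 1 / ((t - a)\<^sup>2 + d\<^sup>2)" for t
  proof -
    have "d\<^sup>2 * (1 + (- a / d + 1 / d * t)\<^sup>2) = (t - a)\<^sup>2 + d\<^sup>2"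
      using assms by (simp add: field_simps power2_eq_square)
    then show ?thesis by (metis inverse_eq_divide inverse_mult_distrib)
  qed
  ultimately show ?thesis by (simp only:)
qed

text \<open>Close the line by a large rectangle in the half-plane above it. The exponent \<open>Suc p \<ge> 2\<close> makes the other
  three sides contribute \<open>O(1 / R)\<close>.\<close>
lemma line_residue:
  assumes h: "\<phi> holomorphic_on UHP" and y: "y > 0"
    and B: "\<And>z. Im z \<ge> y \<Longrightarrow> cmod (\<phi> z) \<le> B" and w: "Im w > y" and p: "p \<ge> 1"
  shows "integrable lborel (\<lambda>t. \<phi> (Complex t y) / (Complex t y - w) ^ Suc p)"
    "(LBINT t. \<phi> (Complex t y) / (Complex t y - w) ^ Suc p) = 2 * pi * \<i> * ((deriv ^^ p) \<phi> w / fact p)"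
proof -
  let ?A = "\<lambda>d t. (t - Re w)\<^sup>2 + d\<^sup>2"
  define f where "f = (\<lambda>z. \<phi> z / (z - w) ^ Suc p)"
  define d where "d = Im w - y"
  have d: "d > 0" using w by (simp add: d_def)
  have B0: "B \<ge> 0" using order_trans[OF norm_ge_zero B[of "Complex 0 y"]] by simp
  have wU: "w \<in> UHP" using w y by (simp add: UHP_iff)
  have fhol: "f holomorphic_on UHP - {w}"
    unfolding f_def by (intro holomorphic_intros holomorphic_on_subset[OF h]) auto
  then have fcont: "continuous_on (UHP - {w}) f" by (rule holomorphic_on_imp_continuous_on)
  have "(\<lambda>t. f (Complex t y)) \<in> borel_measurable borel"
  proof (rule borel_measurable_continuous_onI)
    have "continuous_on UNIV (\<lambda>t. Complex t y)" unfolding complex_eq by (intro continuous_intros)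
    then show "continuous_on UNIV (\<lambda>t. f (Complex t y))"
      using y w by (intro continuous_on_compose2[OF fcont]) (auto simp: UHP_iff)
  qed
  then have fm: "(\<lambda>t. f (Complex t y)) \<in> borel_measurable lborel" by simp
  have dist: "cmod (Complex t y - w) ^ Suc p \<ge> d ^ (p - 1) * (?A d t)" for t
  proof -
    have sq: "(cmod (Complex t y - w))\<^sup>2 = (t - Re w)\<^sup>2 + d\<^sup>2"
      by (simp add: cmod_power2 d_def power2_commute)
    have "d \<le> cmod (Complex t y - w)" using abs_Im_le_cmod[of "Complex t y - w"] by (simp add: d_def)
    then have "d ^ (p - 1) \<le> cmod (Complex t y - w) ^ (p - 1)" using d by (intro power_mono) auto
    then have "d ^ (p - 1) * (cmod (Complex t y - w))\<^sup>2 \<le> cmod (Complex t y - w) ^ (p - 1) * (cmod (Complex t y - w))\<^sup>2"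
      by (intro mult_right_mono) auto
    also have "\<dots> = cmod (Complex t y - w) ^ Suc p" using p by (simp flip: power_add)
    finally show ?thesis unfolding sq .
  qed
  show int: "integrable lborel (\<lambda>t. \<phi> (Complex t y) / (Complex t y - w) ^ Suc p)"
  proof (rule Bochner_Integration.integrable_bound[OF integrable_mult_right[OF integrable_inverse_square[OF d, of "Re w"], of "B / d ^ (p - 1)"]])
    show "(\<lambda>t. \<phi> (Complex t y) / (Complex t y - w) ^ Suc p) \<in> borel_measurable lborel" using fm by (simp add: f_def)
    show "AE t in lborel. norm (\<phi> (Complex t y) / (Complex t y - w) ^ Suc p) \<le> norm (B / d ^ (p - 1) * (1 / (?A d t)))"
    proof (intro AE_I2)
      fix t
      have pos: "d ^ (p - 1) * (?A d t) > 0" using d by (intro mult_pos_pos add_nonneg_pos) auto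
      have "norm (\<phi> (Complex t y) / (Complex t y - w) ^ Suc p) \<le> B / (d ^ (p - 1) * (?A d t))"
        unfolding norm_divide norm_power using dist[of t] pos B[of "Complex t y"] B0 by (intro frac_le) auto
      also have "\<dots> = B / d ^ (p - 1) * (1 / (?A d t))" by simp
      finally show "norm (\<phi> (Complex t y) / (Complex t y - w) ^ Suc p) \<le> norm (B / d ^ (p - 1) * (1 / (?A d t)))"
        unfolding real_norm_def by (rule order_trans[OF _ abs_ge_self])
    qed
  qed
  let ?res = "2 * pi * \<i> * ((deriv ^^ p) \<phi> w / fact p)"
  define I where "I = (\<lambda>N::nat. LINT t:{- real N..real N}|lborel. f (Complex t y))"
  obtain N0 :: nat where N0: "real N0 \<ge> 2 * \<bar>Re w\<bar> + 2 * Im w + 2" using real_arch_simple by blast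
  have key: "cmod (I N - ?res) \<le> 16 * B / real N" if N: "N \<ge> N0" for N
  proof -
    define R where "R = real N"
    have R: "R \<ge> 2 * \<bar>Re w\<bar> + 2 * Im w + 2" using N0 N by (simp add: R_def)
    have R2: "R \<ge> 2" using R w y by (auto intro: order_trans[rotated])
    let ?a1 = "Complex (-R) y" and ?a2 = "Complex R y" and ?a3 = "Complex R (y + R)" and ?a4 = "Complex (-R) (y + R)"
    have rp: "rectpath ?a1 ?a3 = linepath ?a1 ?a2 +++ linepath ?a2 ?a3 +++ linepath ?a3 ?a4 +++ linepath ?a4 ?a1"
      by (simp add: rectpath_def Let_def)
    have wbox: "w \<in> box ?a1 ?a3" using R w y by (auto simp: in_box_complex_iff)
    have s12: "closed_segment ?a1 ?a2 = {z. Im z = y \<and> Re z \<in> {-R..R}}"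
      using R2 by (subst closed_segment_same_Im) (auto simp: closed_segment_eq_real_ivl)
    have s23: "closed_segment ?a2 ?a3 = {z. Re z = R \<and> Im z \<in> {y..y + R}}"
      using R2 by (subst closed_segment_same_Re) (auto simp: closed_segment_eq_real_ivl)
    have s34: "closed_segment ?a3 ?a4 = {z. Im z = y + R \<and> Re z \<in> {-R..R}}"
      using R2 by (subst closed_segment_same_Im) (auto simp: closed_segment_eq_real_ivl)
    have s41: "closed_segment ?a4 ?a1 = {z. Re z = -R \<and> Im z \<in> {y..y + R}}"
      using R2 by (subst closed_segment_same_Re) (auto simp: closed_segment_eq_real_ivl)
    have sub: "closed_segment ?a1 ?a2 \<subseteq> UHP - {w}" "closed_segment ?a2 ?a3 \<subseteq> UHP - {w}"
      "closed_segment ?a3 ?a4 \<subseteq> UHP - {w}" "closed_segment ?a4 ?a1 \<subseteq> UHP - {w}"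
      unfolding s12 s23 s34 s41 using w y R by (auto simp: UHP_iff)
    have ci: "f contour_integrable_on linepath a b" if "closed_segment a b \<subseteq> UHP - {w}" for a b
      using continuous_on_subset[OF fcont that] by (rule contour_integrable_continuous_linepath)
    have split: "contour_integral (rectpath ?a1 ?a3) f = contour_integral (linepath ?a1 ?a2) f + (contour_integral (linepath ?a2 ?a3) f
        + (contour_integral (linepath ?a3 ?a4) f + contour_integral (linepath ?a4 ?a1) f))"
      unfolding rp using sub by (simp add: ci contour_integrable_join valid_path_join)
    have "contour_integral (rectpath ?a1 ?a3) f = 2 * pi * \<i> * (\<Sum>p\<in>{w}. winding_number (rectpath ?a1 ?a3) p * residue f p)"
    proof (rule Residue_theorem)
      show "open UHP" by (rule open_UHP)
      show "connected UHP" by (rule convex_connected[OF convex_UHP])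
      show "f holomorphic_on UHP - {w}" by (rule fhol)
      have "path_image (rectpath ?a1 ?a3) = closed_segment ?a1 ?a2 \<union> closed_segment ?a2 ?a3 \<union> closed_segment ?a3 ?a4 \<union> closed_segment ?a4 ?a1"
        unfolding rp by (simp add: path_image_join Un_assoc)
      then show "path_image (rectpath ?a1 ?a3) \<subseteq> UHP - {w}" using sub by blast
      show "\<forall>z. z \<notin> UHP \<longrightarrow> winding_number (rectpath ?a1 ?a3) z = 0"
        using R2 y by (auto intro!: winding_number_rectpath_outside simp: in_cbox_complex_iff UHP_iff)
    qed auto
    also have "\<dots> = ?res"
      using winding_number_rectpath[OF wbox] residue_holomorphic_over_power[OF open_UHP wU h, of p] by (simp add: f_def[abs_def])
    finally have tot: "contour_integral (rectpath ?a1 ?a3) f = ?res" .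
    have c12: "contour_integral (linepath ?a1 ?a2) f = I N"
      unfolding I_def R_def[symmetric] using R2 continuous_on_subset[OF fcont sub(1)] by (intro contour_integral_horizontal) auto
    have far: "cmod (f z) \<le> B * (4 / R\<^sup>2)" if z: "Im z \<ge> y" "cmod (z - w) \<ge> R / 2" for z
    proof -
      have "(R / 2)\<^sup>2 \<le> (R / 2) ^ Suc p" using R2 p by (intro power_increasing) auto
      also have "\<dots> \<le> cmod (z - w) ^ Suc p" using z(2) R2 by (intro power_mono) auto
      finally have le: "(R / 2)\<^sup>2 \<le> cmod (z - w) ^ Suc p" .
      have "cmod (f z) \<le> B / (R / 2)\<^sup>2"
        unfolding f_def norm_divide norm_power using le R2 B[OF z(1)] B0 by (intro frac_le) auto
      then show ?thesis by (simp add: power_divide)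
    qed
    have side: "cmod (z - w) \<ge> R / 2" if "z \<in> closed_segment ?a2 ?a3 \<or> z \<in> closed_segment ?a3 ?a4 \<or> z \<in> closed_segment ?a4 ?a1" for z
      using that abs_Re_le_cmod[of "z - w"] abs_Im_le_cmod[of "z - w"] R w y unfolding s23 s34 s41 by auto
    have above: "Im z \<ge> y" if "z \<in> closed_segment ?a2 ?a3 \<or> z \<in> closed_segment ?a3 ?a4 \<or> z \<in> closed_segment ?a4 ?a1" for z
      using that R2 unfolding s23 s34 s41 by auto
    have e: "?a3 - ?a2 = \<i> * of_real R" "?a4 - ?a3 = of_real (- 2 * R)" "?a1 - ?a4 = \<i> * of_real (- R)"
      by (simp_all add: complex_eq_iff)
    have n: "cmod (?a3 - ?a2) = R" "cmod (?a4 - ?a3) = 2 * R" "cmod (?a1 - ?a4) = R"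
      unfolding e norm_mult norm_of_real using R2 by auto
    have B4: "0 \<le> B * (4 / R\<^sup>2)" using B0 by simp
    have "cmod (contour_integral (linepath ?a2 ?a3) f) \<le> B * (4 / R\<^sup>2) * R"
      using contour_integral_bound_linepath[OF ci[OF sub(2)] B4] far side above n by metis
    moreover have "cmod (contour_integral (linepath ?a3 ?a4) f) \<le> B * (4 / R\<^sup>2) * (2 * R)"
      using contour_integral_bound_linepath[OF ci[OF sub(3)] B4] far side above n by metis
    moreover have "cmod (contour_integral (linepath ?a4 ?a1) f) \<le> B * (4 / R\<^sup>2) * R"
      using contour_integral_bound_linepath[OF ci[OF sub(4)] B4] far side above n by metis
    moreover have "I N - ?res = - (contour_integral (linepath ?a2 ?a3) f + (contour_integral (linepath ?a3 ?a4) f + contour_integral (linepath ?a4 ?a1) f))"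
      using split unfolding tot c12 by simp
    ultimately have "cmod (I N - ?res) \<le> B * (4 / R\<^sup>2) * R + (B * (4 / R\<^sup>2) * (2 * R) + B * (4 / R\<^sup>2) * R)"
      by (simp only: norm_minus_cancel) (intro norm_triangle_mono)
    also have "\<dots> = 16 * B / R" using R2 by (simp add: field_simps power2_eq_square)
    finally show ?thesis by (simp add: R_def)
  qed
  have "(\<lambda>N. 16 * B / real N) \<longlonglongrightarrow> 0" by (rule lim_const_over_n)
  then have "(\<lambda>N. I N - ?res) \<longlonglongrightarrow> 0"
    by (rule Lim_null_comparison[rotated]) (use key in \<open>auto simp: eventually_sequentially\<close>)
  then have lim1: "I \<longlonglongrightarrow> ?res" by (rule LIM_zero_cancel)
  have intf: "integrable lborel (\<lambda>t. f (Complex t y))" using int by (simp add: f_def)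
  have "(\<lambda>N. LBINT t. indicator {- real N..real N} t *\<^sub>R f (Complex t y)) \<longlonglongrightarrow> (LBINT t. f (Complex t y))"
  proof (rule integral_dominated_convergence[where w = "\<lambda>t. cmod (f (Complex t y))"])
    show "AE t in lborel. (\<lambda>N. indicator {- real N..real N} t *\<^sub>R f (Complex t y)) \<longlonglongrightarrow> f (Complex t y)"
    proof (intro AE_I2)
      fix t :: real
      obtain M :: nat where "\<bar>t\<bar> \<le> real M" using real_arch_simple by blast
      then have "eventually (\<lambda>N. indicator {- real N..real N} t *\<^sub>R f (Complex t y) = f (Complex t y)) sequentially"
        unfolding eventually_sequentially by (intro exI[of _ M]) (auto split: split_indicator)
      then show "(\<lambda>N. indicator {- real N..real N} t *\<^sub>R f (Complex t y)) \<longlonglongrightarrow> f (Complex t y)" by (rule tendsto_eventually)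
    qed
    show "AE t in lborel. norm (indicator {- real N..real N} t *\<^sub>R f (Complex t y)) \<le> cmod (f (Complex t y))" for N
      by (intro AE_I2) (auto split: split_indicator)
  qed (use intf fm in auto)
  then have "I \<longlonglongrightarrow> (LBINT t. f (Complex t y))" by (simp add: I_def[abs_def] set_lebesgue_integral_def)
  from LIMSEQ_unique[OF this lim1] show "(LBINT t. \<phi> (Complex t y) / (Complex t y - w) ^ Suc p) = ?res"
    by (simp add: f_def)
qed

subsection \<open>Vertical integration\<close>

text \<open>On the line of height \<open>y\<close> the conjugate of \<open>z - cnj w\<close> equals \<open>z - vert w y\<close>; the pole moves with the line.\<close>
definition vert :: "complex \<Rightarrow> real \<Rightarrow> complex" where "vert w y = w + 2 * \<i> * of_real y"

lemma vert_UHP: "w \<in> UHP \<Longrightarrow> y \<ge> 0 \<Longrightarrow> vert w y \<in> UHP"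
  by (simp add: vert_def UHP_iff)

text \<open>Repeated integration by parts along the vertical ray; the decay of the derivatives kills the boundary
  terms.\<close>
lemma vertical_integral:
  assumes h: "\<phi> holomorphic_on UHP"
    and C: "C \<ge> 0" "\<And>z. z \<in> UHP \<Longrightarrow> cmod (\<phi> z) \<le> C / Im z ^ j" and w: "w \<in> UHP"
  shows "m + 2 \<le> j + q \<Longrightarrow> m + 1 \<le> q \<Longrightarrow>
    set_integrable lborel {0<..} (\<lambda>y. of_real (y ^ m) * (deriv ^^ q) \<phi> (vert w y)) \<and>
    (LINT y:{0<..}|lborel. of_real (y ^ m) * (deriv ^^ q) \<phi> (vert w y)) = fact m * (\<i> / 2) ^ Suc m * (deriv ^^ (q - Suc m)) \<phi> w"
proof -
  let ?D = "\<lambda>b y. 1 / ((y - 0)\<^sup>2 + b\<^sup>2)"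
  let ?C = "\<lambda>m q. \<lambda>y. of_real (y ^ m) * (deriv ^^ q) \<phi> (vert w y)"
  let ?B = "\<lambda>q y. (deriv ^^ q) \<phi> (vert w y)"
  let ?A = "\<lambda>m q y. of_real (y ^ m) * (deriv ^^ q) \<phi> (vert w y)"
  define b where "b = Im w"
  have b: "b > 0" using w by (simp add: b_def UHP_iff)
  have hq: "(deriv ^^ q) \<phi> holomorphic_on UHP" for q
    using holomorphic_higher_deriv[OF h open_UHP] .
  have hd: "((\<lambda>y. (deriv ^^ q) \<phi> (vert w y)) has_vector_derivative 2 * \<i> * (deriv ^^ Suc q) \<phi> (vert w y)) (at y)" if "y > 0" for y q
  proof -
    have "((deriv ^^ q) \<phi> has_field_derivative (deriv ^^ Suc q) \<phi> (vert w y)) (at (vert w y))"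
      using holomorphic_derivI[OF hq open_UHP vert_UHP[OF w, of y]] that by simp
    moreover have "(vert w has_vector_derivative 2 * \<i>) (at y)"
      unfolding vert_def[abs_def] by (auto intro!: derivative_eq_intros simp: has_vector_derivative_def scaleR_conv_of_real fun_eq_iff)
    ultimately show ?thesis
      using field_vector_diff_chain_at[of "vert w" "2 * \<i>" y "(deriv ^^ q) \<phi>"] by (simp add: o_def)
  qed
  have contq: "isCont (\<lambda>y. (deriv ^^ q) \<phi> (vert w y)) y" if "y > 0" for y q
    using hd[OF that] has_vector_derivative_continuous by blast
  have cont0: "((\<lambda>y. (deriv ^^ q) \<phi> (vert w y)) \<longlongrightarrow> (deriv ^^ q) \<phi> w) (at_right 0)" for q
  proof -
    have "isCont ((deriv ^^ q) \<phi>) w"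
      using hq open_UHP w holomorphic_on_imp_continuous_on continuous_on_interior interior_open by metis
    moreover have "(vert w \<longlongrightarrow> vert w 0) (at_right 0)" unfolding vert_def by (intro tendsto_intros)
    ultimately show ?thesis using isCont_tendsto_compose[of w "(deriv ^^ q) \<phi>" "vert w"] by (simp add: vert_def)
  qed
  have int: "set_integrable lborel {0<..} (?C m q)" if mq: "m + 2 \<le> j + q" for m q
  proof -
    obtain C' where C': "C' \<ge> 0" "\<And>z. z \<in> UHP \<Longrightarrow> cmod ((deriv ^^ q) \<phi> z) \<le> C' / Im z ^ (j + q)"
      using derivative_decay[OF h C, of q] by blast
    define e where "e = j + q - (m + 2)"
    have je: "j + q = m + (2 + e)" using mq by (simp add: e_def)
    have cancel: "Y ^ m * (C' / Y ^ (m + (2 + e))) = C' / (Y\<^sup>2 * Y ^ e)" if "Y > 0" for Y :: real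
      using that by (simp add: power_add power2_eq_square)
    show ?thesis unfolding set_integrable_def
    proof (rule Bochner_Integration.integrable_bound[OF integrable_mult_right[OF integrable_inverse_square[OF b, of 0], of "C' / b ^ e"]])
      have "continuous_on {0<..} (?C m q)"
        using contq by (intro continuous_intros continuous_at_imp_continuous_on) auto
      then have "(\<lambda>y. indicator {0<..} y *\<^sub>R (?A m q y)) \<in> borel_measurable borel"
        by (rule borel_measurable_continuous_on_indicator[rotated]) simp
      then show "(\<lambda>y. indicator {0<..} y *\<^sub>R (?A m q y)) \<in> borel_measurable lborel"
        unfolding measurable_lborel2 .
      show "AE y in lborel. norm (indicator {0<..} y *\<^sub>R (?A m q y)) \<le> norm (C' / b ^ e * (?D b y))"
      proof (intro AE_I2)
        fix y :: real
        show "norm (indicator {0<..} y *\<^sub>R (?A m q y)) \<le> norm (C' / b ^ e * (?D b y))"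
        proof (cases "y > 0")
          case True
          let ?Y = "b + 2 * y"
          have im: "Im (vert w y) = ?Y" by (simp add: vert_def b_def)
          have Y: "?Y > 0" "?Y \<ge> b" "?Y \<ge> y" using True b by auto
          have "cmod (?B q y) \<le> C' / ?Y ^ (j + q)"
            using C'(2)[OF vert_UHP[OF w], of y] True unfolding im by simp
          then have "y ^ m * cmod (?B q y) \<le> ?Y ^ m * (C' / ?Y ^ (j + q))"
            using True Y by (intro mult_mono power_mono) auto
          also have "\<dots> = C' / (?Y\<^sup>2 * ?Y ^ e)" unfolding je by (rule cancel[OF Y(1)])
          also have "\<dots> \<le> C' / ((y\<^sup>2 + b\<^sup>2) * b ^ e)"
          proof (rule divide_left_mono)
            have "y\<^sup>2 + b\<^sup>2 \<le> ?Y\<^sup>2" using True b by (simp add: power2_eq_square algebra_simps)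
            then show "(y\<^sup>2 + b\<^sup>2) * b ^ e \<le> ?Y\<^sup>2 * ?Y ^ e" using Y b by (intro mult_mono power_mono) auto
            show "0 < ?Y\<^sup>2 * ?Y ^ e * ((y\<^sup>2 + b\<^sup>2) * b ^ e)" using Y b by (intro mult_pos_pos add_nonneg_pos) auto
          qed (rule C')
          also have "\<dots> = C' / b ^ e * (?D b y)" by (simp add: mult.commute)
          also have "\<dots> \<le> norm (C' / b ^ e * (?D b y))"
            unfolding real_norm_def by (rule abs_ge_self)
          finally have le: "y ^ m * cmod (?B q y) \<le> norm (C' / b ^ e * (?D b y))" .
          have "norm (indicator {0<..} y *\<^sub>R (?A m q y)) = y ^ m * cmod (?B q y)"
            using True by (simp add: norm_mult norm_power)
          then show ?thesis using le by (rule ord_eq_le_trans)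
        qed simp
      qed
    qed
  qed
  have lim: "((?C m q) \<longlongrightarrow> 0) at_top" if mq: "m + 1 \<le> j + q" for m q
  proof -
    obtain C' where C': "C' \<ge> 0" "\<And>z. z \<in> UHP \<Longrightarrow> cmod ((deriv ^^ q) \<phi> z) \<le> C' / Im z ^ (j + q)"
      using derivative_decay[OF h C, of q] by blast
    define e where "e = j + q - (m + 1)"
    have je: "j + q = m + Suc e" using mq by (simp add: e_def)
    have cancel: "Y ^ m * (C' / Y ^ (m + Suc e)) = C' / (Y * Y ^ e)" if "Y > 0" for Y :: real
      using that by (simp add: power_add)
    have l: "((\<lambda>y::real. C' / b ^ e * (1 / y)) \<longlongrightarrow> 0) at_top"
      by (intro tendsto_mult_right_zero tendsto_divide_0[OF tendsto_const] filterlim_at_top_imp_at_infinity filterlim_ident)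
    show ?thesis
    proof (rule Lim_null_comparison[OF _ l])
      show "\<forall>\<^sub>F y in at_top. norm (?A m q y) \<le> C' / b ^ e * (1 / y)"
        using eventually_gt_at_top[of 0]
      proof eventually_elim
        case (elim y)
        let ?Y = "b + 2 * y"
        have im: "Im (vert w y) = ?Y" by (simp add: vert_def b_def)
        have Y: "?Y > 0" "?Y \<ge> b" "?Y \<ge> y" using elim b by auto
        have "cmod (?B q y) \<le> C' / ?Y ^ (j + q)"
          using C'(2)[OF vert_UHP[OF w], of y] elim unfolding im by simp
        then have "y ^ m * cmod (?B q y) \<le> ?Y ^ m * (C' / ?Y ^ (j + q))"
          using elim Y by (intro mult_mono power_mono) auto
        also have "\<dots> = C' / (?Y * ?Y ^ e)" unfolding je by (rule cancel[OF Y(1)])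
        also have "\<dots> \<le> C' / (y * b ^ e)"
        proof (rule divide_left_mono)
          show "y * b ^ e \<le> ?Y * ?Y ^ e" using Y b elim by (intro mult_mono power_mono) auto
          show "0 < ?Y * ?Y ^ e * (y * b ^ e)" using Y b elim by (intro mult_pos_pos) auto
        qed (rule C')
        also have "\<dots> = C' / b ^ e * (1 / y)" by (simp add: mult.commute)
        finally show ?case using elim by (simp add: norm_mult norm_power)
      qed
    qed
  qed
  show "m + 2 \<le> j + q \<Longrightarrow> m + 1 \<le> q \<Longrightarrow> ?thesis"
  proof (induction m arbitrary: q)
    case 0
    obtain r where r: "q = Suc r" using 0 by (cases q) auto
    have "(LINT y:{0<..}|lborel. 2 * \<i> * (deriv ^^ Suc r) \<phi> (vert w y)) = 0 - (deriv ^^ r) \<phi> w"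
    proof (rule FTC_half_line[where F = "\<lambda>y. (deriv ^^ r) \<phi> (vert w y)"])
      show "set_integrable lborel {0<..} (\<lambda>y. 2 * \<i> * (deriv ^^ Suc r) \<phi> (vert w y))"
        using int[of 0 "Suc r"] 0 r by (intro set_integrable_mult_right) (simp del: funpow.simps)
      show "((\<lambda>y. (deriv ^^ r) \<phi> (vert w y)) \<longlongrightarrow> 0) at_top" using lim[of 0 r] 0 r by simp
      show "isCont (\<lambda>y. 2 * \<i> * (deriv ^^ Suc r) \<phi> (vert w y)) y" if "y > 0" for y
        by (intro continuous_intros contq that)
    qed (use hd cont0 in auto)
    then have "2 * \<i> * (LINT y:{0<..}|lborel. (deriv ^^ Suc r) \<phi> (vert w y)) = - (deriv ^^ r) \<phi> w"
      by (simp only: set_integral_cmult) simp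
    then have "(LINT y:{0<..}|lborel. (deriv ^^ Suc r) \<phi> (vert w y)) = \<i> / 2 * (deriv ^^ r) \<phi> w"
      by (simp add: field_simps) (metis (no_types, lifting) i_squared mult.assoc mult.commute mult_minus1_right minus_minus mult_minus_left)
    then show ?case using int[of 0 q] 0 r by simp
  next
    case (Suc m)
    obtain r where r: "q = Suc r" using Suc.prems by (cases q) auto
    let ?g = "\<lambda>m q y. of_real (y ^ m) * (deriv ^^ q) \<phi> (vert w y)"
    have IH: "(LINT y:{0<..}|lborel. ?g m r y) = fact m * (\<i> / 2) ^ Suc m * (deriv ^^ (r - Suc m)) \<phi> w"
      using Suc.IH[of r] Suc.prems r by auto
    have i1: "set_integrable lborel {0<..} (?g m r)" and i2: "set_integrable lborel {0<..} (?g (Suc m) q)"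
      using int[of m r] int[of "Suc m" q] Suc.prems r by auto
    have "(LINT y:{0<..}|lborel. of_nat (Suc m) * ?g m r y + 2 * \<i> * ?g (Suc m) q y) = 0 - 0"
    proof (rule FTC_half_line[where F = "?g (Suc m) r"])
      fix y :: real assume y: "y > 0"
      have 1: "((\<lambda>x. complex_of_real (x ^ Suc m)) has_vector_derivative of_real (of_nat (Suc m) * y ^ m)) (at y)"
        using DERIV_pow[of "Suc m" y] by (intro has_vector_derivative_of_real) (simp add: has_real_derivative_iff_has_vector_derivative)
      show "(?g (Suc m) r has_vector_derivative of_nat (Suc m) * ?g m r y + 2 * \<i> * ?g (Suc m) q y) (at y)"
        using has_vector_derivative_mult[OF 1 hd[OF y, of r]] unfolding r by (simp add: algebra_simps del: funpow.simps)
      show "isCont (\<lambda>y. of_nat (Suc m) * ?g m r y + 2 * \<i> * ?g (Suc m) q y) y"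
        by (intro continuous_intros contq y)
    next
      show "set_integrable lborel {0<..} (\<lambda>y. of_nat (Suc m) * ?g m r y + 2 * \<i> * ?g (Suc m) q y)"
        by (intro set_integral_add set_integrable_mult_right i1 i2)
      have "((\<lambda>y. complex_of_real (y ^ Suc m)) \<longlongrightarrow> of_real (0 ^ Suc m)) (at_right 0)" by (intro tendsto_intros)
      from tendsto_mult[OF this cont0[of r]] show "(?g (Suc m) r \<longlongrightarrow> 0) (at_right 0)" by simp
      show "(?g (Suc m) r \<longlongrightarrow> 0) at_top" using lim[of "Suc m" r] Suc.prems r by simp
    qed
    moreover have "(LINT y:{0<..}|lborel. of_nat (Suc m) * ?g m r y + 2 * \<i> * ?g (Suc m) q y)
       = of_nat (Suc m) * (LINT y:{0<..}|lborel. ?g m r y) + 2 * \<i> * (LINT y:{0<..}|lborel. ?g (Suc m) q y)"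
      using set_integral_add(2)[OF set_integrable_mult_right[OF i1, of "of_nat (Suc m)"] set_integrable_mult_right[OF i2, of "2 * \<i>"]]
      by (simp only: set_integral_cmult)
    ultimately have "2 * \<i> * (LINT y:{0<..}|lborel. ?g (Suc m) q y) = - (of_nat (Suc m) * (fact m * (\<i> / 2) ^ Suc m * (deriv ^^ (r - Suc m)) \<phi> w))"
      unfolding IH by (simp add: add_eq_0_iff)
    then have "\<i> / 2 * (- (2 * \<i> * (LINT y:{0<..}|lborel. ?g (Suc m) q y))) = \<i> / 2 * (of_nat (Suc m) * (fact m * (\<i> / 2) ^ Suc m * (deriv ^^ (r - Suc m)) \<phi> w))"
      by simp
    then have "(LINT y:{0<..}|lborel. ?g (Suc m) q y) = fact (Suc m) * (\<i> / 2) ^ Suc (Suc m) * (deriv ^^ (q - Suc (Suc m))) \<phi> w"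
      unfolding r by (simp add: mult_ac)
    then show ?case using i2 by blast
  qed
qed

subsection \<open>The orthogonal complement is trivial\<close>

lemma pint_square_zero:
  assumes "pint (p * p) = 0" shows "p = 0"
proof (rule ccontr)
  assume "p \<noteq> 0"
  have i: "integrable lborel (\<lambda>s. indicator {0<..} s * (poly (p * p) s * exp (- s)))"
    using integrable_poly_exp[of "p * p"] by (simp add: set_integrable_def)
  have "(LBINT s. indicator {0<..} s * (poly (p * p) s * exp (- s))) = 0"
    using assms by (simp add: pint_def set_lebesgue_integral_def)
  then have "AE s in lborel. indicator {0<..} s * (poly (p * p) s * exp (- s)) = 0"
    by (subst (asm) integral_nonneg_eq_0_iff_AE[OF i]) (auto split: split_indicator)
  moreover have "AE s in lborel. s \<notin> {s. poly p s = 0}"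
    using poly_roots_finite[OF \<open>p \<noteq> 0\<close>] by (intro AE_not_in) (auto intro: finite_imp_null_set_lborel)
  ultimately have "AE s in lborel. s \<notin> {0<..<1::real}"
    by eventually_elim (auto split: split_indicator_asm)
  then have "emeasure lborel {0<..<1::real} = 0"
    by (subst (asm) AE_iff_measurable[of "{0<..<1::real}"]) auto
  then show False by simp
qed

text \<open>The matrix of the \<open>(i + k)!\<close> is the Gram matrix of the monomials for the weight \<open>exp (- s)\<close>.\<close>
lemma factorial_hankel_real:
  fixes a :: "nat \<Rightarrow> real"
  assumes "\<And>k. k < n \<Longrightarrow> (\<Sum>i<n. fact (i + k) * a i) = 0" and "i < n"
  shows "a i = 0"
proof -
  define P where "P = (\<Sum>i<n. monom (a i) i)"
  have pm: "pint (monom b k) = b * fact k" for b k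
    unfolding pint_def poly_monom using integral_monom_exp[of k] by (simp add: mult.assoc)
  have ps: "pint (\<Sum>i\<in>A. f i) = (\<Sum>i\<in>A. pint (f i))" if "finite A" for A :: "nat set" and f
    using that by induction (auto simp: pint_add, simp add: pint_def)
  have "P * P = (\<Sum>k<n. \<Sum>i<n. monom (a k * a i) (i + k))"
    unfolding P_def sum_product by (simp add: mult_monom add.commute)
  then have "pint (P * P) = (\<Sum>k<n. a k * (\<Sum>i<n. fact (i + k) * a i))"
    by (simp add: ps pm sum_distrib_left mult_ac)
  also have "\<dots> = 0" using assms(1) by simp
  finally have "P = 0" by (rule pint_square_zero)
  moreover have "coeff P i = (\<Sum>k<n. if k = i then a k else 0)"
    unfolding P_def by (simp add: coeff_sum)
  ultimately show ?thesis using assms(2) by simp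
qed

lemma factorial_hankel:
  fixes a :: "nat \<Rightarrow> complex"
  assumes h: "\<And>k. k < n \<Longrightarrow> (\<Sum>i<n. fact (i + k) * a i) = 0" and "i < n"
  shows "a i = 0"
proof -
  have f: "(fact m :: complex) = of_real (fact m)" for m by simp
  have "(\<Sum>i<n. fact (i + k) * Re (a i)) = 0" "(\<Sum>i<n. fact (i + k) * Im (a i)) = 0" if "k < n" for k
    using arg_cong[OF h[OF that], of Re] arg_cong[OF h[OF that], of Im] unfolding f
    by (simp_all add: Re_sum Im_sum del: of_real_fact)
  from factorial_hankel_real[OF this(1) assms(2)] factorial_hankel_real[OF this(2) assms(2)]
  show ?thesis by (simp add: complex_eq_iff)
qed

text \<open>A function with vanishing derivative of some order is a polynomial, and decay at great height leaves
  only the zero polynomial.\<close>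
lemma vanishing_from_derivative:
  assumes h: "\<phi> holomorphic_on UHP" and C: "C \<ge> 0" "\<And>z. z \<in> UHP \<Longrightarrow> cmod (\<phi> z) \<le> C / Im z ^ Suc j"
  shows "(\<And>z. z \<in> UHP \<Longrightarrow> (deriv ^^ q) \<phi> z = 0) \<Longrightarrow> z \<in> UHP \<Longrightarrow> \<phi> z = 0"
proof (induction q arbitrary: z)
  case (Suc q)
  have hq: "(deriv ^^ q) \<phi> holomorphic_on UHP"
    using holomorphic_higher_deriv[OF h open_UHP] .
  have "\<exists>c. \<forall>z\<in>UHP. (deriv ^^ q) \<phi> z = c"
  proof (rule has_field_derivative_zero_constant[OF convex_UHP])
    fix z assume z: "z \<in> UHP"
    show "((deriv ^^ q) \<phi> has_field_derivative 0) (at z within UHP)"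
      using holomorphic_derivI[OF hq open_UHP z] Suc.prems(1)[OF z] by (simp add: has_field_derivative_at_within)
  qed
  then obtain c where c: "\<And>z. z \<in> UHP \<Longrightarrow> (deriv ^^ q) \<phi> z = c" by blast
  obtain C' where C': "C' \<ge> 0" "\<And>z. z \<in> UHP \<Longrightarrow> cmod ((deriv ^^ q) \<phi> z) \<le> C' / Im z ^ (Suc j + q)"
    using derivative_decay[OF h C, of q] by blast
  have "cmod c \<le> C' / real (Suc n)" for n
  proof -
    have z: "Complex 0 (real (Suc n)) \<in> UHP" by (simp add: UHP_iff)
    have "cmod c \<le> C' / real (Suc n) ^ (Suc j + q)" using C'(2)[OF z] c[OF z] by simp
    also have "\<dots> \<le> C' / real (Suc n) ^ 1"
      by (intro divide_left_mono power_increasing C') auto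
    finally show ?thesis by simp
  qed
  moreover have "(\<lambda>n. C' / real (Suc n)) \<longlonglongrightarrow> 0" by (rule LIMSEQ_Suc[OF lim_const_over_n])
  ultimately have "cmod c \<le> 0" by (intro LIMSEQ_le_const) auto
  then have "c = 0" by simp
  then show ?case using Suc.IH[of z] c Suc.prems(2) by simp
qed simp

text \<open>By the three-term recurrence, multiplication by \<open>s\<close> raises the index of a Laguerre polynomial by at
  most one, so all monomials of degree below \<open>n\<close> are reached.\<close>
lemma orthogonal_all_profiles:
  assumes orth: "\<And>j g. j < n \<Longrightarrow> cinner f (Vop (lagp j) g) = 0"
  shows "k < n \<Longrightarrow> cinner f (Vop (monom 1 k) g) = 0"
proof -
  have lag: "cinner f (Vop (lag j) g) = 0" if "j < n" for j g
  proof -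
    have "lag j = smult ((-1) ^ j) (lagp j)" by (simp add: lagp_def flip: power_mult_distrib)
    then show ?thesis using orth[OF that] by (simp add: Vop_poly_smult cinner_scale_right)
  qed
  have "j + k < n \<Longrightarrow> cinner f (Vop (monom 1 k * lag j) g) = 0" for j k g
  proof (induction k arbitrary: j)
    case 0
    then show ?case using lag by simp
  next
    case (Suc k)
    have rec: "monom 1 (Suc k) * lag j = smult (2 * real j + 1) (monom 1 k * lag j)
       + (smult (- real (Suc j)) (monom 1 k * lag (Suc j)) + smult (- real j) (monom 1 k * lag (j - 1)))"
    proof -
      have "[:0,1:] * lag j = smult (2 * real j + 1) (lag j) + (smult (- real (Suc j)) (lag (Suc j)) + smult (- real j) (lag (j - 1)))"
        unfolding poly_eq_poly_eq_iff[symmetric] using lag_three_term[of j] by (auto simp: fun_eq_iff algebra_simps)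
      then have "monom 1 k * ([:0,1:] * lag j) = monom 1 k * (smult (2 * real j + 1) (lag j) + (smult (- real (Suc j)) (lag (Suc j)) + smult (- real j) (lag (j - 1))))"
        by (rule arg_cong)
      moreover have "monom 1 (Suc k) = monom (1::real) k * [:0,1:]" by (simp add: monom_Suc)
      ultimately show ?thesis by (simp only: mult.assoc distrib_left mult_smult_right)
    qed
    show ?case unfolding rec Vop_poly_add Vop_poly_smult cinner_add_right cinner_scale_right
      using Suc.IH[of j] Suc.IH[of "Suc j"] Suc.IH[of "j - 1"] Suc.prems by simp
  qed
  from this[of 0 k] show "k < n \<Longrightarrow> cinner f (Vop (monom 1 k) g) = 0" by (simp add: lag_0)
qed

text \<open>The Fourier profile of a multiple of \<open>y\<^sup>k / (z - cnj w)\<^sup>n\<^sup>+\<^sup>k\<^sup>+\<^sup>1\<close>. The exponent is such that the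
  order of the derivatives produced by the residues stays nonnegative after \<open>i + k + 1\<close> integrations.\<close>
definition test_profile :: "nat \<Rightarrow> nat \<Rightarrow> complex \<Rightarrow> real \<Rightarrow> complex" where
  "test_profile n k w x = (if x > 0 then of_real (x ^ n / (sqrt (2 * x) * 2 ^ k)) * exp (- (\<i> * cnj w * of_real x)) else 0)"

lemma test_profile_square:
  assumes n: "n \<ge> 1" and w: "w \<in> UHP" shows "square_integrable (test_profile n k w)"
proof -
  let ?A = "\<lambda>m x. indicator {0<..} x *\<^sub>R (complex_of_real (x ^ (2 * m + 1)) * exp (- (of_real (2 * Im w) * of_real x)))"
  have [measurable]: "test_profile n k w \<in> borel_measurable borel" unfolding test_profile_def[abs_def] by measurable
  obtain m where m: "n = Suc m" using n by (cases n) auto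
  have b: "Re (of_real (2 * Im w)) > 0" using w by (simp add: UHP_iff)
  have e: "(cmod (test_profile n k w x))\<^sup>2 = indicator {0<..} x * (1 / (2 * 4 ^ k) * (x ^ (2 * m + 1) * exp (- (2 * Im w * x))))" for x
  proof (cases "x > 0")
    case True
    have "(cmod (test_profile n k w x))\<^sup>2 = (x ^ n)\<^sup>2 / ((sqrt (2 * x))\<^sup>2 * (2 ^ k)\<^sup>2) * (exp (- (Im w * x)))\<^sup>2"
      using True by (simp add: test_profile_def norm_mult norm_divide norm_power power_mult_distrib power_divide)
    also have "\<dots> = (x ^ n)\<^sup>2 / (2 * x * 4 ^ k) * exp (- (2 * Im w * x))"
      using True by (simp add: power2_eq_square flip: exp_add power_mult_distrib)
    also have "(x ^ n)\<^sup>2 = x ^ (2 * m + 1) * x" 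
    proof -
      have "(x ^ n)\<^sup>2 = x ^ (2 * n)" by (simp add: power_mult[symmetric] mult.commute)
      also have "2 * n = Suc (2 * m + 1)" by (simp add: m)
      finally show ?thesis by (simp only: power_Suc2)
    qed
    finally show ?thesis using True by (simp add: field_simps)
  qed (simp add: test_profile_def)
  have "integrable lborel (\<lambda>x. cmod (?A m x))"
    using gamma_integral_scaled(1)[OF b, of "2 * m + 1"] by (intro integrable_norm) (simp add: set_integrable_def)
  then have "integrable lborel (\<lambda>x. 1 / (2 * 4 ^ k) * cmod (?A m x))"
    by (rule integrable_mult_right)
  moreover have "1 / (2 * 4 ^ k) * cmod (?A m x) = (cmod (test_profile n k w x))\<^sup>2" for x
    unfolding e by (auto simp: norm_mult norm_power split: split_indicator)
  ultimately show ?thesis by (simp add: square_integrable_def)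
qed

lemma Vfun_test_profile:
  assumes n: "n \<ge> 1" and w: "w \<in> UHP" and z: "z \<in> UHP"
  shows "Vfun (monom 1 k) (test_profile n k w) z
     = of_real (fact (n + k) / sqrt (2 * pi)) * of_real (Im z) ^ k / (- (\<i> * (z - cnj w))) ^ Suc (n + k)"
proof -
  define c where "c = - (\<i> * (z - cnj w))"
  have c: "Re c > 0" using w z by (simp add: c_def UHP_iff)
  have "laplace k (test_profile n k w) z = (LBINT x. indicator {0<..} x *\<^sub>R (of_real (x ^ (n + k)) * exp (- (c * of_real x))))"
    unfolding laplace_def
  proof (rule Bochner_Integration.integral_cong[OF refl])
    fix x :: real
    show "of_real (indicator {0<..} x * (sqrt (2 * x) * (2 * x) ^ k)) * exp (\<i> * z * of_real x) * test_profile n k w x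
       = indicator {0<..} x *\<^sub>R (of_real (x ^ (n + k)) * exp (- (c * of_real x)))"
    proof (cases "x > 0")
      case True
      have "exp (- (c * of_real x)) = exp (\<i> * z * of_real x) * exp (- (\<i> * cnj w * of_real x))"
        unfolding c_def exp_add[symmetric] by (simp add: algebra_simps)
      moreover have "sqrt (2 * x) * (2 * x) ^ k * (x ^ n / (sqrt (2 * x) * 2 ^ k)) = x ^ (n + k)"
        using True by (simp add: power_mult_distrib power_add)
      then have "complex_of_real (sqrt (2 * x) * (2 * x) ^ k) * of_real (x ^ n / (sqrt (2 * x) * 2 ^ k)) = of_real (x ^ (n + k))"
        by (metis of_real_mult)
      ultimately show ?thesis using True by (simp add: test_profile_def del: of_real_mult of_real_power of_real_divide)
    qed simp
  qed
  also have "\<dots> = fact (n + k) / c ^ Suc (n + k)"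
    using gamma_integral_scaled(2)[OF c, of "n + k"] by (simp add: set_lebesgue_integral_def)
  finally have "Vfun (monom 1 k) (test_profile n k w) z = of_real (Im z) ^ k * (of_real (1 / sqrt (2 * pi)) * (fact (n + k) / c ^ Suc (n + k)))"
  proof -
    let ?l = "\<lambda>i. laplace i (test_profile n k w) z"
    assume l: "?l k = fact (n + k) / c ^ Suc (n + k)"
    have "Vfun (monom 1 k) (test_profile n k w) z
        = (\<Sum>i\<le>k. of_real (Im z) ^ i * (of_real (coeff (monom 1 k) i / sqrt (2 * pi)) * ?l i))"
      using Vfun_laplace[OF test_profile_square[OF n w] z, of "monom 1 k"] by (simp only: degree_monom_eq one_neq_zero not_False_eq_True)
    also have "\<dots> = (\<Sum>i\<le>k. if i = k then of_real (Im z) ^ k * (of_real (1 / sqrt (2 * pi)) * ?l k) else 0)"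
      by (intro sum.cong refl) auto
    also have "\<dots> = of_real (Im z) ^ k * (of_real (1 / sqrt (2 * pi)) * ?l k)" by simp
    finally show ?thesis unfolding l .
  qed
  then show ?thesis by (simp add: c_def field_simps)
qed

text \<open>Pairing with the test functions for a fixed \<open>w\<close> and all \<open>k < n\<close> gives, after residues on horizontal
  lines and integration over the height, a factorial Hankel system for the derivatives
  \<open>(deriv ^^ (n - Suc i)) (\<phi> i) w\<close>.\<close>
theorem orthogonal_complement_trivial:
  assumes f: "f \<in> poly_bergman n" and orth: "\<And>j g. j < n \<Longrightarrow> cinner f (Vop (lagp j) g) = 0"
  shows "f = 0"
proof (cases "n = 0")
  case True
  then show ?thesis using f poly_bergman_0 by auto
next
  case False
  then have n: "n \<ge> 1" by simp
  obtain F \<phi> where F: "f = abs_L2 F" "square_integrable F" "\<And>z. z \<notin> UHP \<Longrightarrow> F z = 0" "polyform n \<phi> F"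
    using f unfolding poly_bergman_iff by blast
  obtain C where C: "C \<ge> 0" "\<And>i z. i < n \<Longrightarrow> z \<in> UHP \<Longrightarrow> cmod (\<phi> i z) \<le> C / Im z ^ Suc i"
    using bergman_component_decay[OF F(4,2)] by blast
  have h: "\<phi> i holomorphic_on UHP" if "i < n" for i using F(4) that by (simp add: polyform_def)
  have moments: "(\<Sum>i<n. fact (i + k) * ((\<i> / 2) ^ i * (deriv ^^ (n - Suc i)) (\<phi> i) w)) = 0"
    if k: "k < n" and w: "w \<in> UHP" for k w
  proof -
    define p where "p = n + k"
    have p1: "p \<ge> 1" using n by (simp add: p_def)
    let ?T = "Vfun (monom 1 k) (test_profile n k w)"
    have sT: "square_integrable ?T" by (rule Vfun_square_integrable[OF test_profile_square[OF n w]])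
    have i: "integrable lborel (\<lambda>z. F z * cnj (?T z))" by (rule square_integrable_prod[OF F(2) sT])
    define c0 where "c0 = of_real (fact p / sqrt (2 * pi)) / \<i> ^ Suc p"
    have c0: "c0 \<noteq> 0" by (simp add: c0_def)
    have FT: "F (Complex t r) * cnj (?T (Complex t r)) = c0 * of_real (r ^ k) * (\<Sum>i<n. of_real (r ^ i) * (\<phi> i (Complex t r) / (Complex t r - vert w r) ^ Suc p))"
      if r: "r > 0" for t r
    proof -
      have zU: "Complex t r \<in> UHP" using r by (simp add: UHP_iff)
      have "cnj (- (\<i> * (Complex t r - cnj w))) = \<i> * (Complex t r - vert w r)"
        by (simp add: vert_def complex_eq_iff)
      then have "cnj (?T (Complex t r)) = of_real (fact p / sqrt (2 * pi)) * of_real (r ^ k) / (\<i> * (Complex t r - vert w r)) ^ Suc p"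
        unfolding Vfun_test_profile[OF n w zU] p_def[symmetric] complex_cnj_mult complex_cnj_divide complex_cnj_power
        by simp
      also have "\<dots> = c0 * of_real (r ^ k) * (1 / (Complex t r - vert w r) ^ Suc p)"
        by (simp add: c0_def power_mult_distrib)
      finally show ?thesis
        using F(4) zU by (simp add: polyform_def sum_distrib_left sum_distrib_right mult_ac divide_inverse)
    qed
    have slice: "(LBINT t. F (Complex t r) * cnj (?T (Complex t r)))
       = indicator {0<..} r *\<^sub>R (c0 * (2 * pi * \<i> / fact p) * (\<Sum>i<n. of_real (r ^ (i + k)) * (deriv ^^ p) (\<phi> i) (vert w r)))" for r
    proof (cases "r > 0")
      case True
      have res: "integrable lborel (\<lambda>t. \<phi> i (Complex t r) / (Complex t r - vert w r) ^ Suc p) \<and>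
        (LBINT t. \<phi> i (Complex t r) / (Complex t r - vert w r) ^ Suc p) = 2 * pi * \<i> * ((deriv ^^ p) (\<phi> i) (vert w r) / fact p)" if i: "i < n" for i
      proof -
        have B: "cmod (\<phi> i z) \<le> C / r ^ Suc i" if "Im z \<ge> r" for z
        proof -
          have "cmod (\<phi> i z) \<le> C / Im z ^ Suc i" using C(2)[OF i, of z] that True by (simp add: UHP_iff)
          also have "\<dots> \<le> C / r ^ Suc i" using that True C(1) by (intro divide_left_mono power_mono mult_pos_pos zero_less_power) auto
          finally show ?thesis .
        qed
        have "Im (vert w r) > r" using w True by (simp add: vert_def UHP_iff)
        from line_residue[OF h[OF i] True B this p1] show ?thesis by blast
      qed
      have "(LBINT t. F (Complex t r) * cnj (?T (Complex t r)))
         = (LBINT t. c0 * of_real (r ^ k) * (\<Sum>i<n. of_real (r ^ i) * (\<phi> i (Complex t r) / (Complex t r - vert w r) ^ Suc p)))"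
        by (simp only: FT[OF True])
      also have "\<dots> = c0 * of_real (r ^ k) * (LBINT t. (\<Sum>i<n. of_real (r ^ i) * (\<phi> i (Complex t r) / (Complex t r - vert w r) ^ Suc p)))"
        by (rule integral_mult_right_zero)
      also have "(LBINT t. (\<Sum>i<n. of_real (r ^ i) * (\<phi> i (Complex t r) / (Complex t r - vert w r) ^ Suc p)))
         = (\<Sum>i<n. LBINT t. of_real (r ^ i) * (\<phi> i (Complex t r) / (Complex t r - vert w r) ^ Suc p))"
        by (rule Bochner_Integration.integral_sum, rule integrable_mult_right) (use res in \<open>simp only: lessThan_iff\<close>)
      also have "\<dots> = (\<Sum>i<n. of_real (r ^ i) * (2 * pi * \<i> * ((deriv ^^ p) (\<phi> i) (vert w r) / fact p)))"
        by (rule sum.cong[OF refl]) (use res in \<open>simp only: integral_mult_right_zero lessThan_iff\<close>)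
      finally show ?thesis using True
        by (simp add: sum_distrib_left power_add mult_ac)
    qed (simp add: Vfun_def)
    have vi: "set_integrable lborel {0<..} (\<lambda>y. of_real (y ^ (i + k)) * (deriv ^^ p) (\<phi> i) (vert w y)) \<and>
        (LINT y:{0<..}|lborel. of_real (y ^ (i + k)) * (deriv ^^ p) (\<phi> i) (vert w y)) = fact (i + k) * (\<i> / 2) ^ Suc (i + k) * (deriv ^^ (p - Suc (i + k))) (\<phi> i) w"
      if "i < n" for i
      using n that C by (intro vertical_integral[OF h[OF that], where j = "Suc i" and C = C] w) (auto simp: p_def)
    have "0 = cinner f (Vop (monom 1 k) (abs_L2 (test_profile n k w)))"
      using orthogonal_all_profiles[OF orth k] by simp
    also have "\<dots> = (LBINT z. F z * cnj (?T z))"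
      unfolding F(1) Vop_abs[OF test_profile_square[OF n w]] by (rule cinner_abs[OF F(2) sT])
    also have "\<dots> = (LBINT r. indicator {0<..} r *\<^sub>R (c0 * (2 * pi * \<i> / fact p) * (\<Sum>i<n. of_real (r ^ (i + k)) * (deriv ^^ p) (\<phi> i) (vert w r))))"
      unfolding integral_complex(1)[OF i] slice ..
    also have "\<dots> = (LBINT r. c0 * (2 * pi * \<i> / fact p) * (\<Sum>i<n. indicator {0<..} r *\<^sub>R (of_real (r ^ (i + k)) * (deriv ^^ p) (\<phi> i) (vert w r))))"
    proof (rule Bochner_Integration.integral_cong[OF refl])
      fix r :: real
      show "indicator {0<..} r *\<^sub>R (c0 * (2 * pi * \<i> / fact p) * (\<Sum>i<n. of_real (r ^ (i + k)) * (deriv ^^ p) (\<phi> i) (vert w r)))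
        = c0 * (2 * pi * \<i> / fact p) * (\<Sum>i<n. indicator {0<..} r *\<^sub>R (of_real (r ^ (i + k)) * (deriv ^^ p) (\<phi> i) (vert w r)))"
        by (cases "r > 0") simp_all
    qed
    also have "\<dots> = c0 * (2 * pi * \<i> / fact p) * (LBINT r. (\<Sum>i<n. indicator {0<..} r *\<^sub>R (of_real (r ^ (i + k)) * (deriv ^^ p) (\<phi> i) (vert w r))))"
      by (rule integral_mult_right_zero)
    also have "(LBINT r. (\<Sum>i<n. indicator {0<..} r *\<^sub>R (of_real (r ^ (i + k)) * (deriv ^^ p) (\<phi> i) (vert w r))))
       = (\<Sum>i<n. LINT y:{0<..}|lborel. of_real (y ^ (i + k)) * (deriv ^^ p) (\<phi> i) (vert w y))"
      unfolding set_lebesgue_integral_def by (rule Bochner_Integration.integral_sum) (use vi in \<open>auto simp: set_integrable_def\<close>)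
    also have "\<dots> = (\<Sum>i<n. (\<i> / 2) ^ Suc k * (fact (i + k) * ((\<i> / 2) ^ i * (deriv ^^ (n - Suc i)) (\<phi> i) w)))"
      using vi by (intro sum.cong refl) (auto simp: p_def power_add mult_ac)
    also have "\<dots> = (\<i> / 2) ^ Suc k * (\<Sum>i<n. fact (i + k) * ((\<i> / 2) ^ i * (deriv ^^ (n - Suc i)) (\<phi> i) w))"
      by (rule sum_distrib_left[symmetric])
    finally show ?thesis using c0 by simp
  qed
  have "\<phi> i z = 0" if i: "i < n" and z: "z \<in> UHP" for i z
  proof (rule vanishing_from_derivative[OF h[OF i] C(1) C(2)[OF i] _ z])
    fix w assume w: "w \<in> UHP"
    have "(\<i> / 2) ^ i * (deriv ^^ (n - Suc i)) (\<phi> i) w = 0"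
      by (rule factorial_hankel[OF moments[OF _ w] i])
    then show "(deriv ^^ (n - Suc i)) (\<phi> i) w = 0" by simp
  qed
  then have "F = (\<lambda>_. 0)" using F(3,4) by (auto simp: polyform_def fun_eq_iff)
  then show ?thesis using F(1) by (simp add: abs_zero)
qed

section \<open>Symbols on the Fourier side\<close>

text \<open>Multipliers matter on \<open>(0, \<infinity>)\<close> only; extending them by \<open>0\<close> makes products with \<open>restr\<close> trivial.\<close>
definition sym_ext :: "(real \<Rightarrow> complex) \<Rightarrow> real \<Rightarrow> complex" where
  "sym_ext m x = (if x > 0 then m x else 0)"

definition cont_sym :: "(real \<Rightarrow> complex) \<Rightarrow> complex \<Rightarrow> complex \<Rightarrow> bool" where
  "cont_sym m p q \<longleftrightarrow> continuous_on {0<..} m \<and> (m \<longlongrightarrow> p) (at_right 0) \<and> (m \<longlongrightarrow> q) at_top"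

lemma cont_sym_const: "cont_sym (\<lambda>_. c) c c"
  by (simp add: cont_sym_def)

lemma cont_sym_add: "cont_sym m p q \<Longrightarrow> cont_sym k p' q' \<Longrightarrow> cont_sym (\<lambda>x. m x + k x) (p + p') (q + q')"
  by (auto simp: cont_sym_def intro!: continuous_intros tendsto_intros)

lemma cont_sym_mult: "cont_sym m p q \<Longrightarrow> cont_sym k p' q' \<Longrightarrow> cont_sym (\<lambda>x. m x * k x) (p * p') (q * q')"
  by (auto simp: cont_sym_def intro!: continuous_intros tendsto_intros)

lemma cont_sym_cnj: "cont_sym m p q \<Longrightarrow> cont_sym (\<lambda>x. cnj (m x)) (cnj p) (cnj q)"
  by (auto simp: cont_sym_def intro!: continuous_intros tendsto_intros)

lemma cont_sym_bounded:
  assumes "cont_sym m p q" shows "\<exists>C. \<forall>x>0. cmod (m x) \<le> C"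
proof -
  have c: "continuous_on {0<..} m" and 0: "(m \<longlongrightarrow> p) (at_right 0)" and i: "(m \<longlongrightarrow> q) at_top"
    using assms by (auto simp: cont_sym_def)
  have "eventually (\<lambda>x. dist (m x) p < 1) (at_right 0)" using tendstoD[OF 0, of 1] by simp
  then obtain a where a: "a > 0" "\<And>x. x > 0 \<Longrightarrow> x < a \<Longrightarrow> dist (m x) p < 1"
    unfolding eventually_at_right_field by auto
  have "eventually (\<lambda>x. dist (m x) q < 1) at_top" using tendstoD[OF i, of 1] by simp
  then obtain b where b: "\<And>x. x \<ge> b \<Longrightarrow> dist (m x) q < 1" unfolding eventually_at_top_linorder by auto
  have "compact (m ` {a..b})" using a by (intro compact_continuous_image continuous_on_subset[OF c]) auto
  then obtain B where B: "\<And>x. x \<in> {a..b} \<Longrightarrow> cmod (m x) \<le> B" using compact_imp_bounded bounded_iff by (metis imageI)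
  have tri: "cmod (m x) \<le> cmod c + 1" if "dist (m x) c < 1" for x c
    using that norm_triangle_ineq[of "m x - c" c] by (simp add: dist_norm)
  show ?thesis
  proof (intro exI[of _ "max B (max (cmod p + 1) (cmod q + 1))"] allI impI)
    fix x :: real assume x: "x > 0"
    consider "x < a" | "x \<in> {a..b}" | "x > b" by force
    then show "cmod (m x) \<le> max B (max (cmod p + 1) (cmod q + 1))"
    proof cases
      case 1 then show ?thesis using tri[OF a(2)[OF x]] by (simp add: le_max_iff_disj)
    next
      case 2 then show ?thesis using B by (simp add: le_max_iff_disj)
    next
      case 3 then show ?thesis using tri[OF b[of x]] by (simp add: le_max_iff_disj)
    qed
  qed
qed

lemma sym_ext_bdd:
  assumes "continuous_on {0<..} m" "\<And>x. x > 0 \<Longrightarrow> cmod (m x) \<le> C" shows "bdd_meas (sym_ext m)"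
proof -
  have "(\<lambda>x. indicator {0<..} x *\<^sub>R m x) \<in> borel_measurable borel"
    using assms(1) by (rule borel_measurable_continuous_on_indicator[rotated]) simp
  moreover have "(\<lambda>x. indicator {0<..} x *\<^sub>R m x) = sym_ext m" by (auto simp: sym_ext_def fun_eq_iff)
  moreover have "cmod (sym_ext m x) \<le> max 0 C" for x using assms(2)[of x] by (auto simp: sym_ext_def)
  ultimately show ?thesis unfolding bdd_meas_def by metis
qed

lemma cont_sym_bdd: "cont_sym m p q \<Longrightarrow> bdd_meas (sym_ext m)"
  using cont_sym_bounded sym_ext_bdd unfolding cont_sym_def by metis

lemma gam_scaled:
  assumes x: "x > 0"
  shows "gam a P x = (LBINT s. indicator {0<..} s * (a (s / (2 * x)) * of_real (poly P s * exp (- s))))"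
proof -
  let ?f = "\<lambda>s. indicator {0<..} s * (a (s / (2 * x)) * of_real (poly P s * exp (- s))) :: complex"
  have "(LBINT s. ?f s) = \<bar>2 * x\<bar> *\<^sub>R (LBINT r. ?f (0 + 2 * x * r))"
    using x by (intro lborel_integral_real_affine) simp
  also have "\<dots> = (LBINT r. \<bar>2 * x\<bar> *\<^sub>R ?f (0 + 2 * x * r))" by (rule integral_scaleR_right[symmetric])
  also have "\<dots> = gam a P x"
    unfolding gam_def if_P[OF x]
    using x by (intro Bochner_Integration.integral_cong) (auto simp: scaleR_conv_of_real indicator_def zero_less_mult_iff)
  finally show ?thesis by simp
qed

lemma gam_dominated:
  assumes a: "bdd_meas a" and lim: "\<And>s. s > 0 \<Longrightarrow> (\<lambda>i. a (s / (2 * X i))) \<longlonglongrightarrow> l" and X: "\<And>i. X i > 0"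
  shows "(\<lambda>i. gam a P (X i)) \<longlonglongrightarrow> l * of_real (pint P)"
proof -
  let ?B = "LBINT s. indicator {0<..} s * (l * of_real (poly P s * exp (- s)))"
  let ?A = "\<lambda>i s. a (s / (2 * X i)) * of_real (poly P s * exp (- s))"
  have [measurable]: "a \<in> borel_measurable borel" using a by (simp add: bdd_meas_def)
  obtain C where C: "\<And>x. cmod (a x) \<le> C" using a by (auto simp: bdd_meas_def)
  have i: "integrable lborel (\<lambda>s. C * \<bar>indicator {0<..} s * (poly P s * exp (- s))\<bar>)"
    using integrable_poly_exp[of P] by (intro integrable_mult_right integrable_abs) (simp add: set_integrable_def)
  have "(\<lambda>i. LBINT s. indicator {0<..} s * (?A i s))
      \<longlonglongrightarrow> ?B"
  proof (rule integral_dominated_convergence[OF _ _ i])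
    show "AE s in lborel. (\<lambda>i. indicator {0<..} s * (?A i s)) \<longlonglongrightarrow> indicator {0<..} s * (l * of_real (poly P s * exp (- s)))"
    proof (intro AE_I2)
      fix s :: real
      show "(\<lambda>i. indicator {0<..} s * (?A i s)) \<longlonglongrightarrow> indicator {0<..} s * (l * of_real (poly P s * exp (- s)))"
        by (cases "s > 0") (auto intro!: tendsto_mult tendsto_const lim)
    qed
    show "AE s in lborel. norm (indicator {0<..} s * (?A i s)) \<le> C * \<bar>indicator {0<..} s * (poly P s * exp (- s))\<bar>" for i
    proof (intro AE_I2)
      fix s :: real
      have "cmod (a (s / (2 * X i))) * \<bar>poly P s * exp (- s)\<bar> \<le> C * \<bar>poly P s * exp (- s)\<bar>"
        by (intro mult_right_mono C) simp
      then show "norm (indicator {0<..} s * (?A i s)) \<le> C * \<bar>indicator {0<..} s * (poly P s * exp (- s))\<bar>"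
        unfolding norm_mult norm_of_real by (cases "s > 0") auto
    qed
  qed measurable
  moreover have "?B = l * of_real (pint P)"
  proof -
    have "?B = (LBINT s. l * of_real (indicator {0<..} s * (poly P s * exp (- s))))"
      by (intro Bochner_Integration.integral_cong) (auto split: split_indicator)
    also have "\<dots> = l * of_real (LBINT s. indicator {0<..} s * (poly P s * exp (- s)))"
      unfolding integral_mult_right_zero integral_complex_of_real ..
    finally show ?thesis by (simp add: pint_def set_lebesgue_integral_def)
  qed
  ultimately show ?thesis using gam_scaled[OF X] by simp
qed

lemma gam_continuous:
  assumes a: "bdd_meas a" shows "continuous_on {0<..} (gam a P)"
proof (rule continuous_at_imp_continuous_on, rule ballI)
  fix x0 :: real assume "x0 \<in> {0<..}"
  then have x0: "x0 > 0" by simp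
  have [measurable]: "a \<in> borel_measurable borel" using a by (simp add: bdd_meas_def)
  obtain C where C: "\<And>x. cmod (a x) \<le> C" using a by (auto simp: bdd_meas_def)
  have C0: "C \<ge> 0" using C norm_ge_zero order_trans by blast
  obtain B where B: "B \<ge> 0" "\<And>s. s \<ge> 0 \<Longrightarrow> \<bar>poly P s\<bar> \<le> B * exp (1/2 * s)" using poly_exp_bound[of "1/2" P] by auto
  have "(gam a P \<longlongrightarrow> gam a P x0) (at x0)"
    unfolding tendsto_at_iff_sequentially
  proof (intro allI impI)
    fix X :: "nat \<Rightarrow> real" assume X: "\<forall>i. X i \<in> UNIV - {x0}" "X \<longlonglongrightarrow> x0"
    have "eventually (\<lambda>i. X i > x0 / 2 \<and> X i < 2 * x0) sequentially"
      using order_tendstoD(1)[OF X(2), of "x0 / 2"] order_tendstoD(2)[OF X(2), of "2 * x0"] x0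
      by (auto intro: eventually_conj)
    then obtain N where N: "\<And>i. i \<ge> N \<Longrightarrow> X i > x0 / 2 \<and> X i < 2 * x0" by (auto simp: eventually_sequentially)
    define Y where "Y = (\<lambda>i. X (i + N))"
    have Y: "Y i > x0 / 2" "Y i < 2 * x0" "Y i > 0" for i using N[of "i + N"] x0 by (auto simp: Y_def)
    have Yx: "Y \<longlonglongrightarrow> x0" unfolding Y_def by (rule LIMSEQ_ignore_initial_segment[OF X(2)])
    let ?f = "\<lambda>x r. indicator {0<..} r * (a r * of_real (2 * x * (poly P (2 * x * r) * exp (- (2 * x * r))))) :: complex"
    have "(\<lambda>i. LBINT r. ?f (Y i) r) \<longlonglongrightarrow> (LBINT r. ?f x0 r)"
    proof (rule integral_dominated_convergence)
      show "integrable lborel (\<lambda>r. 4 * x0 * C * B * exp (- (x0 / 2 * \<bar>r\<bar>)))"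
        using integrable_exp_abs[of "x0 / 2"] x0 by (intro integrable_mult_right) simp
      show "AE r in lborel. (\<lambda>i. ?f (Y i) r) \<longlonglongrightarrow> ?f x0 r"
        by (intro AE_I2 tendsto_intros Yx isCont_tendsto_compose[OF poly_isCont])
      show "AE r in lborel. norm (?f (Y i) r) \<le> 4 * x0 * C * B * exp (- (x0 / 2 * \<bar>r\<bar>))" for i
      proof (intro AE_I2)
        fix r :: real
        show "norm (?f (Y i) r) \<le> 4 * x0 * C * B * exp (- (x0 / 2 * \<bar>r\<bar>))"
        proof (cases "r > 0")
          case True
          have "\<bar>poly P (2 * Y i * r)\<bar> * exp (- (2 * Y i * r)) \<le> B * exp (1/2 * (2 * Y i * r)) * exp (- (2 * Y i * r))"
            using B(2)[of "2 * Y i * r"] True Y(3)[of i] by (intro mult_right_mono) auto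
          also have "\<dots> = B * exp (- (Y i * r))" by (simp add: mult.assoc flip: exp_add)
          also have "\<dots> \<le> B * exp (- (x0 / 2 * r))"
            using Y(1)[of i] True B(1) by (intro mult_left_mono) (auto intro!: mult_right_mono)
          finally have 1: "\<bar>poly P (2 * Y i * r)\<bar> * exp (- (2 * Y i * r)) \<le> B * exp (- (x0 / 2 * r))" .
          have 2: "2 * Y i * (\<bar>poly P (2 * Y i * r)\<bar> * exp (- (2 * Y i * r))) \<le> 4 * x0 * (B * exp (- (x0 / 2 * r)))"
            using Y(2,3)[of i] B(1) x0 by (intro mult_mono[OF _ 1]) auto
          have "cmod (a r) * (2 * Y i * (\<bar>poly P (2 * Y i * r)\<bar> * exp (- (2 * Y i * r)))) \<le> C * (4 * x0 * (B * exp (- (x0 / 2 * r))))"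
            using Y(3)[of i] C0 by (intro mult_mono[OF C 2]) auto
          then show ?thesis using True Y(3)[of i] by (simp add: norm_mult abs_mult mult_ac)
        qed (use x0 C0 B in simp)
      qed
    qed measurable
    then have "(\<lambda>i. gam a P (Y i)) \<longlonglongrightarrow> gam a P x0"
      unfolding gam_def using Y(3) x0 by simp
    then have "(\<lambda>i. (\<lambda>i. gam a P (X i)) (i + N)) \<longlonglongrightarrow> gam a P x0" by (simp add: Y_def)
    then show "(gam a P \<circ> X) \<longlonglongrightarrow> gam a P x0" unfolding o_def by (rule LIMSEQ_offset)
  qed
  then show "isCont (gam a P) x0" by (simp add: isCont_def)
qed

text \<open>Boundary values of the symbol appear, interchanged, as boundary values of the multiplier.\<close>
lemma gam_cont_sym:
  assumes a: "bdd_meas a" and p: "(a \<longlongrightarrow> p) (at_right 0)" and q: "(a \<longlongrightarrow> q) at_top"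
  shows "cont_sym (gam a P) (q * of_real (pint P)) (p * of_real (pint P))"
  unfolding cont_sym_def
proof (intro conjI gam_continuous a)
  show "(gam a P \<longlongrightarrow> q * of_real (pint P)) (at_right 0)"
    unfolding tendsto_at_iff_sequentially
  proof (intro allI impI)
    fix X :: "nat \<Rightarrow> real" assume X: "\<forall>i. X i \<in> {0<..} - {0}" "X \<longlonglongrightarrow> 0"
    have X0: "X i > 0" for i using X(1) by auto
    have "filterlim X (at_right 0) sequentially"
      using X X0 less_imp_neq[OF X0] by (auto simp: filterlim_at intro!: always_eventually)
    then have inv: "filterlim (\<lambda>i. inverse (X i)) at_top sequentially"
      by (rule filterlim_compose[OF filterlim_inverse_at_top_right])
    show "(gam a P \<circ> X) \<longlonglongrightarrow> q * of_real (pint P)"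
      unfolding o_def
    proof (rule gam_dominated[OF a _ X0])
      fix s :: real assume s: "s > 0"
      have "filterlim (\<lambda>i. s / 2 * inverse (X i)) at_top sequentially"
        by (rule filterlim_tendsto_pos_mult_at_top[OF tendsto_const _ inv]) (use s in simp)
      then have "(\<lambda>i. a (s / 2 * inverse (X i))) \<longlonglongrightarrow> q" by (rule filterlim_compose[OF q])
      then show "(\<lambda>i. a (s / (2 * X i))) \<longlonglongrightarrow> q" by (simp add: field_simps)
    qed
  qed
  show "(gam a P \<longlongrightarrow> p * of_real (pint P)) at_top"
  proof (rule tendsto_at_topI_sequentially)
    fix X :: "nat \<Rightarrow> real" assume X: "filterlim X at_top sequentially"
    define Y where "Y = (\<lambda>i. max 1 (X i))"
    have Y0: "Y i > 0" for i by (simp add: Y_def)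
    have ev: "eventually (\<lambda>i. X i = Y i) sequentially"
      using filterlim_at_top[THEN iffD1, OF X, rule_format, of 1] by eventually_elim (simp add: Y_def)
    have Y: "filterlim Y at_top sequentially"
      by (rule filterlim_at_top_mono[OF X]) (simp add: Y_def)
    have inv: "(\<lambda>i. inverse (Y i)) \<longlonglongrightarrow> 0"
      by (rule filterlim_compose[OF tendsto_inverse_0_at_top[OF filterlim_ident] Y])
    have "(\<lambda>i. gam a P (Y i)) \<longlonglongrightarrow> p * of_real (pint P)"
    proof (rule gam_dominated[OF a _ Y0])
      fix s :: real assume s: "s > 0"
      have "(\<lambda>i. s / 2 * inverse (Y i)) \<longlonglongrightarrow> 0" using tendsto_mult_right_zero[OF inv] .
      moreover have "s / 2 * inverse (Y i) > 0" for i using s Y0 by simp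
      ultimately have "filterlim (\<lambda>i. s / 2 * inverse (Y i)) (at_right 0) sequentially"
        using s less_imp_neq[OF Y0] by (auto simp: filterlim_at intro!: always_eventually)
      then have "(\<lambda>i. a (s / 2 * inverse (Y i))) \<longlonglongrightarrow> p" by (rule filterlim_compose[OF p])
      then show "(\<lambda>i. a (s / (2 * Y i))) \<longlonglongrightarrow> p" by (simp add: field_simps)
    qed
    then show "(\<lambda>i. gam a P (X i)) \<longlonglongrightarrow> p * of_real (pint P)"
      by (rule Lim_transform_eventually) (use ev in \<open>auto elim: eventually_mono\<close>)
  qed
qed

lemma gam_interval:
  assumes x: "x > 0" and cd: "0 \<le> c" "c \<le> d"
  shows "gam (indicator {c..d}) (tw Q) x = of_real (exp (- (2 * x * d)) * poly Q (2 * x * d) - exp (- (2 * x * c)) * poly Q (2 * x * c))"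
proof -
  let ?A = "\<lambda>r. poly (tw Q) (2 * x * r) * exp (- (2 * x * r))"
  have "(LBINT r. (2 * x * (?A r)) * indicator {c..d} r)
     = exp (- (2 * x * d)) * poly Q (2 * x * d) - exp (- (2 * x * c)) * poly Q (2 * x * c)"
  proof (rule integral_FTC_Icc_real[OF cd(2), where F = "\<lambda>r. exp (- (2 * x * r)) * poly Q (2 * x * r)"])
    fix r
    have "((\<lambda>r. 2 * x * r) has_real_derivative 2 * x) (at r)" by (auto intro!: derivative_eq_intros)
    from DERIV_chain2[OF deriv_exp_poly this, of Q]
    show "((\<lambda>r. exp (- (2 * x * r)) * poly Q (2 * x * r)) has_real_derivative 2 * x * (?A r)) (at r)"
      by (simp add: mult_ac)
    show "isCont (\<lambda>r. 2 * x * (?A r)) r" by (intro continuous_intros)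
  qed
  moreover have "gam (indicator {c..d}) (tw Q) x = of_real (LBINT r. (2 * x * (?A r)) * indicator {c..d} r)"
    unfolding gam_def if_P[OF x] integral_complex_of_real[symmetric]
  proof (rule integral_cong_AE)
    show "AE r in lborel. indicator {0<..} r * (indicator {c..d} r * of_real (2 * x * (?A r)))
       = complex_of_real ((2 * x * (?A r)) * indicator {c..d} r)"
      using AE_lborel_singleton[of "0::real"] by eventually_elim (use cd in \<open>auto simp: indicator_def\<close>)
  qed measurable
  ultimately show ?thesis by simp
qed

lemma gam_cong_AE:
  assumes "AE r in lborel. r > 0 \<longrightarrow> a r = b r" "a \<in> borel_measurable borel" "b \<in> borel_measurable borel"
  shows "gam a P x = gam b P x"
proof -
  let ?A = "\<lambda>r. 2 * x * (poly P (2 * x * r) * exp (- (2 * x * r)))"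
  have [measurable]: "a \<in> borel_measurable borel" "b \<in> borel_measurable borel" using assms by auto
  have "(LBINT r. indicator {0<..} r * (a r * of_real (?A r)))
    = (LBINT r. indicator {0<..} r * (b r * of_real (?A r)))"
  proof (rule integral_cong_AE)
    show "AE r in lborel. indicator {0<..} r * (a r * of_real (?A r)) = indicator {0<..} r * (b r * of_real (?A r))"
      using assms(1) by eventually_elim (auto split: split_indicator)
  qed measurable
  then show ?thesis by (simp add: gam_def)
qed

lemma tw_minus_one: "tw (- 1) = 1"
  by (simp add: tw_def pderiv_minus)

lemma gam_one_interval:
  "x > 0 \<Longrightarrow> 0 \<le> c \<Longrightarrow> c \<le> d \<Longrightarrow> gam (indicator {c..<d}) 1 x = of_real (exp (- (2 * x * c)) - exp (- (2 * x * d)))"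
proof -
  assume x: "x > 0" and cd: "0 \<le> c" "c \<le> d"
  have "gam (indicator {c..<d}) 1 x = gam (indicator {c..d}) 1 x"
  proof (rule gam_cong_AE)
    show "AE r in lborel. r > 0 \<longrightarrow> (indicator {c..<d} r :: complex) = indicator {c..d} r"
      using AE_lborel_singleton[of d] by eventually_elim (auto split: split_indicator)
  qed auto
  then show ?thesis using gam_interval[OF x cd, of "- 1"] by (simp add: tw_minus_one)
qed

lemma gam_one_ray:
  assumes x: "x > 0" and c: "0 \<le> c"
  shows "gam (indicator {c..}) 1 x = of_real (exp (- (2 * x * c)))"
proof -
  have [simp]: "bdd_meas (\<lambda>x. indicator A x :: complex)" if "A \<in> sets borel" for A :: "real set"
    using that unfolding bdd_meas_def by (auto intro!: exI[of _ 1] split: split_indicator)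
  let ?k = "\<lambda>r. of_real (2 * x * (poly 1 (2 * x * r) * exp (- (2 * x * r)))) :: complex"
  have i: "integrable lborel (\<lambda>r. indicator {0<..} r * (indicator A r * ?k r))" if [measurable]: "A \<in> sets borel" for A :: "real set"
    by (rule Bochner_Integration.integrable_bound[OF scaled_poly_exp(1)[OF x, of 1]]) (use x in \<open>auto simp: norm_mult split: split_indicator\<close>)
  have "gam (indicator {0..<c}) 1 x + gam (indicator {c..}) 1 x = gam (\<lambda>_. 1) 1 x"
    unfolding gam_def if_P[OF x]
  proof (subst Bochner_Integration.integral_add[symmetric, OF i i])
    show "(LBINT r. indicator {0<..} r * (indicator {0..<c} r * ?k r) + indicator {0<..} r * (indicator {c..} r * ?k r)) = (LBINT r. indicator {0<..} r * (1 * ?k r))"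
      using c by (intro Bochner_Integration.integral_cong) (auto split: split_indicator)
  qed auto
  moreover have "gam (\<lambda>_. 1) 1 x = 1"
    using gam_one[of 1 x] x integral_monom_exp[of 0] by (simp add: posfun_def pint_def)
  ultimately show ?thesis using gam_one_interval[OF x _ c] by (simp add: algebra_simps)
qed

text \<open>The multiplier is a boundary term of the Wronskian primitive.\<close>
lemma gam_neighbour_nonzero:
  assumes x: "x > 0" and d: "d > 0"
  shows "gam (indicator {0..d}) (lagp k * lagp (Suc k)) x \<noteq> 0"
proof -
  have "lagp k * lagp (Suc k) = tw (smult (- 1) ([:0,1:] * wronskian k (Suc k)))"
    unfolding tw_smult wronskian_tw by (simp add: lagp_def power_mult_distrib[symmetric])
  then have "gam (indicator {0..d}) (lagp k * lagp (Suc k)) x = of_real (- (exp (- (2 * x * d)) * (2 * x * d * poly (wronskian k (Suc k)) (2 * x * d))))"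
    using gam_interval[OF x order_refl less_imp_le[OF d], of "smult (- 1) ([:0,1:] * wronskian k (Suc k))"] by simp
  then show ?thesis using wronskian_pos[of k "2 * x * d"] x d by simp
qed

section \<open>The decomposition of the poly-Bergman space\<close>

definition syn :: "nat \<Rightarrow> real L2 \<Rightarrow> complex L2" where "syn j = Vop (lagp (j - 1))"
definition ana :: "nat \<Rightarrow> complex L2 \<Rightarrow> real L2" where "ana j = Wop (lagp (j - 1))"

lemma syn_add: "syn j (g + h) = syn j g + syn j h" by (simp add: syn_def Vop_add)
lemma syn_scaleC: "syn j (scaleC c g) = scaleC c (syn j g)" by (simp add: syn_def Vop_scaleC)
lemma ana_add: "ana j (g + h) = ana j g + ana j h" by (simp add: ana_def Wop_add)
lemma ana_scaleC: "ana j (scaleC c g) = scaleC c (ana j g)" by (simp add: ana_def Wop_scaleC)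
lemma syn_zero [simp]: "syn j 0 = 0" using syn_add[of j 0 0] by simp
lemma ana_zero [simp]: "ana j 0 = 0" using ana_add[of j 0 0] by simp
lemma syn_sum: "syn j (\<Sum>i\<in>A. f i) = (\<Sum>i\<in>A. syn j (f i))"
  by (induction A rule: infinite_finite_induct) (auto simp: syn_add)
lemma ana_sum: "ana j (\<Sum>i\<in>A. f i) = (\<Sum>i\<in>A. ana j (f i))"
  by (induction A rule: infinite_finite_induct) (auto simp: ana_add)
lemma ana_diff: "ana j (g - h) = ana j g - ana j h"
  using ana_add[of j "g - h" h] by simp
lemma syn_adj: "cinner (syn j u) f = cinner u (ana j f)" by (simp add: syn_def ana_def Wop_adj)
lemma ana_adj: "cinner (ana j f) u = cinner f (syn j u)" by (simp add: syn_def ana_def Wop_adj')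

lemma ana_syn: "j \<ge> 1 \<Longrightarrow> k \<ge> 1 \<Longrightarrow> ana k (syn j g) = (if j = k then restr g else 0)"
proof -
  assume "j \<ge> 1" "k \<ge> 1"
  then have "(j - 1 = k - 1) = (j = k)" by auto
  moreover have "scaleC 0 g = 0" for g :: "real L2"
    using scaleC_of_real[of 0 g] by simp
  ultimately show ?thesis by (simp add: syn_def ana_def Wop_Vop pint_lagp scaleC_one)
qed

lemma restr_ana [simp]: "restr (ana j f) = ana j f" by (simp add: ana_def restr_Wop)

lemma syn_in: "1 \<le> j \<Longrightarrow> j \<le> n \<Longrightarrow> syn j g \<in> poly_bergman n"
  unfolding syn_def using degree_lagp[of "j - 1"] by (intro Vop_poly_bergman) auto

lemma syn_norm: "norm (syn j g) \<le> norm g"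
  using Vop_norm[of "lagp (j - 1)" g] by (simp add: syn_def pint_lagp)

lemma ana_norm: "norm (ana j f) \<le> norm f"
  using Wop_norm[of "lagp (j - 1)" f] by (simp add: ana_def pint_lagp)

lemma sum_syn_in: "(\<Sum>j=1..n. syn j (g j)) \<in> poly_bergman n"
  by (intro csubspace_sum[OF poly_bergman_csubspace] syn_in) auto

lemma ana_sum_syn: "k \<in> {1..n} \<Longrightarrow> ana k (\<Sum>j=1..n. syn j (g j)) = restr (g k)"
  unfolding ana_sum by (simp add: ana_syn)

theorem poly_bergman_decomposition:
  assumes f: "f \<in> poly_bergman n" shows "f = (\<Sum>j=1..n. syn j (ana j f))"
proof -
  define d where "d = f - (\<Sum>j=1..n. syn j (ana j f))"
  have "d \<in> poly_bergman n" unfolding d_def by (intro csubspace_diff[OF poly_bergman_csubspace f] sum_syn_in)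
  moreover have "cinner d (Vop (lagp j) g) = 0" if "j < n" for j g
  proof -
    have "ana (Suc j) d = 0" unfolding d_def ana_diff using that by (subst ana_sum_syn) auto
    then show ?thesis using ana_adj[of "Suc j" d g] by (simp add: syn_def)
  qed
  ultimately have "d = 0" by (rule orthogonal_complement_trivial)
  then show ?thesis by (simp add: d_def)
qed

lemma ana_tendsto: "X \<longlonglongrightarrow> f \<Longrightarrow> (\<lambda>i. ana j (X i)) \<longlonglongrightarrow> ana j f"
  unfolding ana_def by (rule Wop_tendsto)

lemma syn_tendsto:
  assumes "X \<longlonglongrightarrow> f" shows "(\<lambda>i. syn j (X i)) \<longlonglongrightarrow> syn j f"
proof (rule LIM_zero_cancel, rule Lim_null_comparison)
  have "syn j u - syn j v = syn j (u - v)" for u v using syn_add[of j "u - v" v] by simp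
  then show "\<forall>\<^sub>F i in sequentially. norm (syn j (X i) - syn j f) \<le> norm (X i - f)"
    using syn_norm by simp
  show "(\<lambda>i. norm (X i - f)) \<longlonglongrightarrow> 0" by (intro tendsto_norm_zero LIM_zero assms)
qed

lemma poly_bergman_closed: "closed (poly_bergman n)"
  unfolding closed_sequential_limits
proof (intro allI impI, elim conjE)
  fix X f assume X: "\<forall>i. X i \<in> poly_bergman n" "X \<longlonglongrightarrow> f"
  have "X = (\<lambda>i. \<Sum>j=1..n. syn j (ana j (X i)))" using X(1) poly_bergman_decomposition by blast
  moreover have "(\<lambda>i. \<Sum>j=1..n. syn j (ana j (X i))) \<longlonglongrightarrow> (\<Sum>j=1..n. syn j (ana j f))"
    by (intro tendsto_sum syn_tendsto ana_tendsto X(2))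
  ultimately have "f = (\<Sum>j=1..n. syn j (ana j f))" using X(2) LIMSEQ_unique by metis
  then show "f \<in> poly_bergman n" using sum_syn_in[where n = n and g = "\<lambda>j. ana j f"] by simp
qed

lemma proj_onto_eqI:
  assumes "csubspace S" "g \<in> S" "\<And>h. h \<in> S \<Longrightarrow> cinner (f - g) h = 0"
  shows "proj_onto S f = g"
  unfolding proj_onto_def
proof (rule the_equality)
  fix g' assume g': "g' \<in> S \<and> (\<forall>h\<in>S. cinner (f - g') h = 0)"
  then have d: "g - g' \<in> S" using assms by (auto intro: csubspace_diff)
  have "cinner (g - g') (g - g') = cinner (f - g') (g - g') - cinner (f - g) (g - g')"
    by (simp flip: cinner_diff_left)
  also have "\<dots> = 0" using assms(3)[OF d] g' d by simp
  finally show "g' = g" by (simp add: cinner_self)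
qed (use assms in auto)

lemma poly_bergman_orthI:
  assumes "\<And>j. j \<in> {1..n} \<Longrightarrow> ana j d = 0" "h \<in> poly_bergman n"
  shows "cinner d h = 0"
proof -
  have "cinner d h = (\<Sum>j=1..n. cinner d (syn j (ana j h)))"
    by (subst poly_bergman_decomposition[OF assms(2)]) (simp add: cinner_sum_right)
  also have "\<dots> = 0" using assms(1) by (simp flip: ana_adj)
  finally show ?thesis .
qed

text \<open>The analysis operators are applied to the whole of \<open>L\<^sub>2\<close>: their adjoints map into the space.\<close>
lemma proj_poly_bergman: "proj_onto (poly_bergman n) f = (\<Sum>j=1..n. syn j (ana j f))"
proof (rule proj_onto_eqI[OF poly_bergman_csubspace sum_syn_in])
  fix h assume h: "h \<in> poly_bergman n"
  show "cinner (f - (\<Sum>j=1..n. syn j (ana j f))) h = 0"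
    by (rule poly_bergman_orthI[OF _ h]) (subst ana_diff, subst ana_sum_syn, auto)
qed

lemma true_poly_bergman_iff:
  assumes k: "k \<ge> 1" shows "f \<in> true_poly_bergman k \<longleftrightarrow> f = syn k (ana k f)"
proof
  assume f: "f \<in> true_poly_bergman k"
  then have fk: "f \<in> poly_bergman k" and orth: "\<And>g. g \<in> poly_bergman (k - 1) \<Longrightarrow> cinner f g = 0"
    by (auto simp: true_poly_bergman_def)
  have "ana j f = 0" if "j \<in> {1..k - 1}" for j
    using orth[OF syn_in[of j "k - 1"]] that by (intro cinner_eqI') (simp add: ana_adj)
  then have "(\<Sum>j=1..k. syn j (ana j f)) = (\<Sum>j=1..k. if j = k then syn k (ana k f) else 0)"
    by (intro sum.cong refl) auto
  then show "f = syn k (ana k f)" using poly_bergman_decomposition[OF fk] k by simp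
next
  assume f: "f = syn k (ana k f)"
  have "f \<in> poly_bergman k" by (subst f) (rule syn_in[OF k order_refl])
  moreover have "cinner f g = 0" if "g \<in> poly_bergman (k - 1)" for g
  proof (rule poly_bergman_orthI[OF _ that])
    fix j assume "j \<in> {1..k - 1}"
    then show "ana j f = 0" by (subst f) (auto simp: ana_syn)
  qed
  ultimately show "f \<in> true_poly_bergman k" by (simp add: true_poly_bergman_def)
qed

lemma proj_true_poly_bergman:
  assumes k: "k \<ge> 1" shows "proj_onto (true_poly_bergman k) f = syn k (ana k f)"
proof (rule proj_onto_eqI)
  have a: "ana k (syn k (ana k f)) = ana k f" for f using k by (simp add: ana_syn)
  show "csubspace (true_poly_bergman k)"
    unfolding csubspace_def true_poly_bergman_iff[OF k]
  proof (intro conjI ballI allI)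
    fix u v c assume "u \<in> true_poly_bergman k" "v \<in> true_poly_bergman k"
    then have u: "syn k (ana k u) = u" and v: "syn k (ana k v) = v" by (simp_all add: true_poly_bergman_iff[OF k])
    show "u + v = syn k (ana k (u + v))" unfolding ana_add syn_add u v ..
    show "scaleC c u = syn k (ana k (scaleC c u))" unfolding ana_scaleC syn_scaleC u ..
  qed simp
  show "syn k (ana k f) \<in> true_poly_bergman k" unfolding true_poly_bergman_iff[OF k] a ..
  fix h assume "h \<in> true_poly_bergman k"
  then have h: "h = syn k (ana k h)" using true_poly_bergman_iff[OF k] by blast
  show "cinner (f - syn k (ana k f)) h = 0"
    by (subst h, subst ana_adj[symmetric]) (simp add: ana_diff a)
qed

lemma true_bergman_proj_eq: "k \<ge> 1 \<Longrightarrow> true_bergman_proj n k = (\<lambda>f\<in>poly_bergman n. syn k (ana k f))"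
  unfolding true_bergman_proj_def by (rule restrict_ext) (rule proj_true_poly_bergman)

section \<open>Operator algebras on the poly-Bergman space\<close>

lemma adjoint_op_eqI:
  assumes "\<And>w. w \<in> W \<Longrightarrow> S w \<in> V" "\<And>w u. w \<in> W \<Longrightarrow> u \<in> V \<Longrightarrow> ipW (T u) w = ipV u (S w)"
    and "\<And>v v'. v \<in> V \<Longrightarrow> v' \<in> V \<Longrightarrow> (\<And>u. u \<in> V \<Longrightarrow> ipV u v = ipV u v') \<Longrightarrow> v = v'"
  shows "adjoint_op V ipV W ipW T = (\<lambda>w\<in>W. S w)"
  unfolding adjoint_op_def
proof (rule restrict_ext, rule the_equality)
  fix w assume w: "w \<in> W"
  then show "S w \<in> V \<and> (\<forall>u\<in>V. ipW (T u) w = ipV u (S w))" using assms by simp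
  fix v assume v: "v \<in> V \<and> (\<forall>u\<in>V. ipW (T u) w = ipV u v)"
  show "v = S w"
  proof (rule assms(3))
    fix u assume "u \<in> V"
    then show "ipV u v = ipV u (S w)" using v assms(2)[OF w] by metis
  qed (use v assms(1)[OF w] in auto)
qed

lemma csubspace_separating:
  assumes "csubspace S" "v \<in> S" "v' \<in> S" "\<And>u. u \<in> S \<Longrightarrow> cinner u v = cinner u v'"
  shows "v = v'"
proof -
  have "cinner (v - v') (v - v') = 0"
    using assms(4)[OF csubspace_diff[OF assms(1-3)]] by (simp add: cinner_diff_right)
  then show ?thesis by (simp add: cinner_self)
qed

lemma bounded_opsD:
  assumes "T \<in> bounded_ops H"
  shows "f \<in> H \<Longrightarrow> T f \<in> H" "f \<in> H \<Longrightarrow> g \<in> H \<Longrightarrow> T (f + g) = T f + T g" "f \<in> H \<Longrightarrow> T (scaleC c f) = scaleC c (T f)"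
    "\<exists>K\<ge>0. \<forall>f\<in>H. norm (T f) \<le> K * norm f" "f \<notin> H \<Longrightarrow> T f = undefined"
proof -
  obtain K where K: "\<forall>f\<in>H. norm (T f) \<le> K * norm f" using assms by (auto simp: bounded_ops_def)
  have "norm (T f) \<le> max K 0 * norm f" if "f \<in> H" for f
    using K that mult_right_mono[of K "max K 0" "norm f"] by force
  then show "\<exists>K\<ge>0. \<forall>f\<in>H. norm (T f) \<le> K * norm f" by (intro exI[of _ "max K 0"]) auto
qed (use assms in \<open>auto simp: bounded_ops_def PiE_def Pi_def extensional_def\<close>)

lemma bounded_ops_ext:
  assumes "S \<in> bounded_ops H" "T \<in> bounded_ops H" "\<And>f. f \<in> H \<Longrightarrow> S f = T f"
  shows "S = T"
  using assms(3) bounded_opsD(5)[OF assms(1)] bounded_opsD(5)[OF assms(2)] by (metis ext)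

lemma restrict_bounded_opsI:
  assumes "csubspace H" "\<And>f. f \<in> H \<Longrightarrow> T f \<in> H" "\<And>f g. f \<in> H \<Longrightarrow> g \<in> H \<Longrightarrow> T (f + g) = T f + T g"
    "\<And>c f. f \<in> H \<Longrightarrow> T (scaleC c f) = scaleC c (T f)" "\<And>f. f \<in> H \<Longrightarrow> norm (T f) \<le> K * norm f"
  shows "(\<lambda>f\<in>H. T f) \<in> bounded_ops H"
proof -
  have "\<exists>K. \<forall>f\<in>H. norm (T f) \<le> K * norm f" using assms(5) by blast
  then show ?thesis using assms(1-4) unfolding bounded_ops_def csubspace_def by auto
qed

text \<open>Closedness is needed for the adjoints, which come from the Riesz representation.\<close>
lemma bounded_ops_cstar:
  assumes H: "csubspace H" "closed H"
  shows "cstar_subalgebra H (bounded_ops H)"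
  unfolding cstar_subalgebra_def
proof (intro conjI ballI allI impI)
  have z: "0 \<in> H" and ad: "\<And>u v. u \<in> H \<Longrightarrow> v \<in> H \<Longrightarrow> u + v \<in> H" and sc: "\<And>c u. u \<in> H \<Longrightarrow> scaleC c u \<in> H"
    using H(1) by (auto simp: csubspace_def)
  show "(\<lambda>f\<in>H. 0) \<in> bounded_ops H" by (rule restrict_bounded_opsI[OF H(1), where K = 0]) (use z in auto)
  fix S T assume S: "S \<in> bounded_ops H" and T: "T \<in> bounded_ops H"
  note S' = bounded_opsD[OF S] and T' = bounded_opsD[OF T]
  obtain K L where K: "K \<ge> 0" "\<And>f. f \<in> H \<Longrightarrow> norm (S f) \<le> K * norm f" and L: "L \<ge> 0" "\<And>f. f \<in> H \<Longrightarrow> norm (T f) \<le> L * norm f"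
    using S'(4) T'(4) by blast
  show "(\<lambda>f\<in>H. S f + T f) \<in> bounded_ops H"
  proof (rule restrict_bounded_opsI[OF H(1), where K = "K + L"])
    fix f assume f: "f \<in> H"
    show "norm (S f + T f) \<le> (K + L) * norm f"
      using norm_triangle_mono[OF K(2)[OF f] L(2)[OF f]] by (simp add: distrib_right)
  qed (auto simp: S' T' ad scaleC_add_right algebra_simps)
  show "compose H S T \<in> bounded_ops H"
    unfolding compose_def
  proof (rule restrict_bounded_opsI[OF H(1), where K = "K * L"])
    fix f assume f: "f \<in> H"
    have "norm (S (T f)) \<le> K * norm (T f)" by (rule K(2)[OF T'(1)[OF f]])
    also have "\<dots> \<le> K * (L * norm f)" by (intro mult_left_mono L(2) f K(1))
    finally show "norm (S (T f)) \<le> K * L * norm f" by (simp add: mult.assoc)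
  qed (auto simp: S' T' ad)
next
  fix c T assume T: "T \<in> bounded_ops H"
  note T' = bounded_opsD[OF T]
  obtain L where L: "L \<ge> 0" "\<And>f. f \<in> H \<Longrightarrow> norm (T f) \<le> L * norm f" using T'(4) by blast
  show "(\<lambda>f\<in>H. scaleC c (T f)) \<in> bounded_ops H"
  proof (rule restrict_bounded_opsI[OF H(1), where K = "cmod c * L"])
    fix f assume f: "f \<in> H"
    show "norm (scaleC c (T f)) \<le> cmod c * L * norm f"
      unfolding norm_scaleC mult.assoc by (intro mult_left_mono L(2) f) simp
  qed (use H(1) in \<open>auto simp: T' scaleC_add_right scaleC_scaleC mult.commute csubspace_def\<close>)
next
  fix T assume T: "T \<in> bounded_ops H"
  note T' = bounded_opsD[OF T]
  obtain L where L: "L \<ge> 0" "\<And>f. f \<in> H \<Longrightarrow> norm (T f) \<le> L * norm f" using T'(4) by blast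
  have "\<exists>v\<in>H. \<forall>u\<in>H. cinner (T u) w = cinner u v" for w
  proof (rule riesz_representation[OF H, where K = "L * norm w"])
    fix u assume u: "u \<in> H"
    show "cmod (cinner (T u) w) \<le> L * norm w * norm u"
      using order_trans[OF cinner_Cauchy_Schwarz[of "T u" w] mult_right_mono[OF L(2)[OF u] norm_ge_zero[of w]]] by (simp add: mult_ac)
  qed (auto simp: T' cinner_add_left cinner_scale_left)
  then obtain A where A: "\<And>w. A w \<in> H" "\<And>w u. u \<in> H \<Longrightarrow> cinner (T u) w = cinner u (A w)" by metis
  have eq: "adjoint_op H cinner H cinner T = (\<lambda>w\<in>H. A w)"
    by (rule adjoint_op_eqI) (use A csubspace_separating[OF H(1)] in auto)
  have csH: "\<And>u v. u \<in> H \<Longrightarrow> v \<in> H \<Longrightarrow> u + v \<in> H" "\<And>c u. u \<in> H \<Longrightarrow> scaleC c u \<in> H" using H(1) by (auto simp: csubspace_def)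
  show "adjoint_op H cinner H cinner T \<in> bounded_ops H"
    unfolding eq
  proof (rule restrict_bounded_opsI[OF H(1), where K = L])
    show "A (f + g) = A f + A g" for f g
      by (rule csubspace_separating[OF H(1)]) (auto simp: A(1) csH cinner_add_right A(2)[symmetric])
    show "A (scaleC c f) = scaleC c (A f)" for c f
      by (rule csubspace_separating[OF H(1)]) (auto simp: A(1) csH cinner_scale_right A(2)[symmetric])
    fix w
    show "norm (A w) \<le> L * norm w"
    proof (cases "norm (A w) = 0")
      case False
      have "(norm (A w))\<^sup>2 = cmod (cinner (T (A w)) w)" using A by (simp add: cinner_self norm_power)
      also have "\<dots> \<le> L * norm (A w) * norm w"
        by (rule order_trans[OF cinner_Cauchy_Schwarz mult_right_mono[OF L(2)[OF A(1)] norm_ge_zero]])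
      finally show ?thesis using False by (simp add: power2_eq_square mult_ac)
    qed (use L in simp)
  qed (rule A)
qed auto

lemma cstar_generated_cstar:
  fixes H :: "'a::euclidean_space L2 set"
  assumes "csubspace H" "closed H" "F \<subseteq> bounded_ops H"
  shows "cstar_subalgebra H (cstar_generated H F)"
proof -
  have ne: "bounded_ops H \<in> {\<A>. cstar_subalgebra H \<A> \<and> F \<subseteq> \<A>}"
    using bounded_ops_cstar assms by auto
  then have sub: "cstar_generated H F \<subseteq> bounded_ops H" unfolding cstar_generated_def by blast
  have up: "T \<in> \<A>" if "T \<in> cstar_generated H F" "cstar_subalgebra H \<A>" "F \<subseteq> \<A>" for T \<A>
    using that unfolding cstar_generated_def by blast
  have I: "T \<in> cstar_generated H F" if "\<And>\<A>. cstar_subalgebra H \<A> \<Longrightarrow> F \<subseteq> \<A> \<Longrightarrow> T \<in> \<A>" for T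
    using that unfolding cstar_generated_def by blast
  show ?thesis
    unfolding cstar_subalgebra_def
  proof (intro conjI sub ballI allI impI)
    show "(\<lambda>f\<in>H. 0) \<in> cstar_generated H F" by (rule I) (simp only: cstar_subalgebra_def)
  next
    fix S T assume "S \<in> cstar_generated H F" "T \<in> cstar_generated H F"
    note ST = up[OF this(1)] up[OF this(2)]
    show "(\<lambda>f\<in>H. S f + T f) \<in> cstar_generated H F" "compose H S T \<in> cstar_generated H F"
      by (rule I; use ST in \<open>unfold cstar_subalgebra_def, blast\<close>)+
  next
    fix c T assume "T \<in> cstar_generated H F"
    note T = up[OF this]
    show "(\<lambda>f\<in>H. scaleC c (T f)) \<in> cstar_generated H F"
      by (rule I; use T in \<open>unfold cstar_subalgebra_def, blast\<close>)
  next
    fix T assume "T \<in> cstar_generated H F"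
    note T = up[OF this]
    show "adjoint_op H cinner H cinner T \<in> cstar_generated H F"
      by (rule I; use T in \<open>unfold cstar_subalgebra_def, blast\<close>)
  next
    fix S :: "nat \<Rightarrow> 'a L2 \<Rightarrow> 'a L2" and T
    assume T: "T \<in> bounded_ops H" and S: "(\<forall>i. S i \<in> cstar_generated H F) \<and> (\<lambda>i. op_norm H (\<lambda>f\<in>H. S i f - T f)) \<longlonglongrightarrow> 0"
    show "T \<in> cstar_generated H F"
    proof (rule I)
      fix \<A> assume A: "cstar_subalgebra H \<A>" "F \<subseteq> \<A>"
      have "\<forall>i. S i \<in> \<A>" using S up[OF _ A] by blast
      then show "T \<in> \<A>" using A(1) T S unfolding cstar_subalgebra_def by blast
    qed
  qed
qed

lemma cstar_generated_subset: "F \<subseteq> cstar_generated H F"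
  unfolding cstar_generated_def by blast

lemma cstar_generated_least: "cstar_subalgebra H \<A> \<Longrightarrow> F \<subseteq> \<A> \<Longrightarrow> cstar_generated H F \<subseteq> \<A>"
  unfolding cstar_generated_def by blast

lemma op_norm_le:
  assumes "0 \<in> H" "\<And>f. f \<in> H \<Longrightarrow> norm (T f) \<le> K * norm f" "K \<ge> 0"
  shows "op_norm H T \<le> K"
  unfolding op_norm_def
proof (rule cSUP_least)
  show "{f \<in> H. norm f \<le> 1} \<noteq> {}" using assms(1) by auto
  fix f assume "f \<in> {f \<in> H. norm f \<le> 1}"
  then have "norm (T f) \<le> K * norm f" "K * norm f \<le> K * 1" using assms(2) mult_left_mono[of "norm f" 1 K] assms(3) by auto
  then show "norm (T f) \<le> K" by simp
qed

lemma op_norm_nonneg: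
  assumes "0 \<in> H" "\<And>f. f \<in> H \<Longrightarrow> norm (T f) \<le> K * norm f" "K \<ge> 0"
  shows "op_norm H T \<ge> 0"
proof -
  have "bdd_above ((\<lambda>f. norm (T f)) ` {f \<in> H. norm f \<le> 1})"
  proof (rule bdd_aboveI2[where M = K])
    fix f assume "f \<in> {f \<in> H. norm f \<le> 1}"
    then have "norm (T f) \<le> K * norm f" "K * norm f \<le> K * 1" using assms(2) mult_left_mono[of "norm f" 1 K] assms(3) by auto
    then show "norm (T f) \<le> K" by simp
  qed
  then have "norm (T 0) \<le> op_norm H T" unfolding op_norm_def by (rule cSUP_upper[rotated]) (use assms in auto)
  then show ?thesis using norm_ge_zero order_trans by blast
qed

subsection \<open>Matrix entries\<close>

text \<open>The operator with the multiplication by \<open>m\<close> in position \<open>(j, k)\<close> and zeros elsewhere.\<close>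
definition entry :: "nat \<Rightarrow> nat \<Rightarrow> nat \<Rightarrow> (real \<Rightarrow> complex) \<Rightarrow> complex L2 \<Rightarrow> complex L2" where
  "entry n j k m = (\<lambda>f\<in>poly_bergman n. syn j (mulop (sym_ext m) (ana k f)))"

abbreviation bsym :: "(real \<Rightarrow> complex) \<Rightarrow> bool" where "bsym m \<equiv> bdd_meas (sym_ext m)"

lemma restr_sym_ext: "bsym m \<Longrightarrow> restr (mulop (sym_ext m) g) = mulop (sym_ext m) g"
  by (subst mulop_mulop) (auto simp: sym_ext_def posfun_def mulop_def intro!: arg_cong[of _ _ abs_L2])

lemma sym_ext_const: "sym_ext (\<lambda>_. 1) = posfun"
  by (auto simp: sym_ext_def posfun_def fun_eq_iff)

lemma sym_ext_mult: "sym_ext (\<lambda>x. m x * k x) = (\<lambda>x. sym_ext m x * sym_ext k x)"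
  by (auto simp: sym_ext_def fun_eq_iff)

lemma sym_ext_add: "sym_ext (\<lambda>x. m x + k x) = (\<lambda>x. sym_ext m x + sym_ext k x)"
  by (auto simp: sym_ext_def fun_eq_iff)

lemma sym_ext_cmult: "sym_ext (\<lambda>x. c * m x) = (\<lambda>x. c * sym_ext m x)"
  by (auto simp: sym_ext_def fun_eq_iff)

lemma sym_ext_cnj: "sym_ext (\<lambda>x. cnj (m x)) = (\<lambda>x. cnj (sym_ext m x))"
  by (auto simp: sym_ext_def fun_eq_iff)

lemma bsym_const: "bsym (\<lambda>_. c)"
  by (rule cont_sym_bdd[OF cont_sym_const])

lemma bsym_diff:
  assumes "bsym m" "bsym k" shows "bsym (\<lambda>x. m x - k x)"
proof -
  have "sym_ext (\<lambda>x. m x - k x) = (\<lambda>x. sym_ext m x + (- 1) * sym_ext k x)"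
    by (auto simp: sym_ext_def fun_eq_iff)
  then show ?thesis using assms by (simp only:) (intro bdd_meas_add bdd_meas_mult bdd_meas_const)
qed

lemma entry_cong: "(\<And>x. x > 0 \<Longrightarrow> m x = k x) \<Longrightarrow> entry n j l m = entry n j l k"
proof -
  assume "\<And>x. x > 0 \<Longrightarrow> m x = k x"
  then have "sym_ext m = sym_ext k" by (auto simp: sym_ext_def)
  then show ?thesis by (simp add: entry_def)
qed

lemma entry_norm:
  assumes "f \<in> poly_bergman n" "bsym m" "\<And>x. x > 0 \<Longrightarrow> cmod (m x) \<le> C" "C \<ge> 0"
  shows "norm (entry n j k m f) \<le> C * norm f"
proof -
  have "norm (entry n j k m f) \<le> norm (mulop (sym_ext m) (ana k f))" using assms(1) by (simp add: entry_def syn_norm)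
  also have "\<dots> \<le> C * norm (ana k f)"
    using assms by (intro mulop_norm_le) (auto simp: bdd_meas_def sym_ext_def)
  also have "\<dots> \<le> C * norm f" by (intro mult_left_mono ana_norm assms)
  finally show ?thesis .
qed

lemma entry_bounded:
  assumes j: "j \<in> {1..n}" and m: "bsym m"
  shows "entry n j k m \<in> bounded_ops (poly_bergman n)"
proof -
  obtain C where C: "\<And>x. cmod (sym_ext m x) \<le> C" using m by (auto simp: bdd_meas_def)
  have C0: "C \<ge> 0" using C norm_ge_zero order_trans by blast
  have Cm: "cmod (m x) \<le> C" if "x > 0" for x using C[of x] that by (simp add: sym_ext_def)
  show ?thesis
    unfolding entry_def
  proof (rule restrict_bounded_opsI[OF poly_bergman_csubspace, where K = C])
    fix f assume f: "f \<in> poly_bergman n"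
    show "norm (syn j (mulop (sym_ext m) (ana k f))) \<le> C * norm f"
      using entry_norm[OF f m Cm C0, of j k] f by (simp add: entry_def)
  qed (use j m in \<open>auto intro: syn_in simp: ana_add ana_scaleC mulop_add mulop_scaleC syn_add syn_scaleC\<close>)
qed

lemma entry_compose:
  assumes "j \<in> {1..n}" "k \<in> {1..n}" "bsym m" "bsym m'"
  shows "compose (poly_bergman n) (entry n j k m) (entry n k l m') = entry n j l (\<lambda>x. m x * m' x)"
  unfolding compose_def entry_def
proof (rule restrict_ext)
  fix f assume f: "f \<in> poly_bergman n"
  have "ana k (syn k (mulop (sym_ext m') (ana l f))) = mulop (sym_ext m') (ana l f)"
    using assms by (simp add: ana_syn restr_sym_ext)
  then show "(\<lambda>f\<in>poly_bergman n. syn j (mulop (sym_ext m) (ana k f))) ((\<lambda>f\<in>poly_bergman n. syn k (mulop (sym_ext m') (ana l f))) f) =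
        syn j (mulop (sym_ext (\<lambda>x. m x * m' x)) (ana l f))"
    using f assms by (simp add: syn_in mulop_mulop sym_ext_mult)
qed

lemma entry_adjoint:
  assumes "j \<in> {1..n}" "k \<in> {1..n}" "bsym m"
  shows "adjoint_op (poly_bergman n) cinner (poly_bergman n) cinner (entry n j k m) = entry n k j (\<lambda>x. cnj (m x))"
proof -
  have "adjoint_op (poly_bergman n) cinner (poly_bergman n) cinner (entry n j k m) = (\<lambda>w\<in>poly_bergman n. syn k (mulop (sym_ext (\<lambda>x. cnj (m x))) (ana j w)))"
  proof (rule adjoint_op_eqI)
    fix w u assume "w \<in> poly_bergman n" and u: "u \<in> poly_bergman n"
    show "cinner (entry n j k m u) w = cinner u (syn k (mulop (sym_ext (\<lambda>x. cnj (m x))) (ana j w)))"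
      using u by (simp add: entry_def syn_adj mulop_adjoint[OF assms(3)] ana_adj[symmetric] sym_ext_cnj)
  next
    fix v v' assume "v \<in> poly_bergman n" "v' \<in> poly_bergman n" "\<And>u. u \<in> poly_bergman n \<Longrightarrow> cinner u v = cinner u v'"
    then show "v = v'" by (rule csubspace_separating[OF poly_bergman_csubspace])
  qed (use assms in \<open>auto intro: syn_in\<close>)
  then show ?thesis by (simp add: entry_def)
qed

lemma entry_add: 
  assumes "bsym m" "bsym m'"
  shows "(\<lambda>f\<in>poly_bergman n. entry n j k m f + entry n j k m' f) = entry n j k (\<lambda>x. m x + m' x)"
  unfolding entry_def by (rule restrict_ext) (simp add: sym_ext_add mulop_plus assms syn_add)

lemma entry_scale:
  assumes "bsym m"
  shows "(\<lambda>f\<in>poly_bergman n. scaleC c (entry n j k m f)) = entry n j k (\<lambda>x. c * m x)"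
  unfolding entry_def by (rule restrict_ext) (simp add: sym_ext_cmult mulop_cmult assms syn_scaleC)

lemma entry_one: "k \<ge> 1 \<Longrightarrow> true_bergman_proj n k = entry n k k (\<lambda>_. 1)"
  unfolding true_bergman_proj_eq entry_def sym_ext_const by simp

definition matrix_op :: "nat \<Rightarrow> (nat \<Rightarrow> nat \<Rightarrow> real \<Rightarrow> complex) \<Rightarrow> complex L2 \<Rightarrow> complex L2" where
  "matrix_op n m = (\<lambda>f\<in>poly_bergman n. \<Sum>j=1..n. \<Sum>k=1..n. entry n j k (m j k) f)"

text \<open>Cutting with the diagonal units isolates one entry, so an algebra containing these units contains
  the entries of every matrix in it.\<close>
lemma matrix_op_corner:
  assumes "j \<in> {1..n}" "k \<in> {1..n}" "\<And>j k. j \<in> {1..n} \<Longrightarrow> k \<in> {1..n} \<Longrightarrow> bsym (m j k)"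
  shows "compose (poly_bergman n) (entry n j j (\<lambda>_. 1)) (compose (poly_bergman n) (matrix_op n m) (entry n k k (\<lambda>_. 1))) = entry n j k (m j k)"
proof -
  let ?H = "poly_bergman n"
  have key: "entry n j j (\<lambda>_. 1) (matrix_op n m (entry n k k (\<lambda>_. 1) f)) = entry n j k (m j k) f" if f: "f \<in> ?H" for f
  proof -
    let ?g = "syn k (ana k f)"
    have g: "?g \<in> ?H" using assms by (auto intro: syn_in)
    have e: "entry n k k (\<lambda>_. 1) f = ?g" using f by (simp add: entry_def sym_ext_const)
    have ana_g: "ana k' ?g = (if k = k' then ana k f else 0)" if "k' \<in> {1..n}" for k' using assms that by (simp add: ana_syn)
    have mulop_0: "mulop a 0 = 0" if "bdd_meas a" for a :: "real \<Rightarrow> complex" using mulop_add[OF that, of 0 0] by simp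
    have "matrix_op n m ?g = (\<Sum>j=1..n. \<Sum>k'=1..n. if k = k' then syn j (mulop (sym_ext (m j k)) (ana k f)) else 0)"
      unfolding matrix_op_def restrict_apply if_P[OF g]
    proof (intro sum.cong refl)
      fix i k' assume i: "i \<in> {1..n}" "k' \<in> {1..n}"
      show "entry n i k' (m i k') ?g = (if k = k' then syn i (mulop (sym_ext (m i k)) (ana k f)) else 0)"
        unfolding entry_def restrict_apply if_P[OF g]
        using ana_g[OF i(2)] mulop_0[OF assms(3)[OF i]] by auto
    qed
    also have "\<dots> = (\<Sum>j=1..n. syn j (mulop (sym_ext (m j k)) (ana k f)))" using assms by simp
    finally have m: "matrix_op n m ?g = (\<Sum>j=1..n. syn j (mulop (sym_ext (m j k)) (ana k f)))" .
    have "entry n j j (\<lambda>_. 1) (matrix_op n m ?g) = syn j (ana j (matrix_op n m ?g))"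
      unfolding m using sum_syn_in by (simp add: entry_def sym_ext_const)
    also have "ana j (matrix_op n m ?g) = mulop (sym_ext (m j k)) (ana k f)"
      unfolding m using assms by (subst ana_sum_syn) (auto simp: restr_sym_ext)
    finally show ?thesis unfolding e using f by (simp add: entry_def)
  qed
  show ?thesis
  proof (rule ext)
    fix f
    show "compose ?H (entry n j j (\<lambda>_. 1)) (compose ?H (matrix_op n m) (entry n k k (\<lambda>_. 1))) f = entry n j k (m j k) f"
    proof (cases "f \<in> ?H")
      case True
      show ?thesis unfolding compose_def restrict_apply if_P[OF True] by (rule key[OF True])
    qed (simp add: compose_def entry_def)
  qed
qed

locale cstar_on_bergman =
  fixes n :: nat and \<A> :: "(complex L2 \<Rightarrow> complex L2) set"
  assumes cstar: "cstar_subalgebra (poly_bergman n) \<A>"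
begin

lemma alg_compose: "S \<in> \<A> \<Longrightarrow> T \<in> \<A> \<Longrightarrow> compose (poly_bergman n) S T \<in> \<A>"
  using cstar by (simp add: cstar_subalgebra_def)

lemma alg_add: "S \<in> \<A> \<Longrightarrow> T \<in> \<A> \<Longrightarrow> (\<lambda>f\<in>poly_bergman n. S f + T f) \<in> \<A>"
  using cstar by (simp add: cstar_subalgebra_def)

lemma alg_scale: "T \<in> \<A> \<Longrightarrow> (\<lambda>f\<in>poly_bergman n. scaleC c (T f)) \<in> \<A>"
  using cstar by (simp add: cstar_subalgebra_def)

lemma alg_adjoint: "T \<in> \<A> \<Longrightarrow> adjoint_op (poly_bergman n) cinner (poly_bergman n) cinner T \<in> \<A>"
  using cstar by (simp add: cstar_subalgebra_def)

lemma alg_zero: "(\<lambda>f\<in>poly_bergman n. 0) \<in> \<A>"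
  using cstar by (simp add: cstar_subalgebra_def)

lemma alg_limit:
  assumes "T \<in> bounded_ops (poly_bergman n)" "\<And>i. S i \<in> \<A>" "(\<lambda>i::nat. op_norm (poly_bergman n) (\<lambda>f\<in>poly_bergman n. S i f - T f)) \<longlonglongrightarrow> 0"
  shows "T \<in> \<A>"
  using cstar assms unfolding cstar_subalgebra_def by blast

lemma alg_sum:
  assumes "finite A" "\<And>a. a \<in> A \<Longrightarrow> T a \<in> \<A>"
  shows "(\<lambda>f\<in>poly_bergman n. \<Sum>a\<in>A. T a f) \<in> \<A>"
  using assms
proof (induction A)
  case empty
  then show ?case using alg_zero by (simp only: sum.empty)
next
  case (insert x F)
  then have "(\<lambda>f\<in>poly_bergman n. T x f + (\<lambda>f\<in>poly_bergman n. \<Sum>a\<in>F. T a f) f) \<in> \<A>" by (intro alg_add) auto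
  moreover have "(\<lambda>f\<in>poly_bergman n. T x f + (\<lambda>f\<in>poly_bergman n. \<Sum>a\<in>F. T a f) f) = (\<lambda>f\<in>poly_bergman n. \<Sum>a\<in>insert x F. T a f)"
    using insert by (intro restrict_ext) simp
  ultimately show ?case by (simp only:)
qed

lemma alg_matrix_op:
  assumes "\<And>j k. j \<in> {1..n} \<Longrightarrow> k \<in> {1..n} \<Longrightarrow> entry n j k (m j k) \<in> \<A>"
  shows "matrix_op n m \<in> \<A>"
proof -
  let ?A = "\<lambda>f\<in>poly_bergman n. \<Sum>j\<in>{1..n}. (\<lambda>f\<in>poly_bergman n. \<Sum>k\<in>{1..n}. entry n j k (m j k) f) f"
  have "?A \<in> \<A>"
    by (intro alg_sum assms) auto
  moreover have "?A = matrix_op n m"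
    unfolding matrix_op_def by (intro restrict_ext) simp
  ultimately show ?thesis by simp
qed

lemma alg_entry_limit:
  assumes jk: "j \<in> {1..n}" "k \<in> {1..n}" and m: "bsym m"
    and approx: "\<And>e. e > 0 \<Longrightarrow> \<exists>h. bsym h \<and> entry n j k h \<in> \<A> \<and> (\<forall>x>0. cmod (h x - m x) \<le> e)"
  shows "entry n j k m \<in> \<A>"
proof -
  let ?A = "\<lambda>h i. \<lambda>f\<in>poly_bergman n. entry n j k (h i) f - entry n j k m f"
  have "\<exists>h. bsym h \<and> entry n j k h \<in> \<A> \<and> (\<forall>x>0. cmod (h x - m x) \<le> 1 / real (Suc i))" for i :: nat
    by (rule approx) simp
  then obtain h where h: "\<And>i. bsym (h i)" "\<And>i. entry n j k (h i) \<in> \<A>" "\<And>i x. x > 0 \<Longrightarrow> cmod (h i x - m x) \<le> 1 / real (Suc i)"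
    by metis
  have z: "0 \<in> poly_bergman n" using poly_bergman_csubspace by (simp add: csubspace_def)
  show ?thesis
  proof (rule alg_limit[OF entry_bounded[OF jk(1) m] h(2)])
    have d: "(?A h i) = entry n j k (\<lambda>x. h i x - m x)" for i
    proof -
      have "(\<lambda>f\<in>poly_bergman n. entry n j k m f + entry n j k (\<lambda>x. h i x - m x) f) = entry n j k (h i)"
        using entry_add[OF m bsym_diff[OF h(1) m], of n j k i] by simp
      note sum = fun_cong[OF this]
      show ?thesis
      proof (rule ext)
        fix f
        show "(?A h i) f = entry n j k (\<lambda>x. h i x - m x) f"
        proof (cases "f \<in> poly_bergman n")
          case True
          have "entry n j k m f + entry n j k (\<lambda>x. h i x - m x) f = entry n j k (h i) f"
            using sum[of f] unfolding restrict_apply if_P[OF True] .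
          then show ?thesis unfolding restrict_apply if_P[OF True] by (metis add_diff_cancel_left')
        qed (simp add: entry_def)
      qed
    qed
    have nb: "norm (entry n j k (\<lambda>x. h i x - m x) f) \<le> 1 / real (Suc i) * norm f" if "f \<in> poly_bergman n" for i f
      by (rule entry_norm[OF that bsym_diff[OF h(1) m] h(3)]) auto
    show "(\<lambda>i. op_norm (poly_bergman n) (?A h i)) \<longlonglongrightarrow> 0"
      unfolding d
    proof (rule tendsto_sandwich[OF _ _ tendsto_const])
      show "\<forall>\<^sub>F i in sequentially. 0 \<le> op_norm (poly_bergman n) (entry n j k (\<lambda>x. h i x - m x))"
        by (intro always_eventually allI op_norm_nonneg[OF z nb]) auto
      show "\<forall>\<^sub>F i in sequentially. op_norm (poly_bergman n) (entry n j k (\<lambda>x. h i x - m x)) \<le> 1 / real (Suc i)"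
        by (intro always_eventually allI op_norm_le[OF z nb]) auto
      show "(\<lambda>i. 1 / real (Suc i)) \<longlonglongrightarrow> 0" by (rule LIMSEQ_Suc[OF lim_1_over_n])
    qed
  qed
qed

end

text \<open>In the variable \<open>u = exp (- c x)\<close> the symbol is a continuous function on \<open>[0, 1]\<close>.\<close>
lemma cont_sym_bernstein:
  assumes m: "cont_sym m p q" and c: "c > 0" and e: "e > 0"
  shows "\<exists>N b. \<forall>x>0. cmod ((\<Sum>k\<le>N. b k * of_real (Bernstein N k (exp (- (c * x))))) - m x) \<le> e"
proof -
  define F where "F = (\<lambda>u::real. if u \<le> 0 then q else if u \<ge> 1 then p else m (- ln u / c))"
  have cm: "continuous_on {0<..} m" and m0: "(m \<longlongrightarrow> p) (at_right 0)" and mi: "(m \<longlongrightarrow> q) at_top"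
    using m by (auto simp: cont_sym_def)
  have Fexp: "F (exp (- (c * x))) = m x" if "x > 0" for x
    using mult_pos_pos[OF c that] c by (simp add: F_def)
  have "continuous_on {0..1} F"
    unfolding continuous_on
  proof
    fix u :: real assume u: "u \<in> {0..1}"
    consider "u = 0" | "u = 1" | "0 < u" "u < 1" using u by force
    then show "(F \<longlongrightarrow> F u) (at u within {0..1})"
    proof cases
      case 1
      have "filterlim (\<lambda>u. - ln u / c) at_top (at_right 0)"
      proof -
        have "filterlim (\<lambda>u. (1 / c) * - ln u) at_top (at_right 0)"
          by (rule filterlim_tendsto_pos_mult_at_top[OF tendsto_const])
            (use c ln_at_0 in \<open>auto simp: filterlim_uminus_at_top\<close>)
        then show ?thesis by simp
      qed
      then have "((\<lambda>u. m (- ln u / c)) \<longlongrightarrow> q) (at_right 0)" by (rule filterlim_compose[OF mi])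
      moreover have "\<forall>\<^sub>F u in at_right 0. m (- ln u / c) = F u"
        unfolding eventually_at_right_field by (intro exI[of _ 1]) (auto simp: F_def)
      ultimately have "(F \<longlongrightarrow> q) (at_right 0)" by (rule Lim_transform_eventually)
      moreover have "at (0::real) within {0..1} = at_right 0" by (rule at_within_Icc_at_right) simp
      ultimately show ?thesis using 1 by (simp add: F_def)
    next
      case 2
      have l: "((\<lambda>u. - ln u / c) \<longlongrightarrow> - ln 1 / c) (at_left (1::real))" using c by (intro tendsto_intros) auto
      have "filterlim (\<lambda>u. - ln u / c) (at_right 0) (at_left 1)"
        unfolding filterlim_at
      proof
        show "\<forall>\<^sub>F u in at_left 1. - ln u / c \<in> {0<..} \<and> - ln u / c \<noteq> 0"
          unfolding eventually_at_left_field using c by (intro exI[of _ 0]) (auto simp: divide_neg_pos)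
      qed (use l in simp)
      then have "((\<lambda>u. m (- ln u / c)) \<longlongrightarrow> p) (at_left 1)" by (rule filterlim_compose[OF m0])
      moreover have "\<forall>\<^sub>F u in at_left 1. m (- ln u / c) = F u"
        unfolding eventually_at_left_field by (intro exI[of _ 0]) (auto simp: F_def)
      ultimately have "(F \<longlongrightarrow> p) (at_left 1)" by (rule Lim_transform_eventually)
      moreover have "at (1::real) within {0..1} = at_left 1" by (rule at_within_Icc_at_left) simp
      ultimately show ?thesis using 2 by (simp add: F_def)
    next
      case 3
      have "isCont m (- ln u / c)"
        using cm 3 c by (auto simp: continuous_on_eq_continuous_at divide_neg_pos)
      moreover have "((\<lambda>u. - ln u / c) \<longlongrightarrow> - ln u / c) (at u)" using 3 c by (intro tendsto_intros) auto
      ultimately have "((\<lambda>u. m (- ln u / c)) \<longlongrightarrow> m (- ln u / c)) (at u)" by (rule isCont_tendsto_compose)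
      then have "(F \<longlongrightarrow> m (- ln u / c)) (at u)"
        by (rule Lim_transform_within_open[of _ _ _ _ "{0<..<1}"]) (use 3 in \<open>auto simp: F_def\<close>)
      then show ?thesis using 3 tendsto_within_subset[of F _ u UNIV "{0..1}"] by (simp add: F_def)
    qed
  qed
  then have cR: "continuous_on {0..1} (\<lambda>u. Re (F u))" and cI: "continuous_on {0..1} (\<lambda>u. Im (F u))"
    by (auto intro: continuous_intros)
  have e2: "e / 2 > 0" using e by simp
  obtain N1 where N1: "\<And>n x. N1 \<le> n \<Longrightarrow> x \<in> {0..1} \<Longrightarrow> \<bar>Re (F x) - (\<Sum>k\<le>n. Re (F (real k / real n)) * Bernstein n k x)\<bar> < e / 2"
    using Bernstein_Weierstrass[OF cR e2] by blast
  obtain N2 where N2: "\<And>n x. N2 \<le> n \<Longrightarrow> x \<in> {0..1} \<Longrightarrow> \<bar>Im (F x) - (\<Sum>k\<le>n. Im (F (real k / real n)) * Bernstein n k x)\<bar> < e / 2"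
    using Bernstein_Weierstrass[OF cI e2] by blast
  define N where "N = max N1 N2"
  show ?thesis
  proof (intro exI[of _ N] exI[of _ "\<lambda>k. F (real k / real N)"] allI impI)
    fix x :: real assume x: "x > 0"
    let ?u = "exp (- (c * x))"
    have u: "?u \<in> {0..1}" using x c by simp
    let ?S = "\<Sum>k\<le>N. F (real k / real N) * of_real (Bernstein N k ?u)"
    have "\<bar>Re (?S - m x)\<bar> < e / 2" "\<bar>Im (?S - m x)\<bar> < e / 2"
      using N1[of N ?u] N2[of N ?u] u unfolding Fexp[OF x] N_def by (simp_all add: abs_minus_commute)
    then show "cmod (?S - m x) \<le> e" using cmod_le[of "?S - m x"] by linarith
  qed
qed

text \<open>The regularized quotient \<open>h w\<^sup>* / (\<bar>w\<bar>\<^sup>2 + \<delta>)\<close> is used. Where \<open>w\<close> is small, near the two ends, so is \<open>h\<close>.\<close>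
lemma c0_division:
  assumes h: "cont_sym h 0 0" and w: "cont_sym w 0 0" "\<And>x. x > 0 \<Longrightarrow> w x \<noteq> 0" and e: "e > 0"
  shows "\<exists>f. cont_sym f 0 0 \<and> (\<forall>x>0. cmod (f x * w x - h x) \<le> e)"
proof -
  obtain M where M: "\<And>x. x > 0 \<Longrightarrow> cmod (h x) \<le> M" using cont_sym_bounded[OF h] by blast
  have M0: "M \<ge> 0" using order_trans[OF norm_ge_zero M[of 1]] by simp
  have ch: "continuous_on {0<..} h" and h0: "(h \<longlongrightarrow> 0) (at_right 0)" and hi: "(h \<longlongrightarrow> 0) at_top"
    using h by (auto simp: cont_sym_def)
  have cw: "continuous_on {0<..} w" and w0: "(w \<longlongrightarrow> 0) (at_right 0)" and wi: "(w \<longlongrightarrow> 0) at_top"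
    using w by (auto simp: cont_sym_def)
  obtain a where a: "a > 0" "\<And>x. x > 0 \<Longrightarrow> x < a \<Longrightarrow> cmod (h x) < e"
    using tendstoD[OF h0 e] unfolding eventually_at_right_field by auto
  obtain b where b: "\<And>x. x \<ge> b \<Longrightarrow> cmod (h x) < e"
    using tendstoD[OF hi e] unfolding eventually_at_top_linorder by auto
  obtain \<mu> where \<mu>: "\<mu> > 0" "\<And>x. a \<le> x \<Longrightarrow> x \<le> b \<Longrightarrow> \<mu> \<le> (cmod (w x))\<^sup>2"
  proof (cases "a \<le> b")
    case True
    have "continuous_on {a..b} (\<lambda>x. (cmod (w x))\<^sup>2)"
      using a by (intro continuous_intros continuous_on_subset[OF cw]) auto
    from continuous_attains_inf[OF _ _ this] True obtain y where y: "y \<in> {a..b}" "\<And>x. x \<in> {a..b} \<Longrightarrow> (cmod (w y))\<^sup>2 \<le> (cmod (w x))\<^sup>2" by auto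
    then have "(cmod (w y))\<^sup>2 > 0" using w(2)[of y] a by simp
    then show ?thesis by (rule that) (rule y(2), simp)
  next
    case False
    then show ?thesis using that[of 1] by auto
  qed
  define \<delta> where "\<delta> = e * \<mu> / (M + 1)"
  have \<delta>: "\<delta> > 0" using e \<mu> M0 by (simp add: \<delta>_def)
  define f where "f = (\<lambda>x. h x * cnj (w x) / of_real ((cmod (w x))\<^sup>2 + \<delta>))"
  have den: "(cmod z)\<^sup>2 + \<delta> > 0" for z using \<delta> by (simp add: add_nonneg_pos)
  then have den': "complex_of_real ((cmod z)\<^sup>2 + \<delta>) \<noteq> 0" for z by (metis of_real_eq_0_iff less_irrefl)
  have "cont_sym f 0 0"
    unfolding cont_sym_def
  proof (intro conjI)
    show "continuous_on {0<..} f" unfolding f_def by (intro continuous_intros ch cw) (use den' in auto)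
    have "(f \<longlongrightarrow> 0 * cnj 0 / of_real ((cmod 0)\<^sup>2 + \<delta>)) (at_right 0)" unfolding f_def by (intro tendsto_intros h0 w0 den')
    then show "(f \<longlongrightarrow> 0) (at_right 0)" by simp
    have "(f \<longlongrightarrow> 0 * cnj 0 / of_real ((cmod 0)\<^sup>2 + \<delta>)) at_top" unfolding f_def by (intro tendsto_intros hi wi den')
    then show "(f \<longlongrightarrow> 0) at_top" by simp
  qed
  moreover have "cmod (f x * w x - h x) \<le> e" if x: "x > 0" for x
  proof -
    let ?D = "(cmod (w x))\<^sup>2 + \<delta>"
    have "f x * w x = h x * (w x * cnj (w x)) / of_real ?D" by (simp add: f_def mult_ac)
    also have "\<dots> = h x * of_real ((cmod (w x))\<^sup>2 / ?D)" unfolding complex_norm_square[symmetric] by simp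
    also have "(cmod (w x))\<^sup>2 / ?D = 1 - \<delta> / ?D" using den[of "w x"] by (simp add: field_simps)
    finally have "f x * w x - h x = - (h x * of_real (\<delta> / ?D))" by (simp only: of_real_diff of_real_1 right_diff_distrib mult_1_right) simp
    then have eq: "cmod (f x * w x - h x) = cmod (h x) * \<bar>\<delta> / ?D\<bar>" by (simp only: norm_minus_cancel norm_mult norm_of_real)
    have "\<bar>\<delta> / ?D\<bar> = \<delta> / ?D" using den[of "w x"] \<delta> by simp
    note eq = eq[unfolded this]
    show ?thesis
    proof (cases "a \<le> x \<and> x \<le> b")
      case True
      have "cmod (h x) * (\<delta> / ((cmod (w x))\<^sup>2 + \<delta>)) \<le> M * (\<delta> / \<mu>)"
        using \<mu>(2)[of x] True \<delta> \<mu>(1) M[OF x] M0 by (intro mult_mono frac_le) auto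
      also have "\<dots> = e * (M / (M + 1))" using \<mu>(1) by (simp add: \<delta>_def)
      also have "\<dots> \<le> e * 1" using e M0 by (intro mult_left_mono) auto
      finally show ?thesis using eq by simp
    next
      case False
      then have "cmod (h x) < e" using a(2)[OF x] b[of x] by force
      moreover have "\<delta> / ((cmod (w x))\<^sup>2 + \<delta>) \<le> 1" using \<delta> den[of "w x"] by (simp add: divide_le_eq_1)
      moreover have "\<delta> / ((cmod (w x))\<^sup>2 + \<delta>) \<ge> 0" using \<delta> den[of "w x"] by simp
      ultimately have "cmod (h x) * (\<delta> / ((cmod (w x))\<^sup>2 + \<delta>)) \<le> e * 1" using e by (intro mult_mono) auto
      then show ?thesis using eq by simp
    qed
  qed
  ultimately show ?thesis by blast
qed

section \<open>Algebras containing many matrix entries\<close>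

lemma bsym_mult: "bsym m \<Longrightarrow> bsym k \<Longrightarrow> bsym (\<lambda>x. m x * k x)"
  unfolding sym_ext_mult by (rule bdd_meas_mult)

lemma bsym_add: "bsym m \<Longrightarrow> bsym k \<Longrightarrow> bsym (\<lambda>x. m x + k x)"
  unfolding sym_ext_add by (rule bdd_meas_add)

lemma bsym_cmult: "bsym m \<Longrightarrow> bsym (\<lambda>x. c * m x)"
  unfolding sym_ext_cmult by (intro bdd_meas_mult bdd_meas_const)

lemma exp_cont_sym:
  assumes "c > 0" shows "cont_sym (\<lambda>x. of_real (exp (- (c * x)))) 1 0"
  unfolding cont_sym_def
proof (intro conjI)
  let ?A = "\<lambda>x. complex_of_real (exp (- (c * x)))"
  show "continuous_on {0<..} ?A" by (intro continuous_intros)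
  have "(?A \<longlongrightarrow> of_real (exp (- (c * 0)))) (at_right 0)" by (intro tendsto_intros)
  then show "(?A \<longlongrightarrow> 1) (at_right 0)" by simp
  have "filterlim (\<lambda>x. c * x) at_top at_top"
    by (rule filterlim_tendsto_pos_mult_at_top[OF tendsto_const assms filterlim_ident])
  then have "((\<lambda>x. exp (- (c * x))) \<longlongrightarrow> 0) at_top"
    by (intro filterlim_compose[OF exp_at_bot]) (simp add: filterlim_uminus_at_bot)
  then show "(?A \<longlongrightarrow> 0) at_top" using tendsto_of_real by fastforce
qed

context cstar_on_bergman
begin

lemma mult_in:
  assumes "j \<in> {1..n}" "k \<in> {1..n}" "bsym m" "bsym m'" "entry n j k m \<in> \<A>" "entry n k l m' \<in> \<A>"
  shows "entry n j l (\<lambda>x. m x * m' x) \<in> \<A>"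
  using alg_compose[OF assms(5,6)] entry_compose[OF assms(1-4)] by simp

lemma add_in:
  assumes "bsym m" "bsym m'" "entry n j k m \<in> \<A>" "entry n j k m' \<in> \<A>"
  shows "entry n j k (\<lambda>x. m x + m' x) \<in> \<A>"
  using alg_add[OF assms(3,4)] entry_add[OF assms(1,2)] by simp

lemma scale_in:
  assumes "bsym m" "entry n j k m \<in> \<A>"
  shows "entry n j k (\<lambda>x. c * m x) \<in> \<A>"
  using alg_scale[OF assms(2)] entry_scale[OF assms(1)] by simp

lemma cnj_in:
  assumes "j \<in> {1..n}" "k \<in> {1..n}" "bsym m" "entry n j k m \<in> \<A>"
  shows "entry n k j (\<lambda>x. cnj (m x)) \<in> \<A>"
  using alg_adjoint[OF assms(4)] entry_adjoint[OF assms(1-3)] by simp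

end

text \<open>The elements from which all further ones are produced: diagonal units, one separating symbol in the
  corner, and links from the first summand to the others.\<close>
locale generating_entries = cstar_on_bergman +
  fixes c :: real
  assumes n: "n \<ge> 1" and c: "c > 0"
    and proj: "\<And>j. j \<in> {1..n} \<Longrightarrow> entry n j j (\<lambda>_. 1) \<in> \<A>"
    and generator: "entry n 1 1 (\<lambda>x. of_real (exp (- (c * x)))) \<in> \<A>"
    and link: "\<And>j. j \<in> {2..n} \<Longrightarrow> \<exists>w. cont_sym w 0 0 \<and> (\<forall>x>0. w x \<noteq> 0) \<and> entry n 1 j w \<in> \<A>"
begin

abbreviation E :: "real \<Rightarrow> complex" where "E x \<equiv> of_real (exp (- (c * x)))"

lemma one: "1 \<in> {1..n}" using n by simp

text \<open>A continuous function of \<open>x\<close> with limits at both ends is a continuous function of \<open>exp (- c x)\<close>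
  on \<open>[0, 1]\<close>, so the Weierstrass approximation theorem applies.\<close>
lemma corner_in:
  assumes f: "cont_sym f p q" shows "entry n 1 1 f \<in> \<A>"
proof -
  define In where "In = (\<lambda>f. bsym f \<and> entry n 1 1 f \<in> \<A>)"
  have mult: "In f \<Longrightarrow> In g \<Longrightarrow> In (\<lambda>x. f x * g x)" for f g
    unfolding In_def using mult_in[OF one one] bsym_mult by blast
  have add: "In f \<Longrightarrow> In g \<Longrightarrow> In (\<lambda>x. f x + g x)" for f g
    unfolding In_def using add_in bsym_add by blast
  have scale: "In f \<Longrightarrow> In (\<lambda>x. a * f x)" for f a
    unfolding In_def using scale_in bsym_cmult by blast
  have c1: "In (\<lambda>_. 1)" unfolding In_def using proj[OF one] bsym_const by blast
  have cE: "In E" unfolding In_def using generator cont_sym_bdd[OF exp_cont_sym[OF c]] by blast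
  have c1E: "In (\<lambda>x. 1 - E x)" using add[OF c1 scale[OF cE, of "- 1"]] by simp
  have pow: "In (\<lambda>x. f x ^ i)" if "In f" for f i
    by (induction i) (use c1 mult[OF that] in auto)
  have sum: "In (\<lambda>x. \<Sum>k\<in>K. F k x)" if "finite K" "\<And>k. In (F k)" for K :: "nat set" and F
    using that(1) by (induction K) (use that(2) add scale[OF c1, of 0] in auto)
  have bern: "In (\<lambda>x. \<Sum>k\<le>N. b k * of_real (Bernstein N k (exp (- (c * x)))))" for N b
  proof -
    have "In (\<lambda>x. \<Sum>k\<le>N. b k * (of_nat (N choose k) * (E x ^ k * (1 - E x) ^ (N - k))))"
      by (intro sum scale mult pow cE c1E) simp
    then show ?thesis by (simp add: Bernstein_def mult.assoc)
  qed
  show ?thesis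
  proof (rule alg_entry_limit[OF one one cont_sym_bdd[OF f]])
    fix e :: real assume "e > 0"
    from cont_sym_bernstein[OF f c this] bern
    show "\<exists>h. bsym h \<and> entry n 1 1 h \<in> \<A> \<and> (\<forall>x>0. cmod (h x - f x) \<le> e)"
      unfolding In_def by blast
  qed
qed

lemma link': "j \<in> {1..n} \<Longrightarrow> \<exists>w. cont_sym w 0 0 \<and> (\<forall>x>0. w x \<noteq> 0) \<and> entry n 1 j w \<in> \<A>"
proof (cases "j = 1")
  case True
  have 1: "cont_sym (\<lambda>x. E x * (1 + (- 1) * E x)) (1 * (1 + (- 1) * 1)) (0 * (1 + (- 1) * 0))"
    by (intro cont_sym_mult cont_sym_add cont_sym_const exp_cont_sym c)
  have "E x * (1 + (- 1) * E x) \<noteq> 0" if "x > 0" for x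
  proof -
    have "exp (- (c * x)) < 1" using that c by simp
    then have "complex_of_real (exp (- (c * x))) \<noteq> 1" by (metis less_irrefl of_real_eq_1_iff)
    then show ?thesis by simp
  qed
  moreover have "cont_sym (\<lambda>x. E x * (1 + (- 1) * E x)) 0 0" using 1 by simp
  ultimately show ?thesis using corner_in[OF 1] True by blast
qed (use link in auto)

text \<open>Multiplying a corner entry by two links moves it to any position and makes it vanish at both
  ends. By division such products are dense among all symbols vanishing at both ends.\<close>
lemma c0_in:
  assumes h: "cont_sym h 0 0" and jk: "j \<in> {1..n}" "k \<in> {1..n}"
  shows "entry n j k h \<in> \<A>"
proof -
  obtain u where u: "cont_sym u 0 0" "\<And>x. x > 0 \<Longrightarrow> u x \<noteq> 0" "entry n 1 j u \<in> \<A>" using link'[OF jk(1)] by blast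
  obtain v where v: "cont_sym v 0 0" "\<And>x. x > 0 \<Longrightarrow> v x \<noteq> 0" "entry n 1 k v \<in> \<A>" using link'[OF jk(2)] by blast
  have uc: "cont_sym (\<lambda>x. cnj (u x)) 0 0" using cont_sym_cnj[OF u(1)] by simp
  have w: "cont_sym (\<lambda>x. cnj (u x) * v x) 0 0" using cont_sym_mult[OF uc v(1)] by simp
  have uj: "entry n j 1 (\<lambda>x. cnj (u x)) \<in> \<A>" by (rule cnj_in[OF one jk(1) cont_sym_bdd[OF u(1)] u(3)])
  show ?thesis
  proof (rule alg_entry_limit[OF jk cont_sym_bdd[OF h]])
    fix e :: real assume "e > 0"
    from c0_division[OF h w _ this] u(2) v(2) obtain f where f: "cont_sym f 0 0" "\<And>x. x > 0 \<Longrightarrow> cmod (f x * (cnj (u x) * v x) - h x) \<le> e"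
      by (metis complex_cnj_zero_iff mult_eq_0_iff)
    let ?g = "\<lambda>x. cnj (u x) * (f x * v x)"
    have fv: "bsym (\<lambda>x. f x * v x)" "entry n 1 k (\<lambda>x. f x * v x) \<in> \<A>"
      using mult_in[OF one one cont_sym_bdd[OF f(1)] cont_sym_bdd[OF v(1)] corner_in[OF f(1)] v(3)]
        bsym_mult[OF cont_sym_bdd[OF f(1)] cont_sym_bdd[OF v(1)]] by auto
    have "bsym ?g" by (rule bsym_mult[OF cont_sym_bdd[OF uc] fv(1)])
    moreover have "entry n j k ?g \<in> \<A>" by (rule mult_in[OF jk(1) one cont_sym_bdd[OF uc] fv(1) uj fv(2)])
    moreover have "\<forall>x>0. cmod (?g x - h x) \<le> e" using f(2) by (simp add: mult_ac)
    ultimately show "\<exists>h'. bsym h' \<and> entry n j k h' \<in> \<A> \<and> (\<forall>x>0. cmod (h' x - h x) \<le> e)" by blast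
  qed
qed

lemma diagonal_equal_limits_in:
  assumes h: "cont_sym h p p" and j: "j \<in> {1..n}"
  shows "entry n j j h \<in> \<A>"
proof -
  have 1: "cont_sym (\<lambda>x. h x + (- p)) 0 0" using cont_sym_add[OF h cont_sym_const[of "- p"]] by simp
  have 2: "entry n j j (\<lambda>x. p * 1) \<in> \<A>" by (intro scale_in bsym_const proj j)
  have "entry n j j (\<lambda>x. (h x + (- p)) + p * 1) \<in> \<A>"
    by (rule add_in[OF cont_sym_bdd[OF 1] bsym_const c0_in[OF 1 j j] 2])
  then show ?thesis by simp
qed

text \<open>A multiple of the given symbol absorbs the difference of the two limits.\<close>
lemma diagonal_in:
  assumes e: "cont_sym e p q" "p \<noteq> q" "entry n j j e \<in> \<A>" and h: "cont_sym h p' q'" and j: "j \<in> {1..n}"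
  shows "entry n j j h \<in> \<A>"
proof -
  define s where "s = (p' - q') / (p - q)"
  have s: "s * (p - q) = p' - q'" using e(2) by (simp add: s_def)
  have se: "cont_sym (\<lambda>x. s * e x) (s * p) (s * q)" by (intro cont_sym_mult cont_sym_const e)
  have "cont_sym (\<lambda>x. h x + (- s) * e x) (p' + (- s) * p) (q' + (- s) * q)"
    by (intro cont_sym_mult cont_sym_add cont_sym_const e h)
  moreover have "p' + (- s) * p = q' + (- s) * q" using s by (simp add: algebra_simps)
  ultimately have r: "cont_sym (\<lambda>x. h x + (- s) * e x) (q' + (- s) * q) (q' + (- s) * q)" by simp
  have "entry n j j (\<lambda>x. (h x + (- s) * e x) + s * e x) \<in> \<A>"
    by (rule add_in[OF cont_sym_bdd[OF r] cont_sym_bdd[OF se] diagonal_equal_limits_in[OF r j]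
        scale_in[OF cont_sym_bdd[OF e(1)] e(3)]])
  then show ?thesis by simp
qed

end

section \<open>Toeplitz operators with vertical symbols\<close>

lemma mulop_sum: "bdd_meas m \<Longrightarrow> mulop m (\<Sum>i\<in>A. f i) = (\<Sum>i\<in>A. mulop m (f i))"
proof -
  assume m: "bdd_meas m"
  have "mulop m 0 = 0" using mulop_add[OF m, of 0 0] by simp
  then show ?thesis by (induction A rule: infinite_finite_induct) (auto simp: mulop_add[OF m])
qed

lemma sym_ext_gam: "sym_ext (gam b P) = gam b P"
  by (auto simp: sym_ext_def gam_def fun_eq_iff)

lemma bsym_gam: "bdd_meas b \<Longrightarrow> bsym (gam b P)"
  unfolding sym_ext_gam by (rule gam_bdd_meas)

lemma vertical_multiplication:
  assumes a: "a \<in> borel_measurable (restrict_space lborel {0<..})" and b: "bdd_meas b"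
    and eq: "AE y in lborel. y > 0 \<longrightarrow> a y = b y" and f: "f \<in> L2_on UHP"
  shows "abs_L2 (\<lambda>z. if z \<in> UHP then a (Im z) * rep_L2 f z else 0) = mulop (\<lambda>z. b (Im z)) f"
proof -
  have [measurable]: "rep_L2 f \<in> borel_measurable borel" by (rule sq_measurable[OF sq_rep])
  have UHP [measurable]: "UHP \<in> sets borel" using open_UHP by simp
  have ind: "bdd_meas (\<lambda>z. indicator UHP z :: complex)"
    unfolding bdd_meas_def by (auto intro!: exI[of _ 1] split: split_indicator)
  define a' where "a' = (\<lambda>y. indicator {0<..} y *\<^sub>R a y)"
  have [measurable]: "a' \<in> borel_measurable borel"
    using a unfolding a'_def by (subst (asm) borel_measurable_restrict_space_iff) auto
  let ?f = "\<lambda>z. if z \<in> UHP then a (Im z) * rep_L2 f z else 0"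
  let ?g = "\<lambda>z. b (Im z) * indicator UHP z * rep_L2 f z"
  have "(\<lambda>z. a' (Im z) * rep_L2 f z) \<in> borel_measurable borel" by measurable
  moreover have "(\<lambda>z. a' (Im z) * rep_L2 f z) = ?f" by (auto simp: a'_def UHP_iff fun_eq_iff)
  ultimately have m: "?f \<in> borel_measurable lborel" by simp
  have ae: "AE z in lborel. ?f z = ?g z"
    using AE_complex_Im[OF eq] by eventually_elim (auto simp: UHP_iff)
  have g: "square_integrable ?g" by (intro sq_mul sq_rep bdd_meas_mult bdd_meas_Im b ind)
  have "AE z in lborel. cmod (?f z) \<le> 1 * cmod (?g z)"
    using ae by eventually_elim (simp only: mult_1 order_refl)
  from square_integrable_bound[OF g m this] have "abs_L2 ?f = abs_L2 ?g" using g ae by (rule abs_eqI)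
  also have "\<dots> = mulop (\<lambda>z. b (Im z)) (mulop (\<lambda>z. indicator UHP z) f)"
    unfolding mulop_mulop[OF bdd_meas_Im[OF b] ind] by (simp add: mulop_def)
  also have "\<dots> = mulop (\<lambda>z. b (Im z)) f" using f L2_on_iff[OF UHP] by metis
  finally show ?thesis .
qed

lemma vtoeplitz_matrix:
  assumes a: "a \<in> borel_measurable (restrict_space lborel {0<..})" and b: "bdd_meas b"
    and eq: "AE y in lborel. y > 0 \<longrightarrow> a y = b y"
  shows "vtoeplitz n a = matrix_op n (\<lambda>j k. gam b (lagp (k - 1) * lagp (j - 1)))"
  unfolding vtoeplitz_def toeplitz_def matrix_op_def
proof (rule restrict_ext)
  fix f assume f: "f \<in> poly_bergman n"
  let ?M = "mulop (\<lambda>z. b (Im z))"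
  have e: "entry n j k (gam b P) f = syn j (mulop (gam b P) (ana k f))" for j k P
    using f by (simp add: entry_def sym_ext_gam)
  have "proj_onto (poly_bergman n) (abs_L2 (\<lambda>z. if z \<in> UHP then a (Im z) * rep_L2 f z else 0))
      = (\<Sum>j=1..n. syn j (ana j (?M f)))"
    using f poly_bergman_in_L2 by (subst vertical_multiplication[OF a b eq]) (auto simp: proj_poly_bergman)
  also have "\<dots> = (\<Sum>j=1..n. syn j (ana j (?M (\<Sum>k=1..n. syn k (ana k f)))))"
    using poly_bergman_decomposition[OF f] by simp
  also have "\<dots> = (\<Sum>j=1..n. \<Sum>k=1..n. syn j (ana j (?M (syn k (ana k f)))))"
    by (simp add: mulop_sum bdd_meas_Im[OF b] ana_sum syn_sum)
  also have "\<dots> = (\<Sum>j=1..n. \<Sum>k=1..n. entry n j k (gam b (lagp (k - 1) * lagp (j - 1))) f)"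
    unfolding e ana_def syn_def Wop_mulop_Vop[OF b] ..
  finally show "proj_onto (poly_bergman n) (abs_L2 (\<lambda>z. if z \<in> UHP then a (Im z) * rep_L2 f z else 0))
      = (\<Sum>j=1..n. \<Sum>k=1..n. entry n j k (gam b (lagp (k - 1) * lagp (j - 1))) f)" .
qed

lemma matrix_op_bounded:
  assumes "\<And>j k. j \<in> {1..n} \<Longrightarrow> k \<in> {1..n} \<Longrightarrow> bsym (m j k)"
  shows "matrix_op n m \<in> bounded_ops (poly_bergman n)"
proof -
  interpret cstar_on_bergman n "bounded_ops (poly_bergman n)"
    by unfold_locales (rule bounded_ops_cstar[OF poly_bergman_csubspace poly_bergman_closed])
  show ?thesis by (intro alg_matrix_op entry_bounded assms)
qed

text \<open>An essentially bounded symbol with limits has a bounded representative; truncation at a level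
  above both limits does not disturb them.\<close>
lemma bounded_representative:
  assumes a: "a \<in> Linf_pos" and p: "(a \<longlongrightarrow> p) (at_right 0)" and q: "(a \<longlongrightarrow> q) at_top"
  obtains b where "bdd_meas b" "(b \<longlongrightarrow> p) (at_right 0)" "(b \<longlongrightarrow> q) at_top"
    "AE y in lborel. y > 0 \<longrightarrow> a y = b y" "a \<in> borel_measurable (restrict_space lborel {0<..})"
proof -
  have am: "a \<in> borel_measurable (restrict_space lborel {0<..})" using a by (simp add: Linf_pos_def)
  obtain C where C: "AE y in lborel. y > 0 \<longrightarrow> cmod (a y) \<le> C" using a by (auto simp: Linf_pos_def)
  define D where "D = max C (max (cmod p + 1) (cmod q + 1))"
  have D: "D \<ge> C" "D \<ge> cmod p + 1" "D \<ge> cmod q + 1" by (auto simp: D_def)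
  define a' where "a' = (\<lambda>y. indicator {0<..} y *\<^sub>R a y)"
  have [measurable]: "a' \<in> borel_measurable borel"
    using am unfolding a'_def by (subst (asm) borel_measurable_restrict_space_iff) auto
  define b where "b = (\<lambda>y. if cmod (a' y) \<le> D then a' y else 0)"
  have ba: "a y = b y" if "y > 0" "cmod (a y) \<le> D" for y using that by (simp add: b_def a'_def)
  show thesis
  proof (rule that)
    have "b \<in> borel_measurable borel" unfolding b_def by measurable
    moreover have "cmod (b y) \<le> D" for y using D(2) by (auto simp: b_def intro: order_trans[OF _ D(2)])
    ultimately show "bdd_meas b" unfolding bdd_meas_def by blast
    show "AE y in lborel. y > 0 \<longrightarrow> a y = b y" using C by eventually_elim (use ba D(1) in auto)
    have near: "cmod z \<le> D" if "dist z l < 1" "cmod l + 1 \<le> D" for z l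
      using that norm_triangle_ineq[of "z - l" l] by (simp add: dist_norm)
    have "\<forall>\<^sub>F y in at_right 0. dist (a y) p < 1" using tendstoD[OF p, of 1] by simp
    moreover have "\<forall>\<^sub>F y in at_right 0. y > (0::real)" by (rule eventually_at_right_less)
    ultimately have "\<forall>\<^sub>F y in at_right 0. a y = b y" by eventually_elim (use ba near D(2) in blast)
    then show "(b \<longlongrightarrow> p) (at_right 0)" by (rule Lim_transform_eventually[OF p])
    have "\<forall>\<^sub>F y in at_top. dist (a y) q < 1" using tendstoD[OF q, of 1] by simp
    moreover have "\<forall>\<^sub>F y in at_top. y > (0::real)" by (rule eventually_gt_at_top)
    ultimately have "\<forall>\<^sub>F y in at_top. a y = b y" by eventually_elim (use ba near D(3) in blast)
    then show "(b \<longlongrightarrow> q) at_top" by (rule Lim_transform_eventually[OF q])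
  qed (rule am)
qed

lemma toeplitz_cont_sym:
  assumes "bdd_meas b" "(b \<longlongrightarrow> p) (at_right 0)" "(b \<longlongrightarrow> q) at_top" "j \<ge> 1" "k \<ge> 1"
  shows "cont_sym (gam b (lagp (k - 1) * lagp (j - 1))) (if j = k then q else 0) (if j = k then p else 0)"
proof -
  have "(k - 1 = j - 1) = (j = k)" using assms by auto
  then show ?thesis using gam_cont_sym[OF assms(1-3), of "lagp (k - 1) * lagp (j - 1)"] by (cases "j = k") (auto simp: pint_lagp)
qed

lemma toeplitz_0_inf_bounded: "toeplitz_0_inf n \<subseteq> bounded_ops (poly_bergman n)"
proof
  fix T assume "T \<in> toeplitz_0_inf n"
  then obtain a p q where a: "T = vtoeplitz n a" "a \<in> Linf_pos" "(a \<longlongrightarrow> p) (at_right 0)" "(a \<longlongrightarrow> q) at_top"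
    by (auto simp: toeplitz_0_inf_def)
  from bounded_representative[OF a(2-4)] obtain b where b: "bdd_meas b"
    "AE y in lborel. y > 0 \<longrightarrow> a y = b y" "a \<in> borel_measurable (restrict_space lborel {0<..})" by metis
  show "T \<in> bounded_ops (poly_bergman n)"
    unfolding a(1) vtoeplitz_matrix[OF b(3,1,2)] by (intro matrix_op_bounded bsym_gam b)
qed

lemma toeplitz_0_0_subset: "toeplitz_0_0 n \<subseteq> toeplitz_0_inf n"
  unfolding toeplitz_0_0_def toeplitz_0_inf_def by blast

lemma lagp_0: "lagp 0 = 1"
  by (simp add: lagp_def lag_def one_pCons monom_0)

context generating_entries
begin

lemma vtoeplitz_in:
  assumes a: "a \<in> Linf_pos" "(a \<longlongrightarrow> p) (at_right 0)" "(a \<longlongrightarrow> q) at_top"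
    and diag: "\<And>j. j \<in> {1..n} \<Longrightarrow> p = q \<or> (\<exists>e p q. cont_sym e p q \<and> p \<noteq> q \<and> entry n j j e \<in> \<A>)"
  shows "vtoeplitz n a \<in> \<A>"
proof -
  from bounded_representative[OF a] obtain b where b: "bdd_meas b" "(b \<longlongrightarrow> p) (at_right 0)" "(b \<longlongrightarrow> q) at_top"
    "AE y in lborel. y > 0 \<longrightarrow> a y = b y" "a \<in> borel_measurable (restrict_space lborel {0<..})" by metis
  show ?thesis
    unfolding vtoeplitz_matrix[OF b(5,1,4)]
  proof (rule alg_matrix_op)
    fix j k assume jk: "j \<in> {1..n}" "k \<in> {1..n}"
    then have s: "cont_sym (gam b (lagp (k - 1) * lagp (j - 1))) (if j = k then q else 0) (if j = k then p else 0)"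
      by (intro toeplitz_cont_sym b) auto
    show "entry n j k (gam b (lagp (k - 1) * lagp (j - 1))) \<in> \<A>"
    proof (cases "j = k")
      case True
      then have s': "cont_sym (gam b (lagp (k - 1) * lagp (j - 1))) q p" using s by simp
      show ?thesis
      proof (cases "p = q")
        case True
        then show ?thesis using s' jk diagonal_equal_limits_in \<open>j = k\<close> by metis
      next
        case False
        then show ?thesis using diag[OF jk(1)] s' diagonal_in jk \<open>j = k\<close> by metis
      qed
    qed (use s c0_in jk in simp)
  qed
qed

lemma toeplitz_0_0_in: "toeplitz_0_0 n \<subseteq> \<A>"
  unfolding toeplitz_0_0_def using vtoeplitz_in by blast

lemma toeplitz_0_inf_in:
  assumes "\<And>j. j \<in> {1..n} \<Longrightarrow> \<exists>e p q. cont_sym e p q \<and> p \<noteq> q \<and> entry n j j e \<in> \<A>"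
  shows "toeplitz_0_inf n \<subseteq> \<A>"
  unfolding toeplitz_0_inf_def using vtoeplitz_in assms by blast

end

lemma indicator_bdd_meas:
  fixes A :: "'a::euclidean_space set"
  shows "A \<in> sets borel \<Longrightarrow> bdd_meas (\<lambda>x. indicator A x)"
  unfolding bdd_meas_def by (auto intro!: exI[of _ 1] split: split_indicator)

lemma measurable_on_pos: "bdd_meas a \<Longrightarrow> a \<in> borel_measurable (restrict_space lborel {0<..})"
  by (intro measurable_restrict_space1) (simp add: bdd_meas_def)

lemma bdd_meas_Linf_pos: "bdd_meas a \<Longrightarrow> a \<in> Linf_pos"
  unfolding Linf_pos_def using measurable_on_pos by (auto simp: bdd_meas_def)

lemma vtoeplitz_bdd_meas:
  "bdd_meas a \<Longrightarrow> vtoeplitz n a = matrix_op n (\<lambda>j k. gam a (lagp (k - 1) * lagp (j - 1)))"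
  by (rule vtoeplitz_matrix[OF measurable_on_pos]) auto

lemma a0_symbol_props:
  assumes "\<alpha> > 0"
  shows "bdd_meas (a0_symbol \<alpha>)" "(a0_symbol \<alpha> \<longlongrightarrow> 1) (at_right 0)" "(a0_symbol \<alpha> \<longlongrightarrow> 0) at_top"
proof -
  show "bdd_meas (a0_symbol \<alpha>)" unfolding a0_symbol_def by (rule indicator_bdd_meas) simp
  have "\<forall>\<^sub>F y in at_right 0. 1 = a0_symbol \<alpha> y"
    unfolding eventually_at_right_field a0_symbol_def using assms by (intro exI[of _ "\<alpha> / 2"]) auto
  then show "(a0_symbol \<alpha> \<longlongrightarrow> 1) (at_right 0)" by (rule Lim_transform_eventually[OF tendsto_const])
  have "\<forall>\<^sub>F y in at_top. 0 = a0_symbol \<alpha> y"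
    using eventually_gt_at_top[of "\<alpha> / 2"] by eventually_elim (simp add: a0_symbol_def)
  then show "(a0_symbol \<alpha> \<longlongrightarrow> 0) at_top" by (rule Lim_transform_eventually[OF tendsto_const])
qed

lemma a0_in_toeplitz: "\<alpha> > 0 \<Longrightarrow> vtoeplitz n (a0_symbol \<alpha>) \<in> toeplitz_0_inf n"
  unfolding toeplitz_0_inf_def using a0_symbol_props bdd_meas_Linf_pos by blast

lemma a0_corner:
  assumes "x > 0" "\<alpha> > 0" shows "gam (a0_symbol \<alpha>) 1 x = 1 + (- 1) * of_real (exp (- (\<alpha> * x)))"
  using gam_interval[OF assms(1) order_refl, of "\<alpha> / 2" "- 1"] assms
  by (simp add: a0_symbol_def tw_minus_one mult.commute)

lemma generated_a0_entries:
  assumes "cstar_subalgebra (poly_bergman n) \<A>" "vtoeplitz n (a0_symbol \<alpha>) \<in> \<A>"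
    "\<And>j. j \<in> {1..n} \<Longrightarrow> entry n j j (\<lambda>_. 1) \<in> \<A>" "\<alpha> > 0" "j \<in> {1..n}" "k \<in> {1..n}"
  shows "entry n j k (gam (a0_symbol \<alpha>) (lagp (k - 1) * lagp (j - 1))) \<in> \<A>"
proof -
  interpret cstar_on_bergman n \<A> by unfold_locales (rule assms)
  have "compose (poly_bergman n) (entry n j j (\<lambda>_. 1)) (compose (poly_bergman n) (vtoeplitz n (a0_symbol \<alpha>)) (entry n k k (\<lambda>_. 1))) \<in> \<A>"
    by (intro alg_compose assms)
  then show ?thesis
    unfolding vtoeplitz_bdd_meas[OF a0_symbol_props(1)[OF assms(4)]]
    by (subst (asm) matrix_op_corner[OF assms(5,6)]) (intro bsym_gam a0_symbol_props assms)
qed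

text \<open>The off-diagonal entries next to the diagonal of the operator with symbol \<open>a0_symbol\<close> have no
  zeros, so products along the superdiagonal link the first summand with every other one.\<close>
theorem generating_entries_a0:
  assumes A: "cstar_subalgebra (poly_bergman n) \<A>" "vtoeplitz n (a0_symbol \<alpha>) \<in> \<A>"
    and proj: "\<And>j. j \<in> {1..n} \<Longrightarrow> entry n j j (\<lambda>_. 1) \<in> \<A>" and \<alpha>: "\<alpha> > 0" and n: "n \<ge> 1"
  shows "generating_entries n \<A> \<alpha>"
proof -
  interpret cstar_on_bergman n \<A> by unfold_locales (rule A)
  let ?s = "\<lambda>j k. gam (a0_symbol \<alpha>) (lagp (k - 1) * lagp (j - 1))"
  have ent: "entry n j k (?s j k) \<in> \<A>" if "j \<in> {1..n}" "k \<in> {1..n}" for j k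
    by (rule generated_a0_entries[OF A proj \<alpha> that])
  have one: "1 \<in> {1..n}" using n by simp
  have sb: "bsym (?s j k)" for j k by (intro bsym_gam a0_symbol_props \<alpha>)
  have e: "entry n 1 1 (\<lambda>x. 1 + (- 1) * ?s 1 1 x) \<in> \<A>"
    by (intro add_in scale_in bsym_cmult bsym_const sb ent proj one)
  moreover have "entry n 1 1 (\<lambda>x. 1 + (- 1) * ?s 1 1 x) = entry n 1 1 (\<lambda>x. of_real (exp (- (\<alpha> * x))))"
    by (rule entry_cong) (simp add: lagp_0 a0_corner \<alpha>)
  ultimately have gen: "entry n 1 1 (\<lambda>x. of_real (exp (- (\<alpha> * x)))) \<in> \<A>" by simp
  have nb: "cont_sym (?s j (Suc j)) 0 0" "\<And>x. x > 0 \<Longrightarrow> ?s j (Suc j) x \<noteq> 0" if "j \<ge> 1" for j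
  proof -
    show "cont_sym (?s j (Suc j)) 0 0"
      using toeplitz_cont_sym[OF a0_symbol_props[OF \<alpha>], of j "Suc j"] that by simp
    fix x :: real assume "x > 0"
    then show "?s j (Suc j) x \<noteq> 0"
      using gam_neighbour_nonzero[of x "\<alpha> / 2" "j - 1"] \<alpha> that by (simp add: a0_symbol_def mult.commute)
  qed
  have "\<exists>w. cont_sym w 0 0 \<and> (\<forall>x>0. w x \<noteq> 0) \<and> entry n 1 j w \<in> \<A>" if "2 \<le> j" "j \<le> n" for j
    using that
  proof (induction j rule: dec_induct)
    case base
    then show ?case using ent[of 1 2] nb[of 1] by (intro exI[of _ "?s 1 2"]) (auto simp: numeral_2_eq_2)
  next
    case (step j)
    then obtain w where w: "cont_sym w 0 0" "\<And>x. x > 0 \<Longrightarrow> w x \<noteq> 0" "entry n 1 j w \<in> \<A>" by auto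
    have j: "j \<in> {1..n}" "Suc j \<in> {1..n}" using step by auto
    have "entry n 1 (Suc j) (\<lambda>x. w x * ?s j (Suc j) x) \<in> \<A>"
      by (rule mult_in[OF one j(1) cont_sym_bdd[OF w(1)] sb w(3) ent[OF j]])
    moreover have "cont_sym (\<lambda>x. w x * ?s j (Suc j) x) 0 0" using cont_sym_mult[OF w(1) nb(1)[of j]] j by simp
    ultimately show ?case using w(2) nb(2)[of j] j by (intro exI[of _ "\<lambda>x. w x * ?s j (Suc j) x"]) auto
  qed
  then show ?thesis
    by unfold_locales (use n \<alpha> proj gen in auto)
qed

theorem a0_diagonal:
  assumes A: "cstar_subalgebra (poly_bergman n) \<A>" "vtoeplitz n (a0_symbol \<alpha>) \<in> \<A>"
    and proj: "\<And>j. j \<in> {1..n} \<Longrightarrow> entry n j j (\<lambda>_. 1) \<in> \<A>" and \<alpha>: "\<alpha> > 0" and j: "j \<in> {1..n}"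
  shows "\<exists>e p q. cont_sym e p q \<and> p \<noteq> q \<and> entry n j j e \<in> \<A>"
proof (intro exI conjI)
  show "cont_sym (gam (a0_symbol \<alpha>) (lagp (j - 1) * lagp (j - 1))) 0 1"
    using toeplitz_cont_sym[OF a0_symbol_props[OF \<alpha>], of j j] j by simp
qed (use generated_a0_entries[OF A proj \<alpha> j j] in auto)

section \<open>Square roots of Toeplitz operators on the Bergman space\<close>

lemma entry_in: "j \<in> {1..n} \<Longrightarrow> f \<in> poly_bergman n \<Longrightarrow> entry n j k m f \<in> poly_bergman n"
  by (simp add: entry_def syn_in)

lemma entry_add_apply:
  "f \<in> poly_bergman n \<Longrightarrow> bsym m \<Longrightarrow> bsym m' \<Longrightarrow> entry n j k (\<lambda>x. m x + m' x) f = entry n j k m f + entry n j k m' f"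
  by (simp add: entry_def sym_ext_add mulop_plus syn_add)

lemma entry_scale_apply:
  "f \<in> poly_bergman n \<Longrightarrow> bsym m \<Longrightarrow> entry n j k (\<lambda>x. c * m x) f = scaleC c (entry n j k m f)"
  by (simp add: entry_def sym_ext_cmult mulop_cmult syn_scaleC)

lemma entry_mult_apply:
  assumes "f \<in> poly_bergman n" "j \<in> {1..n}" "k \<in> {1..n}" "bsym m" "bsym m'"
  shows "entry n j l (\<lambda>x. m x * m' x) f = entry n j k m (entry n k l m' f)"
  using fun_cong[OF entry_compose[OF assms(2-5), of l], of f] assms(1) by (simp add: compose_def)

lemma cinner_mulop_square:
  fixes \<rho> :: "real \<Rightarrow> real"
  assumes "bdd_meas (\<lambda>x. complex_of_real (\<rho> x))"
  shows "cinner (mulop (\<lambda>x. of_real (\<rho> x) * of_real (\<rho> x)) u) u = of_real ((norm (mulop (\<lambda>x. of_real (\<rho> x)) u))\<^sup>2)"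
proof -
  let ?M = "mulop (\<lambda>x. of_real (\<rho> x))"
  have "cinner (mulop (\<lambda>x. of_real (\<rho> x) * of_real (\<rho> x)) u) u = cinner (?M (?M u)) u"
    by (simp only: mulop_mulop[OF assms assms])
  also have "\<dots> = cinner (?M u) (mulop (\<lambda>x. cnj (of_real (\<rho> x))) u)" by (rule mulop_adjoint[OF assms])
  also have "\<dots> = of_real ((norm (?M u))\<^sup>2)" by (simp add: cinner_self)
  finally show ?thesis .
qed

lemma mulop_injective:
  assumes m: "bdd_meas m" and nz: "\<And>x. x > 0 \<Longrightarrow> m x \<noteq> 0" and z: "mulop m u = 0"
  shows "restr u = 0"
proof -
  have p: "bdd_meas posfun" using bsym_const[of 1] by (simp add: sym_ext_const)
  have "AE x in lborel. rep_L2 (mulop m u) x = m x * rep_L2 u x"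
    unfolding mulop_def by (rule rep_abs[OF sq_mul[OF m sq_rep]])
  moreover have "AE x in lborel. rep_L2 (0 :: real L2) x = 0"
    using rep_abs[OF square_integrable_0] unfolding abs_zero .
  ultimately have "AE x in lborel. posfun x * rep_L2 u x = 0"
    unfolding z by eventually_elim (use nz in \<open>auto simp: posfun_def indicator_def\<close>)
  from abs_eqI[OF sq_mul[OF p sq_rep] square_integrable_0 this] show ?thesis
    by (simp add: mulop_def abs_zero)
qed

text \<open>Any positive square root commutes with \<open>T\<close>, hence with the limits of polynomials in \<open>T\<close>, and
  the explicit root \<open>Q\<close> is such a limit. For commuting positive roots \<open>(S + Q)(S - Q) = 0\<close>, and the
  quadratic form of \<open>Q\<close> is definite.\<close>
lemma sqrt_op_entry:
  fixes \<gamma> :: "real \<Rightarrow> real"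
  assumes cont: "continuous_on {0<..} \<gamma>" and pos: "\<And>x. x > 0 \<Longrightarrow> 0 < \<gamma> x" and le1: "\<And>x. x > 0 \<Longrightarrow> \<gamma> x \<le> 1"
  shows "sqrt_op (poly_bergman 1) (entry 1 1 1 (\<lambda>x. of_real (\<gamma> x))) = entry 1 1 1 (\<lambda>x. of_real (sqrt (\<gamma> x)))"
proof -
  let ?A = "\<lambda>N x. \<Sum>k\<le>N. sqrt (real k / real N) * Bernstein N k (\<gamma> x)"
  note One_nat_def [simp del]
  let ?H = "poly_bergman 1"
  let ?e = "entry 1 1 1"
  define r where "r = (\<lambda>x. complex_of_real (sqrt (\<gamma> x)))"
  define G where "G = (\<lambda>x. complex_of_real (\<gamma> x))"
  define \<rho> where "\<rho> = (\<lambda>x. if x > 0 then sqrt (sqrt (\<gamma> x)) else 0)"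
  have one: "(1::nat) \<in> {1..1}" by simp
  have bG: "bsym G" unfolding G_def
    by (rule sym_ext_bdd[where C = 1]) (use pos le1 in \<open>auto intro!: continuous_intros cont simp: less_imp_le\<close>)
  have br: "bsym r" unfolding r_def
    by (rule sym_ext_bdd[where C = 1]) (use pos le1 in \<open>auto intro!: continuous_intros cont simp: less_imp_le\<close>)
  have "bsym (\<lambda>x. of_real (sqrt (sqrt (\<gamma> x))))"
    by (rule sym_ext_bdd[where C = 1]) (use pos le1 in \<open>auto intro!: continuous_intros cont simp: less_imp_le\<close>)
  moreover have "sym_ext (\<lambda>x. of_real (sqrt (sqrt (\<gamma> x)))) = (\<lambda>x. complex_of_real (\<rho> x))"
    by (auto simp: sym_ext_def \<rho>_def)
  ultimately have b\<rho>: "bdd_meas (\<lambda>x. complex_of_real (\<rho> x))" by simp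
  have rr: "sym_ext r = (\<lambda>x. of_real (\<rho> x) * of_real (\<rho> x))"
  proof (rule ext)
    fix x
    show "sym_ext r x = of_real (\<rho> x) * of_real (\<rho> x)"
      using less_imp_le[OF pos[of x]] by (simp add: sym_ext_def r_def \<rho>_def flip: of_real_mult)
  qed
  let ?Q = "?e r"
  have form: "cinner (?Q f) f = of_real ((norm (mulop (\<lambda>x. of_real (\<rho> x)) (ana 1 f)))\<^sup>2)" if f: "f \<in> ?H" for f
    using f cinner_mulop_square[OF b\<rho>, of "ana 1 f"] by (simp add: entry_def rr syn_adj)
  have Q: "positive_op ?H ?Q"
    unfolding positive_op_def
  proof (intro conjI ballI entry_bounded one br)
    fix f assume "f \<in> ?H"
    then show "cinner (?Q f) f \<in> \<real>\<^sub>\<ge>\<^sub>0" unfolding form[OF \<open>f \<in> ?H\<close>] by (simp only: nonneg_Reals_of_real_iff zero_le_power2)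
  qed
  have QQ: "compose ?H ?Q ?Q = ?e G"
  proof -
    have "?e (\<lambda>x. r x * r x) = ?e G"
      by (rule entry_cong) (use pos in \<open>simp add: r_def G_def less_imp_le flip: of_real_mult\<close>)
    then show ?thesis using entry_compose[OF one one br br] by simp
  qed
  have unique: "S = ?Q" if S: "positive_op ?H S" "compose ?H S S = ?e G" for S
  proof -
    have Sb: "S \<in> bounded_ops ?H" using S by (simp add: positive_op_def)
    note S' = bounded_opsD[OF Sb]
    have SS: "S (S f) = ?e G f" if "f \<in> ?H" for f using fun_cong[OF S(2), of f] that by (simp add: compose_def)
    define C where "C = (\<lambda>m. bsym m \<and> (\<forall>f\<in>?H. S (?e m f) = ?e m (S f)))"
    note eH = entry_in[OF one]
    have C_add: "C (\<lambda>x. m x + k x)" if "C m" "C k" for m k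
      using that unfolding C_def by (simp add: bsym_add entry_add_apply S' eH)
    have C_mult: "C (\<lambda>x. m x * k x)" if "C m" "C k" for m k
      using that unfolding C_def by (simp add: bsym_mult entry_mult_apply[OF _ one one] S' eH)
    have C_scale: "C (\<lambda>x. a * m x)" if "C m" for m a
      using that unfolding C_def by (simp add: bsym_cmult entry_scale_apply S' eH)
    have C_1: "C (\<lambda>_. 1)"
    proof -
      have "?e (\<lambda>_. 1) f = f" if "f \<in> ?H" for f
        using that poly_bergman_decomposition[OF that] by (simp add: entry_def sym_ext_const)
      then show ?thesis unfolding C_def using S' bsym_const by simp
    qed
    have C_G: "C G" unfolding C_def using bG SS S' by (metis (no_types, lifting))
    have C_G1: "C (\<lambda>x. 1 - G x)" using C_add[OF C_1 C_scale[OF C_G, of "- 1"]] by simp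
    have C_pow: "C (\<lambda>x. m x ^ i)" if "C m" for m i
      by (induction i) (use C_1 C_mult[OF that] in auto)
    have C_sum: "C (\<lambda>x. \<Sum>k\<in>K. F k x)" if "finite K" "\<And>k. C (F k)" for K :: "nat set" and F
      using that(1) by (induction K) (use that(2) C_add C_scale[OF C_1, of 0] in auto)
    have approx: "\<exists>h. C h \<and> (\<forall>x>0. cmod (r x - h x) \<le> e)" if e: "e > 0" for e
    proof -
      have "continuous_on {0..1} sqrt" by (intro continuous_intros)
      from Bernstein_Weierstrass[OF this e] obtain N where
        N: "\<And>x. x \<in> {0..1} \<Longrightarrow> \<bar>sqrt x - (\<Sum>k\<le>N. sqrt (real k / real N) * Bernstein N k x)\<bar> < e" by blast
      let ?h = "\<lambda>x. \<Sum>k\<le>N. of_real (sqrt (real k / real N)) * (of_nat (N choose k) * (G x ^ k * (1 - G x) ^ (N - k)))"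
      have "C ?h" by (intro C_sum C_scale C_mult C_pow C_G C_G1) simp
      moreover have "cmod (r x - ?h x) \<le> e" if x: "x > 0" for x
      proof -
        have "?h x = of_real (?A N x)"
          by (simp add: G_def Bernstein_def mult.assoc)
        then have "r x - ?h x = of_real (sqrt (\<gamma> x) - (?A N x))"
          by (simp only: r_def of_real_diff)
        then have "cmod (r x - ?h x) = \<bar>sqrt (\<gamma> x) - (?A N x)\<bar>"
          by (simp only: norm_of_real)
        then show ?thesis using N[of "\<gamma> x"] pos[OF x] le1[OF x] by simp
      qed
      ultimately show ?thesis by blast
    qed
    obtain K where K: "K \<ge> 0" "\<And>f. f \<in> ?H \<Longrightarrow> norm (S f) \<le> K * norm f" using S'(4) by blast
    have comm: "S (?Q f) = ?Q (S f)" if f: "f \<in> ?H" for f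
    proof (rule ccontr)
      define a where "a = norm (S (?Q f) - ?Q (S f))"
      define B where "B = K * norm f + K * norm f"
      assume "S (?Q f) \<noteq> ?Q (S f)"
      then have a: "a > 0" by (simp add: a_def)
      have B: "B \<ge> 0" using K by (simp add: B_def)
      define \<epsilon> where "\<epsilon> = a / (B + 1)"
      have \<epsilon>: "\<epsilon> > 0" using a B by (simp add: \<epsilon>_def)
      obtain h where h: "C h" "\<And>x. x > 0 \<Longrightarrow> cmod (r x - h x) \<le> \<epsilon>" using approx[OF \<epsilon>] by blast
      have bh: "bsym h" using h(1) by (simp add: C_def)
      let ?d = "\<lambda>x. r x - h x"
      have bd: "bsym ?d" by (rule bsym_diff[OF br bh])
      have split: "?Q g = ?e h g + ?e ?d g" if "g \<in> ?H" for g
        using entry_add_apply[OF that bh bd, of 1 1] by simp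
      have "S (?Q f) - ?Q (S f) = S (?e ?d f) - ?e ?d (S f)"
        using h(1) f unfolding split[OF f] split[OF S'(1)[OF f]] C_def by (simp add: S' eH)
      then have "a \<le> norm (S (?e ?d f)) + norm (?e ?d (S f))" unfolding a_def by (metis norm_triangle_ineq4)
      also have "norm (S (?e ?d f)) \<le> K * (\<epsilon> * norm f)"
        by (rule order_trans[OF K(2)[OF eH[OF f]]])
          (intro mult_left_mono K(1) entry_norm f bd h(2) less_imp_le[OF \<epsilon>])
      also have "norm (?e ?d (S f)) \<le> \<epsilon> * (K * norm f)"
        by (rule order_trans[OF entry_norm[OF S'(1)[OF f] bd h(2) less_imp_le[OF \<epsilon>]]])
          (use K(2)[OF f] \<epsilon> in \<open>auto intro: mult_left_mono\<close>)
      finally have "a \<le> \<epsilon> * B" by (simp add: B_def algebra_simps)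
      moreover have "\<epsilon> * B < a" using a B by (simp add: \<epsilon>_def field_simps)
      ultimately show False by simp
    qed
    show ?thesis
    proof (rule bounded_ops_ext[OF Sb entry_bounded[OF one br]])
      fix f assume f: "f \<in> ?H"
      define g where "g = S f - ?Q f"
      have gH: "g \<in> ?H" unfolding g_def by (intro csubspace_diff[OF poly_bergman_csubspace] S' f eH)
      have Sd: "S (u - v) = S u - S v" if "u \<in> ?H" "v \<in> ?H" for u v
        using S'(2)[OF csubspace_diff[OF poly_bergman_csubspace that] that(2)] by simp
      note Qb = bounded_opsD[OF entry_bounded[OF one br]]
      have Qd: "?Q (u - v) = ?Q u - ?Q v" if "u \<in> ?H" "v \<in> ?H" for u v
        using Qb(2)[OF csubspace_diff[OF poly_bergman_csubspace that] that(2), of 1] by simp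
      have QQf: "?Q (?Q f) = ?e G f" using fun_cong[OF QQ, of f] f by (simp add: compose_def)
      have "S g + ?Q g = 0"
        unfolding g_def Sd[OF S'(1)[OF f] eH[OF f]] Qd[OF S'(1)[OF f] eH[OF f]] comm[OF f] SS[OF f] QQf by simp
      then have "cinner (S g) g + cinner (?Q g) g = 0"
        using cinner_add_left[of "S g" "?Q g" g] cinner_scale_left[of 0 g g] scaleC_of_real[of 0 g] by simp
      moreover have "cinner (S g) g \<in> \<real>\<^sub>\<ge>\<^sub>0" using S(1) gH by (simp add: positive_op_def)
      moreover have "cinner (?Q g) g \<in> \<real>\<^sub>\<ge>\<^sub>0" using Q gH by (simp add: positive_op_def)
      ultimately have "cinner (?Q g) g = 0"
        by (auto simp: complex_nonneg_Reals_iff complex_eq_iff)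
      then have "mulop (\<lambda>x. of_real (\<rho> x)) (ana 1 g) = 0" unfolding form[OF gH] by simp
      then have "restr (ana 1 g) = 0"
        by (rule mulop_injective[OF b\<rho>, rotated]) (use pos in \<open>auto simp: \<rho>_def less_imp_neq[symmetric]\<close>)
      then have "g = 0" using poly_bergman_decomposition[OF gH] by simp
      then show "S f = ?Q f" by (simp add: g_def)
    qed
  qed
  have "sqrt_op ?H (?e G) = ?Q"
    unfolding sqrt_op_def
  proof (rule the_equality)
    show "positive_op ?H ?Q \<and> compose ?H ?Q ?Q = ?e G" using Q QQ by (rule conjI)
  qed (elim conjE, rule unique)
  then show ?thesis by (simp add: G_def r_def)
qed

section \<open>The operator P as a matrix of multiplications\<close>

definition strip :: "nat \<Rightarrow> nat \<Rightarrow> real \<Rightarrow> real" where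
  "strip n j x = exp (- (2 * x * (real j - 1))) - (if j < n then exp (- (2 * x * real j)) else 0)"

definition strip_root :: "nat \<Rightarrow> nat \<Rightarrow> real \<Rightarrow> complex" where
  "strip_root n j x = of_real (sqrt (strip n j x))"

lemma strip_pos: "x > 0 \<Longrightarrow> strip n j x > 0"
  by (simp add: strip_def)

lemma strip_le_1: "x > 0 \<Longrightarrow> j \<ge> 1 \<Longrightarrow> strip n j x \<le> 1"
proof -
  assume "x > 0" "j \<ge> 1"
  then have "exp (- (2 * x * (real j - 1))) \<le> 1" by simp
  moreover have "(if j < n then exp (- (2 * x * real j)) else 0) \<ge> 0" by simp
  ultimately show ?thesis unfolding strip_def by linarith
qed

lemma strip_continuous: "continuous_on A (strip n j)"
  unfolding strip_def by (cases "j < n") (auto intro!: continuous_intros)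

lemma strip_sum:
  assumes "n \<ge> 1" shows "(\<Sum>j=1..n. strip n j x) = 1"
proof -
  have t: "(\<Sum>j=1..m. exp (- (2 * x * (real j - 1))) - exp (- (2 * x * real j))) = 1 - exp (- (2 * x * real m))" for m
    by (induction m) auto
  obtain m where m: "n = Suc m" using assms by (cases n) auto
  have "(\<Sum>j=1..m. strip n j x) = (\<Sum>j=1..m. exp (- (2 * x * (real j - 1))) - exp (- (2 * x * real j)))"
    by (intro sum.cong) (auto simp: strip_def m)
  then show ?thesis using t[of m] by (simp add: m strip_def)
qed

lemma strip_cont_sym:
  assumes j: "j \<in> {1..n}"
  shows "cont_sym (\<lambda>x. of_real (strip n j x)) (if j = n then 1 else 0) (if j = 1 then 1 else 0)"
proof -
  have e: "cont_sym (\<lambda>x. of_real (exp (- (2 * x * real k)))) 1 (if k = 0 then 1 else 0)" for k :: nat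
    using exp_cont_sym[of "2 * real k"] cont_sym_const[of 1] by (cases "k = 0") (auto simp: mult_ac)
  have eq: "complex_of_real (strip n j x) = of_real (exp (- (2 * x * real (j - 1)))) + (if j < n then - 1 else 0) * of_real (exp (- (2 * x * real j)))" for x
    using j by (simp add: strip_def of_nat_diff)
  have c: "cont_sym (\<lambda>x. of_real (strip n j x)) (1 + (if j < n then - 1 else 0) * 1)
     ((if j - 1 = 0 then 1 else 0) + (if j < n then - 1 else 0) * (if j = 0 then 1 else 0))"
    unfolding eq by (intro cont_sym_add cont_sym_mult cont_sym_const e)
  have p: "(1::complex) + (if j < n then - 1 else 0) * 1 = (if j = n then 1 else 0)" using j by auto
  have q: "(if j - 1 = 0 then 1 else 0) + (if j < n then - 1 else 0) * (if j = 0 then 1 else 0) = (if j = 1 then 1 else (0::complex))"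
    using j by auto
  show ?thesis using c unfolding p q .
qed

lemma strip_root_cont_sym:
  assumes j: "j \<in> {1..n}"
  shows "cont_sym (strip_root n j) (if j = n then 1 else 0) (if j = 1 then 1 else 0)"
proof -
  have s: "((\<lambda>x. complex_of_real (strip n j x)) \<longlongrightarrow> (if b then 1 else 0)) F \<Longrightarrow> (strip_root n j \<longlongrightarrow> (if b then 1 else 0)) F" for b F
  proof -
    assume "((\<lambda>x. complex_of_real (strip n j x)) \<longlongrightarrow> (if b then 1 else 0)) F"
    from tendsto_Re[OF this] have "(strip n j \<longlongrightarrow> (if b then 1 else 0)) F" by (cases b) auto
    then have "((\<lambda>x. complex_of_real (sqrt (strip n j x))) \<longlongrightarrow> of_real (sqrt (if b then 1 else 0))) F" by (intro tendsto_intros)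
    then show ?thesis unfolding strip_root_def by (cases b) auto
  qed
  have "continuous_on {0<..} (strip_root n j)" unfolding strip_root_def[abs_def] by (intro continuous_intros strip_continuous)
  then show ?thesis
    using strip_cont_sym[OF j] s[where b = "j = n"] s[where b = "j = 1"] unfolding cont_sym_def by blast
qed

lemma strip_root_square: "x > 0 \<Longrightarrow> strip_root n j x * strip_root n j x = of_real (strip n j x)"
  using less_imp_le[OF strip_pos, of x n j] by (simp add: strip_root_def flip: of_real_mult)

lemma matrix_op_1: "matrix_op 1 m = entry 1 1 1 (m 1 1)"
  by (rule ext) (simp add: matrix_op_def entry_def)

text \<open>The disjoint strips give the increments of the decreasing function \<open>exp (- 2xy)\<close> of \<open>y\<close>.\<close>
lemma sqrt_strip:
  assumes j: "j \<in> {1..n}"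
  shows "sqrt_op (poly_bergman 1) (vtoeplitz 1 (strip_symbol n j)) = entry 1 1 1 (strip_root n j)"
proof -
  have b: "bdd_meas (strip_symbol n j)" unfolding strip_symbol_def by (intro indicator_bdd_meas) auto
  have "vtoeplitz 1 (strip_symbol n j) = entry 1 1 1 (gam (strip_symbol n j) 1)"
    unfolding vtoeplitz_bdd_meas[OF b] matrix_op_1 by (simp add: lagp_0)
  also have "\<dots> = entry 1 1 1 (\<lambda>x. of_real (strip n j x))"
  proof (rule entry_cong)
    fix x :: real assume x: "x > 0"
    show "gam (strip_symbol n j) 1 x = of_real (strip n j x)"
    proof (cases "j < n")
      case True
      then show ?thesis using gam_one_interval[OF x, of "real j - 1" "real j"] j by (simp add: strip_symbol_def strip_def)
    next
      case False
      then show ?thesis using gam_one_ray[OF x, of "real j - 1"] j by (simp add: strip_symbol_def strip_def)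
    qed
  qed
  finally show ?thesis unfolding strip_root_def[abs_def]
    using sqrt_op_entry[OF strip_continuous strip_pos strip_le_1, of j n] j by simp
qed

lemma L2_UHP_csubspace: "csubspace (L2_on UHP)"
proof -
  have UHP: "UHP \<in> sets borel" using open_UHP by simp
  have ind: "bdd_meas (\<lambda>z. indicator UHP z :: complex)" by (rule indicator_bdd_meas[OF UHP])
  show ?thesis unfolding csubspace_def
    using mulop_add[OF ind, of 0 0] by (auto simp: L2_on_iff[OF UHP] mulop_add[OF ind] mulop_scaleC[OF ind])
qed

lemma R_op_ana: "\<phi> \<in> L2_on UHP \<Longrightarrow> R_op m \<phi> = (\<lambda>k\<in>{1..m}. ana k \<phi>)"
  by (simp add: R_op_eq ana_def)

lemma R_adj_eq: "R_adj n = (\<lambda>G\<in>dsum n (L2_on {0<..}). \<Sum>k=1..n. syn k (G k))"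
  unfolding R_adj_def
proof (rule adjoint_op_eqI)
  show "(\<Sum>k=1..n. syn k (G k)) \<in> L2_on UHP" for G :: "nat \<Rightarrow> real L2"
    using sum_syn_in poly_bergman_in_L2 by blast
  show "dsum_inner n (R_op n u) w = cinner u (\<Sum>k=1..n. syn k (w k))" if "u \<in> L2_on UHP" for u w
    by (simp add: R_op_ana[OF that] dsum_inner_def cinner_sum_right ana_adj)
qed (rule csubspace_separating[OF L2_UHP_csubspace])

lemma bold_R_eq: "\<Phi> \<in> dsum n (L2_on UHP) \<Longrightarrow> bold_R n \<Phi> = (\<lambda>k\<in>{1..n}. ana 1 (\<Phi> k))"
proof -
  assume P: "\<Phi> \<in> dsum n (L2_on UHP)"
  show ?thesis
    unfolding bold_R_def restrict_apply'[OF P]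
  proof (rule restrict_ext)
    fix k assume "k \<in> {1..n}"
    then have "\<Phi> k \<in> L2_on UHP" using P by (auto simp: dsum_def)
    then show "R_op 1 (\<Phi> k) 1 = ana 1 (\<Phi> k)" by (simp add: R_op_ana)
  qed
qed

lemma dsum_separating:
  assumes S: "csubspace S" and v: "v \<in> dsum n S" "v' \<in> dsum n S"
    and eq: "\<And>u. u \<in> dsum n S \<Longrightarrow> dsum_inner n u v = dsum_inner n u v'"
  shows "v = v'"
proof (rule PiE_ext)
  show "v \<in> {1..n} \<rightarrow>\<^sub>E S" "v' \<in> {1..n} \<rightarrow>\<^sub>E S" using v by (auto simp: dsum_def)
  fix i assume i: "i \<in> {1..n}"
  have z: "cinner 0 w = 0" for w :: "'a L2" using cinner_add_left[of 0 0 w] by simp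
  show "v i = v' i"
  proof (rule csubspace_separating[OF S])
    show "v i \<in> S" "v' i \<in> S" using v i by (auto simp: dsum_def)
    fix w assume w: "w \<in> S"
    let ?u = "\<lambda>k\<in>{1..n}. if k = i then w else 0"
    have "dsum_inner n ?u t = (\<Sum>k=1..n. if k = i then cinner w (t i) else 0)" for t
      unfolding dsum_inner_def by (intro sum.cong) (auto simp: z)
    then have "dsum_inner n ?u t = cinner w (t i)" for t using i by simp
    moreover have "?u \<in> dsum n S" using w S by (auto simp: dsum_def csubspace_def)
    ultimately show "cinner w (v i) = cinner w (v' i)" using eq by metis
  qed
qed

lemma bold_R_adj_eq: "bold_R_adj n = (\<lambda>G\<in>dsum n (L2_on {0<..}). \<lambda>k\<in>{1..n}. syn 1 (G k))"
  unfolding bold_R_adj_def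
proof (rule adjoint_op_eqI)
  show "(\<lambda>k\<in>{1..n}. syn 1 (G k)) \<in> dsum n (L2_on UHP)" for G :: "nat \<Rightarrow> real L2"
    by (auto simp: dsum_def syn_def Vop_in)
  show "dsum_inner n (bold_R n u) w = dsum_inner n u (\<lambda>k\<in>{1..n}. syn 1 (w k))"
    if "u \<in> dsum n (L2_on UHP)" for u w
    by (simp add: bold_R_eq[OF that] dsum_inner_def ana_adj)
qed (rule dsum_separating[OF L2_UHP_csubspace])

theorem P_op_matrix: "P_op n = matrix_op n (\<lambda>j k x. strip_root n j x * strip_root n k x)"
  unfolding P_op_def matrix_op_def
proof (rule restrict_ext)
  fix f assume f: "f \<in> poly_bergman n"
  let ?U = "L2_on UHP"
  let ?m = "\<lambda>j k x. strip_root n j x * strip_root n k x"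
  have b: "bsym (strip_root n j)" if "j \<in> {1..n}" for j by (rule cont_sym_bdd[OF strip_root_cont_sym[OF that]])
  have bm: "bsym (?m j k)" if "j \<in> {1..n}" "k \<in> {1..n}" for j k by (intro bsym_mult b that)
  have fU: "f \<in> ?U" using f poly_bergman_in_L2 by blast
  define F where "F = (\<lambda>k\<in>{1..n}. syn 1 (ana k f))"
  have "R_op n f \<in> dsum n (L2_on {0<..})" unfolding R_op_ana[OF fU] by (auto simp: dsum_def ana_def Wop_in)
  then have 1: "bold_R_adj n (R_op n f) = F"
    unfolding bold_R_adj_eq F_def by (auto simp: R_op_ana[OF fU] fun_eq_iff)
  have FH: "F \<in> dsum n (poly_bergman 1)" by (auto simp: F_def dsum_def syn_in)
  define X where "X = (\<lambda>j\<in>{1..n}. syn 1 (\<Sum>k=1..n. mulop (sym_ext (?m j k)) (ana k f)))"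
  have 2: "P_T n F = X"
    unfolding P_T_def X_def restrict_apply'[OF FH]
  proof (rule restrict_ext)
    fix j assume j: "j \<in> {1..n}"
    have "sqrt_op (poly_bergman 1) (vtoeplitz 1 (strip_symbol n j)) (sqrt_op (poly_bergman 1) (vtoeplitz 1 (strip_symbol n k)) (F k))
      = syn 1 (mulop (sym_ext (?m j k)) (ana k f))" if k: "k \<in> {1..n}" for k
    proof -
      have Fk: "F k \<in> poly_bergman 1" using FH k by (auto simp: dsum_def)
      have "entry 1 1 1 (strip_root n j) (entry 1 1 1 (strip_root n k) (F k)) = entry 1 1 1 (?m j k) (F k)"
        using entry_mult_apply[OF Fk _ _ b[OF j] b[OF k], of 1 1 1] by simp
      also have "\<dots> = syn 1 (mulop (sym_ext (?m j k)) (ana k f))"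
        using Fk k by (simp add: entry_def F_def ana_syn)
      finally show ?thesis unfolding sqrt_strip[OF j] sqrt_strip[OF k] .
    qed
    then show "(\<Sum>k=1..n. sqrt_op (poly_bergman 1) (vtoeplitz 1 (strip_symbol n j)) (sqrt_op (poly_bergman 1) (vtoeplitz 1 (strip_symbol n k)) (F k)))
      = syn 1 (\<Sum>k=1..n. mulop (sym_ext (?m j k)) (ana k f))"
      unfolding syn_sum by (rule sum.cong[OF refl])
  qed
  have XU: "X \<in> dsum n ?U" by (auto simp: X_def dsum_def syn_def Vop_in)
  have p: "bdd_meas posfun" using bsym_const[of 1] by (simp add: sym_ext_const)
  have 3: "bold_R n X = (\<lambda>j\<in>{1..n}. \<Sum>k=1..n. mulop (sym_ext (?m j k)) (ana k f))"
    unfolding bold_R_eq[OF XU]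
  proof (rule restrict_ext)
    fix j assume j: "j \<in> {1..n}"
    have "ana 1 (X j) = restr (\<Sum>k=1..n. mulop (sym_ext (?m j k)) (ana k f))"
      using j by (simp add: X_def ana_syn)
    also have "\<dots> = (\<Sum>k=1..n. mulop (sym_ext (?m j k)) (ana k f))"
      unfolding mulop_sum[OF p] by (intro sum.cong refl restr_sym_ext bm j)
    finally show "ana 1 (X j) = (\<Sum>k=1..n. mulop (sym_ext (?m j k)) (ana k f))" .
  qed
  have "(\<lambda>j\<in>{1..n}. \<Sum>k=1..n. mulop (sym_ext (?m j k)) (ana k f)) \<in> dsum n (L2_on {0<..})"
    unfolding dsum_def
  proof (rule restrict_PiE_iff[THEN iffD2], rule ballI)
    fix j assume j: "j \<in> {1..n}"
    show "(\<Sum>k=1..n. mulop (sym_ext (?m j k)) (ana k f)) \<in> L2_on {0<..}"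
      unfolding L2_on_pos mulop_sum[OF p] by (intro sum.cong refl restr_sym_ext bm j)
  qed
  then show "R_adj n (bold_R n (P_T n (bold_R_adj n (R_op n f)))) = (\<Sum>j=1..n. \<Sum>k=1..n. entry n j k (?m j k) f)"
    unfolding 1 2 3 R_adj_eq using f by (simp add: syn_sum entry_def)
qed

text \<open>The symbol matrix of \<open>P\<close> is the rank one projection onto the unit vector with entries
  \<open>strip_root n j x\<close>.\<close>
theorem P_op_projection:
  assumes n: "n \<ge> 1" shows "orthogonal_projection_on (poly_bergman n) (P_op n)"
proof -
  let ?B = "\<lambda>x. \<Sum>k=1..n. sym_ext (strip_root n k) x * sym_ext (strip_root n k) x"
  let ?A = "\<lambda>k. \<lambda>x. sym_ext (strip_root n k) x * sym_ext (strip_root n k) x"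
  let ?H = "poly_bergman n"
  let ?M = "\<lambda>j. mulop (sym_ext (strip_root n j))"
  have b: "bsym (strip_root n j)" if "j \<in> {1..n}" for j by (rule cont_sym_bdd[OF strip_root_cont_sym[OF that]])
  define B where "B f = (\<Sum>k=1..n. ?M k (ana k f))" for f
  have P: "P_op n f = (\<Sum>j=1..n. syn j (?M j (B f)))" if f: "f \<in> ?H" for f
  proof -
    have "P_op n f = (\<Sum>j=1..n. \<Sum>k=1..n. syn j (mulop (sym_ext (\<lambda>x. strip_root n j x * strip_root n k x)) (ana k f)))"
      using f by (simp add: P_op_matrix matrix_op_def entry_def)
    also have "\<dots> = (\<Sum>j=1..n. syn j (?M j (B f)))"
      unfolding B_def by (intro sum.cong refl) (simp add: mulop_sum b syn_sum sym_ext_mult mulop_mulop)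
    finally show ?thesis .
  qed
  have PH: "P_op n f \<in> ?H" if "f \<in> ?H" for f unfolding P[OF that] by (rule sum_syn_in)
  have bounded: "P_op n \<in> bounded_ops ?H" unfolding P_op_matrix by (intro matrix_op_bounded bsym_mult b)
  have PP: "P_op n (P_op n f) = P_op n f" if f: "f \<in> ?H" for f
  proof -
    have "B (\<Sum>j=1..n. syn j (?M j g)) = (\<Sum>k=1..n. mulop (?A k) g)" for g
      unfolding B_def
    proof (rule sum.cong[OF refl])
      fix k assume k: "k \<in> {1..n}"
      show "?M k (ana k (\<Sum>j=1..n. syn j (?M j g))) = mulop (?A k) g"
        unfolding ana_sum_syn[OF k] restr_sym_ext[OF b[OF k]] mulop_mulop[OF b[OF k] b[OF k]] ..
    qed
    then have "B (P_op n f) = (\<Sum>k=1..n. mulop (?A k) (B f))"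
      unfolding P[OF f] .
    also have "\<dots> = mulop ?B (B f)"
    proof -
      have "finite K \<Longrightarrow> K \<subseteq> {1..n} \<Longrightarrow> bdd_meas (\<lambda>x. \<Sum>k\<in>K. sym_ext (strip_root n k) x * sym_ext (strip_root n k) x) \<and>
        (\<Sum>k\<in>K. mulop (?A k) g) = mulop (\<lambda>x. \<Sum>k\<in>K. sym_ext (strip_root n k) x * sym_ext (strip_root n k) x) g" for K g
      proof (induction K rule: finite_induct)
        case empty
        have "scaleC 0 g = 0" using scaleC_of_real[of 0 g] by simp
        then show ?case using mulop_const[of 0 g] by simp
      next
        case (insert k K)
        then have "bdd_meas (?A k)" by (intro bdd_meas_mult b) auto
        then show ?case using insert by (auto simp: mulop_plus intro!: bdd_meas_add)
      qed
      then show ?thesis by blast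
    qed
    also have "?B = posfun"
    proof (rule ext)
      fix x
      show "(\<Sum>k=1..n. sym_ext (strip_root n k) x * sym_ext (strip_root n k) x) = posfun x"
        using arg_cong[OF strip_sum[OF n, of x], of complex_of_real]
        by (cases "x > 0") (simp_all add: sym_ext_def posfun_def strip_root_square)
    qed
    finally have 1: "B (P_op n f) = restr (B f)" .
    have p: "bdd_meas posfun" using bsym_const[of 1] by (simp add: sym_ext_const)
    have Mr: "?M j (restr g) = ?M j g" if "j \<in> {1..n}" for j g
      unfolding mulop_mulop[OF b[OF that] p]
      by (rule arg_cong[of _ _ "\<lambda>m. mulop m g"]) (auto simp: sym_ext_def posfun_def fun_eq_iff)
    have "P_op n (P_op n f) = (\<Sum>j=1..n. syn j (?M j (restr (B f))))" using P[OF PH[OF f]] unfolding 1 .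
    also have "\<dots> = (\<Sum>j=1..n. syn j (?M j (B f)))" using Mr by (intro sum.cong refl) simp
    finally show ?thesis unfolding P[OF f] .
  qed
  have form: "cinner (P_op n u) w = cinner (B u) (B w)" if "u \<in> ?H" for u w
  proof -
    have "cnj (sym_ext (strip_root n j) x) = sym_ext (strip_root n j) x" for j x by (simp add: sym_ext_def strip_root_def)
    then show ?thesis
      unfolding P[OF that] B_def[of w] cinner_sum_left cinner_sum_right syn_adj
      by (intro sum.cong refl) (simp add: mulop_adjoint[OF b])
  qed
  have sym: "cinner (P_op n u) w = cinner u (P_op n w)" if "u \<in> ?H" "w \<in> ?H" for u w
    using form[OF that(1), of w] form[OF that(2), of u] by (metis cinner_commute)
  have "adjoint_op ?H cinner ?H cinner (P_op n) = (\<lambda>w\<in>?H. P_op n w)"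
    by (rule adjoint_op_eqI) (use PH sym csubspace_separating[OF poly_bergman_csubspace] in auto)
  also have "\<dots> = P_op n" unfolding P_op_def by (rule restrict_ext) simp
  finally have adj: "adjoint_op ?H cinner ?H cinner (P_op n) = P_op n" .
  have "compose ?H (P_op n) (P_op n) = P_op n"
    using PP bounded_opsD(5)[OF bounded] by (auto simp: compose_def fun_eq_iff)
  then show ?thesis using bounded adj by (simp add: orthogonal_projection_on_def)
qed

lemma true_bergman_proj_projection:
  assumes "k \<in> {1..n}" shows "orthogonal_projection_on (poly_bergman n) (true_bergman_proj n k)"
proof -
  have k: "k \<ge> 1" using assms by simp
  show ?thesis
    unfolding orthogonal_projection_on_def entry_one[OF k]
    using entry_bounded[OF assms bsym_const] entry_compose[OF assms assms bsym_const bsym_const] entry_adjoint[OF assms assms bsym_const]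
    by simp
qed

section \<open>The generated algebras\<close>

lemma true_projections_entries:
  assumes "true_bergman_proj n ` {1..n} \<subseteq> \<A>" "j \<in> {1..n}"
  shows "entry n j j (\<lambda>_. 1) \<in> \<A>"
  using assms entry_one[of j n] by force

lemma P_entries:
  assumes "cstar_subalgebra (poly_bergman n) \<A>" "P_op n \<in> \<A>"
    "\<And>j. j \<in> {1..n} \<Longrightarrow> entry n j j (\<lambda>_. 1) \<in> \<A>" "j \<in> {1..n}" "k \<in> {1..n}"
  shows "entry n j k (\<lambda>x. strip_root n j x * strip_root n k x) \<in> \<A>"
proof -
  interpret cstar_on_bergman n \<A> by unfold_locales (rule assms)
  have "compose (poly_bergman n) (entry n j j (\<lambda>_. 1)) (compose (poly_bergman n) (P_op n) (entry n k k (\<lambda>_. 1))) \<in> \<A>"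
    by (intro alg_compose assms)
  then show ?thesis
    unfolding P_op_matrix
    by (subst (asm) matrix_op_corner[OF assms(4,5)]) (intro bsym_mult cont_sym_bdd[OF strip_root_cont_sym])
qed

text \<open>All entries of \<open>P\<close> are products of positive functions, so the first row already links every summand;
  \<open>exp (- 2x)\<close> is one minus its corner entry.\<close>
lemma generating_entries_P:
  assumes A: "cstar_subalgebra (poly_bergman n) \<A>" "P_op n \<in> \<A>"
    and proj: "\<And>j. j \<in> {1..n} \<Longrightarrow> entry n j j (\<lambda>_. 1) \<in> \<A>" and n: "n \<ge> 2"
  shows "generating_entries n \<A> 2"
proof -
  interpret cstar_on_bergman n \<A> by unfold_locales (rule A)
  have ent: "entry n j k (\<lambda>x. strip_root n j x * strip_root n k x) \<in> \<A>" if "j \<in> {1..n}" "k \<in> {1..n}" for j k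
    by (rule P_entries[OF A proj that])
  have one: "1 \<in> {1..n}" using n by simp
  have sb: "bsym (\<lambda>x. strip_root n j x * strip_root n k x)" if "j \<in> {1..n}" "k \<in> {1..n}" for j k
    by (intro bsym_mult cont_sym_bdd[OF strip_root_cont_sym] that)
  have "entry n 1 1 (\<lambda>x. 1 + (- 1) * (strip_root n 1 x * strip_root n 1 x)) \<in> \<A>"
    by (intro add_in scale_in bsym_cmult bsym_const sb ent proj one)
  moreover have "entry n 1 1 (\<lambda>x. 1 + (- 1) * (strip_root n 1 x * strip_root n 1 x)) = entry n 1 1 (\<lambda>x. of_real (exp (- (2 * x))))"
    by (rule entry_cong) (use n in \<open>simp add: strip_root_square strip_def\<close>)
  ultimately have gen: "entry n 1 1 (\<lambda>x. of_real (exp (- (2 * x)))) \<in> \<A>" by simp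
  have link: "\<exists>w. cont_sym w 0 0 \<and> (\<forall>x>0. w x \<noteq> 0) \<and> entry n 1 j w \<in> \<A>" if j: "j \<in> {2..n}" for j
  proof (intro exI conjI allI impI)
    have jn: "j \<in> {1..n}" using j by auto
    show "cont_sym (\<lambda>x. strip_root n 1 x * strip_root n j x) 0 0"
      using cont_sym_mult[OF strip_root_cont_sym[OF one] strip_root_cont_sym[OF jn]] j n by (auto split: if_splits)
    show "strip_root n 1 x * strip_root n j x \<noteq> 0" if "x > 0" for x
      using strip_pos[OF that, of n 1] strip_pos[OF that, of n j] by (simp add: strip_root_def)
    show "entry n 1 j (\<lambda>x. strip_root n 1 x * strip_root n j x) \<in> \<A>" by (rule ent[OF one jn])
  qed
  show ?thesis by unfold_locales (use n proj gen link in auto)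
qed

text \<open>At \<open>0\<close> only the last strip keeps mass and at \<open>\<infinity>\<close> only the first; for \<open>n = 2\<close> every index is first or last.\<close>
lemma P_diagonal:
  assumes "cstar_subalgebra (poly_bergman 2) \<A>" "P_op 2 \<in> \<A>"
    "\<And>j. j \<in> {1..2} \<Longrightarrow> entry 2 j j (\<lambda>_. 1) \<in> \<A>" "j \<in> {1..2}"
  shows "\<exists>e p q. cont_sym e p q \<and> p \<noteq> q \<and> entry 2 j j e \<in> \<A>"
proof -
  have c: "cont_sym (\<lambda>x. strip_root 2 j x * strip_root 2 j x) ((if j = 2 then 1 else 0) * (if j = 2 then 1 else 0)) ((if j = 1 then 1 else 0) * (if j = 1 then 1 else 0))"
    by (intro cont_sym_mult strip_root_cont_sym assms)
  have "j = 1 \<or> j = 2" using assms(4) by auto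
  then show ?thesis
    using c P_entries[OF assms(1-3) assms(4,4)] by (intro exI conjI) (rule c, auto)
qed

lemma P_in_a0:
  assumes A: "cstar_subalgebra (poly_bergman n) \<A>" "vtoeplitz n (a0_symbol \<alpha>) \<in> \<A>"
    and proj: "\<And>j. j \<in> {1..n} \<Longrightarrow> entry n j j (\<lambda>_. 1) \<in> \<A>" and \<alpha>: "\<alpha> > 0" and n: "n \<ge> 1"
  shows "P_op n \<in> \<A>"
proof -
  interpret generating_entries n \<A> \<alpha> by (rule generating_entries_a0[OF A proj \<alpha> n])
  show ?thesis
    unfolding P_op_matrix
  proof (rule alg_matrix_op)
    fix j k assume j: "j \<in> {1..n}" and k: "k \<in> {1..n}"
    note c = cont_sym_mult[OF strip_root_cont_sym[OF j] strip_root_cont_sym[OF k]]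
    show "entry n j k (\<lambda>x. strip_root n j x * strip_root n k x) \<in> \<A>"
    proof (cases "j = k")
      case True
      obtain e p q where "cont_sym e p q" "p \<noteq> q" "entry n j j e \<in> \<A>" using a0_diagonal[OF A proj \<alpha> j] by blast
      from diagonal_in[OF this c j] show ?thesis using True by simp
    next
      case False
      then have "cont_sym (\<lambda>x. strip_root n j x * strip_root n k x) 0 0" using c by (auto split: if_splits)
      then show ?thesis using j k by (rule c0_in)
    qed
  qed
qed

theorem mainTheorem1:
  fixes n :: nat and \<alpha> :: real
  assumes "n \<ge> 1" and "\<alpha> > 0"
  shows "(\<forall>\<A>\<in>{alg_00 n, alg_P n, alg_a0 n \<alpha>, alg_0_inf n}. cstar_subalgebra (poly_bergman n) \<A>) \<and>
    (n \<ge> 2 \<longrightarrow> alg_00 n \<subseteq> alg_P n) \<and>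
    alg_P n \<subseteq> alg_a0 n \<alpha> \<and>
    alg_0_inf n \<subseteq> alg_a0 n \<alpha> \<and>
    (n = 2 \<longrightarrow>
      (\<forall>Q\<in>{P_op n, true_bergman_proj n 1, true_bergman_proj n 2}.
         orthogonal_projection_on (poly_bergman n) Q) \<and>
      alg_P n = alg_a0 n \<alpha> \<and>
      alg_0_inf n \<subseteq> alg_P n)"
proof -
  have projections: "true_bergman_proj n ` {1..n} \<subseteq> bounded_ops (poly_bergman n)"
    using true_bergman_proj_projection by (auto simp: orthogonal_projection_on_def)
  note generated = cstar_generated_cstar[OF poly_bergman_csubspace poly_bergman_closed]
  have c00: "cstar_subalgebra (poly_bergman n) (alg_00 n)"
    using toeplitz_0_0_subset toeplitz_0_inf_bounded by (intro generated) blast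
  have c0i: "cstar_subalgebra (poly_bergman n) (alg_0_inf n)"
    by (intro generated toeplitz_0_inf_bounded)
  have cP: "cstar_subalgebra (poly_bergman n) (alg_P n)"
    using P_op_projection[OF assms(1)] projections by (intro generated) (simp add: orthogonal_projection_on_def)
  have ca0: "cstar_subalgebra (poly_bergman n) (alg_a0 n \<alpha>)"
    using a0_in_toeplitz[OF assms(2)] toeplitz_0_inf_bounded projections by (intro generated) blast
  have P: "P_op n \<in> alg_P n" and Pp: "true_bergman_proj n ` {1..n} \<subseteq> alg_P n"
    using cstar_generated_subset[of "insert (P_op n) (true_bergman_proj n ` {1..n})" "poly_bergman n"] by simp_all
  have a0: "vtoeplitz n (a0_symbol \<alpha>) \<in> alg_a0 n \<alpha>" and a0p: "true_bergman_proj n ` {1..n} \<subseteq> alg_a0 n \<alpha>"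
    using cstar_generated_subset[of "insert (vtoeplitz n (a0_symbol \<alpha>)) (true_bergman_proj n ` {1..n})" "poly_bergman n"] by simp_all
  have entP: "entry n j j (\<lambda>_. 1) \<in> alg_P n" if "j \<in> {1..n}" for j by (rule true_projections_entries[OF Pp that])
  have ent0: "entry n j j (\<lambda>_. 1) \<in> alg_a0 n \<alpha>" if "j \<in> {1..n}" for j by (rule true_projections_entries[OF a0p that])
  interpret a0: generating_entries n "alg_a0 n \<alpha>" \<alpha>
    by (rule generating_entries_a0[OF ca0 a0 ent0 assms(2,1)])
  have i1: "alg_00 n \<subseteq> alg_P n" if "n \<ge> 2"
  proof -
    interpret P: generating_entries n "alg_P n" 2 by (rule generating_entries_P[OF cP P entP that])
    show ?thesis by (rule cstar_generated_least[OF cP P.toeplitz_0_0_in])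
  qed
  have i2: "alg_P n \<subseteq> alg_a0 n \<alpha>"
    using P_in_a0[OF ca0 a0 ent0 assms(2,1)] a0p by (intro cstar_generated_least[OF ca0]) simp
  have i3: "alg_0_inf n \<subseteq> alg_a0 n \<alpha>"
    by (intro cstar_generated_least[OF ca0] a0.toeplitz_0_inf_in a0_diagonal[OF ca0 a0 ent0 assms(2)])
  have i4: "toeplitz_0_inf n \<subseteq> alg_P n" if n2: "n = 2"
  proof -
    interpret P: generating_entries n "alg_P n" 2 by (rule generating_entries_P[OF cP P entP]) (simp_all add: n2)
    show ?thesis
      using P.toeplitz_0_inf_in P_diagonal[OF cP[unfolded n2] P[unfolded n2] entP[unfolded n2]] unfolding n2 by blast
  qed
  have i5: "alg_a0 n \<alpha> \<subseteq> alg_P n" if "n = 2"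
    using i4[OF that] a0_in_toeplitz[OF assms(2)] Pp by (intro cstar_generated_least[OF cP]) blast
  have i6: "alg_0_inf n \<subseteq> alg_P n" if "n = 2" by (rule cstar_generated_least[OF cP i4[OF that]])
  have orth: "orthogonal_projection_on (poly_bergman n) Q" if "n = 2" "Q \<in> {P_op n, true_bergman_proj n 1, true_bergman_proj n 2}" for Q
    using that P_op_projection[OF assms(1)] true_bergman_proj_projection[of 1 n] true_bergman_proj_projection[of 2 n] by auto
  show ?thesis
  proof (intro conjI impI ballI)
    fix \<A> assume "\<A> \<in> {alg_00 n, alg_P n, alg_a0 n \<alpha>, alg_0_inf n}"
    then show "cstar_subalgebra (poly_bergman n) \<A>" using c00 c0i cP ca0 by (elim insertE) (simp_all only: empty_iff)
  qed (rule i1 i2 i3 i6 orth equalityI[OF i2 i5]; assumption)+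
qed

end
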